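(* Let $r=(r_1,\dots,r_n)\in\mathbb{N}^n$ and $|r|:=\sum_{i=1}^n r_i$. Suppose that Assumption (A) stated in the context holds, and that $\int_{\mathbb{R}^d}u_i^0(x)|x|^2\,dx<\infty$ for each $1\le i\le n$. Then for all sufficiently small $\varepsilon>0$ (the smallness depending on $n$, $T$, $\|\nabla V_{ij}\|_{W^{1,\infty}(\mathbb{R}^d)}$, $\sigma_{\min}$, $u^0$ and $r$), and for all $\eta>0$ and $N\in\mathbb{N}$ with $\varepsilon\log N\ge \eta^{-2d-4}$, we have $$\sup_{t\in[0,T]}\Big\|u^{N,r}_{\eta,n}(t)-\prod_{i=1}^n u_i(t)^{\otimes r_i}\Big\|_{L^1(\mathbb{R}^{d|r|})}\le C\,\eta^{\frac{4}{4+d}},$$ where $C>0$ depends on $n$, $T$, $\|\nabla V_{ij}\|_{W^{1,\infty}(\mathbb{R}^d)}$, $\sigma_{\min}$, $u^0$ and $r$ (in particular, not on $N$, $\eta$, $\varepsilon$).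
   Context: **Data (fixed throughout).** $d\ge1$ is the space dimension, $n\ge 1$ the number of species, $T>0$, $s>d/2+2$. For $1\le i,j\le n$: $\sigma_i>0$, $\sigma_{\min}:=\min_i\sigma_i$; $V_{ij}\in C_0^\infty(\mathbb{R}^d)$ with $\mathrm{supp}(V_{ij})\subset B_1(0)$ and $\int_{\mathbb{R}^d}V_{ij}\,dx=a_{ij}\ge0$; for $\eta>0$, $V_{ij}^\eta(x)=\eta^{-d}V_{ij}(x/\eta)$. The initial data $u^0=(u_1^0,\dots,u_n^0)$ consists of probability densities $u_i^0\ge0$ on $\mathbb{R}^d$, with $u^0\in H^s(\mathbb{R}^d)$. **Limiting cross-diffusion system**, for $u=(u_1,\dots,u_n)$: $$\partial_t u_i-\sigma_i\Delta u_i=\mathrm{div}\Big(\sum_{j=1}^n a_{ij}u_i\nabla u_j\Big),\quad u_i(0)=u_i^0,\quad 1\le i\le n.\tag{P}$$ **Intermediate non-local system**, for $u_\eta=(u_{\eta,1},\dots,u_{\eta,n})$: $$\partial_t u_{\eta,i}-\sigma_i\Delta u_{\eta,i}=\mathrm{div}\Big(\sum_{j=1}^n u_{\eta,i}\,\nabla V_{ij}^\eta * u_{\eta,j}\Big),\quad u_{\eta,i}(0)=u_i^0,\quad 1\le i\le n.\tag{P$_\eta$}$$ **Particle systems.** On a complete filtered probability space let $(W_i^k)_{1\le i\le n,\,1\le k\le N}$ be independent $d$-dimensional Brownian motions, and let $\zeta_i^k$ be independent random variables, independent of the Brownian motions, with $\zeta_i^k$ having density $u_i^0$. For $1\le i\le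 n$, $1\le k\le N$, with common initial value $\zeta_i^k$ at $t=0$, let $$dX^{k,N}_{\eta,i}=-\sum_{j=1}^n\frac1N\sum_{l=1}^N\nabla V_{ij}^\eta(X^{k,N}_{\eta,i}-X^{l,N}_{\eta,j})\,dt+\sqrt{2\sigma_i}\,dW_i^k,$$ $$d\bar X^{k}_{\eta,i}=-\sum_{j=1}^n(\nabla V_{ij}^\eta*u_{\eta,j})(\bar X^k_{\eta,i},t)\,dt+\sqrt{2\sigma_i}\,dW_i^k,$$ $$d\hat X^k_i=-\sum_{j=1}^n a_{ij}\nabla u_j(\hat X^k_i,t)\,dt+\sqrt{2\sigma_i}\,dW_i^k.$$ The laws of $\bar X^k_{\eta,i}(t)$ and $\hat X^k_i(t)$ have densities $u_{\eta,i}(t)$ and $u_i(t)$ respectively. **Joint law and marginals.** $u^N_{\eta,n}(t,x_1^1,\dots,x_1^N,\dots,x_n^1,\dots,x_n^N)$ is the joint probability density on $\mathbb{R}^{dNn}$ of all particles $X^{k,N}_{\eta,i}(t)$; it is the unique classical solution of $$\partial_t u^N_{\eta,n}-\sum_{i=1}^n\sum_{k=1}^N\sigma_i\Delta_{x_i^k}u^N_{\eta,n}=\sum_{i=1}^n\sum_{k=1}^N\mathrm{div}_{x_i^k}\Big(\sum_{j=1}^n\frac1N\sum_{l=1}^N\nabla V_{ij}^\eta(x_i^k-x_j^l)\,u^N_{\eta,n}\Big),$$ with $u^N_{\eta,n}(0)=(u_1^0)^{\otimes N}\otimes\cdots\otimes(u_n^0)^{\otimes N}$. For $r\in\mathbb{N}^n$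 with $r_i\le N$, the $r$-th marginal is $$u^{N,r}_{\eta,n}=\int_{\mathbb{R}^{d\sum_i(N-r_i)}}u^N_{\eta,n}\,dx_1^{r_1+1}\cdots dx_1^N\cdots dx_n^{r_n+1}\cdots dx_n^N,$$ i.e. the joint density of $X^{1,N}_{\eta,1},\dots,X^{r_1,N}_{\eta,1};\dots;X^{1,N}_{\eta,n},\dots,X^{r_n,N}_{\eta,n}$. The notation $\prod_{i=1}^n f_i^{\otimes r_i}$ denotes the function $\prod_{i=1}^n\prod_{k=1}^{r_i}f_i(x_i^k)$ on $\mathbb{R}^{d|r|}$. **Assumption (A).** 1. (P) and, for each $\eta>0$, (P$_\eta$) have unique global solutions $u$ and $u_\eta$ in $L^\infty(0,T;H^s(\mathbb{R}^d))\cap L^2(0,T;H^{s+1}(\mathbb{R}^d))$. Both are componentwise nonnegative, satisfy $\int u_i(t,x)\,dx=\int u_{\eta,i}(t,x)\,dx=1$ for all $t\in[0,T]$ and $1\le i\le n$, and, for $v=u$ and $v=u_\eta$, $$\|v\|_{L^\infty(0,T;H^s)}+\|v\|_{L^2(0,T;H^{s+1})}\le C_0\|u^0\|_{H^s},$$ with $C_0>0$ depending only on $T$, $n$, $\sigma_{\min}$, $u^0$ (not on $\eta$ or $N$). 2. $\|u_\eta-u\|_{L^\infty(0,T;L^2(\mathbb{R}^d))}+\|\nabla(u_\eta-u)\|_{L^2(0,T;L^2(\mathbb{R}^d))}\le C(T,\sigma_{\min})\,\eta$. 3. For all sufficiently small $\varepsilon>0$ and all $\eta>0$, $N\in\mathbb{N}$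 with $\varepsilon\log N\ge\eta^{-2d-4}$, $$\sup_{1\le k\le N}\mathbb{E}\Big[\sum_{i=1}^n\sup_{0<t<T}|X^{k,N}_{\eta,i}(t)-\bar X^k_{\eta,i}(t)|^2\Big]\le CN^{-1+C\varepsilon},$$ $$\sup_{1\le k\le N}\mathbb{E}\Big[\sum_{i=1}^n\sup_{0<t<T}|X^{k,N}_{\eta,i}(t)-\hat X^k_{i}(t)|\Big]\le C\eta,$$ with $C>0$ depending on $T$, $n$, $\|D^2V_{ij}\|_{L^\infty}$, $\sigma_{\min}$, $u^0$. *)

theory Defs
  imports "HOL-Probability.Probability"
begin

text \<open>
  The space \<open>\<real>\<^sup>d\<close> is a type \<open>'a::euclidean_space\<close> with \<open>d = DIM('a)\<close>; the species
  \<open>1, \<dots>, n\<close> are the elements of a type \<open>'n::finite\<close>, so \<open>n = CARD('n)\<close>.  Particles of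
  one species are numbered \<open>k = 1, \<dots>, N\<close>, and the particle \<open>k\<close> of species \<open>i\<close> has index
  \<open>(i, k) :: 'n \<times> nat\<close>.  The space \<open>\<real>\<^bsup>d|r|\<^esup>\<close> is the set of extensional functions
  \<open>slots r \<rightarrow> 'a\<close> with the product Lebesgue measure.
\<close>

section \<open>Calculus\<close>

definition grad :: "('a::euclidean_space \<Rightarrow> real) \<Rightarrow> 'a \<Rightarrow> 'a" where
  "grad f x = (\<Sum>b\<in>Basis. frechet_derivative f (at x) b *\<^sub>R b)"

definition laplacian :: "('a::euclidean_space \<Rightarrow> real) \<Rightarrow> 'a \<Rightarrow> real" where
  "laplacian f x =
    (\<Sum>b\<in>Basis. frechet_derivative (\<lambda>y. frechet_derivative f (at y) b) (at x) b)"

fun C_k :: "nat \<Rightarrow> ('a::euclidean_space \<Rightarrow> real) \<Rightarrow> bool" where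
  "C_k 0 f \<longleftrightarrow> continuous_on UNIV f"
| "C_k (Suc m) f \<longleftrightarrow> (\<forall>x. f differentiable (at x)) \<and>
     (\<forall>b\<in>Basis. C_k m (\<lambda>x. frechet_derivative f (at x) b))"

definition smooth :: "('a::euclidean_space \<Rightarrow> real) \<Rightarrow> bool" where
  "smooth f \<longleftrightarrow> (\<forall>m. C_k m f)"

definition supp :: "('a::euclidean_space \<Rightarrow> real) \<Rightarrow> 'a set" where
  "supp f = closure {x. f x \<noteq> 0}"

definition test_function :: "('a::euclidean_space \<Rightarrow> real) \<Rightarrow> bool" where
  "test_function \<phi> \<longleftrightarrow> smooth \<phi> \<and> compact (supp \<phi>)"

definition conv :: "('a::euclidean_space \<Rightarrow> 'a) \<Rightarrow> ('a \<Rightarrow> real) \<Rightarrow> 'a \<Rightarrow> 'a" where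
  "conv g f x = (\<integral>y. f y *\<^sub>R g (x - y) \<partial>lborel)"

text \<open>The norm of \<open>W\<^bsup>1,\<infinity>\<^esup>\<close> of the gradient of \<open>V\<close>; it is only used for
  \<open>V \<in> C\<^sub>0\<^sup>\<infinity>\<close>, for which the essential suprema are bounded suprema.\<close>

definition grad_W1inf_norm :: "('a::euclidean_space \<Rightarrow> real) \<Rightarrow> real" where
  "grad_W1inf_norm V =
    (SUP x. norm (grad V x)) + (SUP x. onorm (frechet_derivative (grad V) (at x)))"

section \<open>Function spaces\<close>

definition esqrt :: "ennreal \<Rightarrow> ennreal" where
  "esqrt x = (if x = \<infinity> then \<infinity> else ennreal (sqrt (enn2real x)))"

text \<open>\<open>F\<close> is the Fourier-Plancherel transform of \<open>f \<in> L\<^sup>2\<close>: the limit in \<open>L\<^sup>2\<close> of the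
  Fourier integrals over the balls of radius \<open>R\<close>.  It is unique almost everywhere.\<close>

definition is_L2_fourier :: "('a::euclidean_space \<Rightarrow> real) \<Rightarrow> ('a \<Rightarrow> complex) \<Rightarrow> bool" where
  "is_L2_fourier f F \<longleftrightarrow>
     f \<in> borel_measurable lborel \<and> F \<in> borel_measurable lborel \<and>
     (\<integral>\<^sup>+x. ennreal ((f x)\<^sup>2) \<partial>lborel) < \<infinity> \<and>
     ((\<lambda>R. \<integral>\<^sup>+\<xi>. ennreal ((cmod (F \<xi> -
         complex_of_real ((2 * pi) powr (- real DIM('a) / 2)) *
           set_lebesgue_integral lborel (cball 0 R)
             (\<lambda>x. exp (- \<i> * complex_of_real (x \<bullet> \<xi>)) * complex_of_real (f x))))\<^sup>2) \<partial>lborel)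
       \<longlongrightarrow> 0) at_top"

text \<open>Squared norm of \<open>H\<^sup>s\<close> (\<open>s \<ge> 0\<close>).  Since \<open>F\<close> is unique almost everywhere the infimum
  is the value for the transform of \<open>f\<close>; it is \<open>\<infinity>\<close> if \<open>f \<notin> L\<^sup>2\<close>.\<close>

definition Hs_sq :: "real \<Rightarrow> ('a::euclidean_space \<Rightarrow> real) \<Rightarrow> ennreal" where
  "Hs_sq s f = (INF F\<in>{F. is_L2_fourier f F}.
     \<integral>\<^sup>+\<xi>. ennreal ((1 + (norm \<xi>)\<^sup>2) powr s * (cmod (F \<xi>))\<^sup>2) \<partial>lborel)"

definition Hs_norm :: "real \<Rightarrow> ('n::finite \<Rightarrow> 'a::euclidean_space \<Rightarrow> real) \<Rightarrow> ennreal" where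
  "Hs_norm s f = esqrt (\<Sum>i\<in>UNIV. Hs_sq s (f i))"

definition L2_norm :: "('n::finite \<Rightarrow> 'a::euclidean_space \<Rightarrow> 'b::real_normed_vector) \<Rightarrow> ennreal" where
  "L2_norm f = esqrt (\<Sum>i\<in>UNIV. \<integral>\<^sup>+x. ennreal ((norm (f i x))\<^sup>2) \<partial>lborel)"

definition time_Linf :: "real \<Rightarrow> (real \<Rightarrow> ennreal) \<Rightarrow> ennreal" where
  "time_Linf T g = esssup (restrict_space lborel {0<..<T}) g"

definition time_L2 :: "real \<Rightarrow> (real \<Rightarrow> ennreal) \<Rightarrow> ennreal" where
  "time_L2 T g = esqrt (\<integral>\<^sup>+t. (g t)\<^sup>2 \<partial>(restrict_space lborel {0<..<T}))"

section \<open>Data\<close>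

definition potentials ::
  "real \<Rightarrow> ('n::finite \<Rightarrow> 'n \<Rightarrow> real) \<Rightarrow> ('n \<Rightarrow> real) \<Rightarrow> ('n \<Rightarrow> 'n \<Rightarrow> 'a::euclidean_space \<Rightarrow> real)
    \<Rightarrow> ('n \<Rightarrow> 'n \<Rightarrow> real) \<Rightarrow> bool" where
  "potentials sigma_min K \<sigma> V a \<longleftrightarrow>
     (\<forall>i. \<sigma> i > 0) \<and> sigma_min = Min (range \<sigma>) \<and>
     (\<forall>i j. smooth (V i j) \<and> supp (V i j) \<subseteq> ball 0 1 \<and>
            has_bochner_integral lborel (V i j) (a i j) \<and> a i j \<ge> 0 \<and>
            grad_W1inf_norm (V i j) = K i j)"

text \<open>\<open>H\<^sup>s\<close> embeds into \<open>C\<^sup>2\<close> for \<open>s > d/2 + 2\<close>; elements of \<open>H\<^sup>s\<close> are identified with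
  their \<open>C\<^sup>2\<close> representatives, here and for the solutions below.\<close>

definition initial_data :: "real \<Rightarrow> ('n::finite \<Rightarrow> 'a::euclidean_space \<Rightarrow> real) \<Rightarrow> bool" where
  "initial_data s u0 \<longleftrightarrow>
     (\<forall>i. C_k 2 (u0 i) \<and> (\<forall>x. u0 i x \<ge> 0) \<and> has_bochner_integral lborel (u0 i) 1) \<and>
     Hs_norm s u0 < \<infinity>"

definition scaled :: "real \<Rightarrow> ('a::euclidean_space \<Rightarrow> real) \<Rightarrow> 'a \<Rightarrow> real" where
  "scaled \<eta> f x = \<eta> powr (- real DIM('a)) * f (x /\<^sub>R \<eta>)"

section \<open>The limiting and the intermediate system\<close>

text \<open>Both systems have the form \<open>\<partial>\<^sub>t v\<^sub>i - \<sigma>\<^sub>i \<Delta> v\<^sub>i = div (v\<^sub>i B\<^sub>i)\<close> where \<open>B\<^sub>i\<close> at time \<open>t\<close>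
  depends on \<open>v t\<close>.\<close>

definition local_field ::
  "('n::finite \<Rightarrow> 'n \<Rightarrow> real) \<Rightarrow> ('n \<Rightarrow> 'a::euclidean_space \<Rightarrow> real) \<Rightarrow> 'n \<Rightarrow> 'a \<Rightarrow> 'a" where
  "local_field a w i x = (\<Sum>j\<in>UNIV. a i j *\<^sub>R grad (w j) x)"

definition nonlocal_field ::
  "real \<Rightarrow> ('n::finite \<Rightarrow> 'n \<Rightarrow> 'a::euclidean_space \<Rightarrow> real) \<Rightarrow> ('n \<Rightarrow> 'a \<Rightarrow> real) \<Rightarrow> 'n \<Rightarrow> 'a \<Rightarrow> 'a" where
  "nonlocal_field \<eta> V w i x = (\<Sum>j\<in>UNIV. conv (grad (scaled \<eta> (V i j))) (w j) x)"

text \<open>Solutions in \<open>L\<^sup>\<infinity>(0,T;H\<^sup>s) \<inter> L\<^sup>2(0,T;H\<^bsup>s+1\<^esup>)\<close>.  The equation is understood in the sense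
  of distributions, integrated over \<open>[0,t]\<close>.  Requiring this for every \<open>t \<in> [0,T]\<close> selects
  the weakly continuous representative in time, so that \<open>v t\<close> is determined for every \<open>t\<close>
  and the initial value is attained.\<close>

definition solution ::
  "real \<Rightarrow> real \<Rightarrow> ('n::finite \<Rightarrow> real) \<Rightarrow> (('n \<Rightarrow> 'a::euclidean_space \<Rightarrow> real) \<Rightarrow> 'n \<Rightarrow> 'a \<Rightarrow> 'a)
    \<Rightarrow> ('n \<Rightarrow> 'a \<Rightarrow> real) \<Rightarrow> (real \<Rightarrow> 'n \<Rightarrow> 'a \<Rightarrow> real) \<Rightarrow> bool" where
  "solution T s \<sigma> B u0 v \<longleftrightarrow>
     (\<forall>i. (\<lambda>(t, x). v t i x) \<in> borel_measurable (restrict_space lborel {0..T} \<Otimes>\<^sub>M lborel)) \<and>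
     (\<forall>t\<in>{0..T}. \<forall>i. C_k 2 (v t i)) \<and>
     time_Linf T (\<lambda>t. Hs_norm s (v t)) < \<infinity> \<and>
     time_L2 T (\<lambda>t. Hs_norm (s + 1) (v t)) < \<infinity> \<and>
     (\<forall>i \<phi>. test_function \<phi> \<longrightarrow> (\<forall>t\<in>{0..T}.
        (\<integral>x. v t i x * \<phi> x \<partial>lborel) - (\<integral>x. u0 i x * \<phi> x \<partial>lborel) =
        set_lebesgue_integral lborel {0..t} (\<lambda>\<tau>.
          \<sigma> i * (\<integral>x. v \<tau> i x * laplacian \<phi> x \<partial>lborel)
          - (\<integral>x. v \<tau> i x * (B (v \<tau>) i x \<bullet> grad \<phi> x) \<partial>lborel))))"

definition unique_solution ::
  "real \<Rightarrow> real \<Rightarrow> ('n::finite \<Rightarrow> real) \<Rightarrow> (('n \<Rightarrow> 'a::euclidean_space \<Rightarrow> real) \<Rightarrow> 'n \<Rightarrow> 'a \<Rightarrow> 'a)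
    \<Rightarrow> ('n \<Rightarrow> 'a \<Rightarrow> real) \<Rightarrow> (real \<Rightarrow> 'n \<Rightarrow> 'a \<Rightarrow> real) \<Rightarrow> bool" where
  "unique_solution T s \<sigma> B u0 v \<longleftrightarrow> solution T s \<sigma> B u0 v \<and>
     (\<forall>w. solution T s \<sigma> B u0 w \<longrightarrow> (\<forall>t\<in>{0..T}. w t = v t))"

section \<open>Particle systems\<close>

definition filtered_prob_space :: "'w measure \<Rightarrow> (real \<Rightarrow> 'w measure) \<Rightarrow> bool" where
  "filtered_prob_space M F \<longleftrightarrow> prob_space M \<and> complete_measure M \<and>
     filtration (space M) F \<and> (\<forall>t. sets (F t) \<subseteq> sets M) \<and> null_sets M \<subseteq> sets (F 0)"

definition generated :: "'w measure \<Rightarrow> 'b measure \<Rightarrow> ('w \<Rightarrow> 'b) \<Rightarrow> 'w set set" where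
  "generated M N Z = {Z -` A \<inter> space M | A. A \<in> sets N}"

definition brownian_motion ::
  "'w measure \<Rightarrow> (real \<Rightarrow> 'w measure) \<Rightarrow> (real \<Rightarrow> 'w \<Rightarrow> 'a::euclidean_space) \<Rightarrow> bool" where
  "brownian_motion M F W \<longleftrightarrow>
     (\<forall>t\<ge>0. W t \<in> borel_measurable (F t)) \<and>
     (AE \<omega> in M. W 0 \<omega> = 0 \<and> continuous_on {0..} (\<lambda>t. W t \<omega>)) \<and>
     (\<forall>t1 t2. 0 \<le> t1 \<and> t1 < t2 \<longrightarrow>
        prob_space.indep_set M (sets (F t1))
          (generated M borel (\<lambda>\<omega>. W t2 \<omega> - W t1 \<omega>)) \<and>
        distributed M lborel (\<lambda>\<omega>. W t2 \<omega> - W t1 \<omega>)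
          (\<lambda>x. ennreal (\<Prod>b\<in>Basis. normal_density 0 (sqrt (t2 - t1)) (x \<bullet> b))))"

text \<open>The family of all \<open>W\<^sub>i\<^sup>k\<close> and \<open>\<zeta>\<^sub>i\<^sup>k\<close> for \<open>k \<ge> 1\<close>; the system of size \<open>N\<close> uses \<open>k \<le> N\<close>.
  Processes are treated as random variables with values in the path space
  \<open>[0,\<infinity>) \<rightarrow> 'a\<close>.\<close>

definition driving_noise ::
  "'w measure \<Rightarrow> (real \<Rightarrow> 'w measure) \<Rightarrow> ('n::finite \<Rightarrow> 'a::euclidean_space \<Rightarrow> real)
    \<Rightarrow> ('n \<Rightarrow> nat \<Rightarrow> real \<Rightarrow> 'w \<Rightarrow> 'a) \<Rightarrow> ('n \<Rightarrow> nat \<Rightarrow> 'w \<Rightarrow> 'a) \<Rightarrow> bool" where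
  "driving_noise M F u0 W \<zeta> \<longleftrightarrow>
     (let I = UNIV \<times> {1..};
          path_space = PiM {0..} (\<lambda>_. borel :: 'a measure);
          path = (\<lambda>(i, k) \<omega>. \<lambda>t\<in>{0..}. W i k t \<omega>);
          start = (\<lambda>(i, k). \<zeta> i k)
      in (\<forall>(i, k)\<in>I. brownian_motion M F (W i k) \<and> \<zeta> i k \<in> borel_measurable (F 0) \<and>
            distributed M lborel (\<zeta> i k) (\<lambda>x. ennreal (u0 i x))) \<and>
         prob_space.indep_vars M (\<lambda>_. path_space) path I \<and>
         prob_space.indep_vars M (\<lambda>_. borel) start I \<and>
         prob_space.indep_set M
           (generated M (PiM I (\<lambda>_. path_space)) (\<lambda>\<omega>. \<lambda>p\<in>I. path p \<omega>))
           (generated M (PiM I (\<lambda>_. borel)) (\<lambda>\<omega>. \<lambda>p\<in>I. start p \<omega>)))"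

text \<open>Strong solution on \<open>[0,T]\<close> of \<open>dX = b dt + sqrt(2\<sigma>) dW\<close>, \<open>X(0) = z\<close>, where \<open>b t \<omega>\<close> is the
  drift evaluated along the path.  The noise is additive, so the stochastic integral is
  \<open>sqrt(2\<sigma>) W(t)\<close>.\<close>

definition sde_solution ::
  "'w measure \<Rightarrow> (real \<Rightarrow> 'w measure) \<Rightarrow> real \<Rightarrow> real \<Rightarrow> (real \<Rightarrow> 'w \<Rightarrow> 'a::euclidean_space)
    \<Rightarrow> ('w \<Rightarrow> 'a) \<Rightarrow> (real \<Rightarrow> 'w \<Rightarrow> 'a) \<Rightarrow> (real \<Rightarrow> 'w \<Rightarrow> 'a) \<Rightarrow> bool" where
  "sde_solution M F T sig W z b X \<longleftrightarrow>
     (\<forall>t\<in>{0..T}. X t \<in> borel_measurable (F t)) \<and>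
     (AE \<omega> in M. continuous_on {0..T} (\<lambda>t. X t \<omega>) \<and>
        set_integrable lborel {0..T} (\<lambda>t. b t \<omega>) \<and>
        (\<forall>t\<in>{0..T}. X t \<omega> =
           z \<omega> + set_lebesgue_integral lborel {0..t} (\<lambda>\<tau>. b \<tau> \<omega>) + sqrt (2 * sig) *\<^sub>R W t \<omega>))"

text \<open>\<open>interaction \<eta> V N x i y\<close> is the interaction field felt at \<open>y\<close> by species \<open>i\<close>
  in the configuration \<open>x\<close>.\<close>

definition interaction ::
  "real \<Rightarrow> ('n::finite \<Rightarrow> 'n \<Rightarrow> 'a::euclidean_space \<Rightarrow> real) \<Rightarrow> nat \<Rightarrow> ('n \<times> nat \<Rightarrow> 'a) \<Rightarrow> 'n \<Rightarrow> 'a \<Rightarrow> 'a" where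
  "interaction \<eta> V N x i y =
     (\<Sum>j\<in>UNIV. (1 / real N) *\<^sub>R (\<Sum>l\<in>{1..N}. grad (scaled \<eta> (V i j)) (y - x (j, l))))"

definition particle_systems ::
  "'w measure \<Rightarrow> (real \<Rightarrow> 'w measure) \<Rightarrow> real \<Rightarrow> ('n::finite \<Rightarrow> real)
    \<Rightarrow> ('n \<Rightarrow> 'n \<Rightarrow> 'a::euclidean_space \<Rightarrow> real) \<Rightarrow> ('n \<Rightarrow> 'n \<Rightarrow> real)
    \<Rightarrow> (real \<Rightarrow> 'n \<Rightarrow> 'a \<Rightarrow> real) \<Rightarrow> (real \<Rightarrow> real \<Rightarrow> 'n \<Rightarrow> 'a \<Rightarrow> real)
    \<Rightarrow> ('n \<Rightarrow> nat \<Rightarrow> real \<Rightarrow> 'w \<Rightarrow> 'a) \<Rightarrow> ('n \<Rightarrow> nat \<Rightarrow> 'w \<Rightarrow> 'a)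
    \<Rightarrow> (real \<Rightarrow> nat \<Rightarrow> 'n \<Rightarrow> nat \<Rightarrow> real \<Rightarrow> 'w \<Rightarrow> 'a) \<Rightarrow> (real \<Rightarrow> 'n \<Rightarrow> nat \<Rightarrow> real \<Rightarrow> 'w \<Rightarrow> 'a)
    \<Rightarrow> ('n \<Rightarrow> nat \<Rightarrow> real \<Rightarrow> 'w \<Rightarrow> 'a) \<Rightarrow> bool" where
  "particle_systems M F T \<sigma> V a u u_eta W \<zeta> X Xbar Xhat \<longleftrightarrow>
     (\<forall>\<eta>>0. \<forall>N. \<forall>i. \<forall>k\<in>{1..N}.
        sde_solution M F T (\<sigma> i) (W i k) (\<zeta> i k)
          (\<lambda>t \<omega>. - interaction \<eta> V N (\<lambda>(j, l). X \<eta> N j l t \<omega>) i (X \<eta> N i k t \<omega>)) (X \<eta> N i k)) \<and>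
     (\<forall>\<eta>>0. \<forall>i. \<forall>k\<ge>1.
        sde_solution M F T (\<sigma> i) (W i k) (\<zeta> i k)
          (\<lambda>t \<omega>. - nonlocal_field \<eta> V (u_eta \<eta> t) i (Xbar \<eta> i k t \<omega>)) (Xbar \<eta> i k) \<and>
        (\<forall>t\<in>{0..T}. distributed M lborel (Xbar \<eta> i k t) (\<lambda>x. ennreal (u_eta \<eta> t i x)))) \<and>
     (\<forall>i. \<forall>k\<ge>1.
        sde_solution M F T (\<sigma> i) (W i k) (\<zeta> i k)
          (\<lambda>t \<omega>. - local_field a (u t) i (Xhat i k t \<omega>)) (Xhat i k) \<and>
        (\<forall>t\<in>{0..T}. distributed M lborel (Xhat i k t) (\<lambda>x. ennreal (u t i x))))"

section \<open>Joint law and marginals\<close>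

definition slots :: "('n \<Rightarrow> nat) \<Rightarrow> ('n \<times> nat) set" where
  "slots r = (SIGMA i:UNIV. {1..r i})"

definition config_measure ::
  "('n \<times> nat) set \<Rightarrow> ('n \<times> nat \<Rightarrow> 'a::euclidean_space) measure" where
  "config_measure J = PiM J (\<lambda>_. lborel)"

definition marginal ::
  "nat \<Rightarrow> ('n::finite \<Rightarrow> nat) \<Rightarrow> (('n \<times> nat \<Rightarrow> 'a::euclidean_space) \<Rightarrow> real)
    \<Rightarrow> ('n \<times> nat \<Rightarrow> 'a) \<Rightarrow> real" where
  "marginal N r f y = (let R = slots (\<lambda>_. N) - slots r in
     \<integral>z. f (merge (slots r) R (y, z)) \<partial>config_measure R)"

definition tensor ::
  "('n::finite \<Rightarrow> nat) \<Rightarrow> ('n \<Rightarrow> 'a \<Rightarrow> real) \<Rightarrow> ('n \<times> nat \<Rightarrow> 'a) \<Rightarrow> real" where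
  "tensor r f y = (\<Prod>i\<in>UNIV. \<Prod>k\<in>{1..r i}. f i (y (i, k)))"

text \<open>Derivative in direction \<open>b\<close> of the argument \<open>x\<^sub>p\<close> of a function of configurations.\<close>

definition partial ::
  "'p \<Rightarrow> 'a::euclidean_space \<Rightarrow> (('p \<Rightarrow> 'a) \<Rightarrow> real) \<Rightarrow> ('p \<Rightarrow> 'a) \<Rightarrow> real" where
  "partial p b f x = deriv (\<lambda>h. f (x(p := x p + h *\<^sub>R b))) 0"

definition has_partial ::
  "'p \<Rightarrow> 'a::euclidean_space \<Rightarrow> (('p \<Rightarrow> 'a) \<Rightarrow> real) \<Rightarrow> ('p \<Rightarrow> 'a) \<Rightarrow> bool" where
  "has_partial p b f x \<longleftrightarrow> (\<lambda>h. f (x(p := x p + h *\<^sub>R b))) field_differentiable (at 0)"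

text \<open>Classical solutions of the Liouville equation: continuous on \<open>[0,T] \<times> \<real>\<^bsup>dNn\<^esup>\<close>, of class
  \<open>C\<^bsup>1,2\<^esup>\<close> on \<open>(0,T) \<times> \<real>\<^bsup>dNn\<^esup>\<close>, and satisfying the equation pointwise.\<close>

definition liouville_solution ::
  "real \<Rightarrow> ('n::finite \<Rightarrow> real) \<Rightarrow> ('n \<Rightarrow> 'n \<Rightarrow> 'a::euclidean_space \<Rightarrow> real) \<Rightarrow> ('n \<Rightarrow> 'a \<Rightarrow> real)
    \<Rightarrow> real \<Rightarrow> nat \<Rightarrow> (real \<Rightarrow> ('n \<times> nat \<Rightarrow> 'a) \<Rightarrow> real) \<Rightarrow> bool" where
  "liouville_solution T \<sigma> V u0 \<eta> N v \<longleftrightarrow>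
     (let I = slots (\<lambda>_. N); E = PiE I (\<lambda>_. UNIV); Q = {0<..<T} \<times> E in
      continuous_on ({0..T} \<times> E) (\<lambda>(t, x). v t x) \<and>
      (\<forall>x\<in>E. v 0 x = tensor (\<lambda>_. N) u0 x) \<and>
      (\<forall>(t, x)\<in>Q. (\<lambda>\<tau>. v \<tau> x) field_differentiable (at t)) \<and>
      continuous_on Q (\<lambda>(t, x). deriv (\<lambda>\<tau>. v \<tau> x) t) \<and>
      (\<forall>p\<in>I. \<forall>b\<in>Basis.
         (\<forall>(t, x)\<in>Q. has_partial p b (v t) x) \<and>
         continuous_on Q (\<lambda>(t, x). partial p b (v t) x) \<and>
         (\<forall>q\<in>I. \<forall>c\<in>Basis.
            (\<forall>(t, x)\<in>Q. has_partial q c (partial p b (v t)) x) \<and>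
            continuous_on Q (\<lambda>(t, x). partial q c (partial p b (v t)) x))) \<and>
      (\<forall>(t, x)\<in>Q.
         deriv (\<lambda>\<tau>. v \<tau> x) t
         - (\<Sum>(i, k)\<in>I. \<sigma> i * (\<Sum>b\<in>Basis. partial (i, k) b (partial (i, k) b (v t)) x))
         = (\<Sum>(i, k)\<in>I. \<Sum>b\<in>Basis.
              partial (i, k) b (\<lambda>y. (interaction \<eta> V N y i (y (i, k)) \<bullet> b) * v t y) x)))"

definition probability_densities ::
  "real \<Rightarrow> nat \<Rightarrow> (real \<Rightarrow> ('n::finite \<times> nat \<Rightarrow> 'a::euclidean_space) \<Rightarrow> real) \<Rightarrow> bool" where
  "probability_densities T N v \<longleftrightarrow> (\<forall>t\<in>{0..T}.
     (\<forall>x\<in>PiE (slots (\<lambda>_. N)) (\<lambda>_. UNIV). v t x \<ge> 0) \<and>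
     has_bochner_integral (config_measure (slots (\<lambda>_. N))) (v t) 1)"

text \<open>Uniqueness is meant among probability densities; without a growth or sign condition
  it would fail already for the heat equation.\<close>

definition joint_density ::
  "'w measure \<Rightarrow> real \<Rightarrow> ('n::finite \<Rightarrow> real) \<Rightarrow> ('n \<Rightarrow> 'n \<Rightarrow> 'a::euclidean_space \<Rightarrow> real)
    \<Rightarrow> ('n \<Rightarrow> 'a \<Rightarrow> real) \<Rightarrow> (real \<Rightarrow> nat \<Rightarrow> 'n \<Rightarrow> nat \<Rightarrow> real \<Rightarrow> 'w \<Rightarrow> 'a)
    \<Rightarrow> (real \<Rightarrow> nat \<Rightarrow> real \<Rightarrow> ('n \<times> nat \<Rightarrow> 'a) \<Rightarrow> real) \<Rightarrow> bool" where
  "joint_density M T \<sigma> V u0 X uN \<longleftrightarrow> (\<forall>\<eta>>0. \<forall>N\<ge>1.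
     (\<forall>t\<in>{0..T}. distributed M (config_measure (slots (\<lambda>_. N)))
        (\<lambda>\<omega>. \<lambda>(i, k)\<in>slots (\<lambda>_. N). X \<eta> N i k t \<omega>) (\<lambda>x. ennreal (uN \<eta> N t x))) \<and>
     probability_densities T N (uN \<eta> N) \<and>
     liouville_solution T \<sigma> V u0 \<eta> N (uN \<eta> N) \<and>
     (\<forall>v. probability_densities T N v \<and> liouville_solution T \<sigma> V u0 \<eta> N v \<longrightarrow>
        (\<forall>t\<in>{0..T}. \<forall>x\<in>PiE (slots (\<lambda>_. N)) (\<lambda>_. UNIV). v t x = uN \<eta> N t x)))"

section \<open>Assumption (A)\<close>

definition solution_bounds ::
  "real \<Rightarrow> real \<Rightarrow> real \<Rightarrow> ('n::finite \<Rightarrow> 'a::euclidean_space \<Rightarrow> real)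
    \<Rightarrow> (real \<Rightarrow> 'n \<Rightarrow> 'a \<Rightarrow> real) \<Rightarrow> bool" where
  "solution_bounds T s C0 u0 v \<longleftrightarrow>
     (\<forall>t\<in>{0..T}. \<forall>i. (\<forall>x. v t i x \<ge> 0) \<and> has_bochner_integral lborel (v t i) 1) \<and>
     time_Linf T (\<lambda>t. Hs_norm s (v t)) + time_L2 T (\<lambda>t. Hs_norm (s + 1) (v t))
       \<le> ennreal C0 * Hs_norm s u0"

definition assumption_A1 ::
  "real \<Rightarrow> real \<Rightarrow> real \<Rightarrow> ('n::finite \<Rightarrow> 'a::euclidean_space \<Rightarrow> real) \<Rightarrow> ('n \<Rightarrow> real)
    \<Rightarrow> ('n \<Rightarrow> 'n \<Rightarrow> 'a \<Rightarrow> real) \<Rightarrow> ('n \<Rightarrow> 'n \<Rightarrow> real)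
    \<Rightarrow> (real \<Rightarrow> 'n \<Rightarrow> 'a \<Rightarrow> real) \<Rightarrow> (real \<Rightarrow> real \<Rightarrow> 'n \<Rightarrow> 'a \<Rightarrow> real) \<Rightarrow> bool" where
  "assumption_A1 T s C0 u0 \<sigma> V a u u_eta \<longleftrightarrow>
     unique_solution T s \<sigma> (local_field a) u0 u \<and> solution_bounds T s C0 u0 u \<and>
     (\<forall>\<eta>>0. unique_solution T s \<sigma> (nonlocal_field \<eta> V) u0 (u_eta \<eta>) \<and>
            solution_bounds T s C0 u0 (u_eta \<eta>))"

definition assumption_A2 ::
  "real \<Rightarrow> real \<Rightarrow> (real \<Rightarrow> 'n::finite \<Rightarrow> 'a::euclidean_space \<Rightarrow> real)
    \<Rightarrow> (real \<Rightarrow> real \<Rightarrow> 'n \<Rightarrow> 'a \<Rightarrow> real) \<Rightarrow> bool" where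
  "assumption_A2 T C u u_eta \<longleftrightarrow> (\<forall>\<eta>>0.
     time_Linf T (\<lambda>t. L2_norm (\<lambda>i x. u_eta \<eta> t i x - u t i x)) +
     time_L2 T (\<lambda>t. L2_norm (\<lambda>i. grad (\<lambda>x. u_eta \<eta> t i x - u t i x)))
       \<le> ennreal (C * \<eta>))"

definition admissible :: "'a::euclidean_space itself \<Rightarrow> real \<Rightarrow> real \<Rightarrow> nat \<Rightarrow> bool" where
  "admissible _ \<epsilon> \<eta> N \<longleftrightarrow> \<epsilon> * ln (real N) \<ge> \<eta> powr (- 2 * real DIM('a) - 4)"

definition assumption_A3 ::
  "'w measure \<Rightarrow> real \<Rightarrow> real \<Rightarrow> real
    \<Rightarrow> (real \<Rightarrow> nat \<Rightarrow> 'n::finite \<Rightarrow> nat \<Rightarrow> real \<Rightarrow> 'w \<Rightarrow> 'a::euclidean_space)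
    \<Rightarrow> (real \<Rightarrow> 'n \<Rightarrow> nat \<Rightarrow> real \<Rightarrow> 'w \<Rightarrow> 'a) \<Rightarrow> ('n \<Rightarrow> nat \<Rightarrow> real \<Rightarrow> 'w \<Rightarrow> 'a) \<Rightarrow> bool" where
  "assumption_A3 M T \<epsilon>1 C X Xbar Xhat \<longleftrightarrow>
     (\<forall>\<epsilon> \<eta> N. 0 < \<epsilon> \<and> \<epsilon> < \<epsilon>1 \<and> \<eta> > 0 \<and> admissible TYPE('a) \<epsilon> \<eta> N \<longrightarrow>
        (SUP k\<in>{1..N}. \<integral>\<^sup>+\<omega>. (\<Sum>i\<in>UNIV. SUP t\<in>{0<..<T}.
            ennreal ((norm (X \<eta> N i k t \<omega> - Xbar \<eta> i k t \<omega>))\<^sup>2)) \<partial>M)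
          \<le> ennreal (C * real N powr (- 1 + C * \<epsilon>)) \<and>
        (SUP k\<in>{1..N}. \<integral>\<^sup>+\<omega>. (\<Sum>i\<in>UNIV. SUP t\<in>{0<..<T}.
            ennreal (norm (X \<eta> N i k t \<omega> - Xhat i k t \<omega>))) \<partial>M)
          \<le> ennreal (C * \<eta>))"

end

theory Submission
  imports Defs "HOL-Real_Asymp.Real_Asymp"
begin

text \<open>The \<open>L\<^sup>1\<close> distance of two densities is twice the total variation distance of the laws, so the theorem
compares the law of the interacting particles \<open>X\<close> with a product law.  The particles \<open>Xbar\<close> of the
intermediate system lie in between: they start from the same values and use the same Brownian motions
as \<open>X\<close>, but each is driven by its own noise only.  Hence they are independent, their joint density is the
tensor product of the \<open>u_eta\<close>, and the distance splits into that of the laws of \<open>X\<close> and \<open>Xbar\<close> plus, for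
every slot, the \<open>L\<^sup>1\<close> distance of \<open>u_eta\<close> and \<open>u\<close>.

For the first distance, closeness in mean of \<open>X\<close> and \<open>Xbar\<close> says nothing about total variation by itself; the noise
turns it into such a statement.  Adding to two random points an independent Gaussian vector of
covariance \<open>c\<^sup>2 \<tau>\<close> leaves a total variation distance of at most \<open>2 E|x - y| / (c sqrt \<tau>)\<close>
(\<open>gaussian_smoothing\<close>, and \<open>joint_smoothing\<close> for several particles).  A process with drift at most \<open>B\<close>
may be replaced over a time window of length \<open>\<delta>\<close> by the process without drift, at cost
\<open>6 B sqrt \<delta> / c\<close> (\<open>drift_removal\<close>): the drift is removed piece by piece on the intervals between the
times \<open>t - \<delta> / 4^k\<close>, and the noise that is still to come smooths each piece.  Together this bounds the total
variation distance at time \<open>t\<close> by a multiple of \<open>B sqrt \<delta> + E|X - Xbar| / sqrt \<delta>\<close>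
(\<open>tv_drift_processes\<close>).  The drift of \<open>X\<close> is of order \<open>\<eta> powr (- d - 1)\<close>, with \<open>d\<close> the dimension, the mean distance is almost
\<open>1 / sqrt N\<close>, and \<open>\<delta> = 1 / sqrt N\<close> leaves \<open>N powr (- 1 / 8) \<eta> powr (- d - 1)\<close>.  The coupling of \<open>N\<close> and
\<open>\<eta>\<close> makes \<open>N\<close> exponentially large in a power of \<open>1 / \<eta>\<close>, so this is at most a multiple of \<open>\<eta>\<close>
(\<open>admissible_rate\<close>, \<open>joint_rate\<close>).

The smoothing step needs increments that are independent of each other and, jointly, of the past of all
particles.  This holds for the filtration generated by the noise (\<open>noise_brownian_family\<close>); the
particles are adapted to it because they are limits of Euler schemes (\<open>strong_solution_measurable\<close>).

For the second distance, the bound on \<open>u_eta - u\<close> must be uniform in the diffusivities \<open>\<sigma> i\<close>, of which only the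
minimum is prescribed.  The \<open>H\<^sup>s\<close> bounds give \<open>u\<close> and \<open>u_eta\<close> a common Lipschitz constant
(\<open>solution_lipschitz_constant\<close>), so the drifts of \<open>Xbar\<close> and \<open>Xhat\<close> are bounded independently of \<open>\<eta>\<close>.
Both processes are within \<open>O(\<eta>)\<close> of each other in mean, and the argument for the first distance with window
\<open>\<delta> = \<eta>\<close> gives \<open>sqrt (\<eta> / \<sigma>)\<close>.  This is of the order \<open>\<eta> powr (4 / (4 + d))\<close> as soon as
\<open>\<sigma> \<ge> \<eta> powr (- (4 - d) / (4 + d))\<close>.  For smaller \<open>\<sigma>\<close> the \<open>L\<^sup>2\<close> estimate is used: inside
a ball of radius \<open>r\<close> one has \<open>|f| \<le> l + f\<^sup>2 / l\<close>, outside of it the mass is of order \<open>1 / r\<^sup>2\<close> by the second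
moment of the initial data, and \<open>r = \<eta> powr (- 2 / (4 + d))\<close>, \<open>l = \<eta> powr (1 + d / (4 + d))\<close> make
all terms of order \<open>\<eta> powr (4 / (4 + d))\<close>.  The Gaussian part of the displacement is estimated by its
eighth moment, which is of order \<open>(\<sigma> / r\<^sup>2)^4\<close>; the second moment would not suffice for \<open>d < 4\<close>
when \<open>\<sigma>\<close> grows as \<open>\<eta>\<close> tends to zero.\<close>

section \<open>Total variation and densities\<close>

text \<open>Indicators of open sets are increasing limits of continuous functions, and measurable sets are approximated
from outside by open sets.  This allows estimates along almost surely convergent sequences of processes to
be carried out with continuous test functions.\<close>

lemma (in prob_space) tv_le_of_continuous:
  fixes X Y :: "'a \<Rightarrow> 'b::polish_space"
  assumes [measurable]: "X \<in> borel_measurable M" "Y \<in> borel_measurable M"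
  assumes cont: "\<And>\<phi> :: 'b \<Rightarrow> real. continuous_on UNIV \<phi> \<Longrightarrow> (\<And>x. 0 \<le> \<phi> x \<and> \<phi> x \<le> 1) \<Longrightarrow>
      \<bar>expectation (\<lambda>\<omega>. \<phi> (X \<omega>)) - expectation (\<lambda>\<omega>. \<phi> (Y \<omega>))\<bar> \<le> e"
  assumes A: "A \<in> sets borel"
  shows "\<bar>prob (X -` A \<inter> space M) - prob (Y -` A \<inter> space M)\<bar> \<le> e"
proof -
  have op: "\<bar>prob (X -` U \<inter> space M) - prob (Y -` U \<inter> space M)\<bar> \<le> e" if U: "open U" for U
  proof (cases "U = UNIV")
    case True
    have "0 \<le> e" using cont[of "\<lambda>_. 0"] by simp
    then show ?thesis using True by simp
  next
    case False
    then have ne: "- U \<noteq> {}" by auto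
    have cl: "closed (- U)" using U by auto
    define \<phi> where "\<phi> m x = min 1 (real m * infdist x (- U))" for m x
    have c\<phi>: "continuous_on UNIV (\<phi> m)" for m
      unfolding \<phi>_def by (intro continuous_intros)
    have b\<phi>: "0 \<le> \<phi> m x \<and> \<phi> m x \<le> 1" for m x
      unfolding \<phi>_def by (auto simp: infdist_nonneg)
    have lim: "(\<lambda>m. \<phi> m x) \<longlonglongrightarrow> indicator U x" for x
    proof (cases "x \<in> U")
      case True
      then have "infdist x (- U) > 0"
        using infdist_pos_not_in_closed[OF cl ne, of x] by auto
      then have "eventually (\<lambda>m. 1 \<le> real m * infdist x (- U)) sequentially"
        by real_asymp
      then have "eventually (\<lambda>m. \<phi> m x = 1) sequentially"
        by eventually_elim (auto simp: \<phi>_def)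
      then show ?thesis using True by (simp add: tendsto_eventually)
    next
      case False
      then show ?thesis by (simp add: \<phi>_def)
    qed
    have dc: "(\<lambda>m. expectation (\<lambda>\<omega>. \<phi> m (Z \<omega>))) \<longlonglongrightarrow> prob (Z -` U \<inter> space M)"
      if [measurable]: "Z \<in> borel_measurable M" for Z
    proof -
      have [measurable]: "U \<in> sets borel" using U by auto
      have [measurable]: "\<phi> m \<in> borel_measurable borel" for m
        using c\<phi> by (rule borel_measurable_continuous_onI)
      have "(\<lambda>m. expectation (\<lambda>\<omega>. \<phi> m (Z \<omega>))) \<longlonglongrightarrow> expectation (\<lambda>\<omega>. indicator U (Z \<omega>))"
        by (rule integral_dominated_convergence[where w="\<lambda>_. 1"]) (use lim b\<phi> in auto)
      also have "expectation (\<lambda>\<omega>. indicator U (Z \<omega>) :: real) = expectation (indicator (Z -` U \<inter> space M))"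
        by (rule Bochner_Integration.integral_cong) (auto simp: indicator_def)
      finally show ?thesis by (simp add: Int_assoc)
    qed
    have "(\<lambda>m. \<bar>expectation (\<lambda>\<omega>. \<phi> m (X \<omega>)) - expectation (\<lambda>\<omega>. \<phi> m (Y \<omega>))\<bar>) \<longlonglongrightarrow>
        \<bar>prob (X -` U \<inter> space M) - prob (Y -` U \<inter> space M)\<bar>"
      by (intro tendsto_intros dc) auto
    then show ?thesis
      by (rule LIMSEQ_le_const2) (use cont[OF c\<phi> b\<phi>] in auto)
  qed
  have reg: "\<exists>U. open U \<and> A \<subseteq> U \<and> prob (Z -` U \<inter> space M) < prob (Z -` A \<inter> space M) + d"
    if [measurable]: "Z \<in> borel_measurable M" and d: "d > 0" for Z :: "'a \<Rightarrow> 'b" and d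
  proof -
    interpret D: prob_space "distr M borel Z" by (rule prob_space_distr) auto
    have "emeasure (distr M borel Z) A = (INF U\<in>{U. A \<subseteq> U \<and> open U}. emeasure (distr M borel Z) U)"
      by (rule outer_regular) (use A in auto)
    moreover have "emeasure (distr M borel Z) A < emeasure (distr M borel Z) A + ennreal d"
      using d D.emeasure_finite[of A] by (simp add: ennreal_add_left_cancel_less[of _ 0, simplified] less_top)
    ultimately obtain U where "A \<subseteq> U" "open U" "emeasure (distr M borel Z) U < emeasure (distr M borel Z) A + ennreal d"
      by (auto simp: INF_less_iff)
    moreover from this have "D.prob U < D.prob A + d"
      using d by (simp add: D.emeasure_eq_measure ennreal_less_iff flip: ennreal_plus)
    ultimately show ?thesis
      using A by (intro exI[of _ U]) (auto simp: measure_distr)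
  qed
  have half: "prob (Z -` A \<inter> space M) \<le> prob (Z' -` A \<inter> space M) + e"
    if Z [measurable]: "Z \<in> borel_measurable M" and Z' [measurable]: "Z' \<in> borel_measurable M"
      and le: "\<And>U. open U \<Longrightarrow> prob (Z -` U \<inter> space M) \<le> prob (Z' -` U \<inter> space M) + e" for Z Z'
  proof (rule field_le_epsilon)
    fix d :: real assume "d > 0"
    then obtain U where U: "open U" "A \<subseteq> U" "prob (Z' -` U \<inter> space M) < prob (Z' -` A \<inter> space M) + d"
      using reg[OF Z'] by blast
    have "prob (Z -` A \<inter> space M) \<le> prob (Z -` U \<inter> space M)"
      by (rule finite_measure_mono) (use U(1,2) in \<open>auto intro!: measurable_sets[OF Z]\<close>)
    then show "prob (Z -` A \<inter> space M) \<le> prob (Z' -` A \<inter> space M) + e + d"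
      using le[OF U(1)] U(3) by linarith
  qed
  show ?thesis
    using half[of X Y] half[of Y X] op by (smt (verit) assms(1,2))
qed

text \<open>The sets where one density exceeds the other are the events at which the total variation is attained.\<close>

lemma (in prob_space) L1_density_le_tv:
  fixes f g :: "'b \<Rightarrow> real"
  assumes X: "distributed M N X (\<lambda>x. ennreal (f x))" and Y: "distributed M N Y (\<lambda>x. ennreal (g x))"
  assumes [measurable]: "f \<in> borel_measurable N" "g \<in> borel_measurable N"
  assumes nn: "\<And>x. x \<in> space N \<Longrightarrow> 0 \<le> f x" "\<And>x. x \<in> space N \<Longrightarrow> 0 \<le> g x"
  assumes tv: "\<And>A. A \<in> sets N \<Longrightarrow> \<bar>prob (X -` A \<inter> space M) - prob (Y -` A \<inter> space M)\<bar> \<le> e"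
  shows "(\<integral>\<^sup>+x. ennreal \<bar>f x - g x\<bar> \<partial>N) \<le> ennreal (2 * e)"
proof -
  have ef: "(\<integral>\<^sup>+x. ennreal (f x) * indicator A x \<partial>N) = ennreal (prob (X -` A \<inter> space M))" if "A \<in> sets N" for A
    using distributed_emeasure[OF X that] by (simp add: emeasure_eq_measure)
  have eg: "(\<integral>\<^sup>+x. ennreal (g x) * indicator A x \<partial>N) = ennreal (prob (Y -` A \<inter> space M))" if "A \<in> sets N" for A
    using distributed_emeasure[OF Y that] by (simp add: emeasure_eq_measure)
  define P where "P = {x\<in>space N. g x < f x}"
  define Q where "Q = {x\<in>space N. f x < g x}"
  have [measurable]: "P \<in> sets N" "Q \<in> sets N" unfolding P_def Q_def by auto
  have part: "(\<integral>\<^sup>+x. ennreal (f' x - g' x) * indicator P' x \<partial>N) \<le> ennreal e"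
    if [measurable]: "f' \<in> borel_measurable N" "g' \<in> borel_measurable N" "P' \<in> sets N"
      and P': "\<And>x. x \<in> P' \<Longrightarrow> 0 \<le> g' x \<and> g' x \<le> f' x"
      and f': "(\<integral>\<^sup>+x. ennreal (f' x) * indicator P' x \<partial>N) = ennreal p"
      and g': "(\<integral>\<^sup>+x. ennreal (g' x) * indicator P' x \<partial>N) = ennreal q" and pq: "p - q \<le> e" "0 \<le> q" "0 \<le> p"
    for f' g' P' p q
  proof -
    have "(\<integral>\<^sup>+x. ennreal (f' x - g' x) * indicator P' x \<partial>N) + (\<integral>\<^sup>+x. ennreal (g' x) * indicator P' x \<partial>N)
        = (\<integral>\<^sup>+x. ennreal (f' x - g' x) * indicator P' x + ennreal (g' x) * indicator P' x \<partial>N)"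
      by (subst nn_integral_add) auto
    also have "\<dots> = (\<integral>\<^sup>+x. ennreal (f' x) * indicator P' x \<partial>N)"
      by (rule nn_integral_cong) (use P' in \<open>auto simp: indicator_def simp flip: ennreal_plus\<close>)
    finally have eq: "(\<integral>\<^sup>+x. ennreal (f' x - g' x) * indicator P' x \<partial>N) + ennreal q = ennreal p"
      using f' g' by simp
    have "q \<le> p" using eq pq by (metis add.commute ennreal_le_iff le_iff_add)
    with eq have "(\<integral>\<^sup>+x. ennreal (f' x - g' x) * indicator P' x \<partial>N) = ennreal (p - q)"
      using pq by (metis ennreal_add_diff_cancel_right ennreal_minus ennreal_neq_top)
    then show ?thesis using pq by (simp add: ennreal_leI)
  qed
  have "(\<integral>\<^sup>+x. ennreal \<bar>f x - g x\<bar> \<partial>N) =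
     (\<integral>\<^sup>+x. ennreal (f x - g x) * indicator P x + ennreal (g x - f x) * indicator Q x \<partial>N)"
    by (rule nn_integral_cong) (auto simp: P_def Q_def indicator_def abs_if)
  also have "\<dots> = (\<integral>\<^sup>+x. ennreal (f x - g x) * indicator P x \<partial>N) + (\<integral>\<^sup>+x. ennreal (g x - f x) * indicator Q x \<partial>N)"
    by (rule nn_integral_add) auto
  also have "\<dots> \<le> ennreal e + ennreal e"
    by (intro add_mono part[OF _ _ _ _ ef eg] part[OF _ _ _ _ eg ef])
      (use tv[of P] tv[of Q] nn in \<open>auto simp: P_def Q_def\<close>)
  also have "\<dots> = ennreal (2 * e)"
    using tv[of P] by (subst ennreal_plus[symmetric]) auto
  finally show ?thesis .
qed

text \<open>The converse passage, from densities back to laws; it serves to extend bounds from almost all times to all times.\<close>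

lemma (in prob_space) expectation_diff_le_L1_density:
  fixes f g \<phi> :: "'b \<Rightarrow> real"
  assumes X: "distributed M N X (\<lambda>x. ennreal (f x))" and Y: "distributed M N Y (\<lambda>x. ennreal (g x))"
  assumes [measurable]: "f \<in> borel_measurable N" "g \<in> borel_measurable N" "\<phi> \<in> borel_measurable N"
  assumes nn: "\<And>x. x \<in> space N \<Longrightarrow> 0 \<le> f x" "\<And>x. x \<in> space N \<Longrightarrow> 0 \<le> g x"
  assumes \<phi>: "\<And>x. \<bar>\<phi> x\<bar> \<le> 1"
  assumes L1: "(\<integral>\<^sup>+x. ennreal \<bar>f x - g x\<bar> \<partial>N) \<le> ennreal e" "0 \<le> e"
  shows "\<bar>expectation (\<lambda>\<omega>. \<phi> (X \<omega>)) - expectation (\<lambda>\<omega>. \<phi> (Y \<omega>))\<bar> \<le> e"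
proof -
  have int: "integrable N h" if "distributed M N Z (\<lambda>x. ennreal (h x))" "\<And>x. x \<in> space N \<Longrightarrow> 0 \<le> h x"
    and [measurable]: "h \<in> borel_measurable N" for Z h
  proof (rule integrableI_nonneg)
    have "Z -` space N \<inter> space M = space M"
      using distributed_measurable[OF that(1)] by (auto dest: measurable_space)
    then show "(\<integral>\<^sup>+ x. ennreal (h x) \<partial>N) < \<infinity>"
      using distributed_emeasure[OF that(1), of "space N"]
      by (simp add: emeasure_space_1 cong: nn_integral_cong_simp)
  qed (use that in auto)
  have i: "integrable N f" "integrable N g" using int[OF X] int[OF Y] nn by auto
  have ip: "integrable N (\<lambda>x. h x * \<phi> x)" if "integrable N h" for h
    by (rule Bochner_Integration.integrable_bound[OF that]) (use that \<phi> in \<open>auto simp: abs_mult intro!: mult_left_le\<close>)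
  have "expectation (\<lambda>\<omega>. \<phi> (X \<omega>)) - expectation (\<lambda>\<omega>. \<phi> (Y \<omega>)) = (\<integral>x. f x * \<phi> x - g x * \<phi> x \<partial>N)"
    using distributed_integral[OF X, of \<phi>] distributed_integral[OF Y, of \<phi>] nn
    by (subst Bochner_Integration.integral_diff) (auto intro!: ip i)
  also have "\<bar>\<dots>\<bar> \<le> (\<integral>x. \<bar>f x - g x\<bar> \<partial>N)"
  proof (rule order_trans[OF integral_abs_bound integral_mono])
    show "integrable N (\<lambda>x. \<bar>f x * \<phi> x - g x * \<phi> x\<bar>)"
      using ip[OF i(1)] ip[OF i(2)] by auto
    show "integrable N (\<lambda>x. \<bar>f x - g x\<bar>)" using i by auto
    show "\<bar>f x * \<phi> x - g x * \<phi> x\<bar> \<le> \<bar>f x - g x\<bar>" for x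
      using \<phi>[of x] by (auto simp: abs_mult left_diff_distrib[symmetric] intro!: mult_left_le)
  qed
  also have "\<dots> \<le> e"
    using L1 i by (subst (asm) nn_integral_eq_integral) auto
  finally show ?thesis .
qed

section \<open>Gaussian densities\<close>

lemma has_bochner_integral_lborel_shift:
  fixes f :: "'a::euclidean_space \<Rightarrow> 'b::{banach, second_countable_topology}"
  assumes "has_bochner_integral lborel f I"
  shows "has_bochner_integral lborel (\<lambda>x. f (x + c)) I"
proof -
  have m: "f \<in> borel_measurable borel" and p: "(\<lambda>x. x + c) \<in> lborel \<rightarrow>\<^sub>M borel"
    using assms by (auto simp: has_bochner_integral_iff dest: borel_measurable_integrable)
  have d: "lborel = distr lborel borel (\<lambda>x. x + c)"
    using lborel_distr_plus[of c] by (simp add: add.commute[of _ c])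
  from assms have "has_bochner_integral (distr lborel borel (\<lambda>x. x + c)) f I"
    using d by simp
  then show ?thesis
    using m by (simp add: has_bochner_integral_iff integrable_distr_eq[OF p m] integral_distr[OF p m])
qed

text \<open>The density of a centred Gaussian vector with covariance \<tau> times the identity.\<close>

definition gauss :: "real \<Rightarrow> 'a::euclidean_space \<Rightarrow> real" where
  "gauss \<tau> x = (\<Prod>b\<in>Basis. normal_density 0 (sqrt \<tau>) (x \<bullet> b))"

lemma gauss_pos: "\<tau> > 0 \<Longrightarrow> gauss \<tau> x > 0"
  unfolding gauss_def by (intro prod_pos) (auto intro!: normal_density_pos)

lemma gauss_measurable [measurable]: "gauss \<tau> \<in> borel_measurable borel"
  unfolding gauss_def by measurable

text \<open>Fubini over the orthonormal basis; applied to Gaussian densities, moments and characters.\<close>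

lemma integral_lborel_prod:
  fixes f :: "'a::euclidean_space \<Rightarrow> real \<Rightarrow> 'b::{real_normed_field,banach,second_countable_topology}"
  assumes f: "\<And>b. b \<in> Basis \<Longrightarrow> integrable lborel (f b)"
  shows "has_bochner_integral lborel (\<lambda>x. \<Prod>b\<in>Basis. f b (x \<bullet> b)) (\<Prod>b\<in>Basis. integral\<^sup>L lborel (f b))"
proof -
  interpret P: product_sigma_finite "\<lambda>_::'a. lborel :: real measure" ..
  have eq: "(\<Prod>b\<in>Basis. f b ((\<Sum>c\<in>Basis. x c *\<^sub>R c) \<bullet> b)) = (\<Prod>b\<in>Basis. f b (x b))" for x :: "'a \<Rightarrow> real"
    by (rule prod.cong) (auto simp: inner_sum_left inner_Basis if_distrib cong: if_cong)
  have i: "integrable (\<Pi>\<^sub>M b\<in>(Basis::'a set). lborel) (\<lambda>x. \<Prod>b\<in>Basis. f b (x b))"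
    by (rule P.product_integrable_prod) (use f in auto)
  have [measurable]: "(\<lambda>x. f b (x \<bullet> b)) \<in> borel_measurable borel" if "b \<in> Basis" for b
  proof -
    have [measurable]: "f b \<in> borel_measurable borel" using f[OF that] by (auto dest: borel_measurable_integrable)
    show ?thesis by measurable
  qed
  have m: "(\<lambda>x. \<Prod>b\<in>Basis. f b (x \<bullet> b)) \<in> borel_measurable borel" by measurable
  have L: "(lborel :: 'a measure) = distr (\<Pi>\<^sub>M b\<in>Basis. lborel) borel (\<lambda>f. \<Sum>b\<in>Basis. f b *\<^sub>R b)"
    by (rule lborel_eq)
  have m2: "(\<lambda>f. \<Sum>b\<in>(Basis::'a set). f b *\<^sub>R b) \<in> (\<Pi>\<^sub>M b\<in>Basis. lborel) \<rightarrow>\<^sub>M borel" by measurable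
  show ?thesis
    unfolding has_bochner_integral_iff
  proof
    show "integrable lborel (\<lambda>x. \<Prod>b\<in>Basis. f b (x \<bullet> b))"
      by (subst L, subst integrable_distr_eq[OF m2 m]) (use i in \<open>simp add: eq\<close>)
    show "integral\<^sup>L lborel (\<lambda>x. \<Prod>b\<in>Basis. f b (x \<bullet> b)) = (\<Prod>b\<in>Basis. integral\<^sup>L lborel (f b))"
      by (subst L, subst integral_distr[OF m2 m])
        (use f in \<open>simp add: eq P.product_integral_prod\<close>)
  qed
qed

lemma has_bochner_integral_gauss:
  assumes "\<tau> > 0"
  shows "has_bochner_integral lborel (gauss \<tau> :: 'a::euclidean_space \<Rightarrow> real) 1"
proof -
  have "has_bochner_integral lborel (\<lambda>x::'a. \<Prod>b\<in>Basis. normal_density 0 (sqrt \<tau>) (x \<bullet> b))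
     (\<Prod>b\<in>(Basis::'a set). integral\<^sup>L lborel (normal_density 0 (sqrt \<tau>)))"
    by (rule integral_lborel_prod) (use assms in auto)
  then show ?thesis using assms by (simp add: gauss_def[abs_def])
qed

text \<open>Completing the square.  Divided by \<open>gauss \<tau> z\<close>, it shows that the second moment of the likelihood ratio
of two shifted Gaussians is the exponential of \<open>(norm h)\<^sup>2 / \<tau>\<close>.\<close>

lemma gauss_shift_sq:
  assumes "\<tau> > 0"
  shows "(gauss \<tau> (z - h))\<^sup>2 = exp ((norm h)\<^sup>2 / \<tau>) * gauss \<tau> (z - 2 *\<^sub>R h) * gauss \<tau> z"
proof -
  have 1: "(normal_density 0 (sqrt \<tau>) (x - y))\<^sup>2 =
      exp (y\<^sup>2 / \<tau>) * normal_density 0 (sqrt \<tau>) (x - 2 * y) * normal_density 0 (sqrt \<tau>) x" for x y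
  proof -
    have "y\<^sup>2 / \<tau> + - (x - 2 * y)\<^sup>2 / (2 * \<tau>) + - x\<^sup>2 / (2 * \<tau>) = - (x - y)\<^sup>2 / (2 * \<tau>) + - (x - y)\<^sup>2 / (2 * \<tau>)"
      using assms by (simp add: field_simps power2_eq_square)
    then have "exp (y\<^sup>2 / \<tau>) * exp (- (x - 2 * y)\<^sup>2 / (2 * \<tau>)) * exp (- x\<^sup>2 / (2 * \<tau>))
        = exp (- (x - y)\<^sup>2 / (2 * \<tau>)) * exp (- (x - y)\<^sup>2 / (2 * \<tau>))"
      by (simp only: exp_add[symmetric])
    then show ?thesis
      using assms unfolding normal_density_def power2_eq_square by (simp add: mult_ac)
  qed
  have "(norm h)\<^sup>2 = (\<Sum>b\<in>Basis. (h \<bullet> b)\<^sup>2)"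
    using euclidean_inner[of h h] by (simp add: power2_norm_eq_inner power2_eq_square[of "_ \<bullet> _"])
  then have "exp ((norm h)\<^sup>2 / \<tau>) = (\<Prod>b\<in>Basis. exp ((h \<bullet> b)\<^sup>2 / \<tau>))"
    by (simp add: exp_sum sum_divide_distrib)
  then show ?thesis
    unfolding gauss_def by (simp add: inner_diff_left prod_power_distrib 1 prod.distrib)
qed

text \<open>The \<open>L\<^sup>1\<close> distance is controlled by the chi-square distance, which is explicit by the previous identity.\<close>

lemma gauss_shift_L1:
  fixes h :: "'a::euclidean_space"
  assumes \<tau>: "\<tau> > 0"
  shows "integrable lborel (\<lambda>z. \<bar>gauss \<tau> (z - h) - gauss \<tau> z\<bar>)"
    and "(\<integral>z. \<bar>gauss \<tau> (z - h) - gauss \<tau> z\<bar> \<partial>lborel) \<le> 2 * norm h / sqrt \<tau>"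
proof -
  have i0: "integrable lborel (gauss \<tau> :: 'a \<Rightarrow> real)" "integral\<^sup>L lborel (gauss \<tau> :: 'a \<Rightarrow> real) = 1"
    using has_bochner_integral_gauss[OF \<tau>] by (auto simp: has_bochner_integral_iff)
  have i: "integrable lborel (\<lambda>z. gauss \<tau> (z - k))" "(\<integral>z. gauss \<tau> (z - k) \<partial>lborel) = 1" for k :: 'a
    using has_bochner_integral_lborel_shift[OF has_bochner_integral_gauss[OF \<tau>], of "- k"]
    by (auto simp: has_bochner_integral_iff)
  show I: "integrable lborel (\<lambda>z. \<bar>gauss \<tau> (z - h) - gauss \<tau> z\<bar>)" using i0 i by auto
  define l where "l = norm h / sqrt \<tau>"
  have l0: "l \<ge> 0" using \<tau> by (auto simp: l_def)
  consider "h = 0" | "h \<noteq> 0" "l \<ge> 1" | "h \<noteq> 0" "l < 1" by linarith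
  then show "(\<integral>z. \<bar>gauss \<tau> (z - h) - gauss \<tau> z\<bar> \<partial>lborel) \<le> 2 * norm h / sqrt \<tau>"
  proof cases
    case 1 then show ?thesis by simp
  next
    case 2
    have "(\<integral>z. \<bar>gauss \<tau> (z - h) - gauss \<tau> z\<bar> \<partial>lborel) \<le> (\<integral>z. gauss \<tau> (z - h) + gauss \<tau> z \<partial>lborel)"
    proof (rule integral_mono)
      show "\<bar>gauss \<tau> (z - h) - gauss \<tau> z\<bar> \<le> gauss \<tau> (z - h) + gauss \<tau> z" for z
        using gauss_pos[OF \<tau>, of z] gauss_pos[OF \<tau>, of "z - h"] by linarith
    qed (use I i i0 in auto)
    also have "\<dots> = 2" using i i0 by simp
    finally show ?thesis using 2 by (simp add: l_def)
  next
    case 3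
    then have l: "l > 0" using \<tau> by (simp add: l_def)
    have l2: "l\<^sup>2 = (norm h)\<^sup>2 / \<tau>" using \<tau> by (simp add: l_def power_divide)
    \<comment> \<open>With \<open>a\<close> and \<open>b\<close> the two values, \<open>2 |a - b| \<le> l b + (a - b)\<^sup>2 / (l b)\<close>; the choice of \<open>l\<close> balances the two terms
      after integration.\<close>
    have pt: "\<bar>gauss \<tau> (z - h) - gauss \<tau> z\<bar> \<le>
       (l * gauss \<tau> z + (exp (l\<^sup>2) * gauss \<tau> (z - 2 *\<^sub>R h) - 2 * gauss \<tau> (z - h) + gauss \<tau> z) / l) / 2" for z
    proof -
      define a b where "a = gauss \<tau> (z - h)" and "b = gauss \<tau> z"
      have b: "b > 0" using gauss_pos[OF \<tau>] by (simp add: b_def)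
      have "exp (l\<^sup>2) * gauss \<tau> (z - 2 *\<^sub>R h) = a\<^sup>2 / b"
        using gauss_shift_sq[OF \<tau>, of z h] b by (simp add: a_def b_def l2 field_simps)
      moreover have "a\<^sup>2 / b - 2 * a + b = (a - b)\<^sup>2 / b"
        using b by (simp add: field_simps power2_eq_square)
      moreover have "\<bar>a - b\<bar> \<le> (l * b + (a - b)\<^sup>2 / b / l) / 2"
      proof -
        have "0 \<le> (\<bar>a - b\<bar> - l * b)\<^sup>2 / (l * b)" using b l by auto
        also have "\<dots> = (a - b)\<^sup>2 / b / l - 2 * \<bar>a - b\<bar> + l * b"
          using b l by (simp add: field_simps power2_eq_square)
        finally show ?thesis by simp
      qed
      ultimately show ?thesis by (simp add: a_def b_def)
    qed
    have "(\<integral>z. \<bar>gauss \<tau> (z - h) - gauss \<tau> z\<bar> \<partial>lborel) \<le>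
      (\<integral>z. (l * gauss \<tau> z + (exp (l\<^sup>2) * gauss \<tau> (z - 2 *\<^sub>R h) - 2 * gauss \<tau> (z - h) + gauss \<tau> z) / l) / 2 \<partial>lborel)"
      by (rule integral_mono) (use pt I i i0 in auto)
    also have "\<dots> = (l + (exp (l\<^sup>2) - 2 + 1) / l) / 2"
      using i i0 by simp
    also have "\<dots> \<le> 2 * l"
    proof -
      have "l\<^sup>2 \<le> 1" using 3 l by (simp add: power_le_one)
      then have "exp (l\<^sup>2) \<le> 1 + l\<^sup>2 + (l\<^sup>2)\<^sup>2" by (intro exp_bound) auto
      also have "(l\<^sup>2)\<^sup>2 \<le> l\<^sup>2" using \<open>l\<^sup>2 \<le> 1\<close> by (metis mult_left_le power2_eq_square zero_le_power2)
      finally have "exp (l\<^sup>2) - 2 + 1 \<le> 2 * l\<^sup>2" by simp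
      then have "(exp (l\<^sup>2) - 2 + 1) / l \<le> 2 * l"
        using l by (simp add: field_simps power2_eq_square)
      then show ?thesis using l by simp
    qed
    finally show ?thesis by (simp add: l_def)
  qed
qed

section \<open>Gaussian smoothing\<close>

text \<open>Convolving a bounded function with a Gaussian density makes it Lipschitz: the shift can be moved onto the
density.\<close>

lemma gauss_convolution_lipschitz:
  fixes K :: "'a::euclidean_space \<Rightarrow> real"
  assumes \<tau>: "\<tau> > 0" and [measurable]: "K \<in> borel_measurable borel" and K: "\<And>z. \<bar>K z\<bar> \<le> 1"
  shows "\<bar>(\<integral>z. K (a + z) * gauss \<tau> z \<partial>lborel) - (\<integral>z. K (b + z) * gauss \<tau> z \<partial>lborel)\<bar>
     \<le> 2 * norm (a - b) / sqrt \<tau>"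
proof -
  have i0: "integrable lborel (gauss \<tau> :: 'a \<Rightarrow> real)"
    using has_bochner_integral_gauss[OF \<tau>] by (auto simp: has_bochner_integral_iff)
  have iK: "integrable lborel (\<lambda>z. K (k + z) * gauss \<tau> z)" for k
    by (rule Bochner_Integration.integrable_bound[OF i0])
      (use K in \<open>auto simp: abs_mult intro!: mult_left_le_one_le\<close>)
  have sh: "has_bochner_integral lborel (\<lambda>z. K z * gauss \<tau> (z - k)) (\<integral>z. K (k + z) * gauss \<tau> z \<partial>lborel)" for k
    using has_bochner_integral_lborel_shift[OF has_bochner_integral_integrable[OF iK[of k]], of "- k"] by simp
  have ab: "has_bochner_integral lborel (\<lambda>z. \<bar>gauss \<tau> (z - a) - gauss \<tau> (z - b)\<bar>)
     (\<integral>z. \<bar>gauss \<tau> (z - (a - b)) - gauss \<tau> z\<bar> \<partial>lborel)"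
    using has_bochner_integral_lborel_shift[OF has_bochner_integral_integrable[OF gauss_shift_L1(1)[OF \<tau>, of "a - b"]], of "- b"]
    by (simp add: algebra_simps)
  have d: "has_bochner_integral lborel (\<lambda>z. K z * gauss \<tau> (z - a) - K z * gauss \<tau> (z - b))
     ((\<integral>z. K (a + z) * gauss \<tau> z \<partial>lborel) - (\<integral>z. K (b + z) * gauss \<tau> z \<partial>lborel))"
    by (intro has_bochner_integral_diff sh)
  then have "\<bar>(\<integral>z. K (a + z) * gauss \<tau> z \<partial>lborel) - (\<integral>z. K (b + z) * gauss \<tau> z \<partial>lborel)\<bar>
    \<le> (\<integral>z. \<bar>K z * gauss \<tau> (z - a) - K z * gauss \<tau> (z - b)\<bar> \<partial>lborel)"
    using integral_abs_bound[of lborel "\<lambda>z. K z * gauss \<tau> (z - a) - K z * gauss \<tau> (z - b)"]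
    by (simp add: has_bochner_integral_iff)
  also have "\<dots> \<le> (\<integral>z. \<bar>gauss \<tau> (z - a) - gauss \<tau> (z - b)\<bar> \<partial>lborel)"
  proof (rule integral_mono)
    show "\<bar>K z * gauss \<tau> (z - a) - K z * gauss \<tau> (z - b)\<bar> \<le> \<bar>gauss \<tau> (z - a) - gauss \<tau> (z - b)\<bar>" for z
      using K[of z] by (auto simp: abs_mult right_diff_distrib[symmetric] intro!: mult_left_le_one_le)
  qed (use d ab in \<open>auto simp: has_bochner_integral_iff\<close>)
  also have "\<dots> \<le> 2 * norm (a - b) / sqrt \<tau>"
    using ab gauss_shift_L1(2)[OF \<tau>, of "a - b"] by (simp add: has_bochner_integral_iff)
  finally show ?thesis .
qed

lemma generated_Int_stable: "Int_stable (generated M N Z)"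
proof (rule Int_stableI)
  fix a b assume "a \<in> generated M N Z" "b \<in> generated M N Z"
  then obtain A B where "a = Z -` A \<inter> space M" "A \<in> sets N" "b = Z -` B \<inter> space M" "B \<in> sets N"
    by (auto simp: generated_def)
  then have "a \<inter> b = Z -` (A \<inter> B) \<inter> space M" "A \<inter> B \<in> sets N" by auto
  then show "a \<inter> b \<in> generated M N Z" unfolding generated_def by blast
qed

text \<open>Freezing lemma in measure form: given independence, the pair of the identity, which carries the information in \<open>G\<close>,
and \<open>g\<close> has a product law, so one may integrate over \<open>g\<close> with the \<open>G\<close>-measurable data held fixed.\<close>

lemma (in prob_space) distr_pair_of_indep_set:
  assumes G: "subalgebra M G" and ind: "indep_set (sets G) (generated M N g)" and g[measurable]: "g \<in> M \<rightarrow>\<^sub>M N"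
  shows "distr M (G \<Otimes>\<^sub>M N) (\<lambda>\<omega>. (\<omega>, g \<omega>)) = distr M G (\<lambda>\<omega>. \<omega>) \<Otimes>\<^sub>M distr M N g"
proof (rule pair_measure_eqI[symmetric])
  have idm[measurable]: "(\<lambda>\<omega>. \<omega>) \<in> M \<rightarrow>\<^sub>M G"
    using G by (auto simp: subalgebra_def measurable_def)
  show "sigma_finite_measure (distr M G (\<lambda>\<omega>. \<omega>))" "sigma_finite_measure (distr M N g)"
    by (intro prob_space_imp_sigma_finite prob_space_distr, measurable)+
  show "sets (distr M G (\<lambda>\<omega>. \<omega>) \<Otimes>\<^sub>M distr M N g) = sets (distr M (G \<Otimes>\<^sub>M N) (\<lambda>\<omega>. (\<omega>, g \<omega>)))"
    by (simp cong: sets_pair_measure_cong)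
  fix A B assume A: "A \<in> sets (distr M G (\<lambda>\<omega>. \<omega>))" and B: "B \<in> sets (distr M N g)"
  then have [measurable]: "A \<in> sets G" "B \<in> sets N" by auto
  have AM: "A \<subseteq> space M" using sets.sets_into_space[of A G] G by (auto simp: subalgebra_def)
  have "prob (A \<inter> (g -` B \<inter> space M)) = prob A * prob (g -` B \<inter> space M)"
    by (rule indep_setD[OF ind]) (auto simp: generated_def)
  moreover have "(\<lambda>\<omega>. (\<omega>, g \<omega>)) -` (A \<times> B) \<inter> space M = A \<inter> (g -` B \<inter> space M)"
    using AM by auto
  moreover have "(\<lambda>\<omega>. \<omega>) -` A \<inter> space M = A" using AM by auto
  ultimately show "emeasure (distr M G (\<lambda>\<omega>. \<omega>)) A * emeasure (distr M N g) B =
      emeasure (distr M (G \<Otimes>\<^sub>M N) (\<lambda>\<omega>. (\<omega>, g \<omega>))) (A \<times> B)"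
    by (simp add: emeasure_distr emeasure_eq_measure ennreal_mult')
qed

text \<open>The basic mechanism: \<open>h1\<close> and \<open>h2\<close> are known before the Gaussian increment \<open>g\<close> is drawn.  The test function may
also depend on all of the information in \<open>G\<close>; for several particles this covers the coordinates that are
not being replaced.\<close>

lemma (in prob_space) gaussian_smoothing:
  fixes g :: "'a \<Rightarrow> 'b::euclidean_space" and H :: "'a \<times> 'b \<Rightarrow> real"
  assumes G: "subalgebra M G" and ind: "indep_set (sets G) (generated M borel g)"
    and g: "distributed M lborel g (\<lambda>x. ennreal (gauss \<tau> x))" and \<tau>: "\<tau> > 0" and c: "c > 0"
    and h[measurable]: "h1 \<in> borel_measurable G" "h2 \<in> borel_measurable G"
    and H[measurable]: "H \<in> borel_measurable (G \<Otimes>\<^sub>M borel)" and H1: "\<And>p. \<bar>H p\<bar> \<le> 1"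
    and int: "integrable M (\<lambda>\<omega>. norm (h1 \<omega> - h2 \<omega>))"
  shows "\<bar>expectation (\<lambda>\<omega>. H (\<omega>, h1 \<omega> + c *\<^sub>R g \<omega>)) - expectation (\<lambda>\<omega>. H (\<omega>, h2 \<omega> + c *\<^sub>R g \<omega>))\<bar>
    \<le> 2 / (c * sqrt \<tau>) * expectation (\<lambda>\<omega>. norm (h1 \<omega> - h2 \<omega>))"
proof -
  have gm[measurable]: "g \<in> borel_measurable M" using distributed_measurable[OF g] by simp
  have idm[measurable]: "(\<lambda>\<omega>. \<omega>) \<in> M \<rightarrow>\<^sub>M G"
    using G by (auto simp: subalgebra_def measurable_def)
  define \<mu> where "\<mu> = distr M G (\<lambda>\<omega>. \<omega>)"
  define \<nu> where "\<nu> = distr M borel g"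
  have sm[measurable_cong]: "sets \<mu> = sets G" and sn[measurable_cong]: "sets \<nu> = sets borel"
    by (auto simp: \<mu>_def \<nu>_def)
  interpret mu: prob_space \<mu> unfolding \<mu>_def by (rule prob_space_distr) simp
  interpret nu: prob_space \<nu> unfolding \<nu>_def by (rule prob_space_distr) simp
  interpret PP: pair_prob_space \<mu> \<nu> ..
  have law: "distr M (G \<Otimes>\<^sub>M borel) (\<lambda>\<omega>. (\<omega>, g \<omega>)) = \<mu> \<Otimes>\<^sub>M \<nu>"
    unfolding \<mu>_def \<nu>_def by (rule distr_pair_of_indep_set[OF G ind gm])
  have \<nu>: "\<nu> = density lborel (\<lambda>x. ennreal (gauss \<tau> x))"
    using distributed_distr_eq_density[OF g] unfolding \<nu>_def by (simp cong: distr_cong)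
  define \<Phi> where "\<Phi> h \<omega> = (\<integral>z. H (\<omega>, h \<omega> + c *\<^sub>R z) \<partial>\<nu>)" for h \<omega>
  have main: "expectation (\<lambda>\<omega>. H (\<omega>, h \<omega> + c *\<^sub>R g \<omega>)) = (\<integral>\<omega>. \<Phi> h \<omega> \<partial>\<mu>) \<and> integrable \<mu> (\<Phi> h)"
    if [measurable]: "h \<in> borel_measurable G" for h
  proof -
    have [measurable]: "(\<lambda>p. H (fst p, h (fst p) + c *\<^sub>R snd p)) \<in> borel_measurable (G \<Otimes>\<^sub>M borel)"
      by measurable
    have i: "integrable (\<mu> \<Otimes>\<^sub>M \<nu>) (\<lambda>p. H (fst p, h (fst p) + c *\<^sub>R snd p))"
      by (rule PP.P.integrable_const_bound[where B=1]) (use H1 in auto)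
    have "expectation (\<lambda>\<omega>. H (\<omega>, h \<omega> + c *\<^sub>R g \<omega>)) =
       (\<integral>p. H (fst p, h (fst p) + c *\<^sub>R snd p) \<partial>(distr M (G \<Otimes>\<^sub>M borel) (\<lambda>\<omega>. (\<omega>, g \<omega>))))"
      by (subst integral_distr) auto
    also have "\<dots> = (\<integral>\<omega>. \<Phi> h \<omega> \<partial>\<mu>)"
      unfolding law using PP.integral_fst'[OF i] by (simp add: \<Phi>_def)
    finally show ?thesis
      using PP.integrable_fst'[OF i] by (simp add: \<Phi>_def[abs_def])
  qed
  have pt: "\<bar>\<Phi> h1 \<omega> - \<Phi> h2 \<omega>\<bar> \<le> 2 / (c * sqrt \<tau>) * norm (h1 \<omega> - h2 \<omega>)" if \<omega>: "\<omega> \<in> space M" for \<omega>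
  proof -
    have [simp]: "\<omega> \<in> space G" using G \<omega> by (simp add: subalgebra_def)
    have [measurable]: "(\<lambda>z. H (\<omega>, z)) \<in> borel_measurable borel" by measurable
    have e: "\<Phi> h \<omega> = (\<integral>z. H (\<omega>, c *\<^sub>R (h \<omega> /\<^sub>R c + z)) * gauss \<tau> z \<partial>lborel)" for h
      unfolding \<Phi>_def \<nu> using c gauss_pos[OF \<tau>]
      by (subst integral_density) (auto simp: scaleR_add_right mult.commute intro!: less_imp_le)
    have "\<bar>\<Phi> h1 \<omega> - \<Phi> h2 \<omega>\<bar> \<le> 2 * norm (h1 \<omega> /\<^sub>R c - h2 \<omega> /\<^sub>R c) / sqrt \<tau>"
      unfolding e by (rule gauss_convolution_lipschitz[OF \<tau>]) (use H1 in auto)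
    also have "norm (h1 \<omega> /\<^sub>R c - h2 \<omega> /\<^sub>R c) = norm (h1 \<omega> - h2 \<omega>) / c"
      using c by (simp add: scaleR_diff_right[symmetric] divide_inverse mult.commute)
    finally show ?thesis by (simp add: mult.commute)
  qed
  have "\<bar>expectation (\<lambda>\<omega>. H (\<omega>, h1 \<omega> + c *\<^sub>R g \<omega>)) - expectation (\<lambda>\<omega>. H (\<omega>, h2 \<omega> + c *\<^sub>R g \<omega>))\<bar>
     = \<bar>(\<integral>\<omega>. \<Phi> h1 \<omega> - \<Phi> h2 \<omega> \<partial>\<mu>)\<bar>"
    using main h by simp
  also have "\<dots> \<le> (\<integral>\<omega>. \<bar>\<Phi> h1 \<omega> - \<Phi> h2 \<omega>\<bar> \<partial>\<mu>)" by (rule integral_abs_bound)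
  also have "\<dots> \<le> (\<integral>\<omega>. 2 / (c * sqrt \<tau>) * norm (h1 \<omega> - h2 \<omega>) \<partial>\<mu>)"
  proof (rule integral_mono)
    show "integrable \<mu> (\<lambda>\<omega>. 2 / (c * sqrt \<tau>) * norm (h1 \<omega> - h2 \<omega>))"
      unfolding \<mu>_def by (subst integrable_distr_eq) (use int in auto)
    show "\<bar>\<Phi> h1 \<omega> - \<Phi> h2 \<omega>\<bar> \<le> 2 / (c * sqrt \<tau>) * norm (h1 \<omega> - h2 \<omega>)" if "\<omega> \<in> space \<mu>" for \<omega>
      using pt that G by (simp add: \<mu>_def subalgebra_def)
  qed (use main h in auto)
  also have "\<dots> = 2 / (c * sqrt \<tau>) * expectation (\<lambda>\<omega>. norm (h1 \<omega> - h2 \<omega>))"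
    unfolding \<mu>_def by (subst integral_distr) auto
  finally show ?thesis .
qed

text \<open>Configurations indexed by \<open>R\<close>, extended by zero, so that laws of several particles live on a Polish function space
on which continuity and Borel measurability are available.\<close>

definition config :: "'p set \<Rightarrow> ('p \<Rightarrow> 'a::zero) \<Rightarrow> 'p \<Rightarrow> 'a" where
  "config R x = (\<lambda>p. if p \<in> R then x p else 0)"

lemma config_measurable [measurable (raw)]:
  fixes x :: "'p::countable \<Rightarrow> 'w \<Rightarrow> 'a::{zero, second_countable_topology}"
  assumes "\<And>p. p \<in> R \<Longrightarrow> x p \<in> borel_measurable M"
  shows "(\<lambda>\<omega>. config R (\<lambda>p. x p \<omega>)) \<in> borel_measurable M"
proof (rule measurable_coordinatewise_then_product)
  fix p show "(\<lambda>\<omega>. config R (\<lambda>p. x p \<omega>) p) \<in> borel_measurable M"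
    by (cases "p \<in> R") (use assms in \<open>auto simp: config_def\<close>)
qed

lemma tendsto_coordinatewise:
  fixes f :: "'b \<Rightarrow> 'i \<Rightarrow> 'c::topological_space"
  assumes "\<And>i. ((\<lambda>x. f x i) \<longlongrightarrow> l i) F"
  shows "(f \<longlongrightarrow> l) F"
proof -
  have "limitin (product_topology (\<lambda>_. euclidean) UNIV) f l F"
    unfolding limitin_componentwise using assms by (simp add: limitin_canonical_iff)
  then show ?thesis by (simp add: euclidean_product_topology limitin_canonical_iff)
qed

text \<open>What the smoothing argument needs from the noise: each increment is independent of the past together with
the simultaneous increments of all other particles.  This is more than saying that every \<open>W p\<close> is a Brownian
motion for \<open>G\<close>.\<close>

locale brownian_family = prob_space M for M :: "'w measure" +
  fixes R :: "'p::countable set" and W :: "'p \<Rightarrow> real \<Rightarrow> 'w \<Rightarrow> 'a::euclidean_space" and G :: "real \<Rightarrow> 'w measure"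
  assumes finite_R: "finite R"
    and subalg: "0 \<le> t \<Longrightarrow> subalgebra M (G t)"
    and mono: "0 \<le> s \<Longrightarrow> s \<le> t \<Longrightarrow> sets (G s) \<subseteq> sets (G t)"
    and adapted: "p \<in> R \<Longrightarrow> 0 \<le> t \<Longrightarrow> W p t \<in> borel_measurable (G t)"
    and indep: "p \<in> R \<Longrightarrow> 0 \<le> s \<Longrightarrow> s < t \<Longrightarrow>
      indep_set (sigma_sets (space M) (sets (G s) \<union> (\<Union>q\<in>R - {p}. generated M borel (\<lambda>\<omega>. W q t \<omega> - W q s \<omega>))))
        (generated M borel (\<lambda>\<omega>. W p t \<omega> - W p s \<omega>))"
    and gaussian: "p \<in> R \<Longrightarrow> 0 \<le> s \<Longrightarrow> s < t \<Longrightarrow>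
      distributed M lborel (\<lambda>\<omega>. W p t \<omega> - W p s \<omega>) (\<lambda>x. ennreal (gauss (t - s) x))"
begin

lemma G_meas:
  assumes "0 \<le> t" "f \<in> borel_measurable (G t)" shows "f \<in> borel_measurable M"
  using subalg[OF assms(1)] assms(2) by (auto simp: subalgebra_def measurable_def)

lemma G_mono_meas:
  assumes "0 \<le> s" "s \<le> t" "f \<in> borel_measurable (G s)" shows "f \<in> borel_measurable (G t)"
  using subalg[of s] subalg[of t] mono[OF assms(1,2)] assms by (auto simp: subalgebra_def measurable_def)

lemma W_meas: "p \<in> R \<Longrightarrow> 0 \<le> t \<Longrightarrow> W p t \<in> borel_measurable M"
  using G_meas adapted by blast

text \<open>Particles are replaced one at a time, and \<open>gaussian_smoothing\<close> is applied with respect to the past enlarged by the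
increments of the other particles.\<close>

lemma joint_smoothing:
  fixes \<phi> :: "('p \<Rightarrow> 'a) \<Rightarrow> real"
  assumes st: "0 \<le> s" "s < t" and c: "\<And>p. p \<in> R \<Longrightarrow> c p > 0"
    and x[measurable]: "\<And>p. p \<in> R \<Longrightarrow> x p \<in> borel_measurable (G s)"
    and y[measurable]: "\<And>p. p \<in> R \<Longrightarrow> y p \<in> borel_measurable (G s)"
    and int: "\<And>p. p \<in> R \<Longrightarrow> integrable M (\<lambda>\<omega>. norm (x p \<omega> - y p \<omega>))"
    and \<phi>[measurable]: "\<phi> \<in> borel_measurable borel" and \<phi>1: "\<And>z. \<bar>\<phi> z\<bar> \<le> 1"
  shows "\<bar>expectation (\<lambda>\<omega>. \<phi> (config R (\<lambda>p. x p \<omega> + c p *\<^sub>R (W p t \<omega> - W p s \<omega>))))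
       - expectation (\<lambda>\<omega>. \<phi> (config R (\<lambda>p. y p \<omega> + c p *\<^sub>R (W p t \<omega> - W p s \<omega>))))\<bar>
    \<le> (\<Sum>p\<in>R. 2 / (c p * sqrt (t - s)) * expectation (\<lambda>\<omega>. norm (x p \<omega> - y p \<omega>)))"
proof -
  define mix where "mix S p = (if p \<in> S then y p else x p)" for S p
  define Ex where "Ex S = expectation (\<lambda>\<omega>. \<phi> (config R (\<lambda>p. mix S p \<omega> + c p *\<^sub>R (W p t \<omega> - W p s \<omega>))))" for S
  have "\<bar>Ex {} - Ex S\<bar> \<le> (\<Sum>p\<in>S. 2 / (c p * sqrt (t - s)) * expectation (\<lambda>\<omega>. norm (x p \<omega> - y p \<omega>)))"
    if "finite S" "S \<subseteq> R" for S
    using that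
  proof (induction S)
    case empty show ?case by simp
  next
    case (insert p S)
    then have p: "p \<in> R" "p \<notin> S" by auto
    define E where "E = sets (G s) \<union> (\<Union>q\<in>R - {p}. generated M borel (\<lambda>\<omega>. W q t \<omega> - W q s \<omega>))"
    define G' where "G' = sigma (space M) E"
    have Wm: "(\<lambda>\<omega>. W q t \<omega> - W q s \<omega>) \<in> borel_measurable M" if "q \<in> R" for q
      using W_meas[OF that] st by (intro borel_measurable_diff) auto
    have gE: "generated M borel (\<lambda>\<omega>. W q t \<omega> - W q s \<omega>) \<subseteq> sets M" if "q \<in> R" for q
      unfolding generated_def using Wm[OF that] by (auto intro: measurable_sets)
    have sG: "space (G s) = space M" "sets (G s) \<subseteq> sets M" using subalg[OF st(1)] by (auto simp: subalgebra_def)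
    have E: "E \<subseteq> sets M" unfolding E_def using gE sG by blast
    then have EP: "E \<subseteq> Pow (space M)" using sets.sets_into_space by blast
    have sp: "space G' = space M" and se: "sets G' = sigma_sets (space M) E"
      unfolding G'_def using EP by (auto simp: space_measure_of sets_measure_of)
    have sub: "subalgebra M G'" unfolding subalgebra_def sp se using sets.sigma_sets_subset[OF E] by simp
    have ind: "indep_set (sets G') (generated M borel (\<lambda>\<omega>. W p t \<omega> - W p s \<omega>))"
      unfolding se E_def using indep[OF p(1) st] .
    have GG: "f \<in> borel_measurable G'" if "f \<in> borel_measurable (G s)" for f :: "'w \<Rightarrow> 'a"
      using that sG sp se unfolding measurable_def by (auto simp: E_def intro: sigma_sets.Basic)
    have [measurable]: "(\<lambda>\<omega>. W q t \<omega> - W q s \<omega>) \<in> borel_measurable G'" if "q \<in> R - {p}" for q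
    proof (rule measurableI)
      fix A :: "'a set" assume "A \<in> sets borel"
      then show "(\<lambda>\<omega>. W q t \<omega> - W q s \<omega>) -` A \<inter> space G' \<in> sets G'"
        unfolding sp se using that by (intro sigma_sets.Basic) (auto simp: E_def generated_def)
    qed auto
    have [measurable]: "mix S q \<in> borel_measurable G'" if "q \<in> R" for q
      using that x y by (auto simp: mix_def intro!: GG)
    define H where "H = (\<lambda>(\<omega>, z). \<phi> (\<lambda>q. if q = p then z else if q \<in> R then mix S q \<omega> + c q *\<^sub>R (W q t \<omega> - W q s \<omega>) else 0))"
    have Hm: "H \<in> borel_measurable (G' \<Otimes>\<^sub>M borel)"
      unfolding H_def split_beta'
    proof (rule measurable_compose[OF _ \<phi>], rule measurable_coordinatewise_then_product)
      fix q
      consider "q = p" | "q \<noteq> p" "q \<in> R" | "q \<noteq> p" "q \<notin> R" by auto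
      then show "(\<lambda>x. if q = p then snd x else if q \<in> R then mix S q (fst x) + c q *\<^sub>R (W q t (fst x) - W q s (fst x)) else 0)
          \<in> borel_measurable (G' \<Otimes>\<^sub>M borel)"
      proof cases
        case 2
        then have [measurable]: "(\<lambda>\<omega>. W q t \<omega> - W q s \<omega>) \<in> borel_measurable G'" "mix S q \<in> borel_measurable G'"
          by auto
        show ?thesis using 2 by simp
      qed auto
    qed
    have eqx: "config R (\<lambda>q. mix S q \<omega> + c q *\<^sub>R (W q t \<omega> - W q s \<omega>)) =
       (\<lambda>q. if q = p then x p \<omega> + c p *\<^sub>R (W p t \<omega> - W p s \<omega>) else if q \<in> R then mix S q \<omega> + c q *\<^sub>R (W q t \<omega> - W q s \<omega>) else 0)" for \<omega>
      using p by (auto simp: config_def mix_def)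
    have eqy: "config R (\<lambda>q. mix (insert p S) q \<omega> + c q *\<^sub>R (W q t \<omega> - W q s \<omega>)) =
       (\<lambda>q. if q = p then y p \<omega> + c p *\<^sub>R (W p t \<omega> - W p s \<omega>) else if q \<in> R then mix S q \<omega> + c q *\<^sub>R (W q t \<omega> - W q s \<omega>) else 0)" for \<omega>
      using p by (auto simp: config_def mix_def)
    have "\<bar>expectation (\<lambda>\<omega>. H (\<omega>, x p \<omega> + c p *\<^sub>R (W p t \<omega> - W p s \<omega>))) - expectation (\<lambda>\<omega>. H (\<omega>, y p \<omega> + c p *\<^sub>R (W p t \<omega> - W p s \<omega>)))\<bar>
      \<le> 2 / (c p * sqrt (t - s)) * expectation (\<lambda>\<omega>. norm (x p \<omega> - y p \<omega>))"
      by (rule gaussian_smoothing[OF sub ind gaussian[OF p(1) st]])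
        (use st c p Hm \<phi>1 int x y in \<open>auto intro: GG simp: H_def\<close>)
    then have "\<bar>Ex S - Ex (insert p S)\<bar> \<le> 2 / (c p * sqrt (t - s)) * expectation (\<lambda>\<omega>. norm (x p \<omega> - y p \<omega>))"
      unfolding Ex_def eqx eqy by (simp add: H_def)
    with insert show ?case by auto
  qed
  from this[OF finite_R] show ?thesis
    by (simp add: Ex_def mix_def config_def cong: if_cong)
qed

text \<open>A process driven by \<open>c p\<close> times the noise whose drift contributes at most \<open>B\<close> per unit of time.  Solutions are
adapted only up to null sets, since the filtration generated by the noise is not completed.\<close>

definition drift_process :: "real \<Rightarrow> ('p \<Rightarrow> real) \<Rightarrow> real \<Rightarrow> ('p \<Rightarrow> real \<Rightarrow> 'w \<Rightarrow> 'a) \<Rightarrow> bool" where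
  "drift_process T c B X \<longleftrightarrow>
    (\<forall>p\<in>R. \<forall>t\<in>{0..T}. X p t \<in> borel_measurable M \<and> (\<exists>x\<in>borel_measurable (G t). AE \<omega> in M. X p t \<omega> = x \<omega>)) \<and>
    (\<forall>p\<in>R. \<forall>s\<in>{0..T}. \<forall>t\<in>{s..T}. AE \<omega> in M.
       norm (X p t \<omega> - X p s \<omega> - c p *\<^sub>R (W p t \<omega> - W p s \<omega>)) \<le> B * (t - s))"

lemma joint_smoothing_AE:
  fixes \<phi> :: "('p \<Rightarrow> 'a) \<Rightarrow> real"
  assumes st: "0 \<le> s" "s < t" and c: "\<And>p. p \<in> R \<Longrightarrow> c p > 0"
    and x: "\<And>p. p \<in> R \<Longrightarrow> x p \<in> borel_measurable M" "\<And>p. p \<in> R \<Longrightarrow> \<exists>x'\<in>borel_measurable (G s). AE \<omega> in M. x p \<omega> = x' \<omega>"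
    and y: "\<And>p. p \<in> R \<Longrightarrow> y p \<in> borel_measurable M" "\<And>p. p \<in> R \<Longrightarrow> \<exists>x'\<in>borel_measurable (G s). AE \<omega> in M. y p \<omega> = x' \<omega>"
    and int: "\<And>p. p \<in> R \<Longrightarrow> integrable M (\<lambda>\<omega>. norm (x p \<omega> - y p \<omega>))"
    and \<phi>[measurable]: "\<phi> \<in> borel_measurable borel" and \<phi>1: "\<And>z. \<bar>\<phi> z\<bar> \<le> 1"
  shows "\<bar>expectation (\<lambda>\<omega>. \<phi> (config R (\<lambda>p. x p \<omega> + c p *\<^sub>R (W p t \<omega> - W p s \<omega>))))
       - expectation (\<lambda>\<omega>. \<phi> (config R (\<lambda>p. y p \<omega> + c p *\<^sub>R (W p t \<omega> - W p s \<omega>))))\<bar>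
    \<le> (\<Sum>p\<in>R. 2 / (c p * sqrt (t - s)) * expectation (\<lambda>\<omega>. norm (x p \<omega> - y p \<omega>)))"
proof -
  obtain x' where x': "\<And>p. p \<in> R \<Longrightarrow> x' p \<in> borel_measurable (G s)" "\<And>p. p \<in> R \<Longrightarrow> AE \<omega> in M. x p \<omega> = x' p \<omega>"
    using x(2) by metis
  obtain y' where y': "\<And>p. p \<in> R \<Longrightarrow> y' p \<in> borel_measurable (G s)" "\<And>p. p \<in> R \<Longrightarrow> AE \<omega> in M. y p \<omega> = y' p \<omega>"
    using y(2) by metis
  have m: "\<And>p. p \<in> R \<Longrightarrow> x' p \<in> borel_measurable M" "\<And>p. p \<in> R \<Longrightarrow> y' p \<in> borel_measurable M"
    using G_meas[OF st(1)] x' y' by auto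
  have Wm: "\<And>p. p \<in> R \<Longrightarrow> W p t \<in> borel_measurable M" "\<And>p. p \<in> R \<Longrightarrow> W p s \<in> borel_measurable M"
    using W_meas st by auto
  have ex: "expectation (\<lambda>\<omega>. \<phi> (config R (\<lambda>p. z p \<omega> + c p *\<^sub>R (W p t \<omega> - W p s \<omega>)))) =
     expectation (\<lambda>\<omega>. \<phi> (config R (\<lambda>p. z' p \<omega> + c p *\<^sub>R (W p t \<omega> - W p s \<omega>))))"
    if z: "\<And>p. p \<in> R \<Longrightarrow> z p \<in> borel_measurable M" "\<And>p. p \<in> R \<Longrightarrow> z' p \<in> borel_measurable M"
      and zz: "\<And>p. p \<in> R \<Longrightarrow> AE \<omega> in M. z p \<omega> = z' p \<omega>" for z z'
  proof (rule integral_cong_AE)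
    have "AE \<omega> in M. \<forall>p\<in>R. z p \<omega> = z' p \<omega>" using finite_R zz by (simp add: AE_finite_all)
    then show "AE \<omega> in M. \<phi> (config R (\<lambda>p. z p \<omega> + c p *\<^sub>R (W p t \<omega> - W p s \<omega>))) =
       \<phi> (config R (\<lambda>p. z' p \<omega> + c p *\<^sub>R (W p t \<omega> - W p s \<omega>)))"
      by eventually_elim (auto simp: config_def intro!: arg_cong[where f=\<phi>])
  qed (use z Wm in \<open>auto intro!: measurable_compose[OF _ \<phi>] config_measurable\<close>)
  have e: "AE \<omega> in M. norm (x p \<omega> - y p \<omega>) = norm (x' p \<omega> - y' p \<omega>)" if "p \<in> R" for p
    using x'(2)[OF that] y'(2)[OF that] by eventually_elim auto
  have e2: "expectation (\<lambda>\<omega>. norm (x p \<omega> - y p \<omega>)) = expectation (\<lambda>\<omega>. norm (x' p \<omega> - y' p \<omega>))" if "p \<in> R" for p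
    using e[OF that] m x y that by (intro integral_cong_AE) auto
  have e3: "integrable M (\<lambda>\<omega>. norm (x' p \<omega> - y' p \<omega>))" if "p \<in> R" for p
    using int[OF that] e[OF that] m x y that by (subst (asm) integrable_cong_AE) auto
  show ?thesis
    using joint_smoothing[OF st c x'(1) y'(1) e3 \<phi> \<phi>1] ex[of x x'] ex[of y y'] m x y x' y' e2 by simp
qed

text \<open>Over a window the drift may be dropped.  A single application of \<open>joint_smoothing\<close> cannot give this, because no
noise is left at the end of the window.  The drift is instead removed successively on the intervals between
the times \<open>t - (t - s) / 4^k\<close>: the \<open>k\<close>-th interval has length comparable to the time that remains after it, so
its cost is of the order of the square root of its length, and these costs form a geometric series.\<close>

lemma drift_removal:
  fixes \<phi> :: "('p \<Rightarrow> 'a) \<Rightarrow> real"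
  assumes st: "0 \<le> s" "s < t" "t \<le> T" and c: "\<And>p. p \<in> R \<Longrightarrow> c p > 0" and B: "B \<ge> 0"
    and X: "drift_process T c B X"
    and \<phi>: "continuous_on UNIV \<phi>" and \<phi>1: "\<And>z. \<bar>\<phi> z\<bar> \<le> 1"
  shows "\<bar>expectation (\<lambda>\<omega>. \<phi> (config R (\<lambda>p. X p t \<omega>)))
       - expectation (\<lambda>\<omega>. \<phi> (config R (\<lambda>p. X p s \<omega> + c p *\<^sub>R (W p t \<omega> - W p s \<omega>))))\<bar>
    \<le> (\<Sum>p\<in>R. 6 * B * sqrt (t - s) / c p)"
proof -
  define d where "d = t - s"
  have d: "d > 0" using st by (simp add: d_def)
  define tk where "tk k = t - d * (1/4)^k" for k :: nat
  have tk: "s \<le> tk k" "tk k < t" "tk k \<le> tk (Suc k)" "0 \<le> tk k" "tk k \<le> T" for k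
  proof -
    have "(1/4::real)^k \<le> 1" by (simp add: power_le_one)
    then have "d * (1/4)^k \<le> d" using d by (simp add: mult_left_le)
    then show "s \<le> tk k" by (simp add: tk_def d_def)
    then show "0 \<le> tk k" using st by simp
    show "tk k < t" using d by (simp add: tk_def)
    then show "tk k \<le> T" using st by simp
    show "tk k \<le> tk (Suc k)" using d by (simp add: tk_def)
  qed
  have tk0: "tk 0 = s" by (simp add: tk_def d_def)
  have [measurable]: "\<phi> \<in> borel_measurable borel" using \<phi> by (rule borel_measurable_continuous_onI)
  have Xm: "X p u \<in> borel_measurable M" "\<exists>x\<in>borel_measurable (G u). AE \<omega> in M. X p u \<omega> = x \<omega>" if "p \<in> R" "u \<in> {0..T}" for p u
    using X that unfolding drift_process_def by auto
  have Xd: "AE \<omega> in M. norm (X p u \<omega> - X p v \<omega> - c p *\<^sub>R (W p u \<omega> - W p v \<omega>)) \<le> B * (u - v)"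
    if "p \<in> R" "v \<in> {0..T}" "u \<in> {v..T}" for p u v
    using X that unfolding drift_process_def by auto
  \<comment> \<open>\<open>Y k\<close> follows the process up to time \<open>tk k\<close> and then only the noise; \<open>Y 0\<close> is the process without drift on the
    whole window, and \<open>Y k\<close> tends to the process itself.\<close>
  define Y where "Y k p \<omega> = X p (tk k) \<omega> + c p *\<^sub>R (W p t \<omega> - W p (tk k) \<omega>)" for k p \<omega>
  have Ym: "Y k p \<in> borel_measurable M" if "p \<in> R" for k p
  proof -
    have [measurable]: "X p (tk k) \<in> borel_measurable M" "W p t \<in> borel_measurable M" "W p (tk k) \<in> borel_measurable M"
      using that tk st by (auto intro!: Xm(1) W_meas)
    show ?thesis unfolding Y_def by measurable
  qed
  define e where "e k = expectation (\<lambda>\<omega>. \<phi> (config R (\<lambda>p. Y k p \<omega>)))" for k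
  have step: "\<bar>e (Suc k) - e k\<bar> \<le> (\<Sum>p\<in>R. 3 * B * sqrt d / c p) * (1/2)^k" for k
  proof -
    define v u where "v = tk k" and "u = tk (Suc k)"
    have vu: "0 \<le> v" "v \<le> u" "u < t" "u \<le> T" "v \<le> T" "0 \<le> u" using tk[of k] tk[of "Suc k"] by (auto simp: v_def u_def)
    have uv: "u - v = 3 * d * (1/4)^Suc k" by (simp add: v_def u_def tk_def)
    have tu: "t - u = d * (1/4)^Suc k" by (simp add: u_def tk_def)
    have stu: "sqrt (t - u) = sqrt d * (1/2)^Suc k"
    proof -
      have q: "(1/4::real)^n = ((1/2)^n)\<^sup>2" for n by (induction n) (auto simp: power2_eq_square)
      show ?thesis unfolding tu q real_sqrt_mult real_sqrt_abs by simp
    qed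
    \<comment> \<open>The process without drift on the \<open>k\<close>-th interval.  Both \<open>Y k\<close> and \<open>Y (Suc k)\<close> add to a value known at time \<open>u\<close> the
      same increment from \<open>u\<close> to \<open>t\<close>.\<close>
    define y where "y p \<omega> = X p v \<omega> + c p *\<^sub>R (W p u \<omega> - W p v \<omega>)" for p \<omega>
    have yY: "y p \<omega> + c p *\<^sub>R (W p t \<omega> - W p u \<omega>) = Y k p \<omega>" for p \<omega>
      by (simp add: y_def Y_def v_def scaleR_diff_right)
    have ym: "y p \<in> borel_measurable M" if "p \<in> R" for p
    proof -
      have [measurable]: "X p v \<in> borel_measurable M" "W p u \<in> borel_measurable M" "W p v \<in> borel_measurable M"
        using that vu by (auto intro!: Xm(1) W_meas)
      show ?thesis unfolding y_def by measurable
    qed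
    have yG: "\<exists>x\<in>borel_measurable (G u). AE \<omega> in M. y p \<omega> = x \<omega>" if p: "p \<in> R" for p
    proof -
      obtain x where x: "x \<in> borel_measurable (G v)" "AE \<omega> in M. X p v \<omega> = x \<omega>"
        using Xm(2)[OF p, of v] vu by auto
      have [measurable]: "x \<in> borel_measurable (G u)" "W p u \<in> borel_measurable (G u)" "W p v \<in> borel_measurable (G u)"
        using x(1) vu p by (auto intro!: G_mono_meas[of v u] adapted)
      have "(\<lambda>\<omega>. x \<omega> + c p *\<^sub>R (W p u \<omega> - W p v \<omega>)) \<in> borel_measurable (G u)" by measurable
      moreover have "AE \<omega> in M. y p \<omega> = x \<omega> + c p *\<^sub>R (W p u \<omega> - W p v \<omega>)"
        using x(2) by eventually_elim (auto simp: y_def)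
      ultimately show ?thesis
        by (intro bexI[where x="\<lambda>\<omega>. x \<omega> + c p *\<^sub>R (W p u \<omega> - W p v \<omega>)"])
    qed
    have bd: "AE \<omega> in M. norm (X p u \<omega> - y p \<omega>) \<le> B * (u - v)" if "p \<in> R" for p
      using Xd[OF that, of v u] vu by (simp add: y_def diff_diff_eq)
    have int: "integrable M (\<lambda>\<omega>. norm (X p u \<omega> - y p \<omega>))" if "p \<in> R" for p
      by (rule integrable_const_bound[where B="B * (u - v)"])
        (use bd[OF that] ym[OF that] Xm(1)[OF that, of u] vu in auto)
    have "\<bar>expectation (\<lambda>\<omega>. \<phi> (config R (\<lambda>p. X p u \<omega> + c p *\<^sub>R (W p t \<omega> - W p u \<omega>))))
       - expectation (\<lambda>\<omega>. \<phi> (config R (\<lambda>p. y p \<omega> + c p *\<^sub>R (W p t \<omega> - W p u \<omega>))))\<bar>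
      \<le> (\<Sum>p\<in>R. 2 / (c p * sqrt (t - u)) * expectation (\<lambda>\<omega>. norm (X p u \<omega> - y p \<omega>)))"
      by (rule joint_smoothing_AE) (use vu c Xm ym yG int \<phi>1 in auto)
    also have "\<dots> \<le> (\<Sum>p\<in>R. 3 * B * sqrt d / c p * (1/2)^k)"
    proof (rule sum_mono)
      fix p assume p: "p \<in> R"
      have "expectation (\<lambda>\<omega>. norm (X p u \<omega> - y p \<omega>)) \<le> B * (u - v)"
        using integral_mono_AE[OF int[OF p] _ bd[OF p]] by (simp add: prob_space)
      then have "2 / (c p * sqrt (t - u)) * expectation (\<lambda>\<omega>. norm (X p u \<omega> - y p \<omega>)) \<le> 2 / (c p * sqrt (t - u)) * (B * (u - v))"
        using c[OF p] vu by (intro mult_left_mono) auto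
      also have "\<dots> = 2 / c p * B * 3 * sqrt (t - u)"
      proof -
        have a: "u - v = 3 * (sqrt (t - u) * sqrt (t - u))" using uv tu vu by simp
        have b: "2 / (c p * S) * (B * (3 * (S * S))) = 2 / c p * B * 3 * S" if "S \<noteq> 0" for S
          using c[OF p] that by (simp add: field_simps)
        show ?thesis unfolding a by (rule b) (use vu in simp)
      qed
      also have "\<dots> = 3 * B * sqrt d / c p * (1/2)^k" unfolding stu by simp
      finally show "2 / (c p * sqrt (t - u)) * expectation (\<lambda>\<omega>. norm (X p u \<omega> - y p \<omega>)) \<le> 3 * B * sqrt d / c p * (1/2)^k" .
    qed
    also have "\<dots> = (\<Sum>p\<in>R. 3 * B * sqrt d / c p) * (1/2)^k" by (simp add: sum_distrib_right)
    finally show ?thesis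
      unfolding yY unfolding e_def Y_def u_def .
  qed
  have tot: "\<bar>e k - e 0\<bar> \<le> (\<Sum>p\<in>R. 3 * B * sqrt d / c p) * (2 - 2 * (1/2)^k)" for k
  proof (induction k)
    case (Suc k)
    have "\<bar>e (Suc k) - e 0\<bar> \<le> \<bar>e (Suc k) - e k\<bar> + \<bar>e k - e 0\<bar>" by simp
    also have "\<dots> \<le> (\<Sum>p\<in>R. 3 * B * sqrt d / c p) * (1/2)^k + (\<Sum>p\<in>R. 3 * B * sqrt d / c p) * (2 - 2 * (1/2)^k)"
      using Suc step by (intro add_mono) auto
    also have "\<dots> = (\<Sum>p\<in>R. 3 * B * sqrt d / c p) * (2 - 2 * (1/2)^Suc k)" by (simp add: algebra_simps)
    finally show ?case .
  qed simp
  have conv: "AE \<omega> in M. \<forall>p\<in>R. (\<lambda>k. Y k p \<omega>) \<longlonglongrightarrow> X p t \<omega>"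
  proof -
    have "AE \<omega> in M. norm (X p t \<omega> - X p (tk k) \<omega> - c p *\<^sub>R (W p t \<omega> - W p (tk k) \<omega>)) \<le> B * (t - tk k)"
      if "p \<in> R" for p k
      by (rule Xd[OF that]) (use tk[of k] st in auto)
    then have "AE \<omega> in M. \<forall>p\<in>R. \<forall>k. norm (X p t \<omega> - X p (tk k) \<omega> - c p *\<^sub>R (W p t \<omega> - W p (tk k) \<omega>)) \<le> B * (t - tk k)"
      using finite_R by (simp add: AE_all_countable AE_finite_all)
    then show ?thesis
    proof eventually_elim
      case (elim \<omega>)
      show ?case
      proof
        fix p assume p: "p \<in> R"
        have eq: "B * (t - tk k) = B * d * (1/4) ^ k" for k by (simp add: tk_def)
        have lim: "(\<lambda>k. B * (t - tk k)) \<longlonglongrightarrow> 0"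
          unfolding eq by (rule tendsto_mult_right_zero) (rule LIMSEQ_power_zero, simp)
        have "norm (X p t \<omega> - Y k p \<omega>) \<le> B * (t - tk k)" for k
          using elim[rule_format, OF p, of k] by (simp add: Y_def diff_diff_eq)
        then have "(\<lambda>k. X p t \<omega> - Y k p \<omega>) \<longlonglongrightarrow> 0"
          by (intro Lim_null_comparison[OF always_eventually lim]) blast
        from tendsto_diff[OF tendsto_const[of "X p t \<omega>"] this] show "(\<lambda>k. Y k p \<omega>) \<longlonglongrightarrow> X p t \<omega>" by simp
      qed
    qed
  qed
  have "e \<longlonglongrightarrow> expectation (\<lambda>\<omega>. \<phi> (config R (\<lambda>p. X p t \<omega>)))"
    unfolding e_def
  proof (rule integral_dominated_convergence[where w="\<lambda>_. 1"])
    show "AE \<omega> in M. (\<lambda>k. \<phi> (config R (\<lambda>p. Y k p \<omega>))) \<longlonglongrightarrow> \<phi> (config R (\<lambda>p. X p t \<omega>))"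
      using conv
    proof eventually_elim
      case (elim \<omega>)
      have "(\<lambda>k. config R (\<lambda>p. Y k p \<omega>)) \<longlonglongrightarrow> config R (\<lambda>p. X p t \<omega>)"
        unfolding config_def by (rule tendsto_coordinatewise) (use elim in auto)
      then show ?case
        using \<phi> by (intro continuous_on_tendsto_compose[OF \<phi>]) auto
    qed
  qed (use Ym Xm st \<phi>1 in \<open>auto intro!: measurable_compose[OF _ \<open>\<phi> \<in> borel_measurable borel\<close>] config_measurable\<close>)
  then have "(\<lambda>k. \<bar>e k - e 0\<bar>) \<longlonglongrightarrow> \<bar>expectation (\<lambda>\<omega>. \<phi> (config R (\<lambda>p. X p t \<omega>))) - e 0\<bar>"
    by (intro tendsto_intros)
  then have "\<bar>expectation (\<lambda>\<omega>. \<phi> (config R (\<lambda>p. X p t \<omega>))) - e 0\<bar> \<le> (\<Sum>p\<in>R. 3 * B * sqrt d / c p) * 2"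
  proof (rule LIMSEQ_le_const2, intro exI allI impI)
    fix k
    have "0 \<le> (\<Sum>p\<in>R. 3 * B * sqrt d / c p)" using B d c by (intro sum_nonneg) (auto intro!: divide_nonneg_pos)
    then have "(\<Sum>p\<in>R. 3 * B * sqrt d / c p) * (2 - 2 * (1/2)^k) \<le> (\<Sum>p\<in>R. 3 * B * sqrt d / c p) * 2"
      by (intro mult_left_mono) auto
    then show "\<bar>e k - e 0\<bar> \<le> (\<Sum>p\<in>R. 3 * B * sqrt d / c p) * 2" using tot[of k] by linarith
  qed
  also have "\<dots> = (\<Sum>p\<in>R. 6 * B * sqrt (t - s) / c p)"
    by (simp add: sum_distrib_right d_def mult.assoc)
  finally show ?thesis by (simp add: e_def Y_def tk0)
qed

text \<open>Both drifts are removed on the window from \<open>s\<close> to \<open>t\<close>; the two remaining processes differ only in their values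
at time \<open>s\<close>, and the increment up to \<open>t\<close> smooths that difference.\<close>

lemma tv_drift_processes:
  assumes st: "0 \<le> s" "s < t" "t \<le> T" and c: "\<And>p. p \<in> R \<Longrightarrow> c p > 0" and B: "B1 \<ge> 0" "B2 \<ge> 0"
    and X: "drift_process T c B1 X" and Y: "drift_process T c B2 Y"
    and int: "\<And>p. p \<in> R \<Longrightarrow> integrable M (\<lambda>\<omega>. norm (X p s \<omega> - Y p s \<omega>))"
    and A: "A \<in> sets borel"
  shows "\<bar>prob ((\<lambda>\<omega>. config R (\<lambda>p. X p t \<omega>)) -` A \<inter> space M) - prob ((\<lambda>\<omega>. config R (\<lambda>p. Y p t \<omega>)) -` A \<inter> space M)\<bar>
     \<le> (\<Sum>p\<in>R. (6 * (B1 + B2) * sqrt (t - s) + 2 * expectation (\<lambda>\<omega>. norm (X p s \<omega> - Y p s \<omega>)) / sqrt (t - s)) / c p)"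
proof (rule tv_le_of_continuous[OF _ _ _ A])
  have m: "X p u \<in> borel_measurable M \<and> (\<exists>x\<in>borel_measurable (G u). AE \<omega> in M. X p u \<omega> = x \<omega>)"
     "Y p u \<in> borel_measurable M \<and> (\<exists>x\<in>borel_measurable (G u). AE \<omega> in M. Y p u \<omega> = x \<omega>)" if "p \<in> R" "u \<in> {0..T}" for p u
    using X Y that unfolding drift_process_def by auto
  show "(\<lambda>\<omega>. config R (\<lambda>p. X p t \<omega>)) \<in> borel_measurable M" "(\<lambda>\<omega>. config R (\<lambda>p. Y p t \<omega>)) \<in> borel_measurable M"
    using m st by (auto intro!: config_measurable)
  fix \<phi> :: "('p \<Rightarrow> 'a) \<Rightarrow> real"
  assume \<phi>: "continuous_on UNIV \<phi>" "\<And>x. 0 \<le> \<phi> x \<and> \<phi> x \<le> 1"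
  then have \<phi>1: "\<bar>\<phi> x\<bar> \<le> 1" for x by (auto simp: abs_le_iff intro: order_trans[of _ 0])
  have "\<phi> \<in> borel_measurable borel" using \<phi>(1) by (rule borel_measurable_continuous_onI)
  then have "\<bar>expectation (\<lambda>\<omega>. \<phi> (config R (\<lambda>p. X p s \<omega> + c p *\<^sub>R (W p t \<omega> - W p s \<omega>))))
       - expectation (\<lambda>\<omega>. \<phi> (config R (\<lambda>p. Y p s \<omega> + c p *\<^sub>R (W p t \<omega> - W p s \<omega>))))\<bar>
    \<le> (\<Sum>p\<in>R. 2 / (c p * sqrt (t - s)) * expectation (\<lambda>\<omega>. norm (X p s \<omega> - Y p s \<omega>)))"
    by (intro joint_smoothing_AE) (use st c m int \<phi>1 in auto)
  moreover note drift_removal[OF st c B(1) X \<phi>(1) \<phi>1] drift_removal[OF st c B(2) Y \<phi>(1) \<phi>1]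
  ultimately have "\<bar>expectation (\<lambda>\<omega>. \<phi> (config R (\<lambda>p. X p t \<omega>))) - expectation (\<lambda>\<omega>. \<phi> (config R (\<lambda>p. Y p t \<omega>)))\<bar>
    \<le> (\<Sum>p\<in>R. 6 * B1 * sqrt (t - s) / c p) + (\<Sum>p\<in>R. 6 * B2 * sqrt (t - s) / c p)
      + (\<Sum>p\<in>R. 2 / (c p * sqrt (t - s)) * expectation (\<lambda>\<omega>. norm (X p s \<omega> - Y p s \<omega>)))"
    by linarith
  also have "\<dots> = (\<Sum>p\<in>R. (6 * (B1 + B2) * sqrt (t - s) + 2 * expectation (\<lambda>\<omega>. norm (X p s \<omega> - Y p s \<omega>)) / sqrt (t - s)) / c p)"
    unfolding sum.distrib[symmetric]
  proof (intro sum.cong refl)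
    fix p
    show "6 * B1 * sqrt (t - s) / c p + 6 * B2 * sqrt (t - s) / c p + 2 / (c p * sqrt (t - s)) * expectation (\<lambda>\<omega>. norm (X p s \<omega> - Y p s \<omega>))
      = (6 * (B1 + B2) * sqrt (t - s) + 2 * expectation (\<lambda>\<omega>. norm (X p s \<omega> - Y p s \<omega>)) / sqrt (t - s)) / c p"
      by (simp add: add_divide_distrib ring_distribs mult.commute[of "c p"])
  qed
  finally show "\<bar>expectation (\<lambda>\<omega>. \<phi> (config R (\<lambda>p. X p t \<omega>))) - expectation (\<lambda>\<omega>. \<phi> (config R (\<lambda>p. Y p t \<omega>)))\<bar>
    \<le> (\<Sum>p\<in>R. (6 * (B1 + B2) * sqrt (t - s) + 2 * expectation (\<lambda>\<omega>. norm (X p s \<omega> - Y p s \<omega>)) / sqrt (t - s)) / c p)" .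
qed

end

section \<open>Strong solutions as functions of the noise\<close>

text \<open>Euler scheme for \<open>x = z + \<integral> b + w\<close>: only the configuration is frozen on a time step, while the time dependence of
the drift is integrated exactly.  Thus \<open>b\<close> need not be continuous in time.\<close>

fun euler :: "'p set \<Rightarrow> ('p \<Rightarrow> real \<Rightarrow> ('p \<Rightarrow> 'a) \<Rightarrow> 'a) \<Rightarrow> real \<Rightarrow> ('p \<Rightarrow> 'a::euclidean_space) \<Rightarrow> ('p \<Rightarrow> real \<Rightarrow> 'a)
    \<Rightarrow> nat \<Rightarrow> 'p \<Rightarrow> 'a" where
  "euler I b h z w 0 = config I z"
| "euler I b h z w (Suc k) = config I (\<lambda>p. euler I b h z w k p
     + set_lebesgue_integral lborel {real k * h<..real (Suc k) * h} (\<lambda>s. b p s (euler I b h z w k))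
     + (w p (real (Suc k) * h) - w p (real k * h)))"

lemma set_integral_norm_le_const:
  fixes f :: "real \<Rightarrow> 'a::euclidean_space"
  assumes f: "set_integrable lborel {u<..v} f" and uv: "u \<le> v" and C: "\<And>s. s \<in> {u<..v} \<Longrightarrow> norm (f s) \<le> C"
  shows "norm (set_lebesgue_integral lborel {u<..v} f) \<le> C * (v - u)"
proof -
  have i: "integrable lborel (indicat_real {u<..v})"
    using uv by (intro integrable_real_indicator) auto
  have "norm (set_lebesgue_integral lborel {u<..v} f) \<le> set_lebesgue_integral lborel {u<..v} (\<lambda>s. norm (f s))"
    by (rule set_integral_norm_bound[OF f])
  also have "\<dots> \<le> set_lebesgue_integral lborel {u<..v} (\<lambda>s. C)"
    by (rule set_integral_mono) (use C i set_integrable_norm[OF f] in \<open>auto simp: set_integrable_def\<close>)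
  also have "\<dots> = C * (v - u)" using uv by (simp add: set_lebesgue_integral_def)
  finally show ?thesis .
qed

text \<open>Discrete Gronwall inequality.  Here \<open>d\<close> bounds the oscillation of the exact solution over one step, and adding
\<open>card I * d\<close> to the error on the left makes the recursion homogeneous.\<close>

lemma euler_error:
  fixes x w :: "'p \<Rightarrow> real \<Rightarrow> 'a::euclidean_space"
  assumes fin: "finite I" and h: "h \<ge> 0"
    and L: "0 \<le> L" "\<And>p s x y. p \<in> I \<Longrightarrow> s \<in> {0..t0} \<Longrightarrow> norm (b p s x - b p s y) \<le> L * (\<Sum>q\<in>I. norm (x q - y q))"
    and bint: "\<And>p x. p \<in> I \<Longrightarrow> set_integrable lborel {0..t0} (\<lambda>s. b p s x)"
    and xint: "\<And>p. p \<in> I \<Longrightarrow> set_integrable lborel {0..t0} (\<lambda>s. b p s (\<lambda>q. x q s))"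
    and x: "\<And>p t. p \<in> I \<Longrightarrow> t \<in> {0..t0} \<Longrightarrow>
       x p t = z p + set_lebesgue_integral lborel {0..t} (\<lambda>s. b p s (\<lambda>q. x q s)) + w p t"
    and w0: "\<And>p. p \<in> I \<Longrightarrow> w p 0 = 0"
    and d: "0 \<le> d" "\<And>p s s'. p \<in> I \<Longrightarrow> s \<in> {0..t0} \<Longrightarrow> s' \<in> {0..t0} \<Longrightarrow> \<bar>s - s'\<bar> \<le> h \<Longrightarrow> norm (x p s - x p s') \<le> d"
  shows "real k * h \<le> t0 \<Longrightarrow> (\<Sum>p\<in>I. norm (x p (real k * h) - euler I b h z w k p)) + real (card I) * d
     \<le> (1 + real (card I) * L * h) ^ k * (real (card I) * d)"
proof (induction k)
  case 0
  have t0: "0 \<le> t0" using 0 by simp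
  have "x p 0 = z p" if "p \<in> I" for p
  proof -
    have "set_lebesgue_integral lborel {0..0::real} f = 0" for f :: "real \<Rightarrow> 'a"
      unfolding set_lebesgue_integral_def
      by (rule integral_eq_zero_AE) (use AE_lborel_singleton[of "0::real"] in \<open>auto elim!: eventually_mono\<close>)
    then show ?thesis using x[OF that, of 0] w0[OF that] t0 by simp
  qed
  then show ?case by (simp add: config_def)
next
  case (Suc k)
  define u v where "u = real k * h" and "v = real (Suc k) * h"
  define E where "E = euler I b h z w k"
  define e where "e = (\<Sum>p\<in>I. norm (x p u - E p))"
  have uv: "0 \<le> u" "u \<le> v" "v \<le> t0" "v - u = h" using Suc.prems h by (auto simp: u_def v_def algebra_simps)
  have IH: "e + real (card I) * d \<le> (1 + real (card I) * L * h) ^ k * (real (card I) * d)"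
    using Suc uv by (simp add: e_def E_def u_def)
  have sub: "{u<..v} \<subseteq> {0..t0}" using uv by auto
  have step: "norm (x p v - euler I b h z w (Suc k) p) \<le> norm (x p u - E p) + L * (e + real (card I) * d) * h"
    if p: "p \<in> I" for p
  proof -
    have si: "set_integrable lborel {0..u} (\<lambda>s. b p s (\<lambda>q. x q s))"
      by (rule set_integrable_subset[OF xint[OF p]]) (use uv in auto)
    have si1: "set_integrable lborel {u<..v} (\<lambda>s. b p s (\<lambda>q. x q s))"
      by (rule set_integrable_subset[OF xint[OF p]]) (use sub in auto)
    have si2: "set_integrable lborel {u<..v} (\<lambda>s. b p s E)"
      by (rule set_integrable_subset[OF bint[OF p]]) (use sub in auto)
    have "{0..v} = {0..u} \<union> {u<..v}" using uv by auto
    then have "set_lebesgue_integral lborel {0..v} (\<lambda>s. b p s (\<lambda>q. x q s)) =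
      set_lebesgue_integral lborel {0..u} (\<lambda>s. b p s (\<lambda>q. x q s)) + set_lebesgue_integral lborel {u<..v} (\<lambda>s. b p s (\<lambda>q. x q s))"
      using set_integral_Un[OF _ si si1] by (simp add: ivl_disj_int)
    then have xv: "x p v = x p u + (set_lebesgue_integral lborel {u<..v} (\<lambda>s. b p s (\<lambda>q. x q s)) + (w p v - w p u))"
      using x[OF p, of v] x[OF p, of u] uv by simp
    have ev: "euler I b h z w (Suc k) p = E p + set_lebesgue_integral lborel {u<..v} (\<lambda>s. b p s E) + (w p v - w p u)"
      using p by (simp add: config_def E_def u_def v_def)
    have "x p v - euler I b h z w (Suc k) p = (x p u - E p) +
       (set_lebesgue_integral lborel {u<..v} (\<lambda>s. b p s (\<lambda>q. x q s)) - set_lebesgue_integral lborel {u<..v} (\<lambda>s. b p s E))"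
      unfolding xv ev by simp
    also have "\<dots> = (x p u - E p) + set_lebesgue_integral lborel {u<..v} (\<lambda>s. b p s (\<lambda>q. x q s) - b p s E)"
      using set_integral_diff(2)[OF si1 si2] by simp
    finally have "norm (x p v - euler I b h z w (Suc k) p) \<le> norm (x p u - E p) +
        norm (set_lebesgue_integral lborel {u<..v} (\<lambda>s. b p s (\<lambda>q. x q s) - b p s E))"
      by (simp add: norm_triangle_ineq)
    also have "norm (set_lebesgue_integral lborel {u<..v} (\<lambda>s. b p s (\<lambda>q. x q s) - b p s E)) \<le> L * (e + real (card I) * d) * (v - u)"
    proof (rule set_integral_norm_le_const)
      show "set_integrable lborel {u<..v} (\<lambda>s. b p s (\<lambda>q. x q s) - b p s E)"
        by (rule set_integral_diff(1)[OF si1 si2])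
      fix s assume s: "s \<in> {u<..v}"
      have "norm (b p s (\<lambda>q. x q s) - b p s E) \<le> L * (\<Sum>q\<in>I. norm (x q s - E q))"
        by (rule L(2)) (use p s sub in auto)
      also have "(\<Sum>q\<in>I. norm (x q s - E q)) \<le> (\<Sum>q\<in>I. norm (x q u - E q) + d)"
      proof (rule sum_mono)
        fix q assume q: "q \<in> I"
        have "norm (x q s - E q) \<le> norm (x q s - x q u) + norm (x q u - E q)"
          by (rule norm_diff_triangle_ineq[of "x q s" "x q u" "x q u" "E q", simplified])
        moreover have "norm (x q s - x q u) \<le> d" by (rule d(2)) (use q s sub uv in auto)
        ultimately show "norm (x q s - E q) \<le> norm (x q u - E q) + d" by linarith
      qed
      also have "\<dots> = e + real (card I) * d" by (simp add: sum.distrib e_def)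
      finally show "norm (b p s (\<lambda>q. x q s) - b p s E) \<le> L * (e + real (card I) * d)"
        using L(1) by (simp add: mult_left_mono)
    qed (use uv in auto)
    finally show ?thesis using uv by simp
  qed
  have "(\<Sum>p\<in>I. norm (x p v - euler I b h z w (Suc k) p)) + real (card I) * d
      \<le> (\<Sum>p\<in>I. norm (x p u - E p) + L * (e + real (card I) * d) * h) + real (card I) * d"
    by (intro add_mono sum_mono step) auto
  also have "\<dots> = (1 + real (card I) * L * h) * (e + real (card I) * d)"
    by (simp add: sum.distrib e_def algebra_simps)
  also have "\<dots> \<le> (1 + real (card I) * L * h) * ((1 + real (card I) * L * h) ^ k * (real (card I) * d))"
    by (intro mult_left_mono IH) (use L h in auto)
  finally show ?case by (simp add: v_def)
qed

lemma euler_converges: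
  fixes x w :: "'p \<Rightarrow> real \<Rightarrow> 'a::euclidean_space"
  assumes fin: "finite I" and t0: "0 \<le> t0"
    and L: "0 \<le> L" "\<And>p s x y. p \<in> I \<Longrightarrow> s \<in> {0..t0} \<Longrightarrow> norm (b p s x - b p s y) \<le> L * (\<Sum>q\<in>I. norm (x q - y q))"
    and bint: "\<And>p x. p \<in> I \<Longrightarrow> set_integrable lborel {0..t0} (\<lambda>s. b p s x)"
    and xint: "\<And>p. p \<in> I \<Longrightarrow> set_integrable lborel {0..t0} (\<lambda>s. b p s (\<lambda>q. x q s))"
    and x: "\<And>p t. p \<in> I \<Longrightarrow> t \<in> {0..t0} \<Longrightarrow>
       x p t = z p + set_lebesgue_integral lborel {0..t} (\<lambda>s. b p s (\<lambda>q. x q s)) + w p t"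
    and w0: "\<And>p. p \<in> I \<Longrightarrow> w p 0 = 0"
    and cont: "\<And>p. p \<in> I \<Longrightarrow> continuous_on {0..t0} (x p)"
    and p: "p \<in> I"
  shows "(\<lambda>m. euler I b (t0 / real (Suc m)) z w (Suc m) p) \<longlonglongrightarrow> x p t0"
proof (rule LIMSEQ_I)
  fix r :: real assume r: "0 < r"
  define \<Lambda> where "\<Lambda> = exp (real (card I) * L * t0) * real (card I)"
  have \<Lambda>: "\<Lambda> \<ge> 0" unfolding \<Lambda>_def by simp
  define d where "d = r / (2 * (\<Lambda> + 1))"
  have d: "d > 0" using r \<Lambda> by (simp add: d_def)
  have "\<exists>\<delta>>0. \<forall>s\<in>{0..t0}. \<forall>s'\<in>{0..t0}. dist s' s < \<delta> \<longrightarrow> dist (x q s') (x q s) < d" if "q \<in> I" for q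
    using compact_uniformly_continuous[OF cont[OF that]] d unfolding uniformly_continuous_on_def by auto
  then obtain \<delta> where \<delta>: "\<And>q. q \<in> I \<Longrightarrow> \<delta> q > 0"
    "\<And>q s s'. q \<in> I \<Longrightarrow> s \<in> {0..t0} \<Longrightarrow> s' \<in> {0..t0} \<Longrightarrow> dist s' s < \<delta> q \<Longrightarrow> dist (x q s') (x q s) < d"
    by metis
  define \<delta>0 where "\<delta>0 = Min (\<delta> ` I)"
  have "\<delta>0 \<in> \<delta> ` I" unfolding \<delta>0_def using fin p by (intro Min_in) auto
  then have \<delta>0: "\<delta>0 > 0" "\<And>q. q \<in> I \<Longrightarrow> \<delta>0 \<le> \<delta> q" using \<delta>(1) fin by (auto simp: \<delta>0_def)
  obtain m0 :: nat where m0: "real m0 > t0 / \<delta>0" using reals_Archimedean2 by blast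
  show "\<exists>no. \<forall>n\<ge>no. norm (euler I b (t0 / real (Suc n)) z w (Suc n) p - x p t0) < r"
  proof (intro exI allI impI)
    fix m assume m: "m \<ge> m0"
    define h where "h = t0 / real (Suc m)"
    have h0: "h \<ge> 0" using t0 by (simp add: h_def)
    have "t0 / \<delta>0 < real (Suc m)" using m0 m by linarith
    then have h: "h < \<delta>0" using \<delta>0 by (simp add: h_def field_simps)
    have mh: "real (Suc m) * h = t0" by (simp add: h_def)
    have "(\<Sum>p\<in>I. norm (x p (real (Suc m) * h) - euler I b h z w (Suc m) p)) + real (card I) * d
     \<le> (1 + real (card I) * L * h) ^ (Suc m) * (real (card I) * d)"
    proof (rule euler_error[OF fin h0 L bint xint x w0])
      show "norm (x q s - x q s') \<le> d" if "q \<in> I" "s \<in> {0..t0}" "s' \<in> {0..t0}" "\<bar>s - s'\<bar> \<le> h" for q s s'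
        using \<delta>(2)[OF that(1,3,2)] that h \<delta>0(2)[OF that(1)] by (auto simp: dist_norm less_imp_le)
    qed (use d mh in auto)
    moreover have "(1 + real (card I) * L * h) ^ (Suc m) \<le> exp (real (card I) * L * h) ^ Suc m"
      by (intro power_mono exp_ge_add_one_self) (use L h0 in auto)
    moreover have "exp (real (card I) * L * h) ^ Suc m = exp (real (card I) * L * t0)"
      unfolding exp_of_nat_mult[symmetric] mh[symmetric] by (simp only: mult_ac)
    moreover have "norm (x p t0 - euler I b h z w (Suc m) p) \<le> (\<Sum>p\<in>I. norm (x p (real (Suc m) * h) - euler I b h z w (Suc m) p))"
      unfolding mh by (rule member_le_sum) (use p fin in auto)
    moreover have "(1 + real (card I) * L * h) ^ (Suc m) * (real (card I) * d) \<le> \<Lambda> * d"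
      unfolding \<Lambda>_def using calculation(2,3) d by (simp only: mult.assoc[symmetric]) (intro mult_right_mono, auto)
    moreover have "0 \<le> real (card I) * d" using d by simp
    ultimately have "norm (x p t0 - euler I b h z w (Suc m) p) \<le> \<Lambda> * d" by linarith
    also have "\<dots> < r"
    proof -
      have "\<Lambda> * d \<le> (\<Lambda> + 1) * d" using d by (simp add: algebra_simps)
      also have "\<dots> = r / 2" using \<Lambda> by (simp add: d_def field_simps)
      finally show ?thesis using r by simp
    qed
    finally show "norm (euler I b (t0 / real (Suc m)) z w (Suc m) p - x p t0) < r"
      by (simp add: h_def norm_minus_commute)
  qed
qed

text \<open>Continuity for the product topology, which makes functions of configurations Borel measurable.\<close>

lemma continuous_of_coordinate_lipschitz:
  fixes f :: "('p \<Rightarrow> 'a::real_normed_vector) \<Rightarrow> 'b::real_normed_vector"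
  assumes "finite I" "\<And>x y. norm (f x - f y) \<le> C * (\<Sum>q\<in>I. norm (x q - y q))"
  shows "continuous_on UNIV f"
  unfolding continuous_on_def
proof
  fix x :: "'p \<Rightarrow> 'a"
  have c: "((\<lambda>y. y q) \<longlongrightarrow> x q) (at x within UNIV)" for q
    using continuous_on_product_coordinates[of q] unfolding continuous_on_def by auto
  have "((\<lambda>y. C * (\<Sum>q\<in>I. norm (y q - x q))) \<longlongrightarrow> C * (\<Sum>q\<in>I. norm (x q - x q))) (at x within UNIV)"
    by (intro tendsto_intros c)
  then have l: "((\<lambda>y. C * (\<Sum>q\<in>I. norm (y q - x q))) \<longlongrightarrow> 0) (at x within UNIV)" by simp
  have "((\<lambda>y. f y - f x) \<longlongrightarrow> 0) (at x within UNIV)"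
    by (rule Lim_null_comparison[OF _ l], rule always_eventually, rule allI, rule assms(2))
  then show "(f \<longlongrightarrow> f x) (at x within UNIV)" by (rule LIM_zero_cancel)
qed

lemma euler_measurable:
  fixes w :: "'p::countable \<Rightarrow> real \<Rightarrow> 'w \<Rightarrow> 'a::euclidean_space"
  assumes fin: "finite I" and h: "h \<ge> 0"
    and z: "\<And>p. p \<in> I \<Longrightarrow> z p \<in> borel_measurable G"
    and w: "\<And>p t. p \<in> I \<Longrightarrow> t \<in> {0..t0} \<Longrightarrow> w p t \<in> borel_measurable G"
    and L: "0 \<le> L" "\<And>p s x y. p \<in> I \<Longrightarrow> s \<in> {0..t0} \<Longrightarrow> norm (b p s x - b p s y) \<le> L * (\<Sum>q\<in>I. norm (x q - y q))"
    and bint: "\<And>p x. p \<in> I \<Longrightarrow> set_integrable lborel {0..t0} (\<lambda>s. b p s x)"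
  shows "real k * h \<le> t0 \<Longrightarrow> (\<lambda>\<omega>. euler I b h (\<lambda>p. z p \<omega>) (\<lambda>p t. w p t \<omega>) k) \<in> borel_measurable G"
proof (induction k)
  case 0
  then show ?case using z by (simp add: config_measurable)
next
  case (Suc k)
  define u v where "u = real k * h" and "v = real (Suc k) * h"
  have uv: "0 \<le> u" "u \<le> v" "v \<le> t0" "v - u = h" using Suc.prems h by (auto simp: u_def v_def algebra_simps)
  have IH[measurable]: "(\<lambda>\<omega>. euler I b h (\<lambda>p. z p \<omega>) (\<lambda>p t. w p t \<omega>) k) \<in> borel_measurable G"
    using Suc uv by (simp add: u_def)
  show ?case
    unfolding euler.simps u_def[symmetric] v_def[symmetric]
  proof (rule config_measurable)
    fix p assume p: "p \<in> I"
    have [measurable]: "w p u \<in> borel_measurable G" "w p v \<in> borel_measurable G" using w[OF p] uv by auto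
    have si: "set_integrable lborel {u<..v} (\<lambda>s. b p s y)" for y
      by (rule set_integrable_subset[OF bint[OF p]]) (use uv in auto)
    have "continuous_on UNIV (\<lambda>y. set_lebesgue_integral lborel {u<..v} (\<lambda>s. b p s y))"
    proof (rule continuous_of_coordinate_lipschitz[OF fin])
      fix y y'
      have "norm (set_lebesgue_integral lborel {u<..v} (\<lambda>s. b p s y - b p s y')) \<le> L * (\<Sum>q\<in>I. norm (y q - y' q)) * (v - u)"
        by (rule set_integral_norm_le_const) (use uv p in \<open>auto intro!: set_integral_diff(1) si L(2)\<close>)
      then show "norm (set_lebesgue_integral lborel {u<..v} (\<lambda>s. b p s y) - set_lebesgue_integral lborel {u<..v} (\<lambda>s. b p s y'))
          \<le> (L * (v - u)) * (\<Sum>q\<in>I. norm (y q - y' q))"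
        using set_integral_diff(2)[OF si si] by (simp add: mult_ac)
    qed
    then have [measurable]: "(\<lambda>y. set_lebesgue_integral lborel {u<..v} (\<lambda>s. b p s y)) \<in> borel_measurable borel"
      by (rule borel_measurable_continuous_onI)
    have [measurable]: "(\<lambda>\<omega>. euler I b h (\<lambda>p. z p \<omega>) (\<lambda>p t. w p t \<omega>) k p) \<in> borel_measurable G"
      by (rule measurable_product_then_coordinatewise[OF IH])
    show "(\<lambda>\<omega>. euler I b h (\<lambda>p. z p \<omega>) (\<lambda>p t. w p t \<omega>) k p +
        set_lebesgue_integral lborel {u<..v} (\<lambda>s. b p s (euler I b h (\<lambda>p. z p \<omega>) (\<lambda>p t. w p t \<omega>) k)) +
        (w p v \<omega> - w p u \<omega>)) \<in> borel_measurable G"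
      by measurable
  qed
qed

text \<open>Pathwise, the Euler schemes converge to the solution, and each of them is a function of the initial values and of
the noise up to time \<open>t0\<close>.  So the solution coincides almost surely with a function measurable for any
sigma-algebra \<open>G\<close> that contains this information.\<close>

lemma strong_solution_measurable:
  fixes X w :: "'p::countable \<Rightarrow> real \<Rightarrow> 'w \<Rightarrow> 'a::euclidean_space"
  assumes fin: "finite I" and t0: "0 \<le> t0"
    and z: "\<And>p. p \<in> I \<Longrightarrow> z p \<in> borel_measurable G"
    and w: "\<And>p t. p \<in> I \<Longrightarrow> t \<in> {0..t0} \<Longrightarrow> w p t \<in> borel_measurable G"
    and L: "0 \<le> L" "\<And>p s x y. p \<in> I \<Longrightarrow> s \<in> {0..t0} \<Longrightarrow> norm (b p s x - b p s y) \<le> L * (\<Sum>q\<in>I. norm (x q - y q))"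
    and bint: "\<And>p x. p \<in> I \<Longrightarrow> set_integrable lborel {0..t0} (\<lambda>s. b p s x)"
    and X: "\<And>p. p \<in> I \<Longrightarrow> AE \<omega> in M. continuous_on {0..t0} (\<lambda>t. X p t \<omega>) \<and>
        set_integrable lborel {0..t0} (\<lambda>s. b p s (\<lambda>q. X q s \<omega>)) \<and>
        (\<forall>t\<in>{0..t0}. X p t \<omega> = z p \<omega> + set_lebesgue_integral lborel {0..t} (\<lambda>s. b p s (\<lambda>q. X q s \<omega>)) + w p t \<omega>) \<and>
        w p 0 \<omega> = 0"
    and p: "p \<in> I"
  shows "\<exists>x\<in>borel_measurable G. AE \<omega> in M. X p t0 \<omega> = x \<omega>"
proof
  define e where "e m \<omega> = euler I b (t0 / real (Suc m)) (\<lambda>p. z p \<omega>) (\<lambda>p t. w p t \<omega>) (Suc m) p" for m \<omega>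
  have "(\<lambda>\<omega>. euler I b (t0 / real (Suc m)) (\<lambda>p. z p \<omega>) (\<lambda>p t. w p t \<omega>) (Suc m)) \<in> borel_measurable G" for m
  proof (rule euler_measurable[where L=L and G=G])
    show "real (Suc m) * (t0 / real (Suc m)) \<le> t0" by simp
    show "0 \<le> t0 / real (Suc m)" using t0 by simp
  qed (fact fin z w L bint)+
  then have "e m \<in> borel_measurable G" for m
    unfolding e_def by (rule measurable_product_then_coordinatewise)
  then show "(\<lambda>\<omega>. lim (\<lambda>m. e m \<omega>)) \<in> borel_measurable G" by (rule borel_measurable_lim_metric)
  have "AE \<omega> in M. \<forall>p\<in>I. continuous_on {0..t0} (\<lambda>t. X p t \<omega>) \<and>
        set_integrable lborel {0..t0} (\<lambda>s. b p s (\<lambda>q. X q s \<omega>)) \<and>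
        (\<forall>t\<in>{0..t0}. X p t \<omega> = z p \<omega> + set_lebesgue_integral lborel {0..t} (\<lambda>s. b p s (\<lambda>q. X q s \<omega>)) + w p t \<omega>) \<and>
        w p 0 \<omega> = 0"
    using X fin by (simp add: AE_finite_all)
  then show "AE \<omega> in M. X p t0 \<omega> = lim (\<lambda>m. e m \<omega>)"
  proof eventually_elim
    case (elim \<omega>)
    have "(\<lambda>m. e m \<omega>) \<longlonglongrightarrow> X p t0 \<omega>"
      unfolding e_def
      by (rule euler_converges[OF fin t0 L bint, where x="\<lambda>p t. X p t \<omega>"]) (use elim p in auto)
    then show ?case by (simp add: limI)
  qed
qed

section \<open>Independence of the driving noise\<close>

lemma generated_comp_subset:
  assumes Z: "Z \<in> space M \<rightarrow> space N" and f: "f \<in> N \<rightarrow>\<^sub>M N'"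
    and eq: "\<And>\<omega>. \<omega> \<in> space M \<Longrightarrow> Z' \<omega> = f (Z \<omega>)"
  shows "generated M N' Z' \<subseteq> generated M N Z"
proof
  fix a assume "a \<in> generated M N' Z'"
  then obtain A where A: "a = Z' -` A \<inter> space M" "A \<in> sets N'" by (auto simp: generated_def)
  have "a = Z -` (f -` A \<inter> space N) \<inter> space M"
    using A(1) Z eq by auto
  moreover have "f -` A \<inter> space N \<in> sets N" using f A(2) by (rule measurable_sets)
  ultimately show "a \<in> generated M N Z" unfolding generated_def by blast
qed

text \<open>The three independent ingredients of the noise of the particle \<open>(i, k)\<close> relative to times \<open>s < t\<close>: the initial
value for index 0, the path up to time \<open>s\<close> for index 1, and the increment from \<open>s\<close> to \<open>t\<close> for index 2.\<close>

definition noise_part :: "'w measure \<Rightarrow> ('n \<Rightarrow> nat \<Rightarrow> real \<Rightarrow> 'w \<Rightarrow> 'a::euclidean_space) \<Rightarrow> ('n \<Rightarrow> nat \<Rightarrow> 'w \<Rightarrow> 'a)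
    \<Rightarrow> real \<Rightarrow> real \<Rightarrow> ('n \<times> nat) \<times> nat \<Rightarrow> 'w set set" where
  "noise_part M W \<zeta> s t = (\<lambda>((i, k), c).
     if c = 0 then generated M borel (\<zeta> i k)
     else if c = 1 then generated M (PiM {0..s} (\<lambda>_. borel)) (\<lambda>\<omega>. \<lambda>\<tau>\<in>{0..s}. W i k \<tau> \<omega>)
     else generated M borel (\<lambda>\<omega>. W i k t \<omega> - W i k s \<omega>))"

lemma noise_part_Int_stable: "Int_stable (noise_part M W \<zeta> s t p)"
  unfolding noise_part_def split_beta by (auto intro: generated_Int_stable)

text \<open>Independence of paths and initial values of different particles, independence of the two families, and independence
of each increment from its own past combine into independence of the whole array.\<close>

lemma (in prob_space) noise_part_indep:
  fixes W :: "'n::finite \<Rightarrow> nat \<Rightarrow> real \<Rightarrow> 'a \<Rightarrow> 'b::euclidean_space"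
  assumes F: "filtered_prob_space M F" and noise: "driving_noise M F u0 W \<zeta>"
    and J: "finite J" "J \<noteq> {}" "J \<subseteq> UNIV \<times> {1..}" and st: "0 \<le> s" "s < t"
  shows "indep_sets (noise_part M W \<zeta> s t) (J \<times> {0, 1, 2})"
proof -
  define I where "I = (UNIV :: 'n set) \<times> {1::nat..}"
  define PS where "PS = PiM {0::real..} (\<lambda>_. borel :: 'b measure)"
  define path where "path p = (\<lambda>\<omega>. \<lambda>\<tau>\<in>{0..}. W (fst p) (snd p) \<tau> \<omega>)" for p :: "'n \<times> nat"
  define start where "start p = \<zeta> (fst p) (snd p)" for p :: "'n \<times> nat"
  have bm: "brownian_motion M F (W (fst p) (snd p))" and zm: "start p \<in> borel_measurable (F 0)" if "p \<in> I" for p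
    using noise that unfolding driving_noise_def Let_def I_def start_def by (auto simp: split_beta)
  have ip: "indep_vars (\<lambda>_. PS) path I" and iz: "indep_vars (\<lambda>_. borel) start I"
    and ipz: "indep_set (generated M (PiM I (\<lambda>_. PS)) (\<lambda>\<omega>. \<lambda>p\<in>I. path p \<omega>)) (generated M (PiM I (\<lambda>_. borel)) (\<lambda>\<omega>. \<lambda>p\<in>I. start p \<omega>))"
    using noise unfolding driving_noise_def Let_def I_def start_def path_def PS_def by (simp_all add: split_beta')
  have JI: "J \<subseteq> I" using J by (simp add: I_def)
  have FM: "sets (F u) \<subseteq> sets M" "space (F u) = space M" for u
    using F unfolding filtered_prob_space_def filtration_def by (auto simp: filtration.space_F)
  have Fmono: "sets (F u) \<subseteq> sets (F v)" if "u \<le> v" for u v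
    using F that unfolding filtered_prob_space_def by (auto dest: filtration.sets_F_mono)
  have WF: "W (fst p) (snd p) u \<in> borel_measurable (F v)" if "p \<in> I" "0 \<le> u" "u \<le> v" for p u v
  proof -
    have "W (fst p) (snd p) u \<in> borel_measurable (F u)" using bm[OF that(1)] that unfolding brownian_motion_def by auto
    then show ?thesis using Fmono[OF that(3)] FM by (auto simp: measurable_def)
  qed
  have pF: "generated M (PiM {0..s} (\<lambda>_. borel)) (\<lambda>\<omega>. \<lambda>\<tau>\<in>{0..s}. W (fst p) (snd p) \<tau> \<omega>) \<subseteq> sets (F s)" if "p \<in> I" for p
  proof -
    have "(\<lambda>\<omega>. \<lambda>\<tau>\<in>{0..s}. W (fst p) (snd p) \<tau> \<omega>) \<in> F s \<rightarrow>\<^sub>M PiM {0..s} (\<lambda>_. borel)"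
      by (rule measurable_restrict) (use WF that in auto)
    from measurable_sets[OF this] show ?thesis using FM by (auto simp: generated_def)
  qed
  have pathsp: "path p \<in> space M \<rightarrow> space PS" for p
    by (auto simp: path_def PS_def space_PiM)
  have g1: "generated M (PiM {0..s} (\<lambda>_. borel)) (\<lambda>\<omega>. \<lambda>\<tau>\<in>{0..s}. W (fst p) (snd p) \<tau> \<omega>) \<subseteq> generated M PS (path p)" for p
  proof (rule generated_comp_subset[OF pathsp])
    show "(\<lambda>f. restrict f {0..s}) \<in> PS \<rightarrow>\<^sub>M PiM {0..s} (\<lambda>_. borel)"
      unfolding PS_def by (rule measurable_restrict_subset) auto
  qed (auto simp: path_def restrict_def fun_eq_iff)
  have g2: "generated M borel (\<lambda>\<omega>. W (fst p) (snd p) t \<omega> - W (fst p) (snd p) s \<omega>) \<subseteq> generated M PS (path p)" for p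
  proof (rule generated_comp_subset[OF pathsp])
    show "(\<lambda>f. f t - f s) \<in> borel_measurable PS"
      unfolding PS_def using st by (intro borel_measurable_diff measurable_component_singleton) auto
  qed (use st in \<open>auto simp: path_def\<close>)
  have genInt: "a \<inter> b \<in> generated M N Z" if "a \<in> generated M N Z" "b \<in> generated M N Z" for a b N and Z :: "'a \<Rightarrow> 'z"
    using generated_Int_stable[of M N Z] that by (auto simp: Int_stable_def)
  have nonspace: "space M \<in> generated M N Z" if "Z \<in> space M \<rightarrow> space N" for N and Z :: "'a \<Rightarrow> 'z"
  proof -
    have "space M = Z -` space N \<inter> space M" using that by auto
    then show ?thesis unfolding generated_def by blast
  qed
  have evz: "generated M borel (start p) \<subseteq> events" if "p \<in> I" for p
    using measurable_sets[OF zm[OF that]] FM by (auto simp: generated_def)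
  have evp: "generated M PS (path p) \<subseteq> events" if "p \<in> I" for p
  proof -
    have "random_variable PS (path p)" using ip that unfolding indep_vars_def2 by auto
    then show ?thesis by (auto simp: generated_def intro: measurable_sets)
  qed
  have incr: "indep_set (sets (F s)) (generated M borel (\<lambda>\<omega>. W (fst p) (snd p) t \<omega> - W (fst p) (snd p) s \<omega>))" if "p \<in> I" for p
    using bm[OF that] st unfolding brownian_motion_def by auto
  have np: "noise_part M W \<zeta> s t (p, 0) = generated M borel (start p)"
    "noise_part M W \<zeta> s t (p, Suc 0) = generated M (PiM {0..s} (\<lambda>_. borel)) (\<lambda>\<omega>. \<lambda>\<tau>\<in>{0..s}. W (fst p) (snd p) \<tau> \<omega>)"
    "noise_part M W \<zeta> s t (p, 2) = generated M borel (\<lambda>\<omega>. W (fst p) (snd p) t \<omega> - W (fst p) (snd p) s \<omega>)" for p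
    by (auto simp: noise_part_def split_beta start_def)
  show ?thesis
  proof (subst indep_sets_finite)
    show "J \<times> {0, 1, 2::nat} \<noteq> {}" "finite (J \<times> {0, 1, 2::nat})" using J by auto
    show "noise_part M W \<zeta> s t j \<subseteq> events" if "j \<in> J \<times> {0, 1, 2}" for j
      using that evz evp g1 g2 JI by (auto simp: np) blast+
    show "space M \<in> noise_part M W \<zeta> s t j" if "j \<in> J \<times> {0, 1, 2}" for j
      using that by (auto simp: np space_PiM intro!: nonspace)
    show "\<forall>A\<in>Pi (J \<times> {0, 1, 2}) (noise_part M W \<zeta> s t). prob (\<Inter>j\<in>J \<times> {0, 1, 2}. A j) = (\<Prod>j\<in>J \<times> {0, 1, 2}. prob (A j))"
    proof
      fix A assume A: "A \<in> Pi (J \<times> {0, 1, 2::nat}) (noise_part M W \<zeta> s t)"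
      have A0: "A (p, 0) \<in> generated M borel (start p)" and A1: "A (p, 1) \<in> noise_part M W \<zeta> s t (p, Suc 0)"
        and A2: "A (p, 2) \<in> noise_part M W \<zeta> s t (p, 2)" if "p \<in> J" for p
        using A that np(1)[of p] by (auto simp: Pi_iff)
      define B where "B p = A (p, 1) \<inter> A (p, 2)" for p
      have B: "B p \<in> generated M PS (path p)" if "p \<in> J" for p
        unfolding B_def using A1[OF that] A2[OF that] g1[of p] g2[of p] unfolding np by (intro genInt) blast+
      have cyl: "(\<Inter>p\<in>J. C p) \<in> generated M (PiM I (\<lambda>_. N)) (\<lambda>\<omega>. \<lambda>p\<in>I. Z p \<omega>)"
        if C: "\<And>p. p \<in> J \<Longrightarrow> C p \<in> generated M N (Z p)" and Z: "\<And>p. p \<in> I \<Longrightarrow> Z p \<in> space M \<rightarrow> space N" for C N and Z :: "'n \<times> nat \<Rightarrow> 'a \<Rightarrow> 'z"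
      proof -
        obtain D where D: "\<And>p. p \<in> J \<Longrightarrow> C p = Z p -` D p \<inter> space M" "\<And>p. p \<in> J \<Longrightarrow> D p \<in> sets N"
          using C unfolding generated_def by simp metis
        define S where "S = {f\<in>space (PiM I (\<lambda>_. N)). \<forall>p\<in>J. f p \<in> D p}"
        have "S \<in> sets (PiM I (\<lambda>_. N))"
          unfolding S_def
        proof (rule sets.sets_Collect_finite_All'[OF _ J(1,2)])
          fix p assume p: "p \<in> J"
          have "(\<lambda>f. f p) -` D p \<inter> space (PiM I (\<lambda>_. N)) \<in> sets (PiM I (\<lambda>_. N))"
            by (rule measurable_sets[OF measurable_component_singleton]) (use p JI D in auto)
          also have "(\<lambda>f. f p) -` D p \<inter> space (PiM I (\<lambda>_. N)) = {f\<in>space (PiM I (\<lambda>_. N)). f p \<in> D p}" by auto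
          finally show "{f\<in>space (PiM I (\<lambda>_. N)). f p \<in> D p} \<in> sets (PiM I (\<lambda>_. N))" .
        qed
        moreover have "(\<Inter>p\<in>J. C p) = (\<lambda>\<omega>. \<lambda>p\<in>I. Z p \<omega>) -` S \<inter> space M"
        proof (rule set_eqI)
          fix \<omega>
          have "(\<lambda>p\<in>I. Z p \<omega>) \<in> space (PiM I (\<lambda>_. N))" if "\<omega> \<in> space M"
            using Z that by (auto simp: space_PiM)
          then show "\<omega> \<in> (\<Inter>p\<in>J. C p) \<longleftrightarrow> \<omega> \<in> (\<lambda>\<omega>. \<lambda>p\<in>I. Z p \<omega>) -` S \<inter> space M"
            using J(2) D(1) JI unfolding S_def by (auto simp: subset_eq)
        qed
        ultimately show ?thesis unfolding generated_def by blast
      qed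
      \<comment> \<open>First the paths are separated from the initial values, then the particles from each other, and finally
        each increment from the path before it.\<close>
      have "(\<Inter>j\<in>J \<times> {0, 1, 2}. A j) = (\<Inter>p\<in>J. B p) \<inter> (\<Inter>p\<in>J. A (p, 0))"
        by (auto simp: B_def)
      also have "prob \<dots> = prob (\<Inter>p\<in>J. B p) * prob (\<Inter>p\<in>J. A (p, 0))"
        by (rule indep_setD[OF ipz]) (auto intro!: cyl B A0 pathsp[THEN funcset_mem])
      also have "prob (\<Inter>p\<in>J. B p) = (\<Prod>p\<in>J. prob (B p))"
      proof (rule indep_setsD)
        show "indep_sets (\<lambda>p. generated M PS (path p)) I"
          using ip unfolding indep_vars_def2 generated_def by auto
      qed (use J JI B in auto)
      also have "(\<Prod>p\<in>J. prob (B p)) = (\<Prod>p\<in>J. prob (A (p, 1)) * prob (A (p, 2)))"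
      proof (rule prod.cong)
        fix p assume p: "p \<in> J"
        show "prob (B p) = prob (A (p, 1)) * prob (A (p, 2))"
          unfolding B_def
          using A1[OF p] A2[OF p] pF[of p] p JI unfolding np by (intro indep_setD[OF incr[of p]]) blast+
      qed auto
      also have "prob (\<Inter>p\<in>J. A (p, 0)) = (\<Prod>p\<in>J. prob (A (p, 0)))"
      proof (rule indep_setsD)
        show "indep_sets (\<lambda>p. generated M borel (start p)) I"
          using iz unfolding indep_vars_def2 generated_def by auto
      qed (use J JI A0 in auto)
      finally show "prob (\<Inter>j\<in>J \<times> {0, 1, 2}. A j) = (\<Prod>j\<in>J \<times> {0, 1, 2}. prob (A j))"
        using prod.cartesian_product[of "\<lambda>p c. prob (A (p, c))" "{0, 1, 2}" J]
        by (simp add: prod.distrib mult_ac)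
    qed
  qed
qed

text \<open>The information carried by the particles in \<open>J\<close> up to time \<open>s\<close>.  It is used in place of the given filtration, for which
the increments of different particles are not known to be jointly independent of the past.\<close>

definition noise_sigma :: "'w measure \<Rightarrow> ('n \<Rightarrow> nat \<Rightarrow> real \<Rightarrow> 'w \<Rightarrow> 'a::euclidean_space) \<Rightarrow> ('n \<Rightarrow> nat \<Rightarrow> 'w \<Rightarrow> 'a)
    \<Rightarrow> ('n \<times> nat) set \<Rightarrow> real \<Rightarrow> 'w measure" where
  "noise_sigma M W \<zeta> J s = sigma (space M) (\<Union>(i, k)\<in>J. generated M borel (\<zeta> i k)
      \<union> generated M (PiM {0..s} (\<lambda>_. borel)) (\<lambda>\<omega>. \<lambda>\<tau>\<in>{0..s}. W i k \<tau> \<omega>))"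

lemma generated_Pow: "generated M N Z \<subseteq> Pow (space M)"
  by (auto simp: generated_def)

lemma noise_sigma_space [simp]: "space (noise_sigma M W \<zeta> J s) = space M"
  and noise_sigma_sets: "sets (noise_sigma M W \<zeta> J s) = sigma_sets (space M) (\<Union>(i, k)\<in>J. generated M borel (\<zeta> i k)
      \<union> generated M (PiM {0..s} (\<lambda>_. borel)) (\<lambda>\<omega>. \<lambda>\<tau>\<in>{0..s}. W i k \<tau> \<omega>))"
proof -
  have "(\<Union>(i, k)\<in>J. generated M borel (\<zeta> i k)
      \<union> generated M (PiM {0..s} (\<lambda>_. borel)) (\<lambda>\<omega>. \<lambda>\<tau>\<in>{0..s}. W i k \<tau> \<omega>)) \<subseteq> Pow (space M)"
    by (rule UN_least) (simp add: split_beta generated_Pow)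
  then show "space (noise_sigma M W \<zeta> J s) = space M"
    "sets (noise_sigma M W \<zeta> J s) = sigma_sets (space M) (\<Union>(i, k)\<in>J. generated M borel (\<zeta> i k)
      \<union> generated M (PiM {0..s} (\<lambda>_. borel)) (\<lambda>\<omega>. \<lambda>\<tau>\<in>{0..s}. W i k \<tau> \<omega>))"
    by (auto simp: noise_sigma_def space_measure_of sets_measure_of)
qed

lemma noise_sigma_start:
  fixes \<zeta> :: "'n \<Rightarrow> nat \<Rightarrow> 'w \<Rightarrow> 'a::euclidean_space"
  assumes "(i, k) \<in> J" shows "\<zeta> i k \<in> borel_measurable (noise_sigma M W \<zeta> J s)"
proof (rule measurableI)
  fix A :: "'a set" assume "A \<in> sets borel"
  then have "\<zeta> i k -` A \<inter> space M \<in> generated M borel (\<zeta> i k)" unfolding generated_def by blast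
  then show "\<zeta> i k -` A \<inter> space (noise_sigma M W \<zeta> J s) \<in> sets (noise_sigma M W \<zeta> J s)"
    unfolding noise_sigma_sets noise_sigma_space
    by (intro sigma_sets.Basic UN_I[OF assms]) simp
qed auto

lemma noise_sigma_path:
  fixes W :: "'n \<Rightarrow> nat \<Rightarrow> real \<Rightarrow> 'w \<Rightarrow> 'a::euclidean_space"
  assumes "(i, k) \<in> J" "0 \<le> \<tau>" "\<tau> \<le> s" shows "W i k \<tau> \<in> borel_measurable (noise_sigma M W \<zeta> J s)"
proof (rule measurableI)
  fix A :: "'a set" assume A: "A \<in> sets borel"
  have "generated M borel (W i k \<tau>) \<subseteq> generated M (PiM {0..s} (\<lambda>_. borel)) (\<lambda>\<omega>. \<lambda>\<tau>\<in>{0..s}. W i k \<tau> \<omega>)"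
    by (rule generated_comp_subset[where f="\<lambda>f. f \<tau>"])
      (use assms in \<open>auto simp: space_PiM intro!: measurable_component_singleton\<close>)
  then have "W i k \<tau> -` A \<inter> space M \<in> generated M (PiM {0..s} (\<lambda>_. borel)) (\<lambda>\<omega>. \<lambda>\<tau>\<in>{0..s}. W i k \<tau> \<omega>)"
    using A by (auto simp: generated_def)
  then show "W i k \<tau> -` A \<inter> space (noise_sigma M W \<zeta> J s) \<in> sets (noise_sigma M W \<zeta> J s)"
    unfolding noise_sigma_sets noise_sigma_space
    by (intro sigma_sets.Basic UN_I[OF assms(1)]) simp
qed auto

lemma noise_sigma_mono:
  assumes "J \<subseteq> J'" "0 \<le> s" "s \<le> t"
  shows "sets (noise_sigma M W \<zeta> J s) \<subseteq> sets (noise_sigma M W \<zeta> J' t)"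
proof -
  have "generated M (PiM {0..s} (\<lambda>_. borel)) (\<lambda>\<omega>. \<lambda>\<tau>\<in>{0..s}. W i k \<tau> \<omega>) \<subseteq>
    generated M (PiM {0..t} (\<lambda>_. borel)) (\<lambda>\<omega>. \<lambda>\<tau>\<in>{0..t}. W i k \<tau> \<omega>)" for i k
  proof (rule generated_comp_subset)
    show "(\<lambda>f. restrict f {0..s}) \<in> PiM {0..t} (\<lambda>_. borel) \<rightarrow>\<^sub>M PiM {0..s} (\<lambda>_. borel)"
      by (rule measurable_restrict_subset) (use assms in auto)
  qed (use assms in \<open>auto simp: space_PiM restrict_def fun_eq_iff\<close>)
  then show ?thesis
    unfolding noise_sigma_sets split_beta using assms(1) by (intro sigma_sets_mono' UN_mono Un_mono) auto
qed

text \<open>The \<open>R\<close> particles whose marginal is studied interact with all particles in \<open>J\<close>, hence the past of all of \<open>J\<close> enters.\<close>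

lemma (in prob_space) noise_brownian_family:
  fixes W :: "'n::finite \<Rightarrow> nat \<Rightarrow> real \<Rightarrow> 'a \<Rightarrow> 'b::euclidean_space"
  assumes F: "filtered_prob_space M F" and noise: "driving_noise M F u0 W \<zeta>"
    and J: "finite J" "J \<noteq> {}" "J \<subseteq> UNIV \<times> {1..}" and R: "R \<subseteq> J"
  shows "brownian_family M R (\<lambda>p. W (fst p) (snd p)) (noise_sigma M W \<zeta> J)"
proof unfold_locales
  have bm: "brownian_motion M F (W (fst p) (snd p))" if "p \<in> J" for p
    using noise that J unfolding driving_noise_def Let_def by (auto simp: split_beta)
  show "finite R" using J R finite_subset by blast
  fix s t :: real
  show "sets (noise_sigma M W \<zeta> J s) \<subseteq> sets (noise_sigma M W \<zeta> J t)" if "0 \<le> s" "s \<le> t"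
    using noise_sigma_mono that by blast
  show "W (fst p) (snd p) t \<in> borel_measurable (noise_sigma M W \<zeta> J t)" if "p \<in> R" "0 \<le> t" for p
    using noise_sigma_path[of "fst p" "snd p" J t t] that R by auto
  show "distributed M lborel (\<lambda>\<omega>. W (fst p) (snd p) t \<omega> - W (fst p) (snd p) s \<omega>) (\<lambda>x. ennreal (gauss (t - s) x))"
    if "p \<in> R" "0 \<le> s" "s < t" for p
    using bm[of p] that R unfolding brownian_motion_def gauss_def by auto
  have sub: "(\<Union>(i, k)\<in>J. generated M borel (\<zeta> i k) \<union> generated M (PiM {0..s} (\<lambda>_. borel)) (\<lambda>\<omega>. \<lambda>\<tau>\<in>{0..s}. W i k \<tau> \<omega>))
     \<subseteq> (\<Union>j\<in>J \<times> {0, 1}. noise_part M W \<zeta> s t' j)" for s t'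
  proof (rule UN_least)
    fix p assume p: "p \<in> J"
    have "(case p of (i, k) \<Rightarrow> generated M borel (\<zeta> i k) \<union> generated M (PiM {0..s} (\<lambda>_. borel)) (\<lambda>\<omega>. \<lambda>\<tau>\<in>{0..s}. W i k \<tau> \<omega>))
      = noise_part M W \<zeta> s t' (p, 0) \<union> noise_part M W \<zeta> s t' (p, 1)"
      by (simp add: noise_part_def split_beta)
    then show "(case p of (i, k) \<Rightarrow> generated M borel (\<zeta> i k) \<union> generated M (PiM {0..s} (\<lambda>_. borel)) (\<lambda>\<omega>. \<lambda>\<tau>\<in>{0..s}. W i k \<tau> \<omega>))
      \<subseteq> (\<Union>j\<in>J \<times> {0, 1}. noise_part M W \<zeta> s t' j)"
      using p by auto
  qed
  have ev: "noise_part M W \<zeta> s t' j \<subseteq> events" if "0 \<le> s" "s < t'" "j \<in> J \<times> {0, 1, 2}" for s t' j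
    using noise_part_indep[OF F noise J that(1,2)] that(3) by (auto simp: indep_sets_def)
  show "subalgebra M (noise_sigma M W \<zeta> J t)" if "0 \<le> t"
  proof -
    have "(\<Union>j\<in>J \<times> {0, 1}. noise_part M W \<zeta> t (t + 1) j) \<subseteq> events"
      by (rule UN_least, rule ev) (use that in auto)
    from sets.sigma_sets_subset[OF subset_trans[OF sub this]] show ?thesis
      by (simp add: subalgebra_def noise_sigma_sets)
  qed
  show "indep_set (sigma_sets (space M) (sets (noise_sigma M W \<zeta> J s) \<union>
        (\<Union>q\<in>R - {p}. generated M borel (\<lambda>\<omega>. W (fst q) (snd q) t \<omega> - W (fst q) (snd q) s \<omega>))))
        (generated M borel (\<lambda>\<omega>. W (fst p) (snd p) t \<omega> - W (fst p) (snd p) s \<omega>))"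
    if p: "p \<in> R" and st: "0 \<le> s" "s < t" for p
  proof -
    define K where "K b = (if b then J \<times> {0, 1, 2} - {(p, 2)} else {(p, 2::nat)})" for b
    have "indep_sets (\<lambda>b. sigma_sets (space M) (\<Union>j\<in>K b. noise_part M W \<zeta> s t j)) UNIV"
    proof (rule indep_sets_collect_sigma)
      have "(\<Union>b\<in>UNIV. K b) = J \<times> {0, 1, 2}" using p R by (auto simp: K_def UNIV_bool)
      then show "indep_sets (noise_part M W \<zeta> s t) (\<Union>b\<in>UNIV. K b)"
        using noise_part_indep[OF F noise J st] by simp
      show "disjoint_family_on K UNIV" by (auto simp: disjoint_family_on_def K_def)
    qed (rule noise_part_Int_stable)
    then have "indep_set (sigma_sets (space M) (\<Union>j\<in>K True. noise_part M W \<zeta> s t j)) (sigma_sets (space M) (\<Union>j\<in>K False. noise_part M W \<zeta> s t j))"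
      unfolding indep_set_def by (rule indep_sets_mono_sets) (auto split: bool.split)
    then show ?thesis
      unfolding indep_set_def
    proof (rule indep_sets_mono_sets)
      fix b :: bool
      have 1: "sets (noise_sigma M W \<zeta> J s) \<subseteq> sigma_sets (space M) (\<Union>j\<in>K True. noise_part M W \<zeta> s t j)"
      proof -
        have "(\<Union>j\<in>J \<times> {0, 1}. noise_part M W \<zeta> s t j) \<subseteq> (\<Union>j\<in>K True. noise_part M W \<zeta> s t j)"
          by (rule UN_mono) (auto simp: K_def)
        from sigma_sets_mono'[OF subset_trans[OF sub this]] show ?thesis unfolding noise_sigma_sets .
      qed
      have 2: "generated M borel (\<lambda>\<omega>. W (fst q) (snd q) t \<omega> - W (fst q) (snd q) s \<omega>) = noise_part M W \<zeta> s t (q, 2)" for q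
        by (simp add: noise_part_def split_beta)
      have 3: "(\<Union>q\<in>R - {p}. noise_part M W \<zeta> s t (q, 2)) \<subseteq> sigma_sets (space M) (\<Union>j\<in>K True. noise_part M W \<zeta> s t j)"
        using R by (auto simp: K_def intro!: sigma_sets.Basic)
      show "(case b of True \<Rightarrow> sigma_sets (space M) (sets (noise_sigma M W \<zeta> J s) \<union>
          (\<Union>q\<in>R - {p}. generated M borel (\<lambda>\<omega>. W (fst q) (snd q) t \<omega> - W (fst q) (snd q) s \<omega>)))
          | False \<Rightarrow> generated M borel (\<lambda>\<omega>. W (fst p) (snd p) t \<omega> - W (fst p) (snd p) s \<omega>)) \<subseteq>
        (case b of True \<Rightarrow> sigma_sets (space M) (\<Union>j\<in>K True. noise_part M W \<zeta> s t j) | False \<Rightarrow> sigma_sets (space M) (\<Union>j\<in>K False. noise_part M W \<zeta> s t j))"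
        unfolding 2 using sigma_sets_mono[OF Un_least[OF 1 3]]
        by (cases b) (auto simp: K_def)
    qed
  qed
qed

text \<open>Functions of the noises of different particles are independent; this yields the product law of the intermediate system.\<close>

lemma (in prob_space) noise_indep_vars:
  fixes W :: "'n::finite \<Rightarrow> nat \<Rightarrow> real \<Rightarrow> 'a \<Rightarrow> 'b::euclidean_space"
  assumes F: "filtered_prob_space M F" and noise: "driving_noise M F u0 W \<zeta>"
    and J: "finite J" "J \<noteq> {}" "J \<subseteq> UNIV \<times> {1..}" and s: "0 \<le> s"
    and x: "\<And>p. p \<in> J \<Longrightarrow> x p \<in> noise_sigma M W \<zeta> {p} s \<rightarrow>\<^sub>M N"
  shows "indep_vars (\<lambda>_. N) x J"
proof -
  have "indep_sets (\<lambda>p. sigma_sets (space M) (\<Union>j\<in>{p} \<times> {0, 1}. noise_part M W \<zeta> s (s + 1) j)) J"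
  proof (rule indep_sets_collect_sigma)
    show "indep_sets (noise_part M W \<zeta> s (s + 1)) (\<Union>p\<in>J. {p} \<times> {0, 1})"
      by (rule indep_sets_mono_index[OF _ noise_part_indep[OF F noise J s]]) auto
    show "disjoint_family_on (\<lambda>p. {p} \<times> {0, 1}) J" by (auto simp: disjoint_family_on_def)
  qed (rule noise_part_Int_stable)
  moreover have "sigma_sets (space M) (\<Union>j\<in>{p} \<times> {0, 1}. noise_part M W \<zeta> s (s + 1) j) = sets (noise_sigma M W \<zeta> {p} s)" for p
  proof -
    have "(\<Union>j\<in>{p} \<times> {0, 1}. noise_part M W \<zeta> s (s + 1) j) = noise_part M W \<zeta> s (s + 1) (p, 0) \<union> noise_part M W \<zeta> s (s + 1) (p, 1)"
      by auto
    then show ?thesis unfolding noise_sigma_sets by (simp add: noise_part_def split_beta)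
  qed
  ultimately have ind: "indep_sets (\<lambda>p. sets (noise_sigma M W \<zeta> {p} s)) J" by (simp only:)
  have sub: "sets (noise_sigma M W \<zeta> {p} s) \<subseteq> events" if "p \<in> J" for p
    using ind that by (auto simp: indep_sets_def)
  show ?thesis
    unfolding indep_vars_def2
  proof
    show "\<forall>p\<in>J. random_variable N (x p)"
    proof
      fix p assume p: "p \<in> J"
      show "random_variable N (x p)"
      proof (rule measurableI)
        show "x p \<omega> \<in> space N" if "\<omega> \<in> space M" for \<omega>
          using measurable_space[OF x[OF p]] that by simp
        show "x p -` A \<inter> space M \<in> events" if "A \<in> sets N" for A
          using subsetD[OF sub[OF p] measurable_sets[OF x[OF p] that]] by simp
      qed
    qed
    show "indep_sets (\<lambda>i. {x i -` A \<inter> space M |A. A \<in> sets N}) J"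
    proof (rule indep_sets_mono_sets[OF ind])
      fix p assume p: "p \<in> J"
      show "{x p -` A \<inter> space M |A. A \<in> sets N} \<subseteq> sets (noise_sigma M W \<zeta> {p} s)"
        using measurable_sets[OF x[OF p]] by auto
    qed
  qed
qed

section \<open>Fourier transform\<close>

lemma borel_measurable_exp_complex [measurable]: "(exp :: complex \<Rightarrow> complex) \<in> borel_measurable borel"
  by (intro borel_measurable_continuous_onI continuous_intros)

lemma charfun_normal:
  assumes "\<tau> > 0"
  shows "has_bochner_integral lborel (\<lambda>x. iexp (t * x) * complex_of_real (normal_density 0 (sqrt \<tau>) x))
     (complex_of_real (exp (- \<tau> * t\<^sup>2 / 2)))"
proof -
  define f where "f x = iexp (sqrt \<tau> * t * x) * complex_of_real (std_normal_density x)" for x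
  have [measurable]: "f \<in> borel_measurable borel" unfolding f_def by measurable
  have fi: "integrable lborel f"
    by (rule Bochner_Integration.integrable_bound[where f="std_normal_density"])
      (auto simp: f_def norm_mult)
  have fI: "integral\<^sup>L lborel f = complex_of_real (exp (- \<tau> * t\<^sup>2 / 2))"
  proof -
    have "complex_of_real (exp (- (sqrt \<tau> * t)\<^sup>2 / 2)) = char std_normal_distribution (sqrt \<tau> * t)"
      by (simp add: char_std_normal_distribution)
    also have "\<dots> = integral\<^sup>L lborel f"
      unfolding char_def f_def
      by (subst integral_density) (auto simp: scaleR_conv_of_real mult.commute)
    finally show ?thesis using assms by (simp add: power_mult_distrib)
  qed
  have "has_bochner_integral lborel (\<lambda>x. f (x / sqrt \<tau>)) (sqrt \<tau> *\<^sub>R integral\<^sup>L lborel f)"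
    using lborel_has_bochner_integral_real_affine_iff[of "1 / sqrt \<tau>" "\<lambda>x. f x" "integral\<^sup>L lborel f" 0] assms fi
      by (simp add: has_bochner_integral_iff)
  then have "has_bochner_integral lborel (\<lambda>x. f (x / sqrt \<tau>) * complex_of_real (1 / sqrt \<tau>))
     ((sqrt \<tau> *\<^sub>R integral\<^sup>L lborel f) * complex_of_real (1 / sqrt \<tau>))"
    by (rule has_bochner_integral_mult_left)
  moreover have "f (x / sqrt \<tau>) * complex_of_real (1 / sqrt \<tau>) = iexp (t * x) * complex_of_real (normal_density 0 (sqrt \<tau>) x)" for x
    using assms by (simp add: f_def normal_density_def real_sqrt_mult power_divide)
  moreover have "(sqrt \<tau> *\<^sub>R integral\<^sup>L lborel f) * complex_of_real (1 / sqrt \<tau>) = complex_of_real (exp (- \<tau> * t\<^sup>2 / 2))"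
    using assms by (simp add: fI scaleR_conv_of_real)
  ultimately show ?thesis by simp
qed

lemma prod_of_real_gauss: "complex_of_real (gauss \<tau> x) = (\<Prod>b\<in>Basis. complex_of_real (normal_density 0 (sqrt \<tau>) (x \<bullet> b)))"
  unfolding gauss_def by simp

lemma norm_sq_eq_sum: "(norm (x::'a::euclidean_space))\<^sup>2 = (\<Sum>b\<in>Basis. (x \<bullet> b)\<^sup>2)"
  using euclidean_inner[of x x] by (simp add: power2_norm_eq_inner power2_eq_square[of "_ \<bullet> _"])

lemma charfun_gauss:
  fixes z :: "'a::euclidean_space"
  assumes "\<tau> > 0"
  shows "has_bochner_integral lborel (\<lambda>\<xi>. iexp (z \<bullet> \<xi>) * complex_of_real (gauss \<tau> \<xi>))
     (complex_of_real (exp (- \<tau> * (norm z)\<^sup>2 / 2)))"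
proof -
  have "has_bochner_integral lborel
     (\<lambda>\<xi>. \<Prod>b\<in>Basis. iexp ((z \<bullet> b) * (\<xi> \<bullet> b)) * complex_of_real (normal_density 0 (sqrt \<tau>) (\<xi> \<bullet> b)))
     (\<Prod>b\<in>(Basis::'a set). (\<integral>x. iexp ((z \<bullet> b) * x) * complex_of_real (normal_density 0 (sqrt \<tau>) x) \<partial>lborel))"
    by (rule integral_lborel_prod) (use charfun_normal[OF assms] in \<open>auto simp: has_bochner_integral_iff\<close>)
  moreover have "(\<Prod>b\<in>Basis. iexp ((z \<bullet> b) * (\<xi> \<bullet> b)) * complex_of_real (normal_density 0 (sqrt \<tau>) (\<xi> \<bullet> b)))
      = iexp (z \<bullet> \<xi>) * complex_of_real (gauss \<tau> \<xi>)" for \<xi> :: 'a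
    unfolding prod.distrib prod_of_real_gauss by (simp add: euclidean_inner[of z \<xi>] exp_sum[symmetric] sum_distrib_left)
  moreover have "(\<Prod>b\<in>(Basis::'a set). (\<integral>x. iexp ((z \<bullet> b) * x) * complex_of_real (normal_density 0 (sqrt \<tau>) x) \<partial>lborel))
      = complex_of_real (exp (- \<tau> * (norm z)\<^sup>2 / 2))"
  proof -
    have "(\<integral>x. iexp ((z \<bullet> b) * x) * complex_of_real (normal_density 0 (sqrt \<tau>) x) \<partial>lborel)
       = complex_of_real (exp (- \<tau> * (z \<bullet> b)\<^sup>2 / 2))" for b
      using charfun_normal[OF assms] by (simp add: has_bochner_integral_iff)
    then show ?thesis
      by (simp add: norm_sq_eq_sum exp_sum[symmetric] sum_distrib_left sum_divide_distrib sum_negf flip: of_real_prod)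
  qed
  ultimately show ?thesis by simp
qed

lemma gauss_eq:
  fixes x :: "'a::euclidean_space"
  assumes "\<tau> > 0"
  shows "gauss \<tau> x = (1 / sqrt (2 * pi * \<tau>)) ^ DIM('a) * exp (- (norm x)\<^sup>2 / (2 * \<tau>))"
proof -
  have "normal_density 0 (sqrt \<tau>) y = (1 / sqrt (2 * pi * \<tau>)) * exp (- y\<^sup>2 / (2 * \<tau>))" for y
    using assms by (simp add: normal_density_def)
  moreover have "exp (- (norm x)\<^sup>2 / (2 * \<tau>)) = (\<Prod>b\<in>Basis. exp (- (x \<bullet> b)\<^sup>2 / (2 * \<tau>)))"
    by (simp add: norm_sq_eq_sum exp_sum[symmetric] sum_divide_distrib sum_negf)
  ultimately show ?thesis by (simp only: gauss_def prod.distrib prod_constant)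
qed

text \<open>Away from the centre the Gaussian is small both uniformly and relative to a Gaussian of twice the variance;
the first bound is paired with the integrable \<open>f\<close>, the second with the constant \<open>f x\<close>.\<close>

lemma gauss_approx_identity:
  fixes f :: "'a::euclidean_space \<Rightarrow> real"
  assumes c: "continuous_on UNIV f" and i: "integrable lborel f"
  shows "(\<lambda>n. \<integral>y. f y * gauss (1 / real (Suc n)) (x - y) \<partial>lborel) \<longlonglongrightarrow> f x"
proof -
  define \<epsilon> where "\<epsilon> n = 1 / real (Suc n)" for n
  have \<epsilon>: "\<epsilon> n > 0" for n by (simp add: \<epsilon>_def)
  define d where "d = DIM('a)"
  have d: "d > 0" by (simp add: d_def)
  have ix: "integrable lborel (\<lambda>y. f (y + x))"
    using has_bochner_integral_lborel_shift[OF has_bochner_integral_integrable[OF i], of x] by (simp add: has_bochner_integral_iff)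
  have gi: "integrable lborel (gauss (\<epsilon> n) :: 'a \<Rightarrow> real)" "integral\<^sup>L lborel (gauss (\<epsilon> n) :: 'a \<Rightarrow> real) = 1" for n
    using has_bochner_integral_gauss[OF \<epsilon>, of n] by (auto simp: has_bochner_integral_iff)
  have g2i: "integrable lborel (gauss (2 * \<epsilon> n) :: 'a \<Rightarrow> real)" "integral\<^sup>L lborel (gauss (2 * \<epsilon> n) :: 'a \<Rightarrow> real) = 1" for n
    using has_bochner_integral_gauss[of "2 * \<epsilon> n"] \<epsilon>[of n] by (auto simp: has_bochner_integral_iff)
  have fm[measurable]: "f \<in> borel_measurable borel" using c by (rule borel_measurable_continuous_onI)
  have gb: "gauss (\<epsilon> n) z \<le> (1 / sqrt (2 * pi * \<epsilon> n)) ^ d" for n and z :: 'a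
    using \<epsilon>[of n] by (simp add: gauss_eq d_def mult_left_le)
  have gnn: "0 \<le> gauss (\<epsilon> n) z" for n and z :: 'a using gauss_pos[OF \<epsilon>, of n z] by simp
  have pi': "integrable lborel (\<lambda>y. f (y + x) * gauss (\<epsilon> n) y)" for n
    by (rule Bochner_Integration.integrable_bound[OF integrable_mult_left[OF ix, of "(1 / sqrt (2 * pi * \<epsilon> n)) ^ d"]])
      (use gb gnn in \<open>auto simp: abs_mult intro!: mult_left_mono order_trans[OF gb abs_ge_self]\<close>)
  have sym: "gauss \<tau> (- z) = gauss \<tau> z" for \<tau> and z :: 'a
    by (simp add: gauss_def normal_density_def)
  have eq: "(\<integral>y. f y * gauss (\<epsilon> n) (x - y) \<partial>lborel) = (\<integral>y. f (y + x) * gauss (\<epsilon> n) y \<partial>lborel)" for n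
  proof -
    have "has_bochner_integral lborel (\<lambda>y. f (y + - x + x) * gauss (\<epsilon> n) (y + - x)) (\<integral>y. f (y + x) * gauss (\<epsilon> n) y \<partial>lborel)"
      by (rule has_bochner_integral_lborel_shift[OF has_bochner_integral_integrable[OF pi']])
    moreover have "gauss (\<epsilon> n) (y - x) = gauss (\<epsilon> n) (x - y)" for y using sym[of "\<epsilon> n" "y - x"] by simp
    ultimately show ?thesis by (simp add: has_bochner_integral_iff)
  qed
  show ?thesis
    unfolding \<epsilon>_def[symmetric] eq
  proof (rule LIMSEQ_I)
    fix \<delta> :: real assume \<delta>: "\<delta> > 0"
    obtain r where r: "r > 0" "\<And>y. norm y \<le> r \<Longrightarrow> \<bar>f (y + x) - f x\<bar> \<le> \<delta> / 2"
    proof -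
      have "isCont f x" using c by (simp add: continuous_on_eq_continuous_at)
      then obtain r' where r': "r' > 0" "\<And>z. dist z x < r' \<Longrightarrow> dist (f z) (f x) < \<delta> / 2"
        unfolding continuous_at_eps_delta using \<delta> by (metis half_gt_zero)
      show ?thesis
      proof (rule that[of "r' / 2"])
        show "\<bar>f (y + x) - f x\<bar> \<le> \<delta> / 2" if "norm y \<le> r' / 2" for y
          using r'(2)[of "y + x"] that r'(1) by (simp add: dist_norm)
      qed (use r' in auto)
    qed
    define T1 where "T1 n = (1 / sqrt (2 * pi * \<epsilon> n)) ^ d * exp (- r\<^sup>2 / (2 * \<epsilon> n))" for n
    define T2 where "T2 n = sqrt 2 ^ d * exp (- r\<^sup>2 / (4 * \<epsilon> n))" for n
    define B1 where "B1 = (\<integral>y. \<bar>f (y + x)\<bar> \<partial>lborel)"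
    have T10: "T1 n \<ge> 0" "T2 n \<ge> 0" for n using \<epsilon>[of n] by (auto simp: T1_def T2_def)
    have pt: "\<bar>(f (y + x) - f x) * gauss (\<epsilon> n) y\<bar> \<le>
       \<delta> / 2 * gauss (\<epsilon> n) y + T1 n * \<bar>f (y + x)\<bar> + \<bar>f x\<bar> * T2 n * gauss (2 * \<epsilon> n) y" for y n
    proof (cases "norm y \<le> r")
      case True
      have "\<bar>(f (y + x) - f x) * gauss (\<epsilon> n) y\<bar> \<le> \<delta> / 2 * gauss (\<epsilon> n) y"
        using mult_right_mono[OF r(2)[OF True] gnn[of n y]] gnn[of n y] by (simp add: abs_mult)
      moreover have "0 \<le> T1 n * \<bar>f (y + x)\<bar>" "0 \<le> \<bar>f x\<bar> * T2 n * gauss (2 * \<epsilon> n) y"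
        using T10 gauss_pos[of "2 * \<epsilon> n" y] \<epsilon>[of n] by auto
      ultimately show ?thesis by linarith
    next
      case False
      then have ry: "r\<^sup>2 \<le> (norm y)\<^sup>2" using r by (simp add: power_mono)
      have 1: "gauss (\<epsilon> n) y \<le> T1 n"
        unfolding gauss_eq[OF \<epsilon>] T1_def d_def using ry \<epsilon>[of n]
        by (intro mult_left_mono) (auto simp: divide_simps)
      have 2: "gauss (\<epsilon> n) y \<le> T2 n * gauss (2 * \<epsilon> n) y"
      proof -
        have "exp (- (norm y)\<^sup>2 / (2 * \<epsilon> n)) = exp (- (norm y)\<^sup>2 / (4 * \<epsilon> n)) * exp (- (norm y)\<^sup>2 / (4 * \<epsilon> n))"
          using \<epsilon>[of n] by (simp flip: exp_add)
        also have "\<dots> \<le> exp (- r\<^sup>2 / (4 * \<epsilon> n)) * exp (- (norm y)\<^sup>2 / (4 * \<epsilon> n))"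
          using ry \<epsilon>[of n] by (intro mult_right_mono) (auto simp: divide_simps)
        finally have e: "exp (- (norm y)\<^sup>2 / (2 * \<epsilon> n)) \<le> exp (- r\<^sup>2 / (4 * \<epsilon> n)) * exp (- (norm y)\<^sup>2 / (4 * \<epsilon> n))" .
        have s: "sqrt 2 * (1 / sqrt (2 * pi * (2 * \<epsilon> n))) = 1 / sqrt (2 * pi * \<epsilon> n)"
        proof -
          have "sqrt (2 * pi * (2 * \<epsilon> n)) = sqrt 2 * sqrt (2 * pi * \<epsilon> n)" by (simp flip: real_sqrt_mult)
          then show ?thesis by simp
        qed
        have "gauss (\<epsilon> n) y \<le> (1 / sqrt (2 * pi * \<epsilon> n)) ^ d * (exp (- r\<^sup>2 / (4 * \<epsilon> n)) * exp (- (norm y)\<^sup>2 / (4 * \<epsilon> n)))"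
          unfolding gauss_eq[OF \<epsilon>] d_def using e \<epsilon>[of n] by (intro mult_left_mono) auto
        also have "\<dots> = T2 n * gauss (2 * \<epsilon> n) y"
          unfolding T2_def s[symmetric] power_mult_distrib using \<epsilon>[of n]
          by (subst gauss_eq) (auto simp: d_def)
        finally show ?thesis .
      qed
      have "\<bar>(f (y + x) - f x) * gauss (\<epsilon> n) y\<bar> \<le> (\<bar>f (y + x)\<bar> + \<bar>f x\<bar>) * gauss (\<epsilon> n) y"
        using gnn[of n y] by (simp add: abs_mult mult_right_mono)
      also have "\<dots> = \<bar>f (y + x)\<bar> * gauss (\<epsilon> n) y + \<bar>f x\<bar> * gauss (\<epsilon> n) y" by (simp add: ring_distribs)
      also have "\<dots> \<le> \<bar>f (y + x)\<bar> * T1 n + \<bar>f x\<bar> * (T2 n * gauss (2 * \<epsilon> n) y)"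
        by (intro add_mono mult_left_mono 1 2) auto
      also have "\<dots> \<le> \<delta> / 2 * gauss (\<epsilon> n) y + T1 n * \<bar>f (y + x)\<bar> + \<bar>f x\<bar> * T2 n * gauss (2 * \<epsilon> n) y"
        using gnn[of n y] \<delta> by (simp add: mult_ac)
      finally show ?thesis .
    qed
    have bound: "\<bar>(\<integral>y. f (y + x) * gauss (\<epsilon> n) y \<partial>lborel) - f x\<bar> \<le> \<delta> / 2 + T1 n * B1 + \<bar>f x\<bar> * T2 n" for n
    proof -
      have I1: "integrable lborel (\<lambda>y. (f (y + x) - f x) * gauss (\<epsilon> n) y)"
        using pi'[of n] gi(1)[of n] by (auto simp: left_diff_distrib)
      have "(\<integral>y. f (y + x) * gauss (\<epsilon> n) y \<partial>lborel) - f x = (\<integral>y. (f (y + x) - f x) * gauss (\<epsilon> n) y \<partial>lborel)"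
        using pi'[of n] gi[of n] by (simp add: left_diff_distrib)
      also have "\<bar>\<dots>\<bar> \<le> (\<integral>y. \<bar>(f (y + x) - f x) * gauss (\<epsilon> n) y\<bar> \<partial>lborel)" by (rule integral_abs_bound)
      also have "\<dots> \<le> (\<integral>y. \<delta> / 2 * gauss (\<epsilon> n) y + T1 n * \<bar>f (y + x)\<bar> + \<bar>f x\<bar> * T2 n * gauss (2 * \<epsilon> n) y \<partial>lborel)"
        by (rule integral_mono) (use I1 gi g2i ix pt in auto)
      also have "\<dots> = \<delta> / 2 + T1 n * B1 + \<bar>f x\<bar> * T2 n"
        using gi g2i ix by (simp add: B1_def)
      finally show ?thesis .
    qed
    have t1: "T1 \<longlonglongrightarrow> 0"
    proof -
      define g where "g n = sqrt (real (Suc n) / (2 * pi)) * exp (- (r\<^sup>2 / (2 * real d)) * real (Suc n))" for n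
      have e: "T1 n = g n ^ d" for n
      proof -
        have "1 / sqrt (2 * pi * \<epsilon> n) = sqrt (real (Suc n) / (2 * pi))"
          by (simp add: \<epsilon>_def real_sqrt_divide)
        moreover have "exp (- r\<^sup>2 / (2 * \<epsilon> n)) = exp (- (r\<^sup>2 / (2 * real d)) * real (Suc n)) ^ d"
          using d by (simp add: \<epsilon>_def exp_of_nat_mult[symmetric])
        ultimately show ?thesis by (simp only: T1_def g_def power_mult_distrib)
      qed
      have "g \<longlonglongrightarrow> 0"
      proof -
        have "r\<^sup>2 / (2 * real d) > 0" using r d by simp
        then have "((\<lambda>n::nat. sqrt (real (Suc n) / (2 * pi)) * exp (- c * real (Suc n))) \<longlonglongrightarrow> 0)" if "c > 0" for c
          using that by real_asymp
        from this[OF \<open>r\<^sup>2 / (2 * real d) > 0\<close>] show ?thesis by (simp only: g_def[abs_def])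
      qed
      then have "(\<lambda>n. g n ^ d) \<longlonglongrightarrow> 0 ^ d" by (rule tendsto_power)
      then show ?thesis using d by (simp add: e[abs_def] power_0_left)
    qed
    have t2: "T2 \<longlonglongrightarrow> 0"
    proof -
      have "((\<lambda>n::nat. K * exp (- c * real (Suc n))) \<longlonglongrightarrow> 0)" if "c > 0" for c K :: real
        using that by real_asymp
      from this[of "r\<^sup>2 / 4" "sqrt 2 ^ d"] show ?thesis using r by (simp add: T2_def[abs_def] \<epsilon>_def)
    qed
    have "(\<lambda>n. T1 n * B1 + \<bar>f x\<bar> * T2 n) \<longlonglongrightarrow> 0 * B1 + \<bar>f x\<bar> * 0"
      by (intro tendsto_intros t1 t2)
    then have "eventually (\<lambda>n. T1 n * B1 + \<bar>f x\<bar> * T2 n < \<delta> / 2) sequentially"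
      using \<delta> by (intro order_tendstoD(2)) auto
    then obtain N where N: "\<And>n. n \<ge> N \<Longrightarrow> T1 n * B1 + \<bar>f x\<bar> * T2 n < \<delta> / 2"
      by (auto simp: eventually_sequentially)
    show "\<exists>N. \<forall>n\<ge>N. norm ((\<integral>y. f (y + x) * gauss (\<epsilon> n) y \<partial>lborel) - f x) < \<delta>"
    proof (intro exI allI impI)
      fix n assume "n \<ge> N"
      with N[of n] bound[of n] show "norm ((\<integral>y. f (y + x) * gauss (\<epsilon> n) y \<partial>lborel) - f x) < \<delta>" by simp
    qed
  qed
qed

text \<open>Summation over the balls of radius \<open>2^k\<close>: on the shell outside the previous ball the weight is at most a multiple
of \<open>(4 powr (- p))^k\<close>, while the volume is of order \<open>(2^d)^k\<close>.\<close>

lemma bessel_weight_integral_finite: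
  assumes p: "p > real DIM('a::euclidean_space) / 2"
  shows "(\<integral>\<^sup>+\<xi>. ennreal ((1 + (norm (\<xi>::'a))\<^sup>2) powr (- p)) \<partial>lborel) < \<infinity>"
proof -
  define d where "d = DIM('a)"
  define K where "K k = ennreal (4 powr p * (4 powr (- p)) ^ k)" for k :: nat
  have pt: "ennreal ((1 + (norm \<xi>)\<^sup>2) powr (- p)) \<le> (\<Sum>k. K k * indicator (cball 0 (2^k)) \<xi>)" for \<xi> :: 'a
  proof -
    obtain m :: nat where "norm \<xi> < 2 ^ m" using real_arch_pow[of 2 "norm \<xi>"] by auto
    then have ex: "\<exists>k. norm \<xi> \<le> 2 ^ k" by (auto intro: less_imp_le)
    define k where "k = (LEAST k. norm \<xi> \<le> 2 ^ k)"
    have k: "norm \<xi> \<le> 2 ^ k" unfolding k_def using ex by (rule LeastI_ex)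
    have "(1 + (norm \<xi>)\<^sup>2) powr (- p) \<le> 4 powr p * (4 powr (- p)) ^ k"
    proof (cases k)
      case 0
      have pp: "p > 0" using p by (smt (verit) of_nat_0_le_iff divide_nonneg_pos)
      have "(1 + (norm \<xi>)\<^sup>2) powr (- p) \<le> 1 powr (- p)" using pp by (intro powr_mono2') auto
      also have "\<dots> \<le> 4 powr p" using pp by (simp add: ge_one_powr_ge_zero)
      finally show ?thesis using 0 by simp
    next
      case (Suc j)
      have pp: "p > 0" using p by (smt (verit) of_nat_0_le_iff divide_nonneg_pos)
      have "\<not> norm \<xi> \<le> 2 ^ j" using not_less_Least[of j "\<lambda>k. norm \<xi> \<le> 2 ^ k"] Suc by (simp add: k_def)
      then have "(2^j)\<^sup>2 \<le> (norm \<xi>)\<^sup>2" by (intro power_mono) auto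
      then have "4 ^ j \<le> 1 + (norm \<xi>)\<^sup>2" by (simp add: power_mult[symmetric] mult.commute[of j] power_mult)
      then have "(1 + (norm \<xi>)\<^sup>2) powr (- p) \<le> (4 ^ j) powr (- p)" using pp by (intro powr_mono2') auto
      also have "\<dots> = (4 powr (- p)) ^ j"
        by (simp add: powr_realpow[symmetric] powr_powr mult.commute)
      also have "\<dots> = 4 powr p * (4 powr (- p)) ^ k"
        using Suc by (simp add: powr_minus)
      finally show ?thesis .
    qed
    then have "ennreal ((1 + (norm \<xi>)\<^sup>2) powr (- p)) \<le> K k * indicator (cball 0 (2^k)) \<xi>"
      using k by (simp add: K_def ennreal_leI)
    also have "\<dots> \<le> (\<Sum>k. K k * indicator (cball 0 (2^k)) \<xi>)"
    proof -
      have "g k \<le> suminf g" for g :: "nat \<Rightarrow> ennreal" using sum_le_suminf[of g "{k}"] by simp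
      then show ?thesis .
    qed
    finally show ?thesis .
  qed
  define q where "q = 4 powr (- p) * 2 ^ d"
  have q: "0 \<le> q" "q < 1"
  proof -
    have "4 powr (- p) = 2 powr (- 2 * p)" using powr_powr[of 2 2 "- p"] by simp
    then have "q = 2 powr (- 2 * p) * 2 powr real d" by (simp add: q_def powr_realpow)
    also have "\<dots> = 2 powr (real d - 2 * p)" by (simp flip: powr_add)
    also have "\<dots> < 2 powr 0" using p by (intro powr_less_mono) (auto simp: d_def)
    finally show "q < 1" by simp
  qed (simp add: q_def)
  have [measurable]: "cball (0::'a) R \<in> sets borel" for R by simp
  have "(\<integral>\<^sup>+\<xi>. ennreal ((1 + (norm (\<xi>::'a))\<^sup>2) powr (- p)) \<partial>lborel) \<le> (\<integral>\<^sup>+\<xi>. (\<Sum>k. K k * indicator (cball 0 (2^k)) (\<xi>::'a)) \<partial>lborel)"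
    by (intro nn_integral_mono pt)
  also have "\<dots> = (\<Sum>k. \<integral>\<^sup>+\<xi>. K k * indicator (cball 0 (2^k)) (\<xi>::'a) \<partial>lborel)"
    by (rule nn_integral_suminf) auto
  also have "\<dots> = (\<Sum>k. ennreal (4 powr p * unit_ball_vol (real d) * q ^ k))"
  proof (rule suminf_cong)
    fix k
    have "(\<integral>\<^sup>+\<xi>. K k * indicator (cball 0 (2^k)) (\<xi>::'a) \<partial>lborel) = K k * emeasure lborel (cball (0::'a) (2^k))"
      by (simp add: nn_integral_cmult_indicator)
    also have "\<dots> = ennreal (4 powr p * (4 powr (- p)) ^ k) * ennreal (unit_ball_vol (real d) * (2^k) ^ d)"
      by (simp add: K_def emeasure_cball d_def)
    also have "\<dots> = ennreal (4 powr p * unit_ball_vol (real d) * q ^ k)"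
      by (subst ennreal_mult[symmetric]) (auto simp: q_def power_mult_distrib power_mult[symmetric] mult_ac)
    finally show "(\<integral>\<^sup>+\<xi>. K k * indicator (cball 0 (2^k)) (\<xi>::'a) \<partial>lborel) = ennreal (4 powr p * unit_ball_vol (real d) * q ^ k)" .
  qed
  also have "\<dots> < \<infinity>"
    using q by (subst suminf_ennreal2) (auto intro!: summable_mult summable_geometric)
  finally show ?thesis .
qed

text \<open>The \<open>L\<^sup>2\<close> Fourier transform is the limit of truncated Fourier integrals in mean square; for integrable \<open>f\<close> the
truncated integrals also converge pointwise, and Fatou's lemma identifies the two limits.\<close>

lemma L2_fourier_of_integrable:
  fixes f :: "'a::euclidean_space \<Rightarrow> real"
  assumes F: "is_L2_fourier f F" and f: "integrable lborel f"
  shows "AE \<xi> in lborel. F \<xi> = complex_of_real ((2 * pi) powr (- real DIM('a) / 2)) *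
     (\<integral>x. exp (- \<i> * complex_of_real (x \<bullet> \<xi>)) * complex_of_real (f x) \<partial>lborel)"
proof -
  define c where "c = complex_of_real ((2 * pi) powr (- real DIM('a) / 2))"
  define P where "P R \<xi> = set_lebesgue_integral lborel (cball 0 R) (\<lambda>x. exp (- \<i> * complex_of_real (x \<bullet> \<xi>)) * complex_of_real (f x))"
    for R and \<xi> :: 'a
  define Q where "Q \<xi> = (\<integral>x. exp (- \<i> * complex_of_real (x \<bullet> \<xi>)) * complex_of_real (f x) \<partial>lborel)" for \<xi> :: 'a
  have [measurable]: "F \<in> borel_measurable borel" "f \<in> borel_measurable borel"
    using F unfolding is_L2_fourier_def by auto
  have [measurable]: "cball (0::'a) R \<in> sets borel" for R by simp
  have [measurable]: "P R \<in> borel_measurable borel" for R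
    unfolding P_def set_lebesgue_integral_def by measurable
  have lim: "((\<lambda>R. \<integral>\<^sup>+\<xi>. ennreal ((cmod (F \<xi> - c * P R \<xi>))\<^sup>2) \<partial>lborel) \<longlongrightarrow> 0) at_top"
    using F unfolding is_L2_fourier_def c_def P_def by simp
  have lim2: "(\<lambda>n. \<integral>\<^sup>+\<xi>. ennreal ((cmod (F \<xi> - c * P (real n) \<xi>))\<^sup>2) \<partial>lborel) \<longlonglongrightarrow> 0"
    by (rule filterlim_compose[OF lim filterlim_real_sequentially])
  have nrm: "cmod (exp (- (\<i> * complex_of_real y))) = 1" for y
    using norm_exp_i_times[of "- y"] by simp
  have pc: "(\<lambda>n. P (real n) \<xi>) \<longlonglongrightarrow> Q \<xi>" for \<xi>
    unfolding P_def Q_def set_lebesgue_integral_def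
  proof (rule integral_dominated_convergence[where w="\<lambda>x. \<bar>f x\<bar>"])
    show "AE x in lborel. (\<lambda>n. indicat_real (cball 0 (real n)) x *\<^sub>R (exp (- \<i> * complex_of_real (x \<bullet> \<xi>)) * complex_of_real (f x)))
       \<longlonglongrightarrow> exp (- \<i> * complex_of_real (x \<bullet> \<xi>)) * complex_of_real (f x)"
    proof (rule AE_I2)
      fix x :: 'a
      have "eventually (\<lambda>n. norm x \<le> real n) sequentially"
        using filterlim_real_sequentially by (simp add: filterlim_at_top)
      then show "(\<lambda>n. indicat_real (cball 0 (real n)) x *\<^sub>R (exp (- \<i> * complex_of_real (x \<bullet> \<xi>)) * complex_of_real (f x)))
       \<longlonglongrightarrow> exp (- \<i> * complex_of_real (x \<bullet> \<xi>)) * complex_of_real (f x)"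
        by (intro tendsto_eventually) (auto elim!: eventually_mono)
    qed
    show "AE x in lborel. norm (indicat_real (cball 0 (real n)) x *\<^sub>R (exp (- \<i> * complex_of_real (x \<bullet> \<xi>)) * complex_of_real (f x))) \<le> \<bar>f x\<bar>" for n
      by (intro AE_I2) (auto simp: norm_mult nrm indicator_def)
  qed (use f in auto)
  have "(\<integral>\<^sup>+\<xi>. ennreal ((cmod (F \<xi> - c * Q \<xi>))\<^sup>2) \<partial>lborel) =
      (\<integral>\<^sup>+\<xi>. liminf (\<lambda>n. ennreal ((cmod (F \<xi> - c * P (real n) \<xi>))\<^sup>2)) \<partial>lborel)"
  proof (rule nn_integral_cong)
    fix \<xi>
    have "(\<lambda>n. ennreal ((cmod (F \<xi> - c * P (real n) \<xi>))\<^sup>2)) \<longlonglongrightarrow> ennreal ((cmod (F \<xi> - c * Q \<xi>))\<^sup>2)"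
      by (intro tendsto_intros pc)
    then show "ennreal ((cmod (F \<xi> - c * Q \<xi>))\<^sup>2) = liminf (\<lambda>n. ennreal ((cmod (F \<xi> - c * P (real n) \<xi>))\<^sup>2))"
      using lim_imp_Liminf[OF sequentially_bot] by fastforce
  qed
  also have "\<dots> \<le> liminf (\<lambda>n. \<integral>\<^sup>+\<xi>. ennreal ((cmod (F \<xi> - c * P (real n) \<xi>))\<^sup>2) \<partial>lborel)"
    by (rule nn_integral_liminf) measurable
  also have "\<dots> = 0" using lim_imp_Liminf[OF sequentially_bot lim2] .
  finally have z: "(\<integral>\<^sup>+\<xi>. ennreal ((cmod (F \<xi> - c * Q \<xi>))\<^sup>2) \<partial>lborel) = 0" by simp
  have [measurable]: "Q \<in> borel_measurable borel" unfolding Q_def by measurable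
  have "AE \<xi> in lborel. ennreal ((cmod (F \<xi> - c * Q \<xi>))\<^sup>2) = 0"
    using z by (subst (asm) nn_integral_0_iff_AE) auto
  then show ?thesis unfolding c_def[symmetric] Q_def[symmetric] by eventually_elim auto
qed

section \<open>Lipschitz bounds from Sobolev norms\<close>

lemma iexp_lipschitz: "cmod (iexp a - iexp b) \<le> \<bar>a - b\<bar>"
proof -
  have "iexp a - iexp b = iexp b * (iexp (a - b) - 1)"
    by (simp add: right_diff_distrib flip: exp_add)
  then have "cmod (iexp a - iexp b) = cmod (iexp (a - b) - 1)" by (simp add: norm_mult)
  also have "\<dots> \<le> \<bar>a - b\<bar>" using iexp_approx1[of "a - b" 0] by simp
  finally show ?thesis .
qed

text \<open>Fourier inversion for the mollified function, by Fubini and the characteristic function of the Gaussian.\<close>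

lemma fourier_mollified:
  fixes f :: "'a::euclidean_space \<Rightarrow> real"
  assumes f: "integrable lborel f" and \<tau>: "\<tau> > 0"
  defines "Q \<equiv> \<lambda>\<xi>::'a. \<integral>x. exp (- \<i> * complex_of_real (x \<bullet> \<xi>)) * complex_of_real (f x) \<partial>lborel"
  shows "integrable lborel (\<lambda>\<xi>. complex_of_real (gauss \<tau> \<xi>) * iexp (x \<bullet> \<xi>) * Q \<xi>)"
    and "complex_of_real (\<integral>y. f y * gauss (1 / \<tau>) (x - y) \<partial>lborel) =
     complex_of_real ((1 / sqrt (2 * pi / \<tau>)) ^ DIM('a)) * (\<integral>\<xi>. complex_of_real (gauss \<tau> \<xi>) * iexp (x \<bullet> \<xi>) * Q \<xi> \<partial>lborel)"
proof -
  have [measurable]: "f \<in> borel_measurable borel" using f by (auto dest: borel_measurable_integrable)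
  have gi: "integrable lborel (gauss \<tau> :: 'a \<Rightarrow> real)"
    using has_bochner_integral_gauss[OF \<tau>] by (auto simp: has_bochner_integral_iff)
  have gp: "gauss \<tau> z > 0" for z :: 'a using gauss_pos[OF \<tau>] .
  have nrm: "cmod (exp (- (\<i> * complex_of_real y))) = 1" for y
    using norm_exp_i_times[of "- y"] by simp
  define H where "H y \<xi> = complex_of_real (f y) * (iexp ((x - y) \<bullet> \<xi>) * complex_of_real (gauss \<tau> \<xi>))" for y \<xi>
  have Hm: "(\<lambda>(y, \<xi>). H y \<xi>) \<in> borel_measurable (lborel \<Otimes>\<^sub>M lborel)"
    unfolding H_def by measurable
  have Hn: "norm (H y \<xi>) = \<bar>f y\<bar> * gauss \<tau> \<xi>" for y \<xi>
    using gp[of \<xi>] by (simp add: H_def norm_mult)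
  have Hy: "integrable lborel (\<lambda>\<xi>. H y \<xi>)" for y
    using charfun_gauss[OF \<tau>, of "x - y"] unfolding H_def by (intro integrable_mult_right) (simp add: has_bochner_integral_iff)
  have Hi: "integrable (lborel \<Otimes>\<^sub>M lborel) (\<lambda>(y, \<xi>). H y \<xi>)"
    by (rule lborel_pair.Fubini_integrable[OF Hm]) (use f gi Hy in \<open>auto simp: Hn\<close>)
  have H1: "(\<integral>\<xi>. H y \<xi> \<partial>lborel) = complex_of_real (f y) * complex_of_real (exp (- \<tau> * (norm (x - y))\<^sup>2 / 2))" for y
    using charfun_gauss[OF \<tau>, of "x - y"] unfolding H_def by (simp add: has_bochner_integral_iff)
  have H2: "(\<integral>y. H y \<xi> \<partial>lborel) = complex_of_real (gauss \<tau> \<xi>) * iexp (x \<bullet> \<xi>) * Q \<xi>" for \<xi>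
  proof -
    have "H y \<xi> = (complex_of_real (gauss \<tau> \<xi>) * iexp (x \<bullet> \<xi>)) * (exp (- \<i> * complex_of_real (y \<bullet> \<xi>)) * complex_of_real (f y))" for y
      unfolding H_def by (simp add: inner_diff_left right_diff_distrib exp_diff exp_minus field_simps)
    then show ?thesis unfolding Q_def by simp
  qed
  show "integrable lborel (\<lambda>\<xi>. complex_of_real (gauss \<tau> \<xi>) * iexp (x \<bullet> \<xi>) * Q \<xi>)"
    using lborel_pair.integrable_snd[OF Hi] by (simp add: H2)
  have ge: "gauss (1 / \<tau>) z = (1 / sqrt (2 * pi / \<tau>)) ^ DIM('a) * exp (- \<tau> * (norm z)\<^sup>2 / 2)" for z :: 'a
    using \<tau> by (simp add: gauss_eq)
  have "complex_of_real (\<integral>y. f y * gauss (1 / \<tau>) (x - y) \<partial>lborel)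
     = complex_of_real ((1 / sqrt (2 * pi / \<tau>)) ^ DIM('a)) * (\<integral>y. complex_of_real (f y * exp (- \<tau> * (norm (x - y))\<^sup>2 / 2)) \<partial>lborel)"
  proof -
    have "(\<integral>y. f y * gauss (1 / \<tau>) (x - y) \<partial>lborel) = (1 / sqrt (2 * pi / \<tau>)) ^ DIM('a) * (\<integral>y. f y * exp (- \<tau> * (norm (x - y))\<^sup>2 / 2) \<partial>lborel)"
      unfolding ge mult.left_commute[of "f _"] by (rule integral_mult_right_zero)
    then show ?thesis
      unfolding integral_complex_of_real of_real_mult[symmetric] by (rule arg_cong)
  qed
  also have "(\<integral>y. complex_of_real (f y * exp (- \<tau> * (norm (x - y))\<^sup>2 / 2)) \<partial>lborel) = (\<integral>y. (\<integral>\<xi>. H y \<xi> \<partial>lborel) \<partial>lborel)"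
    unfolding H1 by simp
  also have "\<dots> = (\<integral>\<xi>. (\<integral>y. H y \<xi> \<partial>lborel) \<partial>lborel)"
    by (rule lborel_pair.Fubini_integral[OF Hi, symmetric])
  finally show "complex_of_real (\<integral>y. f y * gauss (1 / \<tau>) (x - y) \<partial>lborel) =
     complex_of_real ((1 / sqrt (2 * pi / \<tau>)) ^ DIM('a)) * (\<integral>\<xi>. complex_of_real (gauss \<tau> \<xi>) * iexp (x \<bullet> \<xi>) * Q \<xi> \<partial>lborel)"
    unfolding H2 .
qed

text \<open>The function is recovered from its Fourier transform through Gaussian mollification, and the Lipschitz constant is
at most the integral of \<open>norm \<xi> * cmod (F \<xi>)\<close>, up to the normalisation.  This integral is finite because
\<open>(1 + (norm \<xi>)\<^sup>2) powr (1 - s)\<close> is integrable for \<open>s > d / 2 + 1\<close>.\<close>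

lemma lipschitz_of_L2_fourier:
  fixes f :: "'a::euclidean_space \<Rightarrow> real"
  assumes s: "s > real DIM('a) / 2 + 1" and c: "continuous_on UNIV f" and f: "integrable lborel f"
    and F: "is_L2_fourier f F" and A: "A > 0"
    and H: "(\<integral>\<^sup>+\<xi>. ennreal ((1 + (norm \<xi>)\<^sup>2) powr s * (cmod (F \<xi>))\<^sup>2) \<partial>lborel) \<le> ennreal (A\<^sup>2)"
  shows "\<bar>f x - f y\<bar> \<le> (1 / (2 * pi)) ^ DIM('a) / (2 * pi) powr (- real DIM('a) / 2) *
     (enn2real (\<integral>\<^sup>+\<xi>. ennreal ((1 + (norm (\<xi>::'a))\<^sup>2) powr (1 - s)) \<partial>lborel) + 1) * A * norm (x - y)"
proof -
  define k where "k = (2 * pi) powr (- real DIM('a) / 2)"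
  have k: "k > 0" by (simp add: k_def)
  define Q where "Q \<xi> = (\<integral>x. exp (- \<i> * complex_of_real (x \<bullet> \<xi>)) * complex_of_real (f x) \<partial>lborel)" for \<xi> :: 'a
  have [measurable]: "f \<in> borel_measurable borel" "F \<in> borel_measurable borel"
    using F unfolding is_L2_fourier_def by auto
  have [measurable]: "Q \<in> borel_measurable borel" unfolding Q_def by measurable
  have FQ: "AE \<xi> in lborel. F \<xi> = complex_of_real k * Q \<xi>"
    using L2_fourier_of_integrable[OF F f] unfolding k_def Q_def .
  define J where "J = (\<integral>\<^sup>+\<xi>. ennreal ((1 + (norm (\<xi>::'a))\<^sup>2) powr (1 - s)) \<partial>lborel)"
  have J: "J < \<infinity>" using bessel_weight_integral_finite[where 'a='a, of "s - 1"] s by (simp add: J_def)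
  have wt: "ennreal (k * (norm \<xi> * cmod (Q \<xi>))) \<le> ennreal A * ennreal ((1 + (norm \<xi>)\<^sup>2) powr (1 - s)) +
       ennreal (1 / A) * ennreal ((1 + (norm \<xi>)\<^sup>2) powr s * (cmod (F \<xi>))\<^sup>2)" if FQ: "F \<xi> = complex_of_real k * Q \<xi>" for \<xi> :: 'a
  proof -
    define m where "m = 1 + (norm \<xi>)\<^sup>2"
    have m: "m \<ge> 1" by (simp add: m_def)
    define p q where "p = norm \<xi> * m powr (- s / 2)" and "q = m powr (s / 2) * cmod (F \<xi>)"
    have pq: "p \<ge> 0" "q \<ge> 0" by (auto simp: p_def q_def)
    have "k * (norm \<xi> * cmod (Q \<xi>)) = p * q"
      using k m by (simp add: p_def q_def FQ norm_mult powr_minus field_simps)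
    \<comment> \<open>The weight \<open>A\<close> in Young's inequality makes the final bound linear in the norm bound \<open>A\<close>.\<close>
    also have "\<dots> \<le> A * p\<^sup>2 + 1 / A * q\<^sup>2"
    proof -
      have "0 \<le> (A * p - q)\<^sup>2 / A" using A by simp
      also have "\<dots> = A * p\<^sup>2 - 2 * (p * q) + 1 / A * q\<^sup>2" using A by (simp add: power2_eq_square field_simps)
      finally have "2 * (p * q) \<le> A * p\<^sup>2 + 1 / A * q\<^sup>2" by simp
      moreover have "0 \<le> p * q" using pq by simp
      ultimately show ?thesis by linarith
    qed
    also have "p\<^sup>2 \<le> m powr (1 - s)"
    proof -
      have "p\<^sup>2 = (norm \<xi>)\<^sup>2 * m powr (- s)"
        using m by (simp add: p_def power_mult_distrib power2_eq_square[of "_ powr _"] flip: powr_add)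
      also have "\<dots> \<le> m * m powr (- s)" by (intro mult_right_mono) (auto simp: m_def)
      also have "\<dots> = m powr (1 - s)" using m by (simp add: powr_diff powr_minus divide_inverse)
      finally show ?thesis .
    qed
    also have "q\<^sup>2 = m powr s * (cmod (F \<xi>))\<^sup>2"
      using m by (simp add: q_def power_mult_distrib power2_eq_square[of "_ powr _"] flip: powr_add)
    finally have "k * (norm \<xi> * cmod (Q \<xi>)) \<le> A * m powr (1 - s) + 1 / A * (m powr s * (cmod (F \<xi>))\<^sup>2)"
      using A by (simp add: mult_left_mono)
    then show ?thesis
      using A unfolding m_def by (simp add: ennreal_mult'[symmetric] ennreal_plus[symmetric] ennreal_leI del: ennreal_plus)
  qed
  have "(\<integral>\<^sup>+\<xi>. ennreal (k * (norm \<xi> * cmod (Q \<xi>))) \<partial>lborel) \<le>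
     (\<integral>\<^sup>+\<xi>. ennreal A * ennreal ((1 + (norm \<xi>)\<^sup>2) powr (1 - s)) +
       ennreal (1 / A) * ennreal ((1 + (norm \<xi>)\<^sup>2) powr s * (cmod (F \<xi>))\<^sup>2) \<partial>lborel)"
    by (rule nn_integral_mono_AE) (use FQ wt in \<open>auto elim!: eventually_mono\<close>)
  also have "\<dots> = ennreal A * J + ennreal (1 / A) * (\<integral>\<^sup>+\<xi>. ennreal ((1 + (norm \<xi>)\<^sup>2) powr s * (cmod (F \<xi>))\<^sup>2) \<partial>lborel)"
    unfolding J_def by (subst nn_integral_add) (auto simp: nn_integral_cmult)
  also have "\<dots> \<le> ennreal A * J + ennreal (1 / A) * ennreal (A\<^sup>2)"
    by (intro add_mono mult_left_mono H) auto
  also have "\<dots> = ennreal (A * (enn2real J + 1))"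
    using A J by (cases J) (auto simp: ennreal_mult'[symmetric] ennreal_plus[symmetric] power2_eq_square algebra_simps simp del: ennreal_plus)
  finally have I1: "(\<integral>\<^sup>+\<xi>. ennreal (k * (norm \<xi> * cmod (Q \<xi>))) \<partial>lborel) \<le> ennreal (A * (enn2real J + 1))" .
  have Qi: "integrable lborel (\<lambda>\<xi>. k * (norm \<xi> * cmod (Q \<xi>)))"
    by (rule integrableI_nonneg) (use k I1 in \<open>auto simp: le_less_trans[OF I1]\<close>)
  have QI: "(\<integral>\<xi>. k * (norm \<xi> * cmod (Q \<xi>)) \<partial>lborel) \<le> A * (enn2real J + 1)"
    using I1 A k by (subst (asm) nn_integral_eq_integral[OF Qi]) auto
  have Qi': "integrable lborel (\<lambda>\<xi>. norm \<xi> * cmod (Q \<xi>))"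
    using integrable_mult_right[OF Qi, of "1 / k"] k by simp
  have QI': "(\<integral>\<xi>. norm \<xi> * cmod (Q \<xi>) \<partial>lborel) \<le> A * (enn2real J + 1) / k"
    using QI k by (simp add: field_simps)
  define fm where "fm n x = (\<integral>y. f y * gauss (1 / real (Suc n)) (x - y) \<partial>lborel)" for n x
  have fmL: "\<bar>fm n x - fm n y\<bar> \<le> (1 / (2 * pi)) ^ DIM('a) * (A * (enn2real J + 1) / k) * norm (x - y)" for n
  proof -
    define \<tau> where "\<tau> = real (Suc n)"
    have \<tau>: "\<tau> > 0" by (simp add: \<tau>_def)
    define B where "B = (1 / sqrt (2 * pi / \<tau>)) ^ DIM('a)"
    define B' where "B' = (1 / sqrt (2 * pi * \<tau>)) ^ DIM('a)"
    have B: "B \<ge> 0" "B' \<ge> 0" using \<tau> by (auto simp: B_def B'_def)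
    have "sqrt (2 * pi / \<tau>) * sqrt (2 * pi * \<tau>) = 2 * pi"
      using \<tau> real_sqrt_mult[of "2 * pi / \<tau>" "2 * pi * \<tau>"] real_sqrt_mult_self[of "2 * pi"] by (simp add: real_sqrt_mult)
    then have BB: "B * B' = (1 / (2 * pi)) ^ DIM('a)"
      unfolding B_def B'_def power_mult_distrib[symmetric] by simp
    have gB: "gauss \<tau> z \<le> B'" for z :: 'a using \<tau> by (simp add: gauss_eq B'_def mult_left_le)
    have gp: "gauss \<tau> z \<ge> 0" for z :: 'a using gauss_pos[OF \<tau>, of z] by simp
    have fi: "integrable lborel (\<lambda>\<xi>. complex_of_real (gauss \<tau> \<xi>) * iexp (x \<bullet> \<xi>) * Q \<xi>)"
      "complex_of_real (fm n x) = complex_of_real B * (\<integral>\<xi>. complex_of_real (gauss \<tau> \<xi>) * iexp (x \<bullet> \<xi>) * Q \<xi> \<partial>lborel)" for x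
      using fourier_mollified[OF f \<tau>] unfolding Q_def fm_def B_def \<tau>_def by auto
    have "complex_of_real (fm n x - fm n y) = complex_of_real B *
        (\<integral>\<xi>. complex_of_real (gauss \<tau> \<xi>) * iexp (x \<bullet> \<xi>) * Q \<xi> - complex_of_real (gauss \<tau> \<xi>) * iexp (y \<bullet> \<xi>) * Q \<xi> \<partial>lborel)"
      unfolding Bochner_Integration.integral_diff[OF fi(1) fi(1)] of_real_diff fi(2) by (rule right_diff_distrib[symmetric])
    then have "cmod (complex_of_real (fm n x - fm n y)) = cmod (complex_of_real B *
        (\<integral>\<xi>. complex_of_real (gauss \<tau> \<xi>) * iexp (x \<bullet> \<xi>) * Q \<xi> - complex_of_real (gauss \<tau> \<xi>) * iexp (y \<bullet> \<xi>) * Q \<xi> \<partial>lborel))"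
      by (rule arg_cong)
    then have "\<bar>fm n x - fm n y\<bar> = B * cmod (\<integral>\<xi>. complex_of_real (gauss \<tau> \<xi>) * iexp (x \<bullet> \<xi>) * Q \<xi> - complex_of_real (gauss \<tau> \<xi>) * iexp (y \<bullet> \<xi>) * Q \<xi> \<partial>lborel)"
      unfolding norm_mult norm_of_real abs_of_nonneg[OF B(1)] .
    also have "\<dots> \<le> B * (\<integral>\<xi>. B' * norm (x - y) * (norm \<xi> * cmod (Q \<xi>)) \<partial>lborel)"
    proof (intro mult_left_mono order_trans[OF integral_norm_bound integral_mono])
      fix \<xi> :: 'a
      have "complex_of_real (gauss \<tau> \<xi>) * iexp (x \<bullet> \<xi>) * Q \<xi> - complex_of_real (gauss \<tau> \<xi>) * iexp (y \<bullet> \<xi>) * Q \<xi>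
        = complex_of_real (gauss \<tau> \<xi>) * (iexp (x \<bullet> \<xi>) - iexp (y \<bullet> \<xi>)) * Q \<xi>" by (simp add: algebra_simps)
      also have "cmod \<dots> = gauss \<tau> \<xi> * cmod (iexp (x \<bullet> \<xi>) - iexp (y \<bullet> \<xi>)) * cmod (Q \<xi>)"
        using gp[of \<xi>] by (simp add: norm_mult)
      also have "\<dots> \<le> B' * (norm (x - y) * norm \<xi>) * cmod (Q \<xi>)"
      proof (intro mult_right_mono mult_mono gB)
        have "cmod (iexp (x \<bullet> \<xi>) - iexp (y \<bullet> \<xi>)) \<le> \<bar>x \<bullet> \<xi> - y \<bullet> \<xi>\<bar>" by (rule iexp_lipschitz)
        also have "\<dots> = \<bar>(x - y) \<bullet> \<xi>\<bar>" by (simp add: inner_diff_left)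
        also have "\<dots> \<le> norm (x - y) * norm \<xi>" by (rule Cauchy_Schwarz_ineq2)
        finally show "cmod (iexp (x \<bullet> \<xi>) - iexp (y \<bullet> \<xi>)) \<le> norm (x - y) * norm \<xi>" .
      qed (use B in auto)
      finally show "cmod (complex_of_real (gauss \<tau> \<xi>) * iexp (x \<bullet> \<xi>) * Q \<xi> - complex_of_real (gauss \<tau> \<xi>) * iexp (y \<bullet> \<xi>) * Q \<xi>)
        \<le> B' * norm (x - y) * (norm \<xi> * cmod (Q \<xi>))" by (simp add: mult_ac)
    qed (use fi Qi' B in auto)
    also have "\<dots> = B * B' * norm (x - y) * (\<integral>\<xi>. norm \<xi> * cmod (Q \<xi>) \<partial>lborel)" by simp
    also have "\<dots> \<le> B * B' * norm (x - y) * (A * (enn2real J + 1) / k)"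
      by (intro mult_left_mono QI') (use B in auto)
    also have "\<dots> = (1 / (2 * pi)) ^ DIM('a) * (A * (enn2real J + 1) / k) * norm (x - y)"
      unfolding BB by simp
    finally show ?thesis .
  qed
  have "(\<lambda>n. \<bar>fm n x - fm n y\<bar>) \<longlonglongrightarrow> \<bar>f x - f y\<bar>"
    unfolding fm_def by (intro tendsto_intros gauss_approx_identity c f)
  then have "\<bar>f x - f y\<bar> \<le> (1 / (2 * pi)) ^ DIM('a) * (A * (enn2real J + 1) / k) * norm (x - y)"
    by (rule LIMSEQ_le_const2) (use fmL in blast)
  then show ?thesis unfolding J_def k_def by (simp add: mult_ac)
qed

text \<open>The Sobolev embedding of \<open>H\<^sup>s\<close> into Lipschitz functions, for continuous integrable representatives.\<close>

lemma sobolev_lipschitz: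
  assumes s: "s > real DIM('a::euclidean_space) / 2 + 1"
  shows "\<exists>C>0. \<forall>(f :: 'a \<Rightarrow> real) A. continuous_on UNIV f \<longrightarrow> integrable lborel f \<longrightarrow> A > 0 \<longrightarrow>
     Hs_sq s f \<le> ennreal (A\<^sup>2) \<longrightarrow> (\<forall>x y. \<bar>f x - f y\<bar> \<le> C * A * norm (x - y))"
proof -
  define C where "C = (1 / (2 * pi)) ^ DIM('a) / (2 * pi) powr (- real DIM('a) / 2) *
     (enn2real (\<integral>\<^sup>+\<xi>. ennreal ((1 + (norm (\<xi>::'a))\<^sup>2) powr (1 - s)) \<partial>lborel) + 1)"
  have "C > 0" unfolding C_def by (intro mult_pos_pos divide_pos_pos) (auto intro: add_nonneg_pos)
  show ?thesis
  proof (intro exI[of _ "C * 2"] conjI allI impI)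
    fix f :: "'a \<Rightarrow> real" and A x y
    assume f: "continuous_on UNIV f" "integrable lborel f" and A: "A > 0" and H: "Hs_sq s f \<le> ennreal (A\<^sup>2)"
    have "ennreal (A\<^sup>2) < ennreal ((A * 2)\<^sup>2)" using A by (simp add: ennreal_less_iff power2_eq_square)
    with H have "Hs_sq s f < ennreal ((A * 2)\<^sup>2)" by (rule le_less_trans)
    then obtain F where F: "is_L2_fourier f F"
      "(\<integral>\<^sup>+\<xi>. ennreal ((1 + (norm \<xi>)\<^sup>2) powr s * (cmod (F \<xi>))\<^sup>2) \<partial>lborel) < ennreal ((A * 2)\<^sup>2)"
      unfolding Hs_sq_def by (auto simp: INF_less_iff)
    have "\<bar>f x - f y\<bar> \<le> C * (A * 2) * norm (x - y)"
      unfolding C_def by (rule lipschitz_of_L2_fourier[OF s f F(1) _ less_imp_le[OF F(2)]]) (use A in simp)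
    then show "\<bar>f x - f y\<bar> \<le> C * 2 * A * norm (x - y)" by (simp add: mult_ac)
  qed (use \<open>C > 0\<close> in simp)
qed

lemma esqrt_leD:
  assumes "esqrt x \<le> ennreal A" "0 \<le> A" shows "x \<le> ennreal (A\<^sup>2)"
proof (cases x)
  case (real r)
  with assms have "sqrt r \<le> A" by (simp add: esqrt_def)
  then have "r \<le> A\<^sup>2" using real(1) by (simp add: sqrt_le_D)
  then show ?thesis using real by (simp add: ennreal_leI)
next
  case top
  then show ?thesis using assms by (simp add: esqrt_def top_unique)
qed

lemma member_le_sum_ennreal:
  fixes f :: "'i \<Rightarrow> ennreal"
  assumes "finite I" "i \<in> I" shows "f i \<le> sum f I"
  using sum_mono2[of I "{i}" f] assms by simp

lemma Hs_norm_component: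
  assumes "Hs_norm s f \<le> ennreal A" "0 \<le> A" shows "Hs_sq s (f i) \<le> ennreal (A\<^sup>2)"
  using esqrt_leD[OF assms[unfolded Hs_norm_def]] member_le_sum_ennreal[of UNIV i "\<lambda>i. Hs_sq s (f i)"]
  by (auto intro: order_trans)

lemma AE_le_of_time_Linf:
  assumes "time_Linf T g \<le> ennreal A"
  shows "AE t in lborel. t \<in> {0<..<T} \<longrightarrow> g t \<le> ennreal A"
proof -
  have "AE t in restrict_space lborel {0<..<T}. g t \<le> ennreal A"
  proof (rule eventually_mono[OF esssup_AE[of g "restrict_space lborel {0<..<T}"]])
    fix t assume "g t \<le> esssup (restrict_space lborel {0<..<T}) g"
    then show "g t \<le> ennreal A" using assms unfolding time_Linf_def by (rule order_trans)
  qed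
  then show ?thesis by (subst (asm) AE_restrict_space_iff) auto
qed

section \<open>Gradients and interaction potentials\<close>

lemma has_derivative_norm_le_lipschitz:
  fixes f :: "'a::real_normed_vector \<Rightarrow> 'b::real_normed_vector"
  assumes D: "(f has_derivative D) (at x)" and L: "\<And>y. norm (f y - f x) \<le> L * norm (y - x)"
  shows "norm (D v) \<le> L * norm v"
proof (cases "v = 0")
  case True
  then show ?thesis using has_derivative_bounded_linear[OF D] by (simp add: linear_simps)
next
  case False
  show ?thesis
  proof (rule field_le_epsilon)
    fix e :: real assume e: "e > 0"
    define e' where "e' = e / norm v"
    have e': "e' > 0" using e False by (simp add: e'_def)
    obtain d where d: "d > 0" "\<And>y. norm (y - x) < d \<Longrightarrow> norm (f y - f x - D (y - x)) \<le> e' * norm (y - x)"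
      using D e' unfolding has_derivative_at_alt by blast
    define t where "t = d / 2 / norm v"
    have t: "t > 0" using d False by (simp add: t_def)
    have "norm (t *\<^sub>R v) < d" using False d by (simp add: t_def)
    then have 1: "norm (f (x + t *\<^sub>R v) - f x - D (t *\<^sub>R v)) \<le> e' * norm (t *\<^sub>R v)"
      using d(2)[of "x + t *\<^sub>R v"] by simp
    have 2: "norm (f (x + t *\<^sub>R v) - f x) \<le> L * norm (t *\<^sub>R v)" using L[of "x + t *\<^sub>R v"] by simp
    have "norm (D (t *\<^sub>R v)) \<le> norm (f (x + t *\<^sub>R v) - f x) + norm (f (x + t *\<^sub>R v) - f x - D (t *\<^sub>R v))"
      by (metis norm_minus_commute norm_triangle_sub)
    also have "\<dots> \<le> (L + e') * norm (t *\<^sub>R v)" using 1 2 by (simp add: distrib_right)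
    also have "D (t *\<^sub>R v) = t *\<^sub>R D v"
      using has_derivative_bounded_linear[OF D] by (simp add: linear_simps)
    finally have "t * norm (D v) \<le> t * ((L + e') * norm v)" using t by (simp add: mult_ac)
    then have "norm (D v) \<le> (L + e') * norm v" using t by simp
    also have "\<dots> = L * norm v + e" using False by (simp add: e'_def distrib_right)
    finally show "norm (D v) \<le> L * norm v + e" .
  qed
qed

lemma grad_inner:
  assumes "f differentiable (at x)"
  shows "grad f x \<bullet> v = frechet_derivative f (at x) v"
proof -
  have l: "linear (frechet_derivative f (at x))" by (rule linear_frechet_derivative[OF assms])
  have "frechet_derivative f (at x) v = frechet_derivative f (at x) (\<Sum>b\<in>Basis. (v \<bullet> b) *\<^sub>R b)"
    by (simp add: euclidean_representation)
  also have "\<dots> = (\<Sum>b\<in>Basis. (v \<bullet> b) * frechet_derivative f (at x) b)"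
    by (simp add: linear_sum[OF l] linear_scale[OF l])
  also have "\<dots> = grad f x \<bullet> v"
    by (simp add: grad_def inner_sum_left mult.commute inner_commute[of v])
  finally show ?thesis by simp
qed

lemma norm_grad_le_lipschitz:
  assumes "f differentiable (at x)" "\<And>y. \<bar>f y - f x\<bar> \<le> L * norm (y - x)" "0 \<le> L"
  shows "norm (grad f x) \<le> L"
proof -
  have "(norm (grad f x))\<^sup>2 = frechet_derivative f (at x) (grad f x)"
    using grad_inner[OF assms(1), of "grad f x"] by (simp add: power2_norm_eq_inner)
  also have "\<dots> \<le> L * norm (grad f x)"
    using has_derivative_norm_le_lipschitz[of f "frechet_derivative f (at x)" x L "grad f x"] assms
    by (simp add: frechet_derivative_works[symmetric])
  finally have "norm (grad f x) * norm (grad f x) \<le> L * norm (grad f x)" by (simp add: power2_eq_square)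
  then show ?thesis using assms(3) by (cases "norm (grad f x) = 0") auto
qed

lemma lipschitz_of_grad_bound:
  fixes f :: "'a::euclidean_space \<Rightarrow> real"
  assumes "\<And>x. f differentiable (at x)" "\<And>x. norm (grad f x) \<le> B"
  shows "\<bar>f x - f y\<bar> \<le> B * norm (x - y)"
proof -
  have "norm (f x - f y) \<le> B * norm (x - y)"
  proof (rule differentiable_bound[of UNIV f "\<lambda>x. frechet_derivative f (at x)"])
    show "(f has_derivative frechet_derivative f (at x)) (at x within UNIV)" for x
      using assms(1) by (simp add: frechet_derivative_works[symmetric])
    show "onorm (frechet_derivative f (at x)) \<le> B" for x
    proof (rule onorm_le)
      fix v
      have "norm (frechet_derivative f (at x) v) \<le> norm (grad f x) * norm v"
        unfolding grad_inner[OF assms(1), symmetric] by (simp add: Cauchy_Schwarz_ineq2)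
      also have "\<dots> \<le> B * norm v" by (intro mult_right_mono assms) auto
      finally show "norm (frechet_derivative f (at x) v) \<le> B * norm v" .
    qed
  qed auto
  then show ?thesis by simp
qed

lemma grad_zero_outside_supp:
  assumes "x \<notin> supp f" shows "frechet_derivative f (at x) = (\<lambda>_. 0)"
proof -
  have "open (- supp f)" by (simp add: supp_def open_Compl)
  moreover have "f y = 0" if "y \<in> - supp f" for y
    using that closure_subset[of "{x. f x \<noteq> 0}"] by (auto simp: supp_def)
  ultimately have "(f has_derivative (\<lambda>_. 0)) (at x)"
    using assms by (intro has_derivative_transform_within_open[OF has_derivative_const[of 0], of "- supp f" x]) auto
  then show ?thesis by (rule frechet_derivative_at[symmetric])
qed

lemma C_1_compact_lipschitz:
  fixes f :: "'a::euclidean_space \<Rightarrow> real"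
  assumes f: "C_k 1 f" and K: "compact (supp f)"
  shows "\<exists>L\<ge>0. \<forall>x y. \<bar>f x - f y\<bar> \<le> L * norm (x - y)"
proof -
  have d: "f differentiable (at x)" for x using f by simp
  have c: "continuous_on UNIV (grad f)"
    unfolding grad_def[abs_def] using f by (auto intro!: continuous_intros)
  have "compact (grad f ` supp f)" by (rule compact_continuous_image[OF continuous_on_subset[OF c] K]) simp
  then obtain B where B: "\<And>x. x \<in> supp f \<Longrightarrow> norm (grad f x) \<le> B"
    using compact_imp_bounded bounded_iff by (metis imageI)
  have "norm (grad f x) \<le> max B 0" for x
    using B[of x] by (cases "x \<in> supp f") (auto simp: grad_def grad_zero_outside_supp)
  from lipschitz_of_grad_bound[OF d this] show ?thesis by (intro exI[of _ "max B 0"]) auto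
qed

locale potential =
  fixes V :: "'a::euclidean_space \<Rightarrow> real" and K :: real
  assumes smooth_V: "smooth V" and supp_V: "supp V \<subseteq> ball 0 1" and K_V: "grad_W1inf_norm V = K"
begin

lemma C2: "C_k 2 V" using smooth_V by (simp add: smooth_def)

lemma diff_V: "V differentiable (at x)" using smooth_V unfolding smooth_def by (metis C_k.simps(2))

lemma compact_supp: "compact (supp V)"
  using supp_V by (auto simp: supp_def compact_eq_bounded_closed intro: bounded_subset[OF bounded_ball])

lemma grad_V_lipschitz: "\<exists>L\<ge>0. \<forall>x y. norm (grad V x - grad V y) \<le> L * norm (x - y)"
proof -
  define D where "D b x = frechet_derivative V (at x) b" for b x
  have C1: "C_k 1 (D b)" if "b \<in> Basis" for b
    using C2 that unfolding D_def by (simp add: numeral_2_eq_2)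
  have "x \<in> supp V" if "D b x \<noteq> 0" for b x
  proof (rule ccontr)
    assume "x \<notin> supp V"
    from grad_zero_outside_supp[OF this] that show False by (simp add: D_def)
  qed
  then have "{x. D b x \<noteq> 0} \<subseteq> supp V" for b by auto
  then have "supp (D b) \<subseteq> supp V" for b
    unfolding supp_def[of "D b"] by (intro closure_minimal) (auto simp: supp_def)
  then have e: "supp V \<inter> supp (D b) = supp (D b)" for b by blast
  have "closed (supp (D b))" for b by (simp add: supp_def)
  from compact_Int_closed[OF compact_supp this] have "compact (supp (D b))" for b
    unfolding e .
  then have "\<forall>b\<in>Basis. \<exists>L\<ge>0. \<forall>x y. \<bar>D b x - D b y\<bar> \<le> L * norm (x - y)"
    using C_1_compact_lipschitz C1 by blast
  then obtain L where L: "\<And>b. b \<in> Basis \<Longrightarrow> L b \<ge> 0" "\<And>b x y. b \<in> Basis \<Longrightarrow> \<bar>D b x - D b y\<bar> \<le> L b * norm (x - y)"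
    by metis
  show ?thesis
  proof (intro exI[of _ "\<Sum>b\<in>Basis. L b"] conjI allI)
    show "0 \<le> (\<Sum>b\<in>Basis. L b)" by (rule sum_nonneg) (rule L)
    fix x y
    have "norm (grad V x - grad V y) = norm (\<Sum>b\<in>Basis. (D b x - D b y) *\<^sub>R b)"
      by (simp add: grad_def D_def sum_subtractf scaleR_diff_left)
    also have "\<dots> \<le> (\<Sum>b\<in>Basis. L b * norm (x - y))"
      by (rule sum_norm_le) (use L in simp)
    finally show "norm (grad V x - grad V y) \<le> (\<Sum>b\<in>Basis. L b) * norm (x - y)" by (simp add: sum_distrib_right)
  qed
qed

lemma grad_V_zero: "x \<notin> ball 0 1 \<Longrightarrow> grad V x = 0"
  using supp_V by (auto simp: grad_def grad_zero_outside_supp subset_eq)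

lemma V_zero: "x \<notin> ball 0 1 \<Longrightarrow> V x = 0"
  using supp_V closure_subset[of "{x. V x \<noteq> 0}"] by (auto simp: supp_def subset_eq)

lemma grad_V_bound: "norm (grad V x) \<le> K" and K_nonneg: "0 \<le> K"
proof -
  obtain L where L: "L \<ge> 0" "\<And>x y. norm (grad V x - grad V y) \<le> L * norm (x - y)" using grad_V_lipschitz by blast
  have dg: "grad V differentiable (at x)" for x
    unfolding grad_def[abs_def] using C2 by (auto simp: numeral_2_eq_2 intro!: differentiable_sum differentiable_scaleR)
  have "norm (frechet_derivative (grad V) (at x) v) \<le> L * norm v" for x v
    by (rule has_derivative_norm_le_lipschitz[of "grad V" _ x]) (use dg L in \<open>auto simp: frechet_derivative_works[symmetric]\<close>)
  then have ob: "onorm (frechet_derivative (grad V) (at x)) \<le> L" for x by (rule onorm_le)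
  have op: "0 \<le> onorm (frechet_derivative (grad V) (at x))" for x
    by (rule onorm_pos_le) (use dg in \<open>auto simp: frechet_derivative_works intro: has_derivative_bounded_linear\<close>)
  have S2: "0 \<le> (SUP x. onorm (frechet_derivative (grad V) (at x)))"
    by (rule cSUP_upper2[of _ _ 0]) (use ob op in \<open>auto simp: bdd_above_def\<close>)
  obtain e :: 'a where e: "norm e = 1" using vector_choose_size[of 1] by auto
  have g0: "grad V e = 0" using e by (intro grad_V_zero) auto
  have gL: "norm (grad V x) \<le> 2 * L" for x
  proof (cases "x \<in> ball 0 1")
    case True
    have "norm (grad V x) \<le> L * norm (x - e)" using L(2)[of x e] g0 by simp
    also have "\<dots> \<le> L * 2" using norm_triangle_ineq4[of x e] e True by (intro mult_left_mono L) simp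
    finally show ?thesis by simp
  next
    case False then show ?thesis using L by (simp add: grad_V_zero)
  qed
  have "norm (grad V x) \<le> (SUP x. norm (grad V x))" for x
    by (rule cSUP_upper) (use gL in \<open>auto simp: bdd_above_def\<close>)
  then show *: "norm (grad V x) \<le> K" for x using S2 K_V unfolding grad_W1inf_norm_def by (smt (verit))
  show "0 \<le> K" using *[of 0] norm_ge_zero order_trans by blast
qed

lemma V_lipschitz: "\<bar>V x - V y\<bar> \<le> K * norm (x - y)"
  by (rule lipschitz_of_grad_bound[OF diff_V grad_V_bound])

text \<open>The potential vanishes on the unit sphere and outside, and it is \<open>K\<close>-Lipschitz.\<close>

lemma V_bound: "\<bar>V x\<bar> \<le> 2 * K * indicator (ball 0 1) x"
proof (cases "x \<in> ball 0 1")
  case True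
  obtain e :: 'a where e: "norm e = 1" using vector_choose_size[of 1] by auto
  have "V e = 0" using e by (intro V_zero) auto
  then have "\<bar>V x\<bar> \<le> K * norm (x - e)" using V_lipschitz[of x e] by simp
  also have "\<dots> \<le> K * 2" using norm_triangle_ineq4[of x e] e True by (intro mult_left_mono K_nonneg) simp
  finally show ?thesis using True by simp
qed (simp add: V_zero)

lemma continuous_V: "continuous_on UNIV V"
  using diff_V by (auto intro!: continuous_at_imp_continuous_on differentiable_imp_continuous_within)

lemma continuous_grad_V: "continuous_on UNIV (grad V)"
proof -
  obtain L where L: "L \<ge> 0" "\<And>x y. norm (grad V x - grad V y) \<le> L * norm (x - y)" using grad_V_lipschitz by blast
  then have "L-lipschitz_on UNIV (grad V)" by (intro lipschitz_onI) (auto simp: dist_norm)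
  then show ?thesis by (rule lipschitz_on_continuous_on)
qed

lemma measurable_V [measurable]: "V \<in> borel_measurable borel" and measurable_grad_V [measurable]: "grad V \<in> borel_measurable borel"
  using continuous_V continuous_grad_V by (auto intro: borel_measurable_continuous_onI)

lemma integrable_indicator_ball: "integrable lborel (indicat_real (ball (c::'a) r))"
  using emeasure_bounded_finite[OF bounded_ball[of c r]] by (intro integrable_real_indicator) simp_all

lemma integral_V_le: "(\<integral>x. V x \<partial>lborel) \<le> 2 * K * measure lborel (ball (0::'a) 1)"
proof -
  have i: "integrable lborel V"
    by (rule Bochner_Integration.integrable_bound[OF integrable_mult_right[OF integrable_indicator_ball, of "2 * K" 0 1]])
      (use V_bound K_nonneg in auto)
  have "(\<integral>x. V x \<partial>lborel) \<le> (\<integral>x. 2 * K * indicator (ball (0::'a) 1) x \<partial>lborel)"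
  proof (rule integral_mono[OF i])
    show "integrable lborel (\<lambda>x. 2 * K * indicator (ball (0::'a) 1) x)"
      by (rule integrable_mult_right[OF integrable_indicator_ball])
    show "V x \<le> 2 * K * indicator (ball 0 1) x" for x using V_bound[of x] by linarith
  qed
  then show ?thesis by simp
qed

text \<open>The integral of a difference quotient vanishes by translation invariance; dominated convergence passes to the
derivative.\<close>

lemma integral_grad_V: "integrable lborel (grad V)" "(\<integral>x. grad V x \<partial>lborel) = 0"
proof -
  have gi: "norm (grad V x) \<le> K * indicator (ball 0 1) x" for x
    using grad_V_bound[of x] by (cases "x \<in> ball 0 1") (auto simp: grad_V_zero)
  show ig: "integrable lborel (grad V)"
    by (rule Bochner_Integration.integrable_bound[OF integrable_mult_right[OF integrable_indicator_ball, of K 0 1]])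
      (use gi K_nonneg in auto)
  have iV: "integrable lborel V"
    by (rule Bochner_Integration.integrable_bound[OF integrable_mult_right[OF integrable_indicator_ball, of "2 * K" 0 1]])
      (use V_bound K_nonneg in auto)
  have comp: "(\<integral>x. grad V x \<bullet> b \<partial>lborel) = 0" if b: "b \<in> Basis" for b
  proof -
    define q where "q n x = (V (x + (1 / real (Suc n)) *\<^sub>R b) - V x) * real (Suc n)" for n x
    have q0: "(\<integral>x. q n x \<partial>lborel) = 0" and qi: "integrable lborel (q n)" for n
      using has_bochner_integral_lborel_shift[OF has_bochner_integral_integrable[OF iV], of "(1 / real (Suc n)) *\<^sub>R b"] iV
      by (auto simp: has_bochner_integral_iff q_def[abs_def])
    have ql: "(\<lambda>n. q n x) \<longlonglongrightarrow> grad V x \<bullet> b" for x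
    proof -
      have "((\<lambda>h. V (x + h *\<^sub>R b)) has_derivative (\<lambda>h. frechet_derivative V (at x) (h *\<^sub>R b))) (at 0)"
      proof -
        have "(V has_derivative frechet_derivative V (at x)) (at (x + 0 *\<^sub>R b))"
          using diff_V by (simp add: frechet_derivative_works[symmetric])
        moreover have "((\<lambda>h. x + h *\<^sub>R b) has_derivative (\<lambda>h. h *\<^sub>R b)) (at 0)" by (auto intro!: derivative_eq_intros)
        ultimately show ?thesis using has_derivative_compose by blast
      qed
      moreover have "frechet_derivative V (at x) (h *\<^sub>R b) = (grad V x \<bullet> b) * h" for h
        unfolding grad_inner[OF diff_V, symmetric] by simp
      ultimately have "((\<lambda>h. V (x + h *\<^sub>R b)) has_field_derivative grad V x \<bullet> b) (at 0)"
        unfolding has_field_derivative_def by (simp only:)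
      then have "((\<lambda>h. (V (x + h *\<^sub>R b) - V x) / h) \<longlongrightarrow> grad V x \<bullet> b) (at 0)"
        by (simp add: DERIV_def)
      moreover have "filterlim (\<lambda>n. 1 / real (Suc n)) (at 0) sequentially"
        unfolding filterlim_at using LIMSEQ_inverse_real_of_nat by (auto simp: inverse_eq_divide)
      ultimately have "(\<lambda>n. (V (x + (1 / real (Suc n)) *\<^sub>R b) - V x) / (1 / real (Suc n))) \<longlonglongrightarrow> grad V x \<bullet> b"
        by (rule filterlim_compose)
      then show ?thesis by (simp add: q_def[abs_def])
    qed
    have "(\<lambda>n. \<integral>x. q n x \<partial>lborel) \<longlonglongrightarrow> (\<integral>x. grad V x \<bullet> b \<partial>lborel)"
    proof (rule integral_dominated_convergence[where w="\<lambda>x. K * indicator (ball 0 2) x"])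
      show "integrable lborel (\<lambda>x. K * indicator (ball (0::'a) 2) x)" by (intro integrable_mult_right integrable_indicator_ball)
      show "AE x in lborel. norm (q n x) \<le> K * indicator (ball 0 2) x" for n
      proof (rule AE_I2)
        fix x :: 'a
        define h where "h = (1 / real (Suc n)) *\<^sub>R b"
        have h: "norm h = 1 / real (Suc n)" using b by (simp add: h_def)
        then have h1: "norm h \<le> 1" by simp
        show "norm (q n x) \<le> K * indicator (ball 0 2) x"
        proof (cases "x \<in> ball 0 2")
          case True
          have "\<bar>V (x + h) - V x\<bar> \<le> K * norm h" using V_lipschitz[of "x + h" x] by simp
          then have "\<bar>V (x + h) - V x\<bar> * real (Suc n) \<le> K * norm h * real (Suc n)" by (rule mult_right_mono) simp
          also have "\<dots> = K" unfolding h by simp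
          finally show ?thesis using True by (simp add: q_def h_def abs_mult)
        next
          case False
          then have "norm x \<ge> 2" by simp
          then have "norm (x + h) \<ge> 1" using h1 norm_diff_ineq[of x h] by simp
          then have "V (x + h) = 0" "V x = 0" using \<open>norm x \<ge> 2\<close> by (auto intro!: V_zero)
          moreover have "q n x = (V (x + h) - V x) * real (Suc n)" by (simp only: q_def h_def)
          ultimately show ?thesis using K_nonneg by simp
        qed
      qed
    qed (use ql qi in \<open>auto intro: borel_measurable_integrable\<close>)
    then show ?thesis using q0 by (simp add: LIMSEQ_const_iff)
  qed
  show "(\<integral>x. grad V x \<partial>lborel) = 0"
    by (rule euclidean_eqI) (use comp ig in \<open>simp flip: integral_inner_left\<close>)
qed

lemma grad_scaled:
  assumes "\<eta> > 0"
  shows "grad (scaled \<eta> V) x = (\<eta> powr (- real DIM('a)) / \<eta>) *\<^sub>R grad V (x /\<^sub>R \<eta>)"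
proof -
  define D where "D = frechet_derivative V (at (x /\<^sub>R \<eta>))"
  have D: "(V has_derivative D) (at (x /\<^sub>R \<eta>))" using diff_V by (simp add: D_def frechet_derivative_works[symmetric])
  have l: "linear D" using D has_derivative_linear by blast
  have "((\<lambda>x. x /\<^sub>R \<eta>) has_derivative (\<lambda>v. v /\<^sub>R \<eta>)) (at x)" by (auto intro!: derivative_eq_intros)
  from has_derivative_compose[OF this D]
  have "((\<lambda>x. \<eta> powr (- real DIM('a)) * V (x /\<^sub>R \<eta>)) has_derivative (\<lambda>v. \<eta> powr (- real DIM('a)) * D (v /\<^sub>R \<eta>))) (at x)"
    by (rule has_derivative_mult_right)
  then have "frechet_derivative (scaled \<eta> V) (at x) = (\<lambda>v. \<eta> powr (- real DIM('a)) * D (v /\<^sub>R \<eta>))"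
    unfolding scaled_def[abs_def] by (rule frechet_derivative_at[symmetric])
  then show ?thesis
    by (simp add: grad_def D_def[symmetric] linear_scale[OF l] scaleR_sum_right divide_inverse mult_ac)
qed

lemma grad_scaled_bound:
  assumes "\<eta> > 0"
  shows "norm (grad (scaled \<eta> V) x) \<le> \<eta> powr (- real DIM('a)) / \<eta> * K"
  using assms by (simp add: grad_scaled divide_right_mono mult_left_mono grad_V_bound)

lemma grad_scaled_lipschitz:
  assumes "\<eta> > 0"
  shows "\<exists>L\<ge>0. \<forall>x y. norm (grad (scaled \<eta> V) x - grad (scaled \<eta> V) y) \<le> L * norm (x - y)"
proof -
  obtain L where L: "L \<ge> 0" "\<And>x y. norm (grad V x - grad V y) \<le> L * norm (x - y)" using grad_V_lipschitz by blast
  define k where "k = \<eta> powr (- real DIM('a)) / \<eta>"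
  have k: "k \<ge> 0" using assms by (simp add: k_def)
  show ?thesis
  proof (intro exI[of _ "k * L / \<eta>"] conjI allI)
    show "0 \<le> k * L / \<eta>" using k L assms by simp
    fix x y
    have "norm (grad (scaled \<eta> V) x - grad (scaled \<eta> V) y) = k * norm (grad V (x /\<^sub>R \<eta>) - grad V (y /\<^sub>R \<eta>))"
      using k by (simp add: grad_scaled[OF assms] k_def[symmetric] flip: scaleR_diff_right)
    also have "\<dots> \<le> k * (L * norm (x /\<^sub>R \<eta> - y /\<^sub>R \<eta>))" by (intro mult_left_mono L k)
    also have "\<dots> = k * L / \<eta> * norm (x - y)"
      using assms by (simp add: divide_inverse flip: scaleR_diff_right)
    finally show "norm (grad (scaled \<eta> V) x - grad (scaled \<eta> V) y) \<le> k * L / \<eta> * norm (x - y)" .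
  qed
qed

lemma measurable_grad_scaled:
  assumes "\<eta> > 0" shows "grad (scaled \<eta> V) \<in> borel_measurable borel"
  unfolding grad_scaled[OF assms, abs_def] by measurable

lemma grad_scaled_zero: "\<eta> > 0 \<Longrightarrow> x \<notin> ball 0 \<eta> \<Longrightarrow> grad (scaled \<eta> V) x = 0"
  by (simp add: grad_scaled grad_V_zero field_simps)

lemma integral_grad_scaled:
  assumes \<eta>: "\<eta> > 0"
  shows "integrable lborel (grad (scaled \<eta> V))" "(\<integral>x. grad (scaled \<eta> V) x \<partial>lborel) = 0"
proof -
  have L: "lborel = density (distr lborel borel ((*\<^sub>R) (1 / \<eta>))) (\<lambda>_::'a. \<bar>1 / \<eta>\<bar> ^ DIM('a))"
    using lborel_affine[of "1 / \<eta>" "0::'a"] \<eta> by simp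
  have Lm: "(*\<^sub>R) (1 / \<eta>) \<in> lborel \<rightarrow>\<^sub>M (borel :: 'a measure)" by measurable
  have "integrable lborel (\<lambda>x. grad V ((1 / \<eta>) *\<^sub>R x)) \<and> (\<integral>x. grad V ((1 / \<eta>) *\<^sub>R x) \<partial>lborel) = 0"
  proof -
    have "integrable (density (distr lborel borel ((*\<^sub>R) (1 / \<eta>))) (\<lambda>_::'a. \<bar>1 / \<eta>\<bar> ^ DIM('a))) (grad V)"
      using integral_grad_V(1) L by simp
    then have 1: "integrable lborel (\<lambda>x. (1 / \<eta>) ^ DIM('a) *\<^sub>R grad V ((1 / \<eta>) *\<^sub>R x))"
      using \<eta> by (subst (asm) integrable_density) (auto simp: integrable_distr_eq[OF Lm] ennreal_power[symmetric])
    have "(\<integral>x. grad V x \<partial>(density (distr lborel borel ((*\<^sub>R) (1 / \<eta>))) (\<lambda>_::'a. \<bar>1 / \<eta>\<bar> ^ DIM('a)))) = 0"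
      using integral_grad_V(2) L by simp
    then have 2: "(\<integral>x. (1 / \<eta>) ^ DIM('a) *\<^sub>R grad V ((1 / \<eta>) *\<^sub>R x) \<partial>lborel) = 0"
      using \<eta> by (subst (asm) integral_density) (auto simp: integral_distr[OF Lm] ennreal_power[symmetric])
    have "integrable lborel (\<lambda>x. \<eta> ^ DIM('a) *\<^sub>R ((1 / \<eta>) ^ DIM('a) *\<^sub>R grad V ((1 / \<eta>) *\<^sub>R x)))"
      by (rule integrable_scaleR_right[OF 1])
    then show ?thesis using 2 \<eta> by (simp add: power_divide)
  qed
  then show "integrable lborel (grad (scaled \<eta> V))" "(\<integral>x. grad (scaled \<eta> V) x \<partial>lborel) = 0"
    unfolding grad_scaled[OF \<eta>, abs_def] by (auto simp: divide_inverse)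
qed

text \<open>Since the gradient of the scaled potential has integral zero, the value of \<open>w\<close> at \<open>x\<close> may be subtracted.  On the
support \<open>w\<close> varies by at most \<open>\<Lambda> * \<eta>\<close>, which compensates the factor \<open>1 / \<eta>\<close> of the gradient: the
bound does not depend on \<open>\<eta>\<close>.\<close>

lemma conv_lipschitz_bound:
  assumes \<eta>: "\<eta> > 0" and w: "integrable lborel w" and \<Lambda>: "\<Lambda> \<ge> 0" "\<And>x y. \<bar>w x - w y\<bar> \<le> \<Lambda> * norm (x - y)"
  shows "norm (conv (grad (scaled \<eta> V)) w x) \<le> \<Lambda> * K * measure lborel (ball (0::'a) 1)"
proof -
  define g where "g = grad (scaled \<eta> V)"
  define k where "k = \<eta> powr (- real DIM('a)) / \<eta> * K"
  have k: "k \<ge> 0" using \<eta> K_nonneg by (simp add: k_def)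
  have gb: "norm (g z) \<le> k * indicator (ball 0 \<eta>) z" for z
    using grad_scaled_bound[OF \<eta>, of z] grad_scaled_zero[OF \<eta>, of z] by (cases "z \<in> ball 0 \<eta>") (auto simp: g_def k_def)
  have [measurable]: "g \<in> borel_measurable borel" unfolding g_def by (rule measurable_grad_scaled[OF \<eta>])
  have [measurable]: "w \<in> borel_measurable borel" using w by (auto dest: borel_measurable_integrable)
  have gi: "has_bochner_integral lborel g 0"
    using integral_grad_scaled[OF \<eta>] by (simp add: g_def has_bochner_integral_iff)
  have rfl: "has_bochner_integral lborel (\<lambda>y. h (x - y)) I" if h: "has_bochner_integral lborel h I"
    for h :: "'a \<Rightarrow> 'b::{banach,second_countable_topology}" and I
  proof -
    have L: "lborel = density (distr lborel borel (\<lambda>y. x + (- 1) *\<^sub>R y)) (\<lambda>_::'a. \<bar>- 1 :: real\<bar> ^ DIM('a))"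
      by (rule lborel_affine) simp
    have L': "lborel = distr lborel borel (\<lambda>y. x - y)" using L by (simp add: density_1)
    have m: "(\<lambda>y. x - y) \<in> lborel \<rightarrow>\<^sub>M borel" by measurable
    have hm: "h \<in> borel_measurable borel" using h by (auto simp: has_bochner_integral_iff dest: borel_measurable_integrable)
    have "has_bochner_integral (distr lborel borel (\<lambda>y. x - y)) h I" using h L' by simp
    then show ?thesis by (simp add: has_bochner_integral_iff integrable_distr_eq[OF m hm] integral_distr[OF m hm])
  qed
  have i1: "integrable lborel (\<lambda>y. w y *\<^sub>R g (x - y))"
  proof (rule Bochner_Integration.integrable_bound[OF integrable_mult_left[OF w, of k]])
    have "norm (g z) \<le> k" for z using grad_scaled_bound[OF \<eta>] by (simp add: g_def k_def)
    then show "AE y in lborel. norm (w y *\<^sub>R g (x - y)) \<le> norm (w y * k)"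
      using k by (intro AE_I2) (auto simp: abs_mult intro!: mult_left_mono)
  qed measurable
  have i2: "has_bochner_integral lborel (\<lambda>y. w x *\<^sub>R g (x - y)) 0"
    using has_bochner_integral_scaleR_right[OF rfl[OF gi], of "w x"] by simp
  have ib: "has_bochner_integral lborel (\<lambda>y. \<Lambda> * \<eta> * k * indicator (ball 0 \<eta>) (x - y)) (\<Lambda> * \<eta> * k * measure lborel (ball (0::'a) \<eta>))"
    by (rule rfl) (use integrable_indicator_ball in \<open>auto simp: has_bochner_integral_iff intro!: integrable_mult_right\<close>)
  have "conv g w x = (\<integral>y. (w y - w x) *\<^sub>R g (x - y) \<partial>lborel)"
    unfolding conv_def using i1 i2 by (simp add: scaleR_diff_left has_bochner_integral_iff)
  also have "norm \<dots> \<le> (\<integral>y. \<Lambda> * \<eta> * k * indicator (ball 0 \<eta>) (x - y) \<partial>lborel)"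
  proof (rule Bochner_Integration.integral_norm_bound_integral)
    show "integrable lborel (\<lambda>y. (w y - w x) *\<^sub>R g (x - y))"
      using i1 i2 by (simp add: scaleR_diff_left has_bochner_integral_iff)
    show "integrable lborel (\<lambda>y. \<Lambda> * \<eta> * k * indicator (ball 0 \<eta>) (x - y))" using ib by (simp add: has_bochner_integral_iff)
    fix y
    show "norm ((w y - w x) *\<^sub>R g (x - y)) \<le> \<Lambda> * \<eta> * k * indicator (ball 0 \<eta>) (x - y)"
    proof (cases "x - y \<in> ball 0 \<eta>")
      case True
      have "\<bar>w y - w x\<bar> \<le> \<Lambda> * \<eta>"
        using \<Lambda>(2)[of y x] True \<Lambda>(1) by (smt (verit) mem_ball_0 mult_left_mono norm_minus_commute)
      then show ?thesis using gb[of "x - y"] True \<Lambda>(1) \<eta> by (auto intro!: mult_mono)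
    next
      case False
      then have "g (x - y) = 0" using grad_scaled_zero[OF \<eta>] by (simp add: g_def)
      then show ?thesis using False by simp
    qed
  qed
  also have "\<dots> = \<Lambda> * \<eta> * k * measure lborel (ball (0::'a) \<eta>)" using ib by (simp add: has_bochner_integral_iff)
  also have "measure lborel (ball (0::'a) \<eta>) = unit_ball_vol (real DIM('a)) * \<eta> ^ DIM('a)"
    using \<eta> content_ball[of \<eta> "0::'a"] by simp
  also have "\<Lambda> * \<eta> * k * (unit_ball_vol (real DIM('a)) * \<eta> ^ DIM('a)) = \<Lambda> * K * unit_ball_vol (real DIM('a))"
    using \<eta> by (simp add: k_def powr_minus powr_realpow field_simps)
  also have "unit_ball_vol (real DIM('a)) = measure lborel (ball (0::'a) 1)"
    using content_ball[of 1 "0::'a"] by simp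
  finally show ?thesis by (simp add: g_def)
qed

lemma conv_lipschitz:
  assumes \<eta>: "\<eta> > 0" and L: "\<And>x y. norm (grad (scaled \<eta> V) x - grad (scaled \<eta> V) y) \<le> L * norm (x - y)"
    and w: "has_bochner_integral lborel w 1" "\<And>x. w x \<ge> 0"
  shows "norm (conv (grad (scaled \<eta> V)) w x - conv (grad (scaled \<eta> V)) w y) \<le> L * norm (x - y)"
proof -
  define g where "g = grad (scaled \<eta> V)"
  define k where "k = \<eta> powr (- real DIM('a)) / \<eta> * K"
  have [measurable]: "g \<in> borel_measurable borel" unfolding g_def by (rule measurable_grad_scaled[OF \<eta>])
  have wi: "integrable lborel w" "integral\<^sup>L lborel w = 1" using w by (auto simp: has_bochner_integral_iff)
  have [measurable]: "w \<in> borel_measurable borel" using wi by (auto dest: borel_measurable_integrable)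
  have i: "integrable lborel (\<lambda>y. w y *\<^sub>R g (x - y))" for x
  proof (rule Bochner_Integration.integrable_bound[OF integrable_mult_left[OF wi(1), of k]])
    have "norm (g z) \<le> k" for z using grad_scaled_bound[OF \<eta>] by (simp add: g_def k_def)
    moreover from this[of 0] have "k \<ge> 0" using norm_ge_zero order_trans by blast
    ultimately show "AE y in lborel. norm (w y *\<^sub>R g (x - y)) \<le> norm (w y * k)"
      by (intro AE_I2) (auto simp: abs_mult intro!: mult_left_mono)
  qed measurable
  have "norm (conv g w x - conv g w y) = norm (\<integral>z. w z *\<^sub>R (g (x - z) - g (y - z)) \<partial>lborel)"
    unfolding conv_def using i by (simp add: scaleR_diff_right)
  also have "\<dots> \<le> (\<integral>z. w z * (L * norm (x - y)) \<partial>lborel)"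
  proof (rule Bochner_Integration.integral_norm_bound_integral)
    show "integrable lborel (\<lambda>z. w z *\<^sub>R (g (x - z) - g (y - z)))" using i by (simp add: scaleR_diff_right)
    fix z
    show "norm (w z *\<^sub>R (g (x - z) - g (y - z))) \<le> w z * (L * norm (x - y))"
      using w(2)[of z] L[of "x - z" "y - z"] by (simp add: g_def mult_left_mono)
  qed (use wi in simp)
  also have "\<dots> = L * norm (x - y)" using wi by simp
  finally show ?thesis by (simp add: g_def)
qed

end

section \<open>Increments of solutions, product densities and tails\<close>

lemma set_integral_norm_le_AE:
  fixes f :: "real \<Rightarrow> 'a::euclidean_space"
  assumes f: "set_integrable lborel {u<..v} f" and uv: "u \<le> v" and C: "AE s in lborel. s \<in> {u<..v} \<longrightarrow> norm (f s) \<le> C"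
  shows "norm (set_lebesgue_integral lborel {u<..v} f) \<le> C * (v - u)"
proof -
  have i: "integrable lborel (\<lambda>s. indicat_real {u<..v} s *\<^sub>R C)"
    using uv by (intro integrable_scaleR_left integrable_real_indicator) auto
  have "norm (set_lebesgue_integral lborel {u<..v} f) \<le> (\<integral>s. norm (indicator {u<..v} s *\<^sub>R f s) \<partial>lborel)"
    unfolding set_lebesgue_integral_def by (rule integral_norm_bound)
  also have "\<dots> \<le> (\<integral>s. indicat_real {u<..v} s *\<^sub>R C \<partial>lborel)"
  proof (rule integral_mono_AE)
    show "integrable lborel (\<lambda>s. norm (indicat_real {u<..v} s *\<^sub>R f s))"
      using f unfolding set_integrable_def by (rule integrable_norm)
    show "AE s in lborel. norm (indicat_real {u<..v} s *\<^sub>R f s) \<le> indicat_real {u<..v} s *\<^sub>R C"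
      using C by eventually_elim (auto simp: indicator_def)
  qed (rule i)
  also have "\<dots> = C * (v - u)" using uv by simp
  finally show ?thesis .
qed

lemma sde_solution_measurable:
  assumes "sde_solution M F T sig W z b X" "filtered_prob_space M F" "t \<in> {0..T}"
  shows "X t \<in> borel_measurable (F t)" "X t \<in> borel_measurable M"
proof -
  show 1: "X t \<in> borel_measurable (F t)" using assms by (auto simp: sde_solution_def)
  have "sets (F t) \<subseteq> sets M" "space (F t) = space M"
    using assms(2) unfolding filtered_prob_space_def by (auto simp: filtration.space_F)
  then show "X t \<in> borel_measurable M" using 1 by (auto simp: measurable_def)
qed

text \<open>A bound on the drift at almost every time, uniform in the sample point, is what the Sobolev bounds provide.\<close>

lemma sde_solution_increment:
  assumes sde: "sde_solution M F T sig W z b X" and st: "0 \<le> s" "s \<le> t" "t \<le> T"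
    and B: "AE \<tau> in lborel. \<tau> \<in> {0..T} \<longrightarrow> (\<forall>\<omega>. norm (b \<tau> \<omega>) \<le> B)"
  shows "AE \<omega> in M. norm (X t \<omega> - X s \<omega> - sqrt (2 * sig) *\<^sub>R (W t \<omega> - W s \<omega>)) \<le> B * (t - s)"
proof -
  have "AE \<omega> in M. set_integrable lborel {0..T} (\<lambda>t. b t \<omega>) \<and>
        (\<forall>t\<in>{0..T}. X t \<omega> = z \<omega> + set_lebesgue_integral lborel {0..t} (\<lambda>\<tau>. b \<tau> \<omega>) + sqrt (2 * sig) *\<^sub>R W t \<omega>)"
    using sde unfolding sde_solution_def by (auto elim!: eventually_mono)
  then show ?thesis
  proof eventually_elim
    case (elim \<omega>)
    have i: "set_integrable lborel A (\<lambda>t. b t \<omega>)" if "A \<subseteq> {0..T}" "A \<in> sets borel" for A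
      by (rule set_integrable_subset[OF conjunct1[OF elim]]) (use that in auto)
    have "{0..t} = {0..s} \<union> {s<..t}" using st by auto
    moreover have "set_lebesgue_integral lborel ({0..s} \<union> {s<..t}) (\<lambda>\<tau>. b \<tau> \<omega>) =
        set_lebesgue_integral lborel {0..s} (\<lambda>\<tau>. b \<tau> \<omega>) + set_lebesgue_integral lborel {s<..t} (\<lambda>\<tau>. b \<tau> \<omega>)"
      by (rule set_integral_Un) (use st in \<open>auto intro!: i\<close>)
    ultimately have e: "set_lebesgue_integral lborel {0..t} (\<lambda>\<tau>. b \<tau> \<omega>) =
        set_lebesgue_integral lborel {0..s} (\<lambda>\<tau>. b \<tau> \<omega>) + set_lebesgue_integral lborel {s<..t} (\<lambda>\<tau>. b \<tau> \<omega>)" by simp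
    have xt: "X t \<omega> = z \<omega> + set_lebesgue_integral lborel {0..t} (\<lambda>\<tau>. b \<tau> \<omega>) + sqrt (2 * sig) *\<^sub>R W t \<omega>"
      and xs: "X s \<omega> = z \<omega> + set_lebesgue_integral lborel {0..s} (\<lambda>\<tau>. b \<tau> \<omega>) + sqrt (2 * sig) *\<^sub>R W s \<omega>"
      using elim st by auto
    have "X t \<omega> - X s \<omega> - sqrt (2 * sig) *\<^sub>R (W t \<omega> - W s \<omega>) = set_lebesgue_integral lborel {s<..t} (\<lambda>\<tau>. b \<tau> \<omega>)"
      unfolding xt xs e scaleR_diff_right by simp
    moreover have "norm (set_lebesgue_integral lborel {s<..t} (\<lambda>\<tau>. b \<tau> \<omega>)) \<le> B * (t - s)"
    proof (rule set_integral_norm_le_AE)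
      show "AE \<tau> in lborel. \<tau> \<in> {s<..t} \<longrightarrow> norm (b \<tau> \<omega>) \<le> B"
        using B by eventually_elim (use st in auto)
    qed (use st in \<open>auto intro!: i\<close>)
    ultimately show ?case by simp
  qed
qed

lemma set_integral_singleton: "set_lebesgue_integral lborel {a} f = (0 :: 'b::euclidean_space)" for a :: real
  unfolding set_lebesgue_integral_def
  by (rule integral_eq_zero_AE) (use AE_lborel_singleton[of a] in \<open>auto elim!: eventually_mono\<close>)

lemma sde_solution_start:
  assumes sde: "sde_solution M F T sig W z b X" and W: "brownian_motion M F W" and T: "0 \<le> T"
  shows "AE \<omega> in M. X 0 \<omega> = z \<omega>"
proof -
  have "AE \<omega> in M. (\<forall>t\<in>{0..T}. X t \<omega> = z \<omega> + set_lebesgue_integral lborel {0..t} (\<lambda>\<tau>. b \<tau> \<omega>) + sqrt (2 * sig) *\<^sub>R W t \<omega>)"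
    using sde unfolding sde_solution_def by (auto elim!: eventually_mono)
  moreover have "AE \<omega> in M. W 0 \<omega> = 0" using W unfolding brownian_motion_def by (auto elim!: eventually_mono)
  ultimately show ?thesis
  proof eventually_elim
    case (elim \<omega>)
    then show ?case using T bspec[OF elim(1), of 0] by (simp add: set_integral_singleton)
  qed
qed

lemma (in prob_space) distributed_PiM:
  fixes x :: "'p \<Rightarrow> 'a \<Rightarrow> 'b::euclidean_space"
  assumes R: "finite R" and ind: "indep_vars (\<lambda>_. borel) x R"
    and d: "\<And>p. p \<in> R \<Longrightarrow> distributed M lborel (x p) (\<lambda>y. ennreal (f p y))"
    and fm: "\<And>p. p \<in> R \<Longrightarrow> f p \<in> borel_measurable borel" and f0: "\<And>p y. p \<in> R \<Longrightarrow> 0 \<le> f p y"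
  shows "distributed M (PiM R (\<lambda>_. lborel)) (\<lambda>\<omega>. \<lambda>p\<in>R. x p \<omega>) (\<lambda>y. ennreal (\<Prod>p\<in>R. f p (y p)))"
proof -
  define N where "N p = (if p \<in> R then density lborel (\<lambda>y. ennreal (f p y)) else lborel)" for p
  have Np: "N p = distr M lborel (x p)" if "p \<in> R" for p
    using distributed_distr_eq_density[OF d[OF that]] that by (simp add: N_def)
  have xm: "x p \<in> M \<rightarrow>\<^sub>M lborel" if "p \<in> R" for p using distributed_measurable[OF d[OF that]] .
  have setsN: "sets (N p) = sets borel" for p by (simp add: N_def)
  have "sigma_finite_measure (N p)" for p
  proof (cases "p \<in> R")
    case True
    then show ?thesis using Np[OF True] prob_space_distr[OF xm[OF True]] by (simp add: prob_space_imp_sigma_finite)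
  next
    case False
    then show ?thesis by (simp add: N_def sigma_finite_lborel)
  qed
  then interpret N: product_sigma_finite N by (rule product_sigma_finite.intro)
  interpret L: product_sigma_finite "\<lambda>_::'p. lborel :: 'b measure" ..
  have sP: "sets (PiM R N) = sets (PiM R (\<lambda>_. lborel :: 'b measure))"
    by (rule sets_PiM_cong) (auto simp: setsN)
  have pm: "(\<lambda>y. ennreal (\<Prod>p\<in>R. f p (y p))) \<in> borel_measurable (PiM R (\<lambda>_. lborel))"
  proof -
    have [measurable]: "(\<lambda>y. f p (y p)) \<in> borel_measurable (PiM R (\<lambda>_. lborel))" if "p \<in> R" for p
      using fm[OF that] that by (intro measurable_compose[OF measurable_component_singleton]) auto
    show ?thesis by measurable
  qed
  have rm: "(\<lambda>\<omega>. \<lambda>p\<in>R. x p \<omega>) \<in> M \<rightarrow>\<^sub>M PiM R (\<lambda>_. lborel)"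
    by (rule measurable_restrict) (rule xm)
  have e1: "density (PiM R (\<lambda>_. lborel)) (\<lambda>y. ennreal (\<Prod>p\<in>R. f p (y p))) = PiM R N"
  proof (rule N.PiM_eqI[OF R])
    show "sets (density (PiM R (\<lambda>_. lborel)) (\<lambda>y. ennreal (\<Prod>p\<in>R. f p (y p)))) = sets (PiM R N)" by (simp add: sP)
    fix A assume A: "\<And>p. p \<in> R \<Longrightarrow> A p \<in> sets (N p)"
    then have A': "A p \<in> sets borel" if "p \<in> R" for p using that setsN by auto
    have AE: "Pi\<^sub>E R A \<in> sets (PiM R (\<lambda>_. lborel))"
      by (rule sets_PiM_I_finite[OF R]) (use A' in auto)
    have "emeasure (density (PiM R (\<lambda>_. lborel)) (\<lambda>y. ennreal (\<Prod>p\<in>R. f p (y p)))) (Pi\<^sub>E R A) =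
      (\<integral>\<^sup>+y. ennreal (\<Prod>p\<in>R. f p (y p)) * indicator (Pi\<^sub>E R A) y \<partial>PiM R (\<lambda>_. lborel))"
      by (rule emeasure_density[OF pm AE])
    also have "\<dots> = (\<integral>\<^sup>+y. (\<Prod>p\<in>R. ennreal (f p (y p)) * indicator (A p) (y p)) \<partial>PiM R (\<lambda>_. lborel))"
    proof (rule nn_integral_cong)
      fix y :: "'p \<Rightarrow> 'b" assume y: "y \<in> space (PiM R (\<lambda>_. lborel))"
      have "indicator (Pi\<^sub>E R A) y = (\<Prod>p\<in>R. indicator (A p) (y p) :: ennreal)"
      proof (cases "y \<in> Pi\<^sub>E R A")
        case True
        then show ?thesis by (auto simp: PiE_iff intro!: prod.neutral[symmetric])
      next
        case False
        then obtain p where "p \<in> R" "y p \<notin> A p" using y by (auto simp: space_PiM PiE_iff)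
        then have "(\<Prod>p\<in>R. indicator (A p) (y p) :: ennreal) = 0" using R by (intro prod_zero bexI[of _ p]) auto
        then show ?thesis using False by simp
      qed
      then show "ennreal (\<Prod>p\<in>R. f p (y p)) * indicator (Pi\<^sub>E R A) y = (\<Prod>p\<in>R. ennreal (f p (y p)) * indicator (A p) (y p))"
        using f0 by (simp add: prod_ennreal prod.distrib)
    qed
    also have "\<dots> = (\<Prod>p\<in>R. \<integral>\<^sup>+y. ennreal (f p y) * indicator (A p) y \<partial>lborel)"
      by (rule L.product_nn_integral_prod[OF R]) (use fm A' in auto)
    also have "\<dots> = (\<Prod>p\<in>R. emeasure (N p) (A p))"
    proof (rule prod.cong)
      fix p assume p: "p \<in> R"
      then show "(\<integral>\<^sup>+y. ennreal (f p y) * indicator (A p) y \<partial>lborel) = emeasure (N p) (A p)"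
        using fm[OF p] A'[OF p] by (simp add: N_def emeasure_density)
    qed simp
    finally show "emeasure (density (PiM R (\<lambda>_. lborel)) (\<lambda>y. ennreal (\<Prod>p\<in>R. f p (y p)))) (Pi\<^sub>E R A) = (\<Prod>p\<in>R. emeasure (N p) (A p))" .
  qed
  have e2: "distr M (PiM R (\<lambda>_. lborel)) (\<lambda>\<omega>. \<lambda>p\<in>R. x p \<omega>) = PiM R N"
  proof (rule N.PiM_eqI[OF R])
    show "sets (distr M (PiM R (\<lambda>_. lborel)) (\<lambda>\<omega>. \<lambda>p\<in>R. x p \<omega>)) = sets (PiM R N)" by (simp add: sP)
    fix A assume A: "\<And>p. p \<in> R \<Longrightarrow> A p \<in> sets (N p)"
    then have A': "A p \<in> sets borel" if "p \<in> R" for p using that setsN by auto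
    have AE: "Pi\<^sub>E R A \<in> sets (PiM R (\<lambda>_. lborel))"
      by (rule sets_PiM_I_finite[OF R]) (use A' in auto)
    have "emeasure (distr M (PiM R (\<lambda>_. lborel)) (\<lambda>\<omega>. \<lambda>p\<in>R. x p \<omega>)) (Pi\<^sub>E R A) =
      emeasure M ((\<lambda>\<omega>. \<lambda>p\<in>R. x p \<omega>) -` Pi\<^sub>E R A \<inter> space M)"
      by (rule emeasure_distr[OF rm AE])
    also have "\<dots> = (\<Prod>p\<in>R. emeasure (N p) (A p))"
    proof (cases "R = {}")
      case True
      then have "(\<lambda>\<omega>. \<lambda>p\<in>R. x p \<omega>) -` Pi\<^sub>E R A \<inter> space M = space M" by (auto simp: restrict_def)
      then show ?thesis using True by (simp add: emeasure_space_1)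
    next
      case False
      have "(\<lambda>\<omega>. \<lambda>p\<in>R. x p \<omega>) -` Pi\<^sub>E R A \<inter> space M = (\<Inter>p\<in>R. x p -` A p \<inter> space M)"
        using False by (auto simp: PiE_iff)
      moreover have "prob (\<Inter>p\<in>R. x p -` A p \<inter> space M) = (\<Prod>p\<in>R. prob (x p -` A p \<inter> space M))"
        by (rule indep_varsD_finite[OF ind False R]) (use A' in auto)
      moreover have "emeasure (N p) (A p) = ennreal (prob (x p -` A p \<inter> space M))" if "p \<in> R" for p
        using xm[OF that] A'[OF that] by (simp add: Np[OF that] emeasure_distr emeasure_eq_measure)
      ultimately show ?thesis by (simp add: emeasure_eq_measure prod_ennreal)
    qed
    finally show "emeasure (distr M (PiM R (\<lambda>_. lborel)) (\<lambda>\<omega>. \<lambda>p\<in>R. x p \<omega>)) (Pi\<^sub>E R A) = (\<Prod>p\<in>R. emeasure (N p) (A p))" .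
  qed
  show ?thesis unfolding distributed_def using e1 e2 pm rm by simp
qed

text \<open>Telescoping: the factors are exchanged one at a time, and the others integrate to one.\<close>

lemma L1_product_le_sum:
  fixes f g :: "'p \<Rightarrow> 'b::euclidean_space \<Rightarrow> real"
  assumes "finite R"
    and "\<And>p. p \<in> R \<Longrightarrow> f p \<in> borel_measurable borel" "\<And>p. p \<in> R \<Longrightarrow> g p \<in> borel_measurable borel"
    and "\<And>p y. p \<in> R \<Longrightarrow> 0 \<le> f p y" "\<And>p y. p \<in> R \<Longrightarrow> 0 \<le> g p y"
    and "\<And>p. p \<in> R \<Longrightarrow> (\<integral>\<^sup>+y. ennreal (f p y) \<partial>lborel) = 1" "\<And>p. p \<in> R \<Longrightarrow> (\<integral>\<^sup>+y. ennreal (g p y) \<partial>lborel) = 1"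
  shows "(\<integral>\<^sup>+y. ennreal \<bar>(\<Prod>p\<in>R. f p (y p)) - (\<Prod>p\<in>R. g p (y p))\<bar> \<partial>PiM R (\<lambda>_. lborel))
     \<le> (\<Sum>p\<in>R. \<integral>\<^sup>+y. ennreal \<bar>f p y - g p y\<bar> \<partial>lborel)"
  using assms
proof (induction R)
  case empty
  interpret L: product_sigma_finite "\<lambda>_::'p. lborel :: 'b measure" ..
  show ?case by (simp add: L.nn_integral_empty)
next
  case (insert i R)
  interpret L: product_sigma_finite "\<lambda>_::'p. lborel :: 'b measure" ..
  have m[measurable]: "f p \<in> borel_measurable borel" "g p \<in> borel_measurable borel" if "p \<in> insert i R" for p
    using insert.prems that by auto
  have [measurable]: "f i \<in> borel_measurable borel" "g i \<in> borel_measurable borel" using m by auto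
  have cm: "(\<lambda>y. h p (y p)) \<in> borel_measurable (PiM S (\<lambda>_. lborel))"
    if "h p \<in> borel_measurable borel" "p \<in> S" for h :: "'p \<Rightarrow> 'b \<Rightarrow> real" and p S
    using that by (intro measurable_compose[OF measurable_component_singleton]) auto
  have pm: "(\<lambda>y. \<Prod>p\<in>S. h p (y p)) \<in> borel_measurable (PiM S (\<lambda>_. lborel))"
    if "\<And>p. p \<in> S \<Longrightarrow> h p \<in> borel_measurable borel" for h :: "'p \<Rightarrow> 'b \<Rightarrow> real" and S
    using that by (intro borel_measurable_prod cm) auto
  define a where "a y = (\<Prod>p\<in>R. f p (y p))" for y
  define b where "b y = (\<Prod>p\<in>R. g p (y p))" for y
  have [measurable]: "a \<in> borel_measurable (PiM R (\<lambda>_. lborel))" "b \<in> borel_measurable (PiM R (\<lambda>_. lborel))"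
    unfolding a_def b_def using m by (auto intro!: pm)
  have a0: "0 \<le> a y" for y unfolding a_def using insert.prems by (intro prod_nonneg) auto
  have g0: "0 \<le> g i y" for y using insert.prems by auto
  have a1: "(\<integral>\<^sup>+y. ennreal (a y) \<partial>PiM R (\<lambda>_. lborel)) = 1"
  proof -
    have "(\<integral>\<^sup>+y. ennreal (a y) \<partial>PiM R (\<lambda>_. lborel)) = (\<integral>\<^sup>+y. (\<Prod>p\<in>R. ennreal (f p (y p))) \<partial>PiM R (\<lambda>_. lborel))"
      unfolding a_def using insert.prems by (intro nn_integral_cong) (simp add: prod_ennreal)
    also have "\<dots> = (\<Prod>p\<in>R. \<integral>\<^sup>+y. ennreal (f p y) \<partial>lborel)"
      by (rule L.product_nn_integral_prod[OF insert.hyps(1)]) (use m in auto)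
    also have "\<dots> = 1" using insert.prems by simp
    finally show ?thesis .
  qed
  have IH: "(\<integral>\<^sup>+y. ennreal \<bar>a y - b y\<bar> \<partial>PiM R (\<lambda>_. lborel)) \<le> (\<Sum>p\<in>R. \<integral>\<^sup>+y. ennreal \<bar>f p y - g p y\<bar> \<partial>lborel)"
    unfolding a_def b_def by (rule insert.IH) (use insert.prems in auto)
  have upd: "(\<Prod>p\<in>insert i R. h p ((x(i := y)) p)) = h i y * (\<Prod>p\<in>R. h p (x p))" for h :: "'p \<Rightarrow> 'b \<Rightarrow> real" and x y
    using insert.hyps by (auto intro!: prod.cong)
  have "(\<integral>\<^sup>+y. ennreal \<bar>(\<Prod>p\<in>insert i R. f p (y p)) - (\<Prod>p\<in>insert i R. g p (y p))\<bar> \<partial>PiM (insert i R) (\<lambda>_. lborel))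
     = (\<integral>\<^sup>+x. \<integral>\<^sup>+y. ennreal \<bar>f i y * a x - g i y * b x\<bar> \<partial>lborel \<partial>PiM R (\<lambda>_. lborel))"
  proof (subst L.product_nn_integral_insert[OF insert.hyps])
    show "(\<lambda>y. ennreal \<bar>(\<Prod>p\<in>insert i R. f p (y p)) - (\<Prod>p\<in>insert i R. g p (y p))\<bar>) \<in> borel_measurable (PiM (insert i R) (\<lambda>_. lborel))"
      by (intro measurable_compose[OF _ measurable_ennreal] borel_measurable_abs borel_measurable_diff pm m)
  qed (simp only: upd a_def b_def)
  also have "\<dots> \<le> (\<integral>\<^sup>+x. \<integral>\<^sup>+y. ennreal (a x) * ennreal \<bar>f i y - g i y\<bar> + ennreal \<bar>a x - b x\<bar> * ennreal (g i y) \<partial>lborel \<partial>PiM R (\<lambda>_. lborel))"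
  proof (intro nn_integral_mono)
    fix x :: "'p \<Rightarrow> 'b" and y :: 'b
    have "f i y * a x - g i y * b x = a x * (f i y - g i y) + (a x - b x) * g i y" by (simp add: algebra_simps)
    then have "\<bar>f i y * a x - g i y * b x\<bar> \<le> a x * \<bar>f i y - g i y\<bar> + \<bar>a x - b x\<bar> * g i y"
      using a0[of x] g0[of y] abs_triangle_ineq[of "a x * (f i y - g i y)" "(a x - b x) * g i y"] by (simp add: abs_mult)
    then show "ennreal \<bar>f i y * a x - g i y * b x\<bar> \<le> ennreal (a x) * ennreal \<bar>f i y - g i y\<bar> + ennreal \<bar>a x - b x\<bar> * ennreal (g i y)"
      using a0[of x] g0[of y] by (simp add: ennreal_mult'[symmetric] ennreal_plus[symmetric] ennreal_leI del: ennreal_plus)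
  qed
  also have "\<dots> = (\<integral>\<^sup>+x. ennreal (a x) * (\<integral>\<^sup>+y. ennreal \<bar>f i y - g i y\<bar> \<partial>lborel) + ennreal \<bar>a x - b x\<bar> \<partial>PiM R (\<lambda>_. lborel))"
    using insert.prems by (simp add: nn_integral_add nn_integral_cmult)
  also have "\<dots> = (\<integral>\<^sup>+y. ennreal \<bar>f i y - g i y\<bar> \<partial>lborel) + (\<integral>\<^sup>+y. ennreal \<bar>a y - b y\<bar> \<partial>PiM R (\<lambda>_. lborel))"
    by (subst nn_integral_add) (auto simp: nn_integral_multc a1)
  also have "\<dots> \<le> (\<Sum>p\<in>insert i R. \<integral>\<^sup>+y. ennreal \<bar>f p y - g p y\<bar> \<partial>lborel)"
    using insert.hyps IH by (simp add: add_left_mono)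
  finally show ?case .
qed

text \<open>Integrating out coordinates of a density gives the density of the remaining coordinates.  The marginal is a Bochner
integral, so exceptional sections with infinite mass, where it is zero by convention, have to be discarded.\<close>

lemma distributed_marginal:
  fixes Z :: "'w \<Rightarrow> 'p \<Rightarrow> 'b::euclidean_space" and v :: "('p \<Rightarrow> 'b) \<Rightarrow> real"
  assumes I: "finite I" and R: "R \<subseteq> I"
    and Z: "distributed M (PiM I (\<lambda>_. lborel)) Z (\<lambda>x. ennreal (v x))"
    and v: "integrable (PiM I (\<lambda>_. lborel)) v" and v0: "\<And>x. x \<in> PiE I (\<lambda>_. UNIV) \<Longrightarrow> 0 \<le> v x"
  defines "m \<equiv> \<lambda>y. \<integral>z. v (merge R (I - R) (y, z)) \<partial>PiM (I - R) (\<lambda>_. lborel)"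
  shows "distributed M (PiM R (\<lambda>_. lborel)) (\<lambda>\<omega>. restrict (Z \<omega>) R) (\<lambda>y. ennreal (m y))"
    and "m \<in> borel_measurable (PiM R (\<lambda>_. lborel))"
    and "\<And>y. y \<in> space (PiM R (\<lambda>_. lborel)) \<Longrightarrow> 0 \<le> m y"
proof -
  interpret L: product_sigma_finite "\<lambda>_::'p. lborel :: 'b measure" ..
  interpret LR: sigma_finite_measure "PiM (I - R) (\<lambda>_::'p. lborel :: 'b measure)"
    using I by (intro L.sigma_finite) auto
  have fin: "finite R" "finite (I - R)" using I R finite_subset by auto
  have IR: "R \<union> (I - R) = I" "R \<inter> (I - R) = {}" using R by auto
  have vm[measurable]: "v \<in> borel_measurable (PiM I (\<lambda>_. lborel))" using v by (rule borel_measurable_integrable)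
  have mm[measurable]: "merge R (I - R) \<in> (PiM R (\<lambda>_. lborel :: 'b measure)) \<Otimes>\<^sub>M (PiM (I - R) (\<lambda>_. lborel)) \<rightarrow>\<^sub>M PiM I (\<lambda>_. lborel)"
    using measurable_merge[of R "I - R" "\<lambda>_. lborel :: 'b measure"] unfolding IR .
  have vmm: "(\<lambda>p. v (merge R (I - R) p)) \<in> borel_measurable ((PiM R (\<lambda>_. lborel)) \<Otimes>\<^sub>M (PiM (I - R) (\<lambda>_. lborel)))"
    by measurable
  show mmeas[measurable]: "m \<in> borel_measurable (PiM R (\<lambda>_. lborel))"
    unfolding m_def by (rule LR.borel_measurable_lebesgue_integral) (use vmm in \<open>simp add: split_beta'\<close>)
  have v0': "0 \<le> v (merge R (I - R) (y, z))" if "y \<in> space (PiM R (\<lambda>_. lborel))" "z \<in> space (PiM (I - R) (\<lambda>_. lborel))" for y z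
  proof (rule v0)
    have "merge R (I - R) (y, z) \<in> space (PiM I (\<lambda>_. lborel))"
      by (rule measurable_space[OF mm]) (use that in \<open>auto simp: space_pair_measure\<close>)
    then show "merge R (I - R) (y, z) \<in> PiE I (\<lambda>_. UNIV)" by (simp add: space_PiM)
  qed
  show m0: "0 \<le> m y" if "y \<in> space (PiM R (\<lambda>_. lborel))" for y
    unfolding m_def by (rule integral_nonneg_AE) (use v0'[OF that] in auto)
  have Zm: "Z \<in> M \<rightarrow>\<^sub>M PiM I (\<lambda>_. lborel)" using Z by (rule distributed_measurable)
  have rm: "(\<lambda>\<omega>. restrict (Z \<omega>) R) \<in> M \<rightarrow>\<^sub>M PiM R (\<lambda>_. lborel)"
    by (rule measurable_compose[OF Zm measurable_restrict_subset[OF R]])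
  define n where "n y = (\<integral>\<^sup>+z. ennreal (v (merge R (I - R) (y, z))) \<partial>PiM (I - R) (\<lambda>_. lborel))" for y
  have nm[measurable]: "n \<in> borel_measurable (PiM R (\<lambda>_. lborel))"
    unfolding n_def by (rule LR.borel_measurable_nn_integral) (use vmm in \<open>simp add: split_beta'\<close>)
  have tot: "(\<integral>\<^sup>+y. n y \<partial>PiM R (\<lambda>_. lborel)) = (\<integral>\<^sup>+x. ennreal (v x) \<partial>PiM I (\<lambda>_. lborel))"
    unfolding n_def using L.product_nn_integral_fold[OF IR(2) fin, of "\<lambda>x. ennreal (v x)"] vm unfolding IR by simp
  have "(\<integral>\<^sup>+x. ennreal (v x) \<partial>PiM I (\<lambda>_. lborel)) < \<infinity>"
  proof -
    have "(\<integral>\<^sup>+x. ennreal (v x) \<partial>PiM I (\<lambda>_. lborel)) = ennreal (integral\<^sup>L (PiM I (\<lambda>_. lborel)) v)"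
      by (rule nn_integral_eq_integral[OF v], rule AE_I2, rule v0) (simp add: space_PiM)
    then show ?thesis by simp
  qed
  then have "AE y in PiM R (\<lambda>_. lborel). n y \<noteq> \<infinity>"
    using tot by (intro nn_integral_PInf_AE) auto
  then have nmAE: "AE y in PiM R (\<lambda>_. lborel). n y = ennreal (m y)"
  proof (rule AE_mp, intro AE_I2 impI)
    fix y assume y: "y \<in> space (PiM R (\<lambda>_. lborel :: 'b measure))" and fi: "n y \<noteq> \<infinity>"
    have my: "(\<lambda>z. v (merge R (I - R) (y, z))) \<in> borel_measurable (PiM (I - R) (\<lambda>_. lborel))"
      using measurable_compose_Pair1[OF y vmm] by simp
    have "integrable (PiM (I - R) (\<lambda>_. lborel)) (\<lambda>z. v (merge R (I - R) (y, z)))"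
      by (rule integrableI_nonneg[OF my]) (use fi v0'[OF y] in \<open>auto simp: n_def top.not_eq_extremum\<close>)
    then show "n y = ennreal (m y)"
      unfolding n_def m_def by (rule nn_integral_eq_integral) (use v0'[OF y] in auto)
  qed
  have "distr M (PiM R (\<lambda>_. lborel)) (\<lambda>\<omega>. restrict (Z \<omega>) R) = density (PiM R (\<lambda>_. lborel)) (\<lambda>y. ennreal (m y))"
  proof (rule measure_eqI)
    fix A assume "A \<in> sets (distr M (PiM R (\<lambda>_. lborel)) (\<lambda>\<omega>. restrict (Z \<omega>) R))"
    then have A[measurable]: "A \<in> sets (PiM R (\<lambda>_. lborel))" by simp
    define A' where "A' = (\<lambda>x. restrict x R) -` A \<inter> space (PiM I (\<lambda>_. lborel :: 'b measure))"
    have A'[measurable]: "A' \<in> sets (PiM I (\<lambda>_. lborel))"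
      unfolding A'_def by (rule measurable_sets[OF measurable_restrict_subset[OF R] A])
    have "emeasure (distr M (PiM R (\<lambda>_. lborel)) (\<lambda>\<omega>. restrict (Z \<omega>) R)) A = emeasure M ((\<lambda>\<omega>. restrict (Z \<omega>) R) -` A \<inter> space M)"
      by (rule emeasure_distr[OF rm A])
    also have "(\<lambda>\<omega>. restrict (Z \<omega>) R) -` A \<inter> space M = Z -` A' \<inter> space M"
      using measurable_space[OF Zm] by (auto simp: A'_def)
    also have "emeasure M (Z -` A' \<inter> space M) = (\<integral>\<^sup>+x. ennreal (v x) * indicator A' x \<partial>PiM I (\<lambda>_. lborel))"
      by (rule distributed_emeasure[OF Z A'])
    also have "\<dots> = (\<integral>\<^sup>+y. \<integral>\<^sup>+z. ennreal (v (merge R (I - R) (y, z))) * indicator A' (merge R (I - R) (y, z)) \<partial>PiM (I - R) (\<lambda>_. lborel) \<partial>PiM R (\<lambda>_. lborel))"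
      using L.product_nn_integral_fold[OF IR(2) fin, of "\<lambda>x. ennreal (v x) * indicator A' x"] unfolding IR by simp
    also have "\<dots> = (\<integral>\<^sup>+y. n y * indicator A y \<partial>PiM R (\<lambda>_. lborel))"
    proof (rule nn_integral_cong)
      fix y assume y: "y \<in> space (PiM R (\<lambda>_. lborel :: 'b measure))"
      have my: "(\<lambda>z. v (merge R (I - R) (y, z))) \<in> borel_measurable (PiM (I - R) (\<lambda>_. lborel))"
        using measurable_compose_Pair1[OF y vmm] by simp
      have "(\<integral>\<^sup>+z. ennreal (v (merge R (I - R) (y, z))) * indicator A' (merge R (I - R) (y, z)) \<partial>PiM (I - R) (\<lambda>_. lborel))
         = (\<integral>\<^sup>+z. ennreal (v (merge R (I - R) (y, z))) * indicator A y \<partial>PiM (I - R) (\<lambda>_. lborel))"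
      proof (rule nn_integral_cong)
        fix z assume z: "z \<in> space (PiM (I - R) (\<lambda>_. lborel :: 'b measure))"
        have "merge R (I - R) (y, z) \<in> space (PiM I (\<lambda>_. lborel))"
          by (rule measurable_space[OF mm]) (use y z in \<open>auto simp: space_pair_measure\<close>)
        moreover have "restrict (merge R (I - R) (y, z)) R = y"
          using y by (auto simp: fun_eq_iff merge_def space_PiM PiE_iff extensional_def)
        ultimately have "indicator A' (merge R (I - R) (y, z)) = (indicator A y :: ennreal)"
          by (simp add: A'_def indicator_def)
        then show "ennreal (v (merge R (I - R) (y, z))) * indicator A' (merge R (I - R) (y, z)) = ennreal (v (merge R (I - R) (y, z))) * indicator A y"
          by simp
      qed
      also have "\<dots> = n y * indicator A y" unfolding n_def using my by (intro nn_integral_multc) simp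
      finally show "(\<integral>\<^sup>+z. ennreal (v (merge R (I - R) (y, z))) * indicator A' (merge R (I - R) (y, z)) \<partial>PiM (I - R) (\<lambda>_. lborel)) = n y * indicator A y" .
    qed
    also have "\<dots> = (\<integral>\<^sup>+y. ennreal (m y) * indicator A y \<partial>PiM R (\<lambda>_. lborel))"
      by (rule nn_integral_cong_AE) (use nmAE in \<open>auto elim!: eventually_mono\<close>)
    also have "\<dots> = emeasure (density (PiM R (\<lambda>_. lborel)) (\<lambda>y. ennreal (m y))) A"
      by (rule emeasure_density[symmetric]) auto
    finally show "emeasure (distr M (PiM R (\<lambda>_. lborel)) (\<lambda>\<omega>. restrict (Z \<omega>) R)) A = emeasure (density (PiM R (\<lambda>_. lborel)) (\<lambda>y. ennreal (m y))) A" .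
  qed simp
  then show "distributed M (PiM R (\<lambda>_. lborel)) (\<lambda>\<omega>. restrict (Z \<omega>) R) (\<lambda>y. ennreal (m y))"
    unfolding distributed_def using rm by simp
qed

text \<open>Inside the ball \<open>|f - g| \<le> l + (f - g)\<^sup>2 / l\<close>; outside, the densities are integrated separately.  The level \<open>l\<close> is
chosen later together with the radius.\<close>

lemma (in prob_space) L1_le_L2_plus_tails:
  fixes f g :: "'b::euclidean_space \<Rightarrow> real"
  assumes X: "distributed M lborel X (\<lambda>x. ennreal (f x))" and Y: "distributed M lborel Y (\<lambda>x. ennreal (g x))"
    and [measurable]: "f \<in> borel_measurable borel" "g \<in> borel_measurable borel" and nn: "\<And>x. 0 \<le> f x" "\<And>x. 0 \<le> g x"
    and L2: "(\<integral>\<^sup>+x. ennreal ((f x - g x)\<^sup>2) \<partial>lborel) \<le> ennreal (a\<^sup>2)" and l: "l > 0" and r: "r \<ge> 0"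
  shows "(\<integral>\<^sup>+x. ennreal \<bar>f x - g x\<bar> \<partial>lborel) \<le>
    ennreal (l * (unit_ball_vol (real DIM('b)) * r ^ DIM('b)) + a\<^sup>2 / l + prob {\<omega>\<in>space M. r < norm (X \<omega>)} + prob {\<omega>\<in>space M. r < norm (Y \<omega>)})"
proof -
  have [measurable]: "cball (0::'b) r \<in> sets borel" by simp
  have tail: "(\<integral>\<^sup>+x. ennreal (h x) * indicator (- cball 0 r) x \<partial>lborel) = ennreal (prob {\<omega>\<in>space M. r < norm (Z \<omega>)})"
    if "distributed M lborel Z (\<lambda>x. ennreal (h x))" for Z :: "'a \<Rightarrow> 'b" and h
  proof -
    have "Z -` (- cball 0 r) \<inter> space M = {\<omega>\<in>space M. r < norm (Z \<omega>)}" by auto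
    then show ?thesis using distributed_emeasure[OF that, of "- cball 0 r"] by (simp add: emeasure_eq_measure)
  qed
  have "(\<integral>\<^sup>+x. ennreal \<bar>f x - g x\<bar> \<partial>lborel) \<le>
    (\<integral>\<^sup>+x. ennreal l * indicator (cball 0 r) x + ennreal (1 / l) * ennreal ((f x - g x)\<^sup>2)
      + ennreal (f x) * indicator (- cball 0 r) x + ennreal (g x) * indicator (- cball 0 r) x \<partial>lborel)"
  proof (rule nn_integral_mono)
    fix x :: 'b
    show "ennreal \<bar>f x - g x\<bar> \<le> ennreal l * indicator (cball 0 r) x + ennreal (1 / l) * ennreal ((f x - g x)\<^sup>2)
      + ennreal (f x) * indicator (- cball 0 r) x + ennreal (g x) * indicator (- cball 0 r) x"
    proof (cases "x \<in> cball 0 r")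
      case True
      define d where "d = \<bar>f x - g x\<bar>"
      have "0 \<le> (d - l)\<^sup>2 / l" using l by simp
      also have "\<dots> = d\<^sup>2 / l - 2 * d + l" using l by (simp add: power2_eq_square field_simps)
      finally have "2 * d \<le> l + 1 / l * d\<^sup>2" by simp
      moreover have "0 \<le> d" by (simp add: d_def)
      ultimately have "d \<le> l + 1 / l * d\<^sup>2" by linarith
      then have "\<bar>f x - g x\<bar> \<le> l + 1 / l * (f x - g x)\<^sup>2" by (simp add: d_def)
      then show ?thesis
        using True l by (simp add: ennreal_mult'[symmetric] ennreal_plus[symmetric] ennreal_leI del: ennreal_plus)
    next
      case False
      have "ennreal \<bar>f x - g x\<bar> \<le> ennreal (f x) + ennreal (g x)"
        using nn[of x] by (simp add: ennreal_plus[symmetric] del: ennreal_plus)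
      also have "\<dots> \<le> ennreal (1 / l) * ennreal ((f x - g x)\<^sup>2) + (ennreal (f x) + ennreal (g x))" by simp
      finally show ?thesis using False by (simp add: add.assoc)
    qed
  qed
  also have "\<dots> = ennreal l * emeasure lborel (cball (0::'b) r) + ennreal (1 / l) * (\<integral>\<^sup>+x. ennreal ((f x - g x)\<^sup>2) \<partial>lborel)
      + ennreal (prob {\<omega>\<in>space M. r < norm (X \<omega>)}) + ennreal (prob {\<omega>\<in>space M. r < norm (Y \<omega>)})"
    by (simp add: nn_integral_add nn_integral_cmult nn_integral_cmult_indicator tail[OF X] tail[OF Y])
  also have "\<dots> \<le> ennreal l * ennreal (unit_ball_vol (real DIM('b)) * r ^ DIM('b)) + ennreal (1 / l) * ennreal (a\<^sup>2)
      + ennreal (prob {\<omega>\<in>space M. r < norm (X \<omega>)}) + ennreal (prob {\<omega>\<in>space M. r < norm (Y \<omega>)})"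
    using L2 r by (intro add_mono mult_left_mono) (auto simp: emeasure_cball)
  also have "\<dots> = ennreal (l * (unit_ball_vol (real DIM('b)) * r ^ DIM('b)) + a\<^sup>2 / l + prob {\<omega>\<in>space M. r < norm (X \<omega>)} + prob {\<omega>\<in>space M. r < norm (Y \<omega>)})"
    using l r by (simp add: ennreal_mult'[symmetric] ennreal_plus[symmetric] del: ennreal_plus)
  finally show ?thesis .
qed

text \<open>The constant is \<open>7 * 5 * 3 = 105\<close>.\<close>

lemma gauss_moment_8:
  fixes b :: "'b::euclidean_space"
  assumes t: "t > 0" and b: "b \<in> Basis"
  shows "has_bochner_integral lborel (\<lambda>x. gauss t x * (x \<bullet> b) ^ 8) (105 * t ^ 4)"
proof -
  define f where "f c = (\<lambda>x. normal_density 0 (sqrt t) x * (if c = b then x ^ 8 else 1))" for c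
  have m8: "has_bochner_integral lborel (\<lambda>x. normal_density 0 (sqrt t) x * x ^ 8) (105 * t ^ 4)"
  proof -
    have "fact 8 / ((2 / (sqrt t)\<^sup>2) ^ 4 * fact 4) = 105 * t ^ 4"
      using t by (simp add: fact_numeral field_simps)
    then show ?thesis using normal_moment_even[of "sqrt t" 0 4] t by simp
  qed
  have n1: "has_bochner_integral lborel (normal_density 0 (sqrt t)) 1"
    using t by (simp add: has_bochner_integral_iff)
  have fc: "has_bochner_integral lborel (f c) (if c = b then 105 * t ^ 4 else 1)" for c
    using m8 n1 by (simp add: f_def)
  have "has_bochner_integral lborel (\<lambda>x::'b. \<Prod>c\<in>Basis. f c (x \<bullet> c)) (\<Prod>c\<in>(Basis::'b set). integral\<^sup>L lborel (f c))"
    by (rule integral_lborel_prod) (use fc in \<open>simp add: has_bochner_integral_iff\<close>)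
  moreover have "(\<Prod>c\<in>(Basis::'b set). integral\<^sup>L lborel (f c)) = 105 * t ^ 4"
  proof -
    have "(\<Prod>c\<in>(Basis::'b set). integral\<^sup>L lborel (f c)) = (\<Prod>c\<in>(Basis::'b set). if c = b then 105 * t ^ 4 else 1)"
      using fc by (intro prod.cong) (auto simp: has_bochner_integral_iff)
    also have "\<dots> = 105 * t ^ 4" using b by (simp add: prod.delta)
    finally show ?thesis .
  qed
  moreover have "(\<Prod>c\<in>Basis. f c (x \<bullet> c)) = gauss t x * (x \<bullet> b) ^ 8" for x :: 'b
  proof -
    have "(\<Prod>c\<in>Basis. f c (x \<bullet> c)) = gauss t x * (\<Prod>c\<in>(Basis::'b set). if c = b then (x \<bullet> c) ^ 8 else 1)"
      unfolding f_def gauss_def by (simp add: prod.distrib)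
    also have "(\<Prod>c\<in>(Basis::'b set). if c = b then (x \<bullet> c) ^ 8 else 1) = (x \<bullet> b) ^ 8"
      using b by (simp add: prod.delta)
    finally show ?thesis .
  qed
  ultimately show ?thesis by simp
qed

lemma (in prob_space) gauss_tail:
  fixes W :: "'a \<Rightarrow> 'b::euclidean_space"
  assumes W: "distributed M lborel W (\<lambda>x. ennreal (gauss t x))" and t: "t > 0" and r: "r > 0"
  shows "prob {\<omega>\<in>space M. r < norm (W \<omega>)} \<le> real DIM('b) ^ 9 * 105 * t ^ 4 / r ^ 8"
proof -
  define d where "d = real DIM('b)"
  have d: "d > 0" by (simp add: d_def)
  have [measurable]: "W \<in> borel_measurable M" using distributed_measurable[OF W] by simp
  have i: "integrable M (\<lambda>\<omega>. (W \<omega> \<bullet> b) ^ 8)" and I: "expectation (\<lambda>\<omega>. (W \<omega> \<bullet> b) ^ 8) = 105 * t ^ 4" if "b \<in> Basis" for b :: 'b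
  proof -
    note m = gauss_moment_8[OF t that]
    have gp: "0 \<le> gauss t x" for x :: 'b using gauss_pos[OF t, of x] by simp
    show "integrable M (\<lambda>\<omega>. (W \<omega> \<bullet> b) ^ 8)"
      using distributed_integrable[OF W, of "\<lambda>x. (x \<bullet> b) ^ 8"] m gp by (simp add: has_bochner_integral_iff)
    show "expectation (\<lambda>\<omega>. (W \<omega> \<bullet> b) ^ 8) = 105 * t ^ 4"
      using distributed_integral[OF W, of "\<lambda>x. (x \<bullet> b) ^ 8"] m gp by (simp add: has_bochner_integral_iff)
  qed
  have "prob {\<omega>\<in>space M. r < norm (W \<omega>)} = expectation (indicator {\<omega>\<in>space M. r < norm (W \<omega>)})"
    by simp
  also have "\<dots> \<le> expectation (\<lambda>\<omega>. (d / r) ^ 8 * (\<Sum>b\<in>Basis. (W \<omega> \<bullet> b) ^ 8))"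
  proof (rule integral_mono)
    show "integrable M (indicat_real {\<omega> \<in> space M. r < norm (W \<omega>)})" by (intro integrable_real_indicator) (auto simp: emeasure_eq_measure)
    show "integrable M (\<lambda>\<omega>. (d / r) ^ 8 * (\<Sum>b\<in>Basis. (W \<omega> \<bullet> b) ^ 8))" using i by auto
    fix \<omega>
    have nn: "0 \<le> (d / r) ^ 8 * (\<Sum>b\<in>Basis. (W \<omega> \<bullet> b) ^ 8)"
      using d r by (intro mult_nonneg_nonneg sum_nonneg) auto
    show "indicat_real {\<omega> \<in> space M. r < norm (W \<omega>)} \<omega> \<le> (d / r) ^ 8 * (\<Sum>b\<in>Basis. (W \<omega> \<bullet> b) ^ 8)"
    proof (cases "r < norm (W \<omega>)")
      case True
      \<comment> \<open>A long vector has at least one coordinate that is comparable to its length.\<close>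
      have "\<exists>b\<in>Basis. r / d \<le> \<bar>W \<omega> \<bullet> b\<bar>"
      proof (rule ccontr)
        assume "\<not> ?thesis"
        then have "(\<Sum>b\<in>Basis. \<bar>W \<omega> \<bullet> b\<bar>) \<le> (\<Sum>b\<in>(Basis::'b set). r / d)" by (intro sum_mono) auto
        also have "\<dots> = r" using d by (simp add: d_def)
        finally show False using norm_le_l1[of "W \<omega>"] True by simp
      qed
      then obtain b where b: "b \<in> Basis" "r / d \<le> \<bar>W \<omega> \<bullet> b\<bar>" by blast
      have "1 = (d / r) ^ 8 * (r / d) ^ 8" using d r by (simp add: field_simps)
      also have "\<dots> \<le> (d / r) ^ 8 * \<bar>W \<omega> \<bullet> b\<bar> ^ 8" using b(2) d r by (intro mult_left_mono power_mono) auto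
      also have "\<dots> \<le> (d / r) ^ 8 * (\<Sum>b\<in>Basis. (W \<omega> \<bullet> b) ^ 8)"
        using d r b(1) member_le_sum[of b Basis "\<lambda>b. (W \<omega> \<bullet> b) ^ 8"] by (intro mult_left_mono) auto
      finally show ?thesis by (auto simp: indicator_def)
    qed (use nn in simp)
  qed
  also have "\<dots> = (d / r) ^ 8 * (d * (105 * t ^ 4))" using i I by (simp add: d_def)
  also have "\<dots> = d ^ 9 * 105 * t ^ 4 / r ^ 8" by (simp add: field_simps eval_nat_numeral)
  finally show ?thesis by (simp add: d_def)
qed

text \<open>Different moments for the two contributions: the variance of the Gaussian part carries the unbounded diffusivity and
needs a high moment, the initial value has only two.\<close>

lemma (in prob_space) tail_of_gauss_plus_square_integrable:
  fixes W X z :: "'a \<Rightarrow> 'b::euclidean_space"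
  assumes W: "distributed M lborel W (\<lambda>x. ennreal (gauss t x))" and t: "t > 0" and r: "r > 0" and c: "c > 0" and b: "b \<ge> 0"
    and [measurable]: "X \<in> borel_measurable M" "z \<in> borel_measurable M"
    and zi: "integrable M (\<lambda>\<omega>. (norm (z \<omega>))\<^sup>2)"
    and X: "AE \<omega> in M. norm (X \<omega> - z \<omega> - c *\<^sub>R W \<omega>) \<le> b"
  shows "prob {\<omega>\<in>space M. r < norm (X \<omega>)} \<le>
     real DIM('b) ^ 9 * 105 * t ^ 4 * (2 * c / r) ^ 8 + 8 * (expectation (\<lambda>\<omega>. (norm (z \<omega>))\<^sup>2) + b\<^sup>2) / r\<^sup>2"
proof -
  have [measurable]: "W \<in> borel_measurable M" using distributed_measurable[OF W] by simp
  define A where "A = {\<omega>\<in>space M. r / (2 * c) < norm (W \<omega>)}"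
  define D where "D = {\<omega>\<in>space M. r / 2 < norm (z \<omega>) + b}"
  have [measurable]: "A \<in> events" "D \<in> events" by (auto simp: A_def D_def)
  have "prob {\<omega>\<in>space M. r < norm (X \<omega>)} \<le> prob (A \<union> D)"
  proof (rule finite_measure_mono_AE)
    show "AE \<omega> in M. \<omega> \<in> {\<omega> \<in> space M. r < norm (X \<omega>)} \<longrightarrow> \<omega> \<in> A \<union> D"
      using X
    proof eventually_elim
      case (elim \<omega>)
      show ?case
      proof
        assume w: "\<omega> \<in> {\<omega> \<in> space M. r < norm (X \<omega>)}"
        have "norm (X \<omega>) \<le> norm (X \<omega> - z \<omega> - c *\<^sub>R W \<omega>) + norm (z \<omega> + c *\<^sub>R W \<omega>)"
          using norm_triangle_ineq[of "X \<omega> - z \<omega> - c *\<^sub>R W \<omega>" "z \<omega> + c *\<^sub>R W \<omega>"] by simp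
        also have "\<dots> \<le> b + (norm (z \<omega>) + c * norm (W \<omega>))"
          using elim norm_triangle_ineq[of "z \<omega>" "c *\<^sub>R W \<omega>"] c by (simp add: add_mono)
        finally have "r < b + (norm (z \<omega>) + c * norm (W \<omega>))" using w by simp
        then have "r / 2 < norm (z \<omega>) + b \<or> r / 2 < c * norm (W \<omega>)" by linarith
        then show "\<omega> \<in> A \<union> D" using w c by (auto simp: A_def D_def field_simps)
      qed
    qed
  qed simp
  also have "\<dots> \<le> prob A + prob D" by (rule measure_Un_le) auto
  also have "prob A \<le> real DIM('b) ^ 9 * 105 * t ^ 4 / (r / (2 * c)) ^ 8"
    unfolding A_def by (rule gauss_tail[OF W t]) (use r c in simp)
  also have "\<dots> = real DIM('b) ^ 9 * 105 * t ^ 4 * (2 * c / r) ^ 8" using c r by (simp add: power_divide)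
  also have "prob D \<le> 8 * (expectation (\<lambda>\<omega>. (norm (z \<omega>))\<^sup>2) + b\<^sup>2) / r\<^sup>2"
  proof -
    have "prob D = expectation (indicator D)" by simp
    also have "\<dots> \<le> expectation (\<lambda>\<omega>. 8 / r\<^sup>2 * ((norm (z \<omega>))\<^sup>2 + b\<^sup>2))"
    proof (rule integral_mono)
      show "integrable M (indicat_real D)" by (intro integrable_real_indicator) (auto simp: emeasure_eq_measure)
      show "integrable M (\<lambda>\<omega>. 8 / r\<^sup>2 * ((norm (z \<omega>))\<^sup>2 + b\<^sup>2))" using zi by auto
      fix \<omega>
      show "indicat_real D \<omega> \<le> 8 / r\<^sup>2 * ((norm (z \<omega>))\<^sup>2 + b\<^sup>2)"
      proof (cases "\<omega> \<in> D")
        case True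
        then have "(r / 2)\<^sup>2 \<le> (norm (z \<omega>) + b)\<^sup>2" using r by (intro power_mono) (auto simp: D_def)
        also have "\<dots> \<le> 2 * ((norm (z \<omega>))\<^sup>2 + b\<^sup>2)"
          using sum_squares_bound[of "norm (z \<omega>)" b] by (simp add: power2_sum)
        finally show ?thesis using True r by (simp add: field_simps power2_eq_square)
      qed (use b in simp)
    qed
    also have "\<dots> = 8 * (expectation (\<lambda>\<omega>. (norm (z \<omega>))\<^sup>2) + b\<^sup>2) / r\<^sup>2"
      using zi by (simp add: prob_space)
    finally show ?thesis .
  qed
  finally show ?thesis by simp
qed

section \<open>The particle systems\<close>

text \<open>For times before \<open>\<delta>\<close> the window starts at time zero, where the processes coincide.\<close>

lemma (in brownian_family) tv_drift_processes_same_start: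
  assumes c: "\<And>p. p \<in> R \<Longrightarrow> c p > 0" and B: "B1 \<ge> 0" "B2 \<ge> 0"
    and X: "drift_process T c B1 X" and Y: "drift_process T c B2 Y"
    and start: "\<And>p. p \<in> R \<Longrightarrow> AE \<omega> in M. X p 0 \<omega> = Y p 0 \<omega>"
    and e: "\<And>p s. p \<in> R \<Longrightarrow> 0 < s \<Longrightarrow> s < T \<Longrightarrow> expectation (\<lambda>\<omega>. norm (X p s \<omega> - Y p s \<omega>)) \<le> e" and e0: "0 \<le> e"
    and t: "t \<in> {0..T}" and \<delta>: "\<delta> > 0" and A: "A \<in> sets borel"
  shows "\<bar>prob ((\<lambda>\<omega>. config R (\<lambda>p. X p t \<omega>)) -` A \<inter> space M) - prob ((\<lambda>\<omega>. config R (\<lambda>p. Y p t \<omega>)) -` A \<inter> space M)\<bar>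
     \<le> (\<Sum>p\<in>R. (6 * (B1 + B2) * sqrt \<delta> + 2 * e / sqrt \<delta>) / c p)"
proof -
  have Xm: "X p u \<in> borel_measurable M" and Ym: "Y p u \<in> borel_measurable M" if "p \<in> R" "u \<in> {0..T}" for p u
    using X Y that unfolding drift_process_def by auto
  have pos: "0 \<le> (6 * (B1 + B2) * sqrt \<delta> + 2 * e / sqrt \<delta>) / c p" if "p \<in> R" for p
    using B e0 \<delta> c[OF that] by (intro divide_nonneg_pos add_nonneg_nonneg) auto
  show ?thesis
  proof (cases "t = 0")
    case True
    have T0: "0 \<in> {0..T}" using t by auto
    have "AE \<omega> in M. \<forall>p\<in>R. X p 0 \<omega> = Y p 0 \<omega>" using finite_R start by (simp add: AE_finite_all)
    then have "AE \<omega> in M. config R (\<lambda>p. X p 0 \<omega>) = config R (\<lambda>p. Y p 0 \<omega>)"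
      by eventually_elim (auto simp: config_def)
    moreover have m: "(\<lambda>\<omega>. config R (\<lambda>p. X p 0 \<omega>)) \<in> borel_measurable M" "(\<lambda>\<omega>. config R (\<lambda>p. Y p 0 \<omega>)) \<in> borel_measurable M"
      using Xm[OF _ T0] Ym[OF _ T0] by (auto intro!: config_measurable)
    ultimately have "prob ((\<lambda>\<omega>. config R (\<lambda>p. X p 0 \<omega>)) -` A \<inter> space M) = prob ((\<lambda>\<omega>. config R (\<lambda>p. Y p 0 \<omega>)) -` A \<inter> space M)"
      using measurable_sets[OF m(1) A] measurable_sets[OF m(2) A]
      by (intro finite_measure_eq_AE) (auto elim!: eventually_mono)
    then show ?thesis using True pos by (simp add: sum_nonneg)
  next
    case False
    define s where "s = max 0 (t - \<delta>)"
    have st: "0 \<le> s" "s < t" "t \<le> T" using t False \<delta> by (auto simp: s_def)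
    have sT: "s \<in> {0..T}" using st by auto
    have T0: "0 \<in> {0..T}" using st by auto
    have dX: "AE \<omega> in M. norm (X p s \<omega> - X p 0 \<omega> - c p *\<^sub>R (W p s \<omega> - W p 0 \<omega>)) \<le> B1 * (s - 0)" if "p \<in> R" for p
      by (rule conjunct2[OF X[unfolded drift_process_def], rule_format, OF that T0]) (use sT in simp)
    have dY: "AE \<omega> in M. norm (Y p s \<omega> - Y p 0 \<omega> - c p *\<^sub>R (W p s \<omega> - W p 0 \<omega>)) \<le> B2 * (s - 0)" if "p \<in> R" for p
      by (rule conjunct2[OF Y[unfolded drift_process_def], rule_format, OF that T0]) (use sT in simp)
    have int: "integrable M (\<lambda>\<omega>. norm (X p s \<omega> - Y p s \<omega>))" if p: "p \<in> R" for p
    proof (rule integrable_const_bound[where B="(B1 + B2) * s"])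
      show "AE \<omega> in M. norm (norm (X p s \<omega> - Y p s \<omega>)) \<le> (B1 + B2) * s"
        using dX[OF p] dY[OF p] start[OF p]
      proof eventually_elim
        case (elim \<omega>)
        have "X p s \<omega> - Y p s \<omega> = (X p s \<omega> - X p 0 \<omega> - c p *\<^sub>R (W p s \<omega> - W p 0 \<omega>)) - (Y p s \<omega> - Y p 0 \<omega> - c p *\<^sub>R (W p s \<omega> - W p 0 \<omega>))"
          using elim(3) by simp
        then have "norm (X p s \<omega> - Y p s \<omega>) \<le> B1 * s + B2 * s"
          using elim(1,2) norm_triangle_ineq4[of "X p s \<omega> - X p 0 \<omega> - c p *\<^sub>R (W p s \<omega> - W p 0 \<omega>)" "Y p s \<omega> - Y p 0 \<omega> - c p *\<^sub>R (W p s \<omega> - W p 0 \<omega>)"]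
          by simp
        then show ?case by (simp add: distrib_right)
      qed
    qed (use Xm[OF p sT] Ym[OF p sT] in auto)
    have "\<bar>prob ((\<lambda>\<omega>. config R (\<lambda>p. X p t \<omega>)) -` A \<inter> space M) - prob ((\<lambda>\<omega>. config R (\<lambda>p. Y p t \<omega>)) -` A \<inter> space M)\<bar>
     \<le> (\<Sum>p\<in>R. (6 * (B1 + B2) * sqrt (t - s) + 2 * expectation (\<lambda>\<omega>. norm (X p s \<omega> - Y p s \<omega>)) / sqrt (t - s)) / c p)"
      by (rule tv_drift_processes[OF st c B X Y int A])
    also have "\<dots> \<le> (\<Sum>p\<in>R. (6 * (B1 + B2) * sqrt \<delta> + 2 * e / sqrt \<delta>) / c p)"
    proof (intro sum_mono divide_right_mono add_mono mult_left_mono)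
      fix p assume p: "p \<in> R"
      show "0 \<le> c p" using c[OF p] by simp
      show "sqrt (t - s) \<le> sqrt \<delta>" by (simp add: s_def)
      show "2 * expectation (\<lambda>\<omega>. norm (X p s \<omega> - Y p s \<omega>)) / sqrt (t - s) \<le> 2 * e / sqrt \<delta>"
      proof (cases "t \<le> \<delta>")
        case True
        then have s0: "s = 0" by (simp add: s_def)
        have "expectation (\<lambda>\<omega>. norm (X p s \<omega> - Y p s \<omega>)) = expectation (\<lambda>\<omega>. 0)"
          using start[OF p] Xm[OF p T0] Ym[OF p T0] unfolding s0 by (intro integral_cong_AE) (auto elim!: eventually_mono)
        then show ?thesis using e0 \<delta> by simp
      next
        case F: False
        then have "t - s = \<delta>" "0 < s" "s < T" using st by (auto simp: s_def)
        then show ?thesis using e[OF p] \<delta> by (simp add: divide_right_mono)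
      qed
    qed (use B in auto)
    finally show ?thesis .
  qed
qed

text \<open>Product events become Borel events of configurations, because extension by zero and restriction are inverse to
each other on the relevant coordinates.\<close>

lemma config_event:
  fixes A :: "('p::countable \<Rightarrow> 'a::euclidean_space) set"
  assumes "A \<in> sets (PiM R (\<lambda>_. lborel))"
  shows "\<exists>A'\<in>sets borel. \<forall>x. config R x \<in> A' \<longleftrightarrow> (\<lambda>p\<in>R. x p) \<in> A"
proof
  have "(\<lambda>f :: 'p \<Rightarrow> 'a. \<lambda>p\<in>R. f p) \<in> borel \<rightarrow>\<^sub>M PiM R (\<lambda>_. lborel)"
    by (rule measurable_restrict) (auto intro!: borel_measurable_continuous_onI)
  from measurable_sets[OF this assms] show "(\<lambda>f :: 'p \<Rightarrow> 'a. \<lambda>p\<in>R. f p) -` A \<in> sets borel" by simp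
  have "(\<lambda>p\<in>R. config R x p) = (\<lambda>p\<in>R. x p)" for x :: "'p \<Rightarrow> 'a" by (auto simp: config_def restrict_def)
  then show "\<forall>x. config R x \<in> (\<lambda>f :: 'p \<Rightarrow> 'a. \<lambda>p\<in>R. f p) -` A \<longleftrightarrow> (\<lambda>p\<in>R. x p) \<in> A" by simp
qed

lemma distributed_cong_AE:
  assumes "distributed M N X f" "AE \<omega> in M. X \<omega> = Y \<omega>" "Y \<in> M \<rightarrow>\<^sub>M N"
  shows "distributed M N Y f"
proof -
  have "distr M N X = distr M N Y"
    using assms by (intro distr_cong_AE) (auto simp: distributed_def)
  then show ?thesis using assms by (simp add: distributed_def)
qed

text \<open>The constant is chosen before the solution: the solution enters only through the bound on its norm.\<close>

lemma solution_lipschitz_constant: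
  fixes u0 :: "'n::finite \<Rightarrow> 'a::euclidean_space \<Rightarrow> real"
  assumes s: "s > real DIM('a) / 2 + 2" and init: "initial_data s u0" and C0: "C0 > 0"
  shows "\<exists>\<Lambda>\<ge>0. \<forall>v :: real \<Rightarrow> 'n \<Rightarrow> 'a \<Rightarrow> real. solution_bounds T s C0 u0 v \<longrightarrow> (\<forall>t\<in>{0..T}. \<forall>i. continuous_on UNIV (v t i)) \<longrightarrow>
     (AE t in lborel. t \<in> {0..T} \<longrightarrow> (\<forall>i x y. \<bar>v t i x - v t i y\<bar> \<le> \<Lambda> * norm (x - y)))"
proof -
  have s1: "s > real DIM('a) / 2 + 1" using s by simp
  obtain C where C': "C > 0 \<and> (\<forall>(f :: 'a \<Rightarrow> real) A. continuous_on UNIV f \<longrightarrow> integrable lborel f \<longrightarrow> A > 0 \<longrightarrow>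
     Hs_sq s f \<le> ennreal (A\<^sup>2) \<longrightarrow> (\<forall>x y. \<bar>f x - f y\<bar> \<le> C * A * norm (x - y)))"
    using sobolev_lipschitz[OF s1] ..
  note C = conjunct1[OF C'] conjunct2[OF C', rule_format]
  have "Hs_norm s u0 < \<infinity>" using init by (simp add: initial_data_def)
  then obtain h where h: "h \<ge> 0" "Hs_norm s u0 = ennreal h" by (cases "Hs_norm s u0") auto
  define A where "A = C0 * h + 1"
  have A: "A > 0" using C0 h by (simp add: A_def add_nonneg_pos)
  show ?thesis
  proof (intro exI[of _ "C * A"] conjI allI impI)
    show "0 \<le> C * A" using C A by simp
    fix v :: "real \<Rightarrow> 'n \<Rightarrow> 'a \<Rightarrow> real"
    assume b: "solution_bounds T s C0 u0 v" and c: "\<forall>t\<in>{0..T}. \<forall>i. continuous_on UNIV (v t i)"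
    have "time_Linf T (\<lambda>t. Hs_norm s (v t)) + 0 \<le> time_Linf T (\<lambda>t. Hs_norm s (v t)) + time_L2 T (\<lambda>t. Hs_norm (s + 1) (v t))"
      by (rule add_left_mono) simp
    also have "\<dots> \<le> ennreal C0 * ennreal h" using b h unfolding solution_bounds_def by simp
    also have "\<dots> \<le> ennreal A" using C0 h by (simp add: A_def ennreal_mult'[symmetric] ennreal_leI)
    finally have "time_Linf T (\<lambda>t. Hs_norm s (v t)) \<le> ennreal A" by simp
    then have "AE t in lborel. t \<in> {0<..<T} \<longrightarrow> Hs_norm s (v t) \<le> ennreal A" by (rule AE_le_of_time_Linf)
    moreover have "AE t in lborel. t \<noteq> 0" "AE t in lborel. t \<noteq> T" by (rule AE_lborel_singleton)+
    ultimately show "AE t in lborel. t \<in> {0..T} \<longrightarrow> (\<forall>i x y. \<bar>v t i x - v t i y\<bar> \<le> C * A * norm (x - y))"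
    proof eventually_elim
      case (elim t)
      show ?case
      proof (intro impI allI)
        fix i x y assume t: "t \<in> {0..T}"
        then have "Hs_norm s (v t) \<le> ennreal A" using elim by auto
        then have "Hs_sq s (v t i) \<le> ennreal (A\<^sup>2)" using A by (intro Hs_norm_component) auto
        moreover have "integrable lborel (v t i)"
          using b t unfolding solution_bounds_def by (auto simp: has_bochner_integral_iff)
        ultimately show "\<bar>v t i x - v t i y\<bar> \<le> C * A * norm (x - y)"
          by (intro C(2) A) (use c t in auto)
      qed
    qed
  qed
qed

lemma C_2_differentiable: "C_k 2 f \<Longrightarrow> f differentiable (at x)" and C_2_continuous: "C_k 2 f \<Longrightarrow> continuous_on UNIV f"
  by (auto simp: numeral_2_eq_2 intro!: continuous_at_imp_continuous_on differentiable_imp_continuous_within)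

lemma solution_C2: "solution T s \<sigma> B u0 v \<Longrightarrow> t \<in> {0..T} \<Longrightarrow> C_k 2 (v t i)"
  unfolding solution_def by (elim conjE) (drule bspec, assumption, erule spec)

lemma solution_measurable:
  "solution T s \<sigma> B u0 v \<Longrightarrow> (\<lambda>(t, x). v t i x) \<in> borel_measurable (restrict_space lborel {0..T} \<Otimes>\<^sub>M lborel)"
  unfolding solution_def by (elim conjE) (erule spec)

lemma solution_bounds_density:
  assumes "solution_bounds T s C0 u0 v" "t \<in> {0..T}"
  shows "0 \<le> v t i x" "has_bochner_integral lborel (v t i) 1"
proof -
  have "(\<forall>x. 0 \<le> v t i x) \<and> has_bochner_integral lborel (v t i) 1"
    by (rule spec[where x=i], rule bspec[OF conjunct1[OF assms(1)[unfolded solution_bounds_def]] assms(2)])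
  then show "0 \<le> v t i x" "has_bochner_integral lborel (v t i) 1" by simp_all
qed

text \<open>The setting of the theorem, together with a Lipschitz constant \<open>\<Lambda>\<close> common to all solutions that satisfy the
bounds.  It is a parameter, since the constants of the theorem are chosen before the solutions.\<close>

locale chaos =
  fixes T s sigma_min C0 C2 C3 \<epsilon>1 \<Lambda> :: real
    and K :: "'n::finite \<Rightarrow> 'n \<Rightarrow> real"
    and u0 :: "'n \<Rightarrow> 'a::euclidean_space \<Rightarrow> real"
    and \<sigma> :: "'n \<Rightarrow> real" and V :: "'n \<Rightarrow> 'n \<Rightarrow> 'a \<Rightarrow> real" and a :: "'n \<Rightarrow> 'n \<Rightarrow> real"
    and u :: "real \<Rightarrow> 'n \<Rightarrow> 'a \<Rightarrow> real" and u_eta :: "real \<Rightarrow> real \<Rightarrow> 'n \<Rightarrow> 'a \<Rightarrow> real"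
    and M :: "'w measure" and F :: "real \<Rightarrow> 'w measure"
    and W :: "'n \<Rightarrow> nat \<Rightarrow> real \<Rightarrow> 'w \<Rightarrow> 'a" and \<zeta> :: "'n \<Rightarrow> nat \<Rightarrow> 'w \<Rightarrow> 'a"
    and X :: "real \<Rightarrow> nat \<Rightarrow> 'n \<Rightarrow> nat \<Rightarrow> real \<Rightarrow> 'w \<Rightarrow> 'a"
    and Xbar :: "real \<Rightarrow> 'n \<Rightarrow> nat \<Rightarrow> real \<Rightarrow> 'w \<Rightarrow> 'a" and Xhat :: "'n \<Rightarrow> nat \<Rightarrow> real \<Rightarrow> 'w \<Rightarrow> 'a"
    and uN :: "real \<Rightarrow> nat \<Rightarrow> real \<Rightarrow> ('n \<times> nat \<Rightarrow> 'a) \<Rightarrow> real"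
  assumes T: "T > 0" and C3: "C3 > 0" and C2: "C2 > 0"
    and moment: "\<And>i. integrable lborel (\<lambda>x. u0 i x * (norm x)\<^sup>2)"
    and init: "initial_data s u0"
    and pot: "potentials sigma_min K \<sigma> V a"
    and fil: "filtered_prob_space M F"
    and noise: "driving_noise M F u0 W \<zeta>"
    and sys: "particle_systems M F T \<sigma> V a u u_eta W \<zeta> X Xbar Xhat"
    and joint: "joint_density M T \<sigma> V u0 X uN"
    and A1: "assumption_A1 T s C0 u0 \<sigma> V a u u_eta"
    and A2: "assumption_A2 T C2 u u_eta"
    and A3: "assumption_A3 M T \<epsilon>1 C3 X Xbar Xhat"
    and \<Lambda>0: "0 \<le> \<Lambda>"
    and \<Lambda>: "\<And>v :: real \<Rightarrow> 'n \<Rightarrow> 'a \<Rightarrow> real. solution_bounds T s C0 u0 v \<Longrightarrow> (\<forall>t\<in>{0..T}. \<forall>i. continuous_on UNIV (v t i)) \<Longrightarrow>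
     (AE t in lborel. t \<in> {0..T} \<longrightarrow> (\<forall>i x y. \<bar>v t i x - v t i y\<bar> \<le> \<Lambda> * norm (x - y)))"
begin

sublocale prob_space M using fil by (simp add: filtered_prob_space_def)

definition "ball_vol = measure lborel (ball (0::'a) 1)"
definition "K_sum = (\<Sum>i\<in>UNIV. \<Sum>j\<in>UNIV. K i j)"
text \<open>A bound for the limiting and the intermediate drift alike; the factor 2 comes from the limiting one, where the total mass
\<open>a i j\<close> is bounded by \<open>2 * K i j * ball_vol\<close>.\<close>

definition "drift_bound = 2 * \<Lambda> * ball_vol * K_sum"
definition "c p = sqrt (2 * \<sigma> (fst p))" for p :: "'n \<times> nat"
definition "W_at p = W (fst p) (snd p)"
definition "X_at \<eta> N p = X \<eta> N (fst p) (snd p)"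
definition "Xbar_at \<eta> p = Xbar \<eta> (fst p) (snd p)"
definition "Xhat_at p = Xhat (fst p) (snd p)"

lemma sigma_ge: "sigma_min \<le> \<sigma> i" and sigma_min_pos: "0 < sigma_min" and sigma_pos: "0 < \<sigma> i"
proof -
  have m: "sigma_min = Min (range \<sigma>)" and p: "\<And>i. \<sigma> i > 0" using pot by (auto simp: potentials_def)
  show "sigma_min \<le> \<sigma> i" unfolding m by (rule Min_le) auto
  have "Min (range \<sigma>) \<in> range \<sigma>" by (rule Min_in) auto
  then show "0 < sigma_min" unfolding m using p by auto
  show "0 < \<sigma> i" by (rule p)
qed

lemma c_pos: "c p > 0" using sigma_pos[of "fst p"] by (simp add: c_def)

lemma potential: "potential (V i j) (K i j)"
  using pot by (auto simp: potentials_def potential_def)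

lemma K_nonneg: "0 \<le> K i j" by (rule potential.K_nonneg[OF potential])

lemma K_row_le: "(\<Sum>j\<in>UNIV. K i j) \<le> K_sum"
  unfolding K_sum_def by (rule member_le_sum) (auto intro: sum_nonneg K_nonneg)

lemma K_sum_nonneg: "0 \<le> K_sum" unfolding K_sum_def by (intro sum_nonneg K_nonneg)

lemma ball_vol_nonneg: "0 \<le> ball_vol" by (simp add: ball_vol_def)

lemma drift_bound_nonneg: "0 \<le> drift_bound" unfolding drift_bound_def using \<Lambda>0 ball_vol_nonneg K_sum_nonneg by simp

text \<open>The mass \<open>a i j\<close> is not a parameter of the constants, so it has to be expressed through \<open>K\<close>.\<close>

lemma a_bound: "0 \<le> a i j" "a i j \<le> 2 * K i j * ball_vol"
proof -
  have "has_bochner_integral lborel (V i j) (a i j)" "0 \<le> a i j" using pot by (auto simp: potentials_def)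
  then show "0 \<le> a i j" "a i j \<le> 2 * K i j * ball_vol"
    using potential.integral_V_le[OF potential[of i j]] by (auto simp: has_bochner_integral_iff ball_vol_def)
qed

lemma u_solution: "solution T s \<sigma> (local_field a) u0 u" "solution_bounds T s C0 u0 u"
  by (rule conjunct1[OF conjunct1[OF A1[unfolded assumption_A1_def unique_solution_def]]]
    conjunct1[OF conjunct2[OF A1[unfolded assumption_A1_def]]])+

lemma u_eta_solution:
  assumes "\<eta> > 0" shows "solution T s \<sigma> (nonlocal_field \<eta> V) u0 (u_eta \<eta>)" "solution_bounds T s C0 u0 (u_eta \<eta>)"
proof -
  have "unique_solution T s \<sigma> (nonlocal_field \<eta> V) u0 (u_eta \<eta>) \<and> solution_bounds T s C0 u0 (u_eta \<eta>)"
    using A1 assms unfolding assumption_A1_def by (elim conjE) (erule allE, erule (1) mp)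
  note h = this
  show "solution T s \<sigma> (nonlocal_field \<eta> V) u0 (u_eta \<eta>)" "solution_bounds T s C0 u0 (u_eta \<eta>)"
    by (rule conjunct1[OF conjunct1[OF h[unfolded unique_solution_def]]] conjunct2[OF h])+
qed

lemma u_facts:
  assumes "t \<in> {0..T}"
  shows "0 \<le> u t i x" "has_bochner_integral lborel (u t i) 1" "C_k 2 (u t i)"
  by (rule solution_bounds_density[OF u_solution(2) assms] solution_C2[OF u_solution(1) assms])+

lemma u_eta_facts:
  assumes "\<eta> > 0" "t \<in> {0..T}"
  shows "0 \<le> u_eta \<eta> t i x" "has_bochner_integral lborel (u_eta \<eta> t i) 1" "C_k 2 (u_eta \<eta> t i)"
  by (rule solution_bounds_density[OF u_eta_solution(2)[OF assms(1)] assms(2)] solution_C2[OF u_eta_solution(1)[OF assms(1)] assms(2)])+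

lemma u_measurable: "t \<in> {0..T} \<Longrightarrow> u t i \<in> borel_measurable borel"
  using C_2_continuous[OF u_facts(3)] by (rule borel_measurable_continuous_onI)

lemma u_eta_measurable: "\<eta> > 0 \<Longrightarrow> t \<in> {0..T} \<Longrightarrow> u_eta \<eta> t i \<in> borel_measurable borel"
  using C_2_continuous[OF u_eta_facts(3)] by (rule borel_measurable_continuous_onI)

lemma local_field_bound:
  "AE t in lborel. t \<in> {0..T} \<longrightarrow> (\<forall>i x. norm (local_field a (u t) i x) \<le> drift_bound)"
proof -
  have "AE t in lborel. t \<in> {0..T} \<longrightarrow> (\<forall>i x y. \<bar>u t i x - u t i y\<bar> \<le> \<Lambda> * norm (x - y))"
    by (rule \<Lambda>) (use u_solution(2) C_2_continuous[OF u_facts(3)] in blast)+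
  then show ?thesis
  proof eventually_elim
    case (elim t)
    show ?case
    proof (intro impI allI)
      fix i x assume t: "t \<in> {0..T}"
      have g: "norm (grad (u t j) x) \<le> \<Lambda>" for j
        by (rule norm_grad_le_lipschitz) (use elim t \<Lambda>0 C_2_differentiable[OF u_facts(3)[OF t]] in auto)
      have "norm (local_field a (u t) i x) \<le> (\<Sum>j\<in>UNIV. 2 * K i j * ball_vol * \<Lambda>)"
        unfolding local_field_def
      proof (rule sum_norm_le)
        fix j
        have "norm (a i j *\<^sub>R grad (u t j) x) = a i j * norm (grad (u t j) x)" using a_bound(1)[of i j] by simp
        also have "\<dots> \<le> (2 * K i j * ball_vol) * \<Lambda>"
          using a_bound[of i j] g[of j] K_nonneg[of i j] ball_vol_nonneg by (intro mult_mono) auto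
        finally show "norm (a i j *\<^sub>R grad (u t j) x) \<le> 2 * K i j * ball_vol * \<Lambda>" .
      qed
      also have "\<dots> = 2 * \<Lambda> * ball_vol * (\<Sum>j\<in>UNIV. K i j)" by (simp add: sum_distrib_left mult_ac)
      also have "\<dots> \<le> drift_bound" unfolding drift_bound_def using K_row_le[of i] \<Lambda>0 ball_vol_nonneg by (intro mult_left_mono) auto
      finally show "norm (local_field a (u t) i x) \<le> drift_bound" .
    qed
  qed
qed

lemma nonlocal_field_bound:
  assumes \<eta>: "\<eta> > 0"
  shows "AE t in lborel. t \<in> {0..T} \<longrightarrow> (\<forall>i x. norm (nonlocal_field \<eta> V (u_eta \<eta> t) i x) \<le> drift_bound)"
proof -
  have "AE t in lborel. t \<in> {0..T} \<longrightarrow> (\<forall>i x y. \<bar>u_eta \<eta> t i x - u_eta \<eta> t i y\<bar> \<le> \<Lambda> * norm (x - y))"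
    by (rule \<Lambda>) (use u_eta_solution(2)[OF \<eta>] C_2_continuous[OF u_eta_facts(3)[OF \<eta>]] in blast)+
  then show ?thesis
  proof eventually_elim
    case (elim t)
    show ?case
    proof (intro impI allI)
      fix i x assume t: "t \<in> {0..T}"
      have "norm (nonlocal_field \<eta> V (u_eta \<eta> t) i x) \<le> (\<Sum>j\<in>UNIV. \<Lambda> * K i j * ball_vol)"
        unfolding nonlocal_field_def ball_vol_def
      proof (rule sum_norm_le)
        fix j
        show "norm (conv (grad (scaled \<eta> (V i j))) (u_eta \<eta> t j) x) \<le> \<Lambda> * K i j * measure lborel (ball (0::'a) 1)"
          by (rule potential.conv_lipschitz_bound[OF potential \<eta> _ \<Lambda>0])
            (use elim t u_eta_facts(2)[OF \<eta> t] in \<open>auto simp: has_bochner_integral_iff\<close>)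
      qed
      also have "\<dots> = \<Lambda> * ball_vol * (\<Sum>j\<in>UNIV. K i j)" by (simp add: sum_distrib_left mult_ac)
      also have "\<dots> \<le> \<Lambda> * ball_vol * K_sum" using K_row_le[of i] \<Lambda>0 ball_vol_nonneg by (intro mult_left_mono) auto
      also have "\<dots> \<le> drift_bound" unfolding drift_bound_def using \<Lambda>0 ball_vol_nonneg K_sum_nonneg by simp
      finally show "norm (nonlocal_field \<eta> V (u_eta \<eta> t) i x) \<le> drift_bound" .
    qed
  qed
qed

lemma interaction_bound:
  assumes \<eta>: "\<eta> > 0"
  shows "norm (interaction \<eta> V N x i y) \<le> \<eta> powr (- real DIM('a)) / \<eta> * K_sum"
proof -
  have "norm (interaction \<eta> V N x i y) \<le> (\<Sum>j\<in>UNIV. \<eta> powr (- real DIM('a)) / \<eta> * K i j)"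
    unfolding interaction_def
  proof (rule sum_norm_le)
    fix j
    have k: "0 \<le> \<eta> powr (- real DIM('a)) / \<eta> * K i j" using \<eta> K_nonneg[of i j] by simp
    have "norm ((1 / real N) *\<^sub>R (\<Sum>l\<in>{1..N}. grad (scaled \<eta> (V i j)) (y - x (j, l)))) \<le>
       1 / real N * (\<Sum>l\<in>{1..N}. \<eta> powr (- real DIM('a)) / \<eta> * K i j)"
      unfolding norm_scaleR
      by (intro mult_mono sum_norm_le potential.grad_scaled_bound[OF potential \<eta>]) (use k in auto)
    also have "\<dots> \<le> \<eta> powr (- real DIM('a)) / \<eta> * K i j" using k by (cases "N = 0") auto
    finally show "norm ((1 / real N) *\<^sub>R (\<Sum>l\<in>{1..N}. grad (scaled \<eta> (V i j)) (y - x (j, l)))) \<le> \<eta> powr (- real DIM('a)) / \<eta> * K i j" .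
  qed
  also have "\<dots> = \<eta> powr (- real DIM('a)) / \<eta> * (\<Sum>j\<in>UNIV. K i j)" by (simp add: sum_distrib_left)
  also have "\<dots> \<le> \<eta> powr (- real DIM('a)) / \<eta> * K_sum" using K_row_le[of i] \<eta> by (intro mult_left_mono) auto
  finally show ?thesis .
qed

lemma scaled_lipschitz:
  assumes \<eta>: "\<eta> > 0"
  shows "\<exists>L. (\<forall>i j. 0 \<le> L i j) \<and> (\<forall>i j x y. norm (grad (scaled \<eta> (V i j)) x - grad (scaled \<eta> (V i j)) y) \<le> L i j * norm (x - y))"
  using potential.grad_scaled_lipschitz[OF potential \<eta>] by metis

lemma interaction_lipschitz:
  assumes \<eta>: "\<eta> > 0"
  shows "\<exists>L\<ge>0. \<forall>i k x y. (i, k) \<in> slots (\<lambda>_. N) \<longrightarrow>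
    norm (- interaction \<eta> V N x i (x (i, k)) - - interaction \<eta> V N y i (y (i, k))) \<le> L * (\<Sum>q\<in>slots (\<lambda>_. N). norm (x q - y q))"
proof -
  obtain L where L': "(\<forall>i j. 0 \<le> L i j) \<and> (\<forall>i j x y. norm (grad (scaled \<eta> (V i j)) x - grad (scaled \<eta> (V i j)) y) \<le> L i j * norm (x - y))"
    using scaled_lipschitz[OF \<eta>] ..
  note L = conjunct1[OF L', rule_format] conjunct2[OF L', rule_format]
  have fin: "finite (slots (\<lambda>_::'n. N))" by (simp add: slots_def)
  show ?thesis
  proof (intro exI[of _ "\<Sum>i\<in>UNIV. \<Sum>j\<in>UNIV. 2 * L i j"] conjI allI impI)
    show "0 \<le> (\<Sum>i\<in>UNIV. \<Sum>j\<in>UNIV. 2 * L i j)" using L(1) by (intro sum_nonneg) auto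
    fix i k and x y :: "'n \<times> nat \<Rightarrow> 'a" assume ik: "(i, k) \<in> slots (\<lambda>_::'n. N)"
    define S where "S = (\<Sum>q\<in>slots (\<lambda>_. N). norm (x q - y q))"
    have S0: "0 \<le> S" unfolding S_def by (rule sum_nonneg) simp
    have Sq: "norm (x q - y q) \<le> S" if "q \<in> slots (\<lambda>_. N)" for q
      unfolding S_def by (rule member_le_sum[OF that _ fin]) simp
    have N: "N \<noteq> 0" using ik by (auto simp: slots_def)
    have "norm (- interaction \<eta> V N x i (x (i, k)) - - interaction \<eta> V N y i (y (i, k))) =
      norm (\<Sum>j\<in>UNIV. (1 / real N) *\<^sub>R (\<Sum>l\<in>{1..N}. grad (scaled \<eta> (V i j)) (x (i, k) - x (j, l)) - grad (scaled \<eta> (V i j)) (y (i, k) - y (j, l))))"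
      unfolding interaction_def by (simp add: sum_subtractf scaleR_diff_right norm_minus_commute)
    also have "\<dots> \<le> (\<Sum>j\<in>UNIV. 2 * L i j * S)"
    proof (rule sum_norm_le)
      fix j
      have "norm (\<Sum>l\<in>{1..N}. grad (scaled \<eta> (V i j)) (x (i, k) - x (j, l)) - grad (scaled \<eta> (V i j)) (y (i, k) - y (j, l))) \<le> (\<Sum>l\<in>{1..N}. 2 * L i j * S)"
      proof (rule sum_norm_le)
        fix l assume l: "l \<in> {1..N}"
        have jl: "(j, l) \<in> slots (\<lambda>_. N)" using l by (simp add: slots_def)
        have "norm (grad (scaled \<eta> (V i j)) (x (i, k) - x (j, l)) - grad (scaled \<eta> (V i j)) (y (i, k) - y (j, l)))
          \<le> L i j * norm ((x (i, k) - x (j, l)) - (y (i, k) - y (j, l)))" by (rule L(2))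
        also have "(x (i, k) - x (j, l)) - (y (i, k) - y (j, l)) = (x (i, k) - y (i, k)) - (x (j, l) - y (j, l))" by simp
        also have "L i j * norm \<dots> \<le> L i j * (S + S)"
          using norm_triangle_ineq4[of "x (i, k) - y (i, k)" "x (j, l) - y (j, l)"] Sq[OF ik] Sq[OF jl] L(1)[of i j]
          by (intro mult_left_mono) auto
        finally show "norm (grad (scaled \<eta> (V i j)) (x (i, k) - x (j, l)) - grad (scaled \<eta> (V i j)) (y (i, k) - y (j, l))) \<le> 2 * L i j * S" by simp
      qed
      then show "norm ((1 / real N) *\<^sub>R (\<Sum>l\<in>{1..N}. grad (scaled \<eta> (V i j)) (x (i, k) - x (j, l)) - grad (scaled \<eta> (V i j)) (y (i, k) - y (j, l)))) \<le> 2 * L i j * S"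
        using N by (simp add: divide_simps mult_ac)
    qed
    also have "\<dots> = (\<Sum>j\<in>UNIV. 2 * L i j) * S" by (simp add: sum_distrib_right)
    also have "\<dots> \<le> (\<Sum>i\<in>UNIV. \<Sum>j\<in>UNIV. 2 * L i j) * S"
      by (intro mult_right_mono S0 member_le_sum[of i UNIV "\<lambda>i. \<Sum>j\<in>UNIV. 2 * L i j"]) (use L(1) in \<open>auto intro!: sum_nonneg\<close>)
    finally show "norm (- interaction \<eta> V N x i (x (i, k)) - - interaction \<eta> V N y i (y (i, k))) \<le> (\<Sum>i\<in>UNIV. \<Sum>j\<in>UNIV. 2 * L i j) * (\<Sum>q\<in>slots (\<lambda>_. N). norm (x q - y q))"
      by (simp add: S_def)
  qed
qed

text \<open>The Lipschitz constant may degenerate as \<open>\<eta>\<close> tends to zero; only measurability of the solution depends on it.\<close>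

lemma nonlocal_lipschitz:
  assumes \<eta>: "\<eta> > 0"
  shows "\<exists>L\<ge>0. \<forall>t\<in>{0..T}. \<forall>i x y. norm (- nonlocal_field \<eta> V (u_eta \<eta> t) i x - - nonlocal_field \<eta> V (u_eta \<eta> t) i y) \<le> L * norm (x - y)"
proof -
  obtain L where L': "(\<forall>i j. 0 \<le> L i j) \<and> (\<forall>i j x y. norm (grad (scaled \<eta> (V i j)) x - grad (scaled \<eta> (V i j)) y) \<le> L i j * norm (x - y))"
    using scaled_lipschitz[OF \<eta>] ..
  note L = conjunct1[OF L', rule_format] conjunct2[OF L', rule_format]
  show ?thesis
  proof (intro exI[of _ "\<Sum>i\<in>UNIV. \<Sum>j\<in>UNIV. L i j"] conjI ballI allI)
    show "0 \<le> (\<Sum>i\<in>UNIV. \<Sum>j\<in>UNIV. L i j)" using L(1) by (intro sum_nonneg) auto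
    fix t i and x y :: 'a assume t: "t \<in> {0..T}"
    have "norm (- nonlocal_field \<eta> V (u_eta \<eta> t) i x - - nonlocal_field \<eta> V (u_eta \<eta> t) i y) =
      norm (\<Sum>j\<in>UNIV. conv (grad (scaled \<eta> (V i j))) (u_eta \<eta> t j) x - conv (grad (scaled \<eta> (V i j))) (u_eta \<eta> t j) y)"
      unfolding nonlocal_field_def by (simp add: sum_subtractf norm_minus_commute)
    also have "\<dots> \<le> (\<Sum>j\<in>UNIV. L i j * norm (x - y))"
      by (rule sum_norm_le) (rule potential.conv_lipschitz[OF potential \<eta> L(2) u_eta_facts(2)[OF \<eta> t] u_eta_facts(1)[OF \<eta> t]])
    also have "\<dots> = (\<Sum>j\<in>UNIV. L i j) * norm (x - y)" by (simp add: sum_distrib_right)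
    also have "\<dots> \<le> (\<Sum>i\<in>UNIV. \<Sum>j\<in>UNIV. L i j) * norm (x - y)"
      by (intro mult_right_mono member_le_sum[of i UNIV "\<lambda>i. \<Sum>j\<in>UNIV. L i j"]) (use L(1) in \<open>auto intro!: sum_nonneg\<close>)
    finally show "norm (- nonlocal_field \<eta> V (u_eta \<eta> t) i x - - nonlocal_field \<eta> V (u_eta \<eta> t) i y) \<le> (\<Sum>i\<in>UNIV. \<Sum>j\<in>UNIV. L i j) * norm (x - y)" .
  qed
qed

lemma nonlocal_integrable:
  assumes \<eta>: "\<eta> > 0"
  shows "set_integrable lborel {0..T} (\<lambda>t. - nonlocal_field \<eta> V (u_eta \<eta> t) i x)"
proof -
  have um: "(\<lambda>(t, x). u_eta \<eta> t j x) \<in> borel_measurable (restrict_space lborel {0..T} \<Otimes>\<^sub>M lborel)" for j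
    by (rule solution_measurable[OF u_eta_solution(1)[OF \<eta>]])
  have "(\<lambda>t. conv (grad (scaled \<eta> (V i j))) (u_eta \<eta> t j) x) \<in> borel_measurable (restrict_space lborel {0..T})" for j
  proof -
    have [measurable]: "grad (scaled \<eta> (V i j)) \<in> borel_measurable borel" by (rule potential.measurable_grad_scaled[OF potential \<eta>])
    have [measurable]: "(\<lambda>p. u_eta \<eta> (fst p) j (snd p)) \<in> borel_measurable (restrict_space lborel {0..T} \<Otimes>\<^sub>M lborel)"
      using um[of j] by (simp add: split_beta')
    show ?thesis
      unfolding conv_def by (rule lborel.borel_measurable_lebesgue_integral) (simp add: split_beta', measurable)
  qed
  then have "(\<lambda>t. - nonlocal_field \<eta> V (u_eta \<eta> t) i x) \<in> borel_measurable (restrict_space lborel {0..T})"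
    unfolding nonlocal_field_def by (intro borel_measurable_uminus borel_measurable_sum)
  then have m: "(\<lambda>t. indicat_real {0..T} t *\<^sub>R (- nonlocal_field \<eta> V (u_eta \<eta> t) i x)) \<in> borel_measurable lborel"
    by (subst (asm) borel_measurable_restrict_space_iff) auto
  have ii: "integrable lborel (\<lambda>t. indicat_real {0..T} t * drift_bound)"
    using T by (intro integrable_mult_left integrable_real_indicator) auto
  show ?thesis
    unfolding set_integrable_def
  proof (rule Bochner_Integration.integrable_bound[OF ii m])
    show "AE t in lborel. norm (indicat_real {0..T} t *\<^sub>R (- nonlocal_field \<eta> V (u_eta \<eta> t) i x)) \<le> norm (indicat_real {0..T} t * drift_bound)"
      using nonlocal_field_bound[OF \<eta>] by eventually_elim (use drift_bound_nonneg in \<open>auto simp: indicator_def\<close>)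
  qed
qed

end

section \<open>Drift and joint laws of the particles\<close>

text \<open>Young's inequality \<open>D \<le> q / 2 + D\<^sup>2 / (2 q)\<close>, integrated.\<close>

lemma (in prob_space) nn_integral_le_of_second_moment:
  assumes [measurable]: "D \<in> borel_measurable M" and D0: "\<And>\<omega>. 0 \<le> D \<omega>" and q: "q > 0"
    and sq: "(\<integral>\<^sup>+\<omega>. ennreal ((D \<omega>)\<^sup>2) \<partial>M) \<le> ennreal (q\<^sup>2)"
  shows "(\<integral>\<^sup>+\<omega>. ennreal (D \<omega>) \<partial>M) \<le> ennreal q"
proof -
  have pt: "ennreal (D \<omega>) \<le> ennreal (q / 2) + ennreal (1 / (2 * q)) * ennreal ((D \<omega>)\<^sup>2)" for \<omega>
  proof -
    have "0 \<le> (D \<omega> - q)\<^sup>2 / q" using q by simp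
    also have "\<dots> = (D \<omega>)\<^sup>2 / q - 2 * D \<omega> + q" using q by (simp add: power2_eq_square field_simps)
    finally have "D \<omega> \<le> q / 2 + 1 / (2 * q) * (D \<omega>)\<^sup>2" by simp
    then show ?thesis using q by (simp add: ennreal_mult'[symmetric] ennreal_plus[symmetric] ennreal_leI del: ennreal_plus)
  qed
  have "(\<integral>\<^sup>+\<omega>. ennreal (D \<omega>) \<partial>M) \<le> (\<integral>\<^sup>+\<omega>. ennreal (q / 2) + ennreal (1 / (2 * q)) * ennreal ((D \<omega>)\<^sup>2) \<partial>M)"
    by (rule nn_integral_mono) (rule pt)
  also have "\<dots> = ennreal (q / 2) + ennreal (1 / (2 * q)) * (\<integral>\<^sup>+\<omega>. ennreal ((D \<omega>)\<^sup>2) \<partial>M)"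
    by (simp add: nn_integral_add nn_integral_cmult emeasure_space_1)
  also have "\<dots> \<le> ennreal (q / 2) + ennreal (1 / (2 * q)) * ennreal (q\<^sup>2)"
    by (intro add_left_mono mult_left_mono sq) simp
  also have "\<dots> = ennreal q"
    using q by (simp add: ennreal_mult'[symmetric] ennreal_plus[symmetric] power2_eq_square del: ennreal_plus)
  finally show ?thesis .
qed

lemma expectation_le_of_nn_integral:
  assumes "D \<in> borel_measurable M" "\<And>\<omega>. 0 \<le> D \<omega>" "(\<integral>\<^sup>+\<omega>. ennreal (D \<omega>) \<partial>M) \<le> ennreal e" "0 \<le> e"
  shows "integral\<^sup>L M D \<le> e"
  using integral_eq_nn_integral[of D M] assms enn2real_mono[OF assms(3)] by simp

text \<open>The complement of a null set is dense.\<close>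

lemma AE_dense_sequence:
  assumes P: "AE t in lborel. t \<in> {0<..<T} \<longrightarrow> P t" and T: "T > 0" and t: "t \<in> {0..T::real}"
  shows "\<exists>f. (\<forall>n. f n \<in> {0<..<T} \<and> P (f n)) \<and> f \<longlonglongrightarrow> t"
proof -
  obtain N where N: "{t \<in> space lborel. \<not> (t \<in> {0<..<T} \<longrightarrow> P t)} \<subseteq> N" "emeasure lborel N = 0" "N \<in> sets lborel"
    using AE_E[OF P] .
  have ex: "\<exists>x. x \<in> {0<..<T} \<and> P x \<and> \<bar>x - t\<bar> < d" if d: "d > 0" for d
  proof (rule ccontr)
    assume n: "\<not> ?thesis"
    define lo hi where "lo = max 0 (t - d)" and "hi = min T (t + d)"
    have lh: "lo < hi" using t T d by (auto simp: lo_def hi_def)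
    have "{lo<..<hi} \<subseteq> N"
    proof
      fix x assume x: "x \<in> {lo<..<hi}"
      then have "x \<in> {0<..<T}" "\<bar>x - t\<bar> < d" by (auto simp: lo_def hi_def)
      with n show "x \<in> N" using N(1) by auto
    qed
    then have "emeasure lborel {lo<..<hi} \<le> emeasure lborel N" using N(3) by (rule emeasure_mono)
    then show False using N(2) lh by simp
  qed
  have "\<exists>x. x \<in> {0<..<T} \<and> P x \<and> \<bar>x - t\<bar> < 1 / real (Suc n)" for n by (rule ex) simp
  then obtain f where f: "\<And>n. f n \<in> {0<..<T} \<and> P (f n) \<and> \<bar>f n - t\<bar> < 1 / real (Suc n)" by metis
  have "(\<lambda>n. f n - t) \<longlonglongrightarrow> 0"
  proof (rule Lim_null_comparison)
    show "\<forall>\<^sub>F n in sequentially. norm (f n - t) \<le> inverse (real (Suc n))"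
      by (rule always_eventually) (use f in \<open>auto simp: inverse_eq_divide less_imp_le\<close>)
  qed (rule LIMSEQ_inverse_real_of_nat)
  then have "f \<longlonglongrightarrow> t" by (rule LIM_zero_cancel)
  then show ?thesis using f by blast
qed

lemma sde_strong_form:
  assumes sde: "sde_solution M F T sig Wp z b X" and W: "brownian_motion M F Wp" and t0: "t0 \<in> {0..T}"
  shows "AE \<omega> in M. continuous_on {0..t0} (\<lambda>t. X t \<omega>) \<and> set_integrable lborel {0..t0} (\<lambda>t. b t \<omega>) \<and>
    (\<forall>t\<in>{0..t0}. X t \<omega> = z \<omega> + set_lebesgue_integral lborel {0..t} (\<lambda>\<tau>. b \<tau> \<omega>) + sqrt (2 * sig) *\<^sub>R Wp t \<omega>) \<and>
    sqrt (2 * sig) *\<^sub>R Wp 0 \<omega> = 0"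
proof -
  have "AE \<omega> in M. Wp 0 \<omega> = 0" using W unfolding brownian_motion_def by (auto elim!: eventually_mono)
  moreover have "AE \<omega> in M. continuous_on {0..T} (\<lambda>t. X t \<omega>) \<and> set_integrable lborel {0..T} (\<lambda>t. b t \<omega>) \<and>
        (\<forall>t\<in>{0..T}. X t \<omega> = z \<omega> + set_lebesgue_integral lborel {0..t} (\<lambda>\<tau>. b \<tau> \<omega>) + sqrt (2 * sig) *\<^sub>R Wp t \<omega>)"
    using sde unfolding sde_solution_def by (rule conjunct2)
  ultimately show ?thesis
  proof eventually_elim
    case (elim \<omega>)
    have "continuous_on {0..t0} (\<lambda>t. X t \<omega>)"
      by (rule continuous_on_subset[OF conjunct1[OF elim(2)]]) (use t0 in auto)
    moreover have "set_integrable lborel {0..t0} (\<lambda>t. b t \<omega>)"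
      by (rule set_integrable_subset[OF conjunct1[OF conjunct2[OF elim(2)]]]) (use t0 in auto)
    ultimately show ?case using elim t0 by auto
  qed
qed

context chaos
begin

definition "start_at p = \<zeta> (fst p) (snd p)"

lemma slots_finite: "finite (slots (r :: 'n \<Rightarrow> nat))" unfolding slots_def by (rule finite_SigmaI) auto
lemma slots_sub: "slots r \<subseteq> UNIV \<times> {1..}" by (auto simp: slots_def)
lemma slots_nonempty: "N \<ge> 1 \<Longrightarrow> slots (\<lambda>_::'n. N) \<noteq> {}" by (auto simp: slots_def)
lemma slots_snd: "p \<in> slots r \<Longrightarrow> snd p \<ge> 1" by (auto simp: slots_def)
lemma slots_mono: "(\<And>i. r i \<le> N) \<Longrightarrow> slots r \<subseteq> slots (\<lambda>_. N)" by (force simp: slots_def intro: order_trans)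

lemma noise_facts:
  assumes "snd p \<ge> 1"
  shows "brownian_motion M F (W_at p)" "start_at p \<in> borel_measurable (F 0)" "distributed M lborel (start_at p) (\<lambda>x. ennreal (u0 (fst p) x))"
proof -
  have "\<forall>(i, k)\<in>UNIV \<times> {1..}. brownian_motion M F (W i k) \<and> \<zeta> i k \<in> borel_measurable (F 0) \<and>
            distributed M lborel (\<zeta> i k) (\<lambda>x. ennreal (u0 i x))"
    using noise unfolding driving_noise_def Let_def by (rule conjunct1)
  from bspec[OF this, of p] assms
  show "brownian_motion M F (W_at p)" "start_at p \<in> borel_measurable (F 0)" "distributed M lborel (start_at p) (\<lambda>x. ennreal (u0 (fst p) x))"
    by (auto simp: split_beta W_at_def start_at_def mem_Times_iff)
qed

lemma X_sde:
  assumes "\<eta> > 0" "p \<in> slots (\<lambda>_. N)"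
  shows "sde_solution M F T (\<sigma> (fst p)) (W_at p) (start_at p)
    (\<lambda>t \<omega>. - interaction \<eta> V N (\<lambda>q. X_at \<eta> N q t \<omega>) (fst p) (X_at \<eta> N p t \<omega>)) (X_at \<eta> N p)"
proof -
  have k: "snd p \<in> {1..N}" using assms(2) by (auto simp: slots_def)
  have e: "(\<lambda>(j, l). X \<eta> N j l t \<omega>) = (\<lambda>q. X_at \<eta> N q t \<omega>)" for t \<omega> by (auto simp: X_at_def)
  have "\<forall>\<eta>>0. \<forall>N. \<forall>i. \<forall>k\<in>{1..N}. sde_solution M F T (\<sigma> i) (W i k) (\<zeta> i k)
          (\<lambda>t \<omega>. - interaction \<eta> V N (\<lambda>(j, l). X \<eta> N j l t \<omega>) i (X \<eta> N i k t \<omega>)) (X \<eta> N i k)"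
    using sys unfolding particle_systems_def by (rule conjunct1)
  from this[rule_format, OF assms(1) k, of "fst p"] show ?thesis
    unfolding e by (simp add: W_at_def start_at_def X_at_def)
qed

lemma Xbar_sde:
  assumes "\<eta> > 0" "snd p \<ge> 1"
  shows "sde_solution M F T (\<sigma> (fst p)) (W_at p) (start_at p)
      (\<lambda>t \<omega>. - nonlocal_field \<eta> V (u_eta \<eta> t) (fst p) (Xbar_at \<eta> p t \<omega>)) (Xbar_at \<eta> p)"
    "t \<in> {0..T} \<Longrightarrow> distributed M lborel (Xbar_at \<eta> p t) (\<lambda>x. ennreal (u_eta \<eta> t (fst p) x))"
proof -
  have h: "\<forall>\<eta>>0. \<forall>i. \<forall>k\<ge>1.
        sde_solution M F T (\<sigma> i) (W i k) (\<zeta> i k)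
          (\<lambda>t \<omega>. - nonlocal_field \<eta> V (u_eta \<eta> t) i (Xbar \<eta> i k t \<omega>)) (Xbar \<eta> i k) \<and>
        (\<forall>t\<in>{0..T}. distributed M lborel (Xbar \<eta> i k t) (\<lambda>x. ennreal (u_eta \<eta> t i x)))"
    using sys unfolding particle_systems_def by (elim conjE)
  note h' = h[rule_format, OF assms, of "fst p"]
  show "sde_solution M F T (\<sigma> (fst p)) (W_at p) (start_at p)
      (\<lambda>t \<omega>. - nonlocal_field \<eta> V (u_eta \<eta> t) (fst p) (Xbar_at \<eta> p t \<omega>)) (Xbar_at \<eta> p)"
    using conjunct1[OF h'] by (simp add: W_at_def start_at_def Xbar_at_def)
  show "t \<in> {0..T} \<Longrightarrow> distributed M lborel (Xbar_at \<eta> p t) (\<lambda>x. ennreal (u_eta \<eta> t (fst p) x))"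
    using conjunct2[OF h'] by (simp add: Xbar_at_def)
qed

lemma Xhat_sde:
  assumes "snd p \<ge> 1"
  shows "sde_solution M F T (\<sigma> (fst p)) (W_at p) (start_at p)
      (\<lambda>t \<omega>. - local_field a (u t) (fst p) (Xhat_at p t \<omega>)) (Xhat_at p)"
    "t \<in> {0..T} \<Longrightarrow> distributed M lborel (Xhat_at p t) (\<lambda>x. ennreal (u t (fst p) x))"
proof -
  have h: "\<forall>i. \<forall>k\<ge>1.
        sde_solution M F T (\<sigma> i) (W i k) (\<zeta> i k)
          (\<lambda>t \<omega>. - local_field a (u t) i (Xhat i k t \<omega>)) (Xhat i k) \<and>
        (\<forall>t\<in>{0..T}. distributed M lborel (Xhat i k t) (\<lambda>x. ennreal (u t i x)))"
    using sys unfolding particle_systems_def by (elim conjE)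
  note h' = h[rule_format, OF assms, of "fst p"]
  show "sde_solution M F T (\<sigma> (fst p)) (W_at p) (start_at p)
      (\<lambda>t \<omega>. - local_field a (u t) (fst p) (Xhat_at p t \<omega>)) (Xhat_at p)"
    using conjunct1[OF h'] by (simp add: W_at_def start_at_def Xhat_at_def)
  show "t \<in> {0..T} \<Longrightarrow> distributed M lborel (Xhat_at p t) (\<lambda>x. ennreal (u t (fst p) x))"
    using conjunct2[OF h'] by (simp add: Xhat_at_def)
qed

lemma X_measurable: "\<eta> > 0 \<Longrightarrow> p \<in> slots (\<lambda>_. N) \<Longrightarrow> t \<in> {0..T} \<Longrightarrow> X_at \<eta> N p t \<in> borel_measurable M"
  by (rule sde_solution_measurable(2)[OF X_sde fil])
lemma Xbar_measurable: "\<eta> > 0 \<Longrightarrow> snd p \<ge> 1 \<Longrightarrow> t \<in> {0..T} \<Longrightarrow> Xbar_at \<eta> p t \<in> borel_measurable M"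
  by (rule sde_solution_measurable(2)[OF Xbar_sde(1) fil])
lemma Xhat_measurable: "snd p \<ge> 1 \<Longrightarrow> t \<in> {0..T} \<Longrightarrow> Xhat_at p t \<in> borel_measurable M"
  by (rule sde_solution_measurable(2)[OF Xhat_sde(1) fil])

text \<open>All particles enter, because each of them acts on all others.\<close>

lemma X_noise_measurable:
  assumes \<eta>: "\<eta> > 0" and p: "p \<in> slots (\<lambda>_. N)" and t: "t \<in> {0..T}"
  shows "\<exists>x\<in>borel_measurable (noise_sigma M W \<zeta> (slots (\<lambda>_. N)) t). AE \<omega> in M. X_at \<eta> N p t \<omega> = x \<omega>"
proof -
  define J where "J = slots (\<lambda>_::'n. N)"
  obtain L where L': "L \<ge> 0 \<and> (\<forall>i k x y. (i, k) \<in> J \<longrightarrow>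
    norm (- interaction \<eta> V N x i (x (i, k)) - - interaction \<eta> V N y i (y (i, k))) \<le> L * (\<Sum>q\<in>J. norm (x q - y q)))"
    using interaction_lipschitz[OF \<eta>, of N] unfolding J_def ..
  show ?thesis
    unfolding J_def[symmetric]
  proof (rule strong_solution_measurable[where I=J and X="X_at \<eta> N" and w="\<lambda>p t \<omega>. c p *\<^sub>R W_at p t \<omega>" and z=start_at and L=L
      and b="\<lambda>p s x. - interaction \<eta> V N x (fst p) (x p)"])
    show "finite J" unfolding J_def by (rule slots_finite)
    show "0 \<le> t" using t by simp
    show "0 \<le> L" using L' ..
    show "p \<in> J" using p by (simp add: J_def)
    show "start_at q \<in> borel_measurable (noise_sigma M W \<zeta> J t)" if "q \<in> J" for q
      unfolding start_at_def by (rule noise_sigma_start) (use that in simp)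
    show "(\<lambda>\<omega>. c q *\<^sub>R W_at q \<tau> \<omega>) \<in> borel_measurable (noise_sigma M W \<zeta> J t)" if "q \<in> J" "\<tau> \<in> {0..t}" for q \<tau>
      unfolding W_at_def by (intro borel_measurable_scaleR borel_measurable_const noise_sigma_path) (use that in auto)
    show "norm (- interaction \<eta> V N x (fst q) (x q) - - interaction \<eta> V N y (fst q) (y q)) \<le> L * (\<Sum>q\<in>J. norm (x q - y q))"
      if "q \<in> J" for q x y
      using conjunct2[OF L', rule_format, of "fst q" "snd q" x y] that by simp
    show "set_integrable lborel {0..t} (\<lambda>s. - interaction \<eta> V N x (fst q) (x q))" for q x
      using t unfolding set_integrable_def by (intro integrable_scaleR_left integrable_real_indicator) auto
    show "AE \<omega> in M. continuous_on {0..t} (\<lambda>t. X_at \<eta> N q t \<omega>) \<and>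
        set_integrable lborel {0..t} (\<lambda>s. - interaction \<eta> V N (\<lambda>q. X_at \<eta> N q s \<omega>) (fst q) (X_at \<eta> N q s \<omega>)) \<and>
        (\<forall>t\<in>{0..t}. X_at \<eta> N q t \<omega> = start_at q \<omega> + set_lebesgue_integral lborel {0..t} (\<lambda>s. - interaction \<eta> V N (\<lambda>q. X_at \<eta> N q s \<omega>) (fst q) (X_at \<eta> N q s \<omega>)) + c q *\<^sub>R W_at q t \<omega>) \<and>
        c q *\<^sub>R W_at q 0 \<omega> = 0" if q: "q \<in> J" for q
      unfolding c_def by (rule sde_strong_form[OF X_sde[OF \<eta> q[unfolded J_def]] noise_facts(1)[OF slots_snd[OF q[unfolded J_def]]] t])
  qed
qed

text \<open>In contrast to the interacting system, the noise of the particle itself is sufficient.\<close>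

lemma Xbar_noise_measurable:
  assumes \<eta>: "\<eta> > 0" and p: "snd p \<ge> 1" and t: "t \<in> {0..T}"
  shows "\<exists>x\<in>borel_measurable (noise_sigma M W \<zeta> {p} t). AE \<omega> in M. Xbar_at \<eta> p t \<omega> = x \<omega>"
proof -
  obtain L where L': "L \<ge> 0 \<and> (\<forall>t\<in>{0..T}. \<forall>i x y. norm (- nonlocal_field \<eta> V (u_eta \<eta> t) i x - - nonlocal_field \<eta> V (u_eta \<eta> t) i y) \<le> L * norm (x - y))"
    using nonlocal_lipschitz[OF \<eta>] ..
  show ?thesis
  proof (rule strong_solution_measurable[where I="{p}" and X="Xbar_at \<eta>" and w="\<lambda>p t \<omega>. c p *\<^sub>R W_at p t \<omega>" and z=start_at and L=L
      and b="\<lambda>p s x. - nonlocal_field \<eta> V (u_eta \<eta> s) (fst p) (x p)"])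
    show "0 \<le> t" using t by simp
    show "0 \<le> L" using L' ..
    show "start_at q \<in> borel_measurable (noise_sigma M W \<zeta> {p} t)" if "q \<in> {p}" for q
      unfolding start_at_def by (rule noise_sigma_start) (use that in simp)
    show "(\<lambda>\<omega>. c q *\<^sub>R W_at q \<tau> \<omega>) \<in> borel_measurable (noise_sigma M W \<zeta> {p} t)" if "q \<in> {p}" "\<tau> \<in> {0..t}" for q \<tau>
      unfolding W_at_def by (intro borel_measurable_scaleR borel_measurable_const noise_sigma_path) (use that in auto)
    show "norm (- nonlocal_field \<eta> V (u_eta \<eta> s) (fst q) (x q) - - nonlocal_field \<eta> V (u_eta \<eta> s) (fst q) (y q)) \<le> L * (\<Sum>q\<in>{p}. norm (x q - y q))"
      if "q \<in> {p}" "s \<in> {0..t}" for q s and x y :: "'n \<times> nat \<Rightarrow> 'a"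
    proof -
      have "s \<in> {0..T}" using that t by auto
      from conjunct2[OF L', rule_format, OF this, of "fst q" "x q" "y q"] show ?thesis using that(1) by simp
    qed
    show "set_integrable lborel {0..t} (\<lambda>s. - nonlocal_field \<eta> V (u_eta \<eta> s) (fst q) (x q))" for q and x :: "'n \<times> nat \<Rightarrow> 'a"
      by (rule set_integrable_subset[OF nonlocal_integrable[OF \<eta>]]) (use t in auto)
    show "AE \<omega> in M. continuous_on {0..t} (\<lambda>t. Xbar_at \<eta> q t \<omega>) \<and>
        set_integrable lborel {0..t} (\<lambda>s. - nonlocal_field \<eta> V (u_eta \<eta> s) (fst q) (Xbar_at \<eta> q s \<omega>)) \<and>
        (\<forall>t\<in>{0..t}. Xbar_at \<eta> q t \<omega> = start_at q \<omega> + set_lebesgue_integral lborel {0..t} (\<lambda>s. - nonlocal_field \<eta> V (u_eta \<eta> s) (fst q) (Xbar_at \<eta> q s \<omega>)) + c q *\<^sub>R W_at q t \<omega>) \<and>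
        c q *\<^sub>R W_at q 0 \<omega> = 0" if q: "q \<in> {p}" for q
    proof -
      have q1: "snd q \<ge> 1" using q p by simp
      show ?thesis unfolding c_def by (rule sde_strong_form[OF Xbar_sde(1)[OF \<eta> q1] noise_facts(1)[OF q1] t])
    qed
  qed auto
qed

lemma noise_family:
  assumes "N \<ge> 1" "R \<subseteq> slots (\<lambda>_. N)"
  shows "brownian_family M R W_at (noise_sigma M W \<zeta> (slots (\<lambda>_. N)))"
  using noise_brownian_family[OF fil noise slots_finite slots_nonempty[OF assms(1)] slots_sub assms(2)]
  by (simp add: W_at_def[abs_def])

lemma X_drift:
  assumes \<eta>: "\<eta> > 0" and N: "N \<ge> 1" and R: "R \<subseteq> slots (\<lambda>_. N)"
  shows "brownian_family.drift_process M R W_at (noise_sigma M W \<zeta> (slots (\<lambda>_. N))) T c (\<eta> powr (- real DIM('a)) / \<eta> * K_sum) (X_at \<eta> N)"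
proof -
  interpret BF: brownian_family M R W_at "noise_sigma M W \<zeta> (slots (\<lambda>_. N))" by (rule noise_family[OF N R])
  show ?thesis
    unfolding BF.drift_process_def
  proof (intro conjI ballI)
    fix p t assume p: "p \<in> R" and t: "t \<in> {0..T}"
    have p': "p \<in> slots (\<lambda>_. N)" using p R by auto
    show "X_at \<eta> N p t \<in> borel_measurable M" by (rule X_measurable[OF \<eta> p' t])
    show "\<exists>x\<in>borel_measurable (noise_sigma M W \<zeta> (slots (\<lambda>_. N)) t). AE \<omega> in M. X_at \<eta> N p t \<omega> = x \<omega>"
      by (rule X_noise_measurable[OF \<eta> p' t])
  next
    fix p s t assume p: "p \<in> R" and s: "s \<in> {0..T}" and t: "t \<in> {s..T}"
    have p': "p \<in> slots (\<lambda>_. N)" using p R by auto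
    show "AE \<omega> in M. norm (X_at \<eta> N p t \<omega> - X_at \<eta> N p s \<omega> - c p *\<^sub>R (W_at p t \<omega> - W_at p s \<omega>)) \<le> \<eta> powr (- real DIM('a)) / \<eta> * K_sum * (t - s)"
      unfolding c_def
    proof (rule sde_solution_increment[OF X_sde[OF \<eta> p']])
      show "AE \<tau> in lborel. \<tau> \<in> {0..T} \<longrightarrow> (\<forall>\<omega>. norm (- interaction \<eta> V N (\<lambda>q. X_at \<eta> N q \<tau> \<omega>) (fst p) (X_at \<eta> N p \<tau> \<omega>)) \<le> \<eta> powr (- real DIM('a)) / \<eta> * K_sum)"
        using interaction_bound[OF \<eta>] by simp
    qed (use s t in auto)
  qed
qed

lemma Xbar_increment:
  assumes \<eta>: "\<eta> > 0" and p: "snd p \<ge> 1" and s: "v \<in> {0..T}" and t: "t \<in> {v..T}"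
  shows "AE \<omega> in M. norm (Xbar_at \<eta> p t \<omega> - Xbar_at \<eta> p v \<omega> - c p *\<^sub>R (W_at p t \<omega> - W_at p v \<omega>)) \<le> drift_bound * (t - v)"
  unfolding c_def
proof (rule sde_solution_increment[OF Xbar_sde(1)[OF \<eta> p]])
  show "AE \<tau> in lborel. \<tau> \<in> {0..T} \<longrightarrow> (\<forall>\<omega>. norm (- nonlocal_field \<eta> V (u_eta \<eta> \<tau>) (fst p) (Xbar_at \<eta> p \<tau> \<omega>)) \<le> drift_bound)"
    using nonlocal_field_bound[OF \<eta>] by eventually_elim simp
qed (use s t in auto)

lemma Xhat_increment:
  assumes p: "snd p \<ge> 1" and s: "v \<in> {0..T}" and t: "t \<in> {v..T}"
  shows "AE \<omega> in M. norm (Xhat_at p t \<omega> - Xhat_at p v \<omega> - c p *\<^sub>R (W_at p t \<omega> - W_at p v \<omega>)) \<le> drift_bound * (t - v)"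
  unfolding c_def
proof (rule sde_solution_increment[OF Xhat_sde(1)[OF p]])
  show "AE \<tau> in lborel. \<tau> \<in> {0..T} \<longrightarrow> (\<forall>\<omega>. norm (- local_field a (u \<tau>) (fst p) (Xhat_at p \<tau> \<omega>)) \<le> drift_bound)"
    using local_field_bound by eventually_elim simp
qed (use s t in auto)

lemma Xbar_drift:
  assumes \<eta>: "\<eta> > 0" and N: "N \<ge> 1" and R: "R \<subseteq> slots (\<lambda>_. N)"
  shows "brownian_family.drift_process M R W_at (noise_sigma M W \<zeta> (slots (\<lambda>_. N))) T c drift_bound (Xbar_at \<eta>)"
proof -
  interpret BF: brownian_family M R W_at "noise_sigma M W \<zeta> (slots (\<lambda>_. N))" by (rule noise_family[OF N R])
  show ?thesis
    unfolding BF.drift_process_def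
  proof (intro conjI ballI)
    fix p t assume p: "p \<in> R" and t: "t \<in> {0..T}"
    have p': "p \<in> slots (\<lambda>_. N)" using p R by auto
    show "Xbar_at \<eta> p t \<in> borel_measurable M" by (rule Xbar_measurable[OF \<eta> slots_snd[OF p'] t])
    obtain x where x: "x \<in> borel_measurable (noise_sigma M W \<zeta> {p} t)" "AE \<omega> in M. Xbar_at \<eta> p t \<omega> = x \<omega>"
      using Xbar_noise_measurable[OF \<eta> slots_snd[OF p'] t] ..
    have "sets (noise_sigma M W \<zeta> {p} t) \<subseteq> sets (noise_sigma M W \<zeta> (slots (\<lambda>_. N)) t)"
      by (rule noise_sigma_mono) (use p' t in auto)
    then have "x \<in> borel_measurable (noise_sigma M W \<zeta> (slots (\<lambda>_. N)) t)"
      using x(1) by (auto simp: measurable_def)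
    with x(2) show "\<exists>x\<in>borel_measurable (noise_sigma M W \<zeta> (slots (\<lambda>_. N)) t). AE \<omega> in M. Xbar_at \<eta> p t \<omega> = x \<omega>" by (rule bexI)
  next
    fix p s t assume p: "p \<in> R" and s: "s \<in> {0..T}" and t: "t \<in> {s..T}"
    have "snd p \<ge> 1" using p R slots_snd by blast
    then show "AE \<omega> in M. norm (Xbar_at \<eta> p t \<omega> - Xbar_at \<eta> p s \<omega> - c p *\<^sub>R (W_at p t \<omega> - W_at p s \<omega>)) \<le> drift_bound * (t - s)"
      by (rule Xbar_increment[OF \<eta> _ s t])
  qed
qed

text \<open>For a single particle the given filtration is good enough, as no other increments occur.\<close>

lemma single_family:
  assumes p: "snd p \<ge> 1"
  shows "brownian_family M {p} W_at F"
proof unfold_locales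
  have FM: "sets (F t) \<subseteq> sets M" "space (F t) = space M" for t
    using fil unfolding filtered_prob_space_def by (auto simp: filtration.space_F)
  have Fmono: "sets (F s) \<subseteq> sets (F t)" if "s \<le> t" for s t
    using fil that unfolding filtered_prob_space_def by (auto dest: filtration.sets_F_mono)
  note bm = noise_facts(1)[OF p, unfolded brownian_motion_def]
  show "finite {p}" by simp
  fix s t :: real
  show "subalgebra M (F t)" using FM by (simp add: subalgebra_def)
  show "sets (F s) \<subseteq> sets (F t)" if "s \<le> t" using Fmono[OF that] .
  show "W_at q t \<in> borel_measurable (F t)" if "q \<in> {p}" "0 \<le> t" for q using bm that by auto
  show "indep_set (sigma_sets (space M) (sets (F s) \<union> (\<Union>q\<in>{p} - {q}. generated M borel (\<lambda>\<omega>. W_at q t \<omega> - W_at q s \<omega>))))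
     (generated M borel (\<lambda>\<omega>. W_at q t \<omega> - W_at q s \<omega>))" if q: "q \<in> {p}" and st: "0 \<le> s" "s < t" for q
  proof -
    have "sigma_sets (space M) (sets (F s)) = sets (F s)" using sets.sigma_sets_eq[of "F s"] FM(2) by simp
    moreover have "{p} - {q} = {}" using q by auto
    ultimately show ?thesis using bm q st by auto
  qed
  show "distributed M lborel (\<lambda>\<omega>. W_at q t \<omega> - W_at q s \<omega>) (\<lambda>x. ennreal (gauss (t - s) x))" if "q \<in> {p}" "0 \<le> s" "s < t" for q
    using bm that unfolding gauss_def by auto
qed

lemma single_drift:
  assumes \<eta>: "\<eta> > 0" and p: "snd p \<ge> 1"
  shows "brownian_family.drift_process M {p} W_at F T c drift_bound (Xbar_at \<eta>)" "brownian_family.drift_process M {p} W_at F T c drift_bound Xhat_at"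
proof -
  interpret BF: brownian_family M "{p}" W_at F by (rule single_family[OF p])
  show "BF.drift_process T c drift_bound (Xbar_at \<eta>)"
    unfolding BF.drift_process_def
  proof (intro conjI ballI)
    fix q t assume q: "q \<in> {p}" and t: "t \<in> {0..T}"
    have q1: "snd q \<ge> 1" using q p by simp
    show "Xbar_at \<eta> q t \<in> borel_measurable M" by (rule Xbar_measurable[OF \<eta> q1 t])
    show "\<exists>x\<in>borel_measurable (F t). AE \<omega> in M. Xbar_at \<eta> q t \<omega> = x \<omega>"
      using sde_solution_measurable(1)[OF Xbar_sde(1)[OF \<eta> q1] fil t] by (intro bexI[of _ "Xbar_at \<eta> q t"]) simp_all
  next
    fix q s t assume "q \<in> {p}" and s: "s \<in> {0..T}" and t: "t \<in> {s..T}"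
    then have q1: "snd q \<ge> 1" using p by simp
    show "AE \<omega> in M. norm (Xbar_at \<eta> q t \<omega> - Xbar_at \<eta> q s \<omega> - c q *\<^sub>R (W_at q t \<omega> - W_at q s \<omega>)) \<le> drift_bound * (t - s)"
      by (rule Xbar_increment[OF \<eta> q1 s t])
  qed
  show "BF.drift_process T c drift_bound Xhat_at"
    unfolding BF.drift_process_def
  proof (intro conjI ballI)
    fix q t assume q: "q \<in> {p}" and t: "t \<in> {0..T}"
    have q1: "snd q \<ge> 1" using q p by simp
    show "Xhat_at q t \<in> borel_measurable M" by (rule Xhat_measurable[OF q1 t])
    show "\<exists>x\<in>borel_measurable (F t). AE \<omega> in M. Xhat_at q t \<omega> = x \<omega>"
      using sde_solution_measurable(1)[OF Xhat_sde(1)[OF q1] fil t] by (intro bexI[of _ "Xhat_at q t"]) simp_all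
  next
    fix q s t assume "q \<in> {p}" and s: "s \<in> {0..T}" and t: "t \<in> {s..T}"
    then have q1: "snd q \<ge> 1" using p by simp
    show "AE \<omega> in M. norm (Xhat_at q t \<omega> - Xhat_at q s \<omega> - c q *\<^sub>R (W_at q t \<omega> - W_at q s \<omega>)) \<le> drift_bound * (t - s)"
      by (rule Xhat_increment[OF q1 s t])
  qed
qed

lemma start_eq:
  assumes "snd p \<ge> 1"
  shows "\<eta> > 0 \<Longrightarrow> p \<in> slots (\<lambda>_. N) \<Longrightarrow> AE \<omega> in M. X_at \<eta> N p 0 \<omega> = start_at p \<omega>"
    "\<eta> > 0 \<Longrightarrow> AE \<omega> in M. Xbar_at \<eta> p 0 \<omega> = start_at p \<omega>"
    "AE \<omega> in M. Xhat_at p 0 \<omega> = start_at p \<omega>"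
  using sde_solution_start[OF X_sde noise_facts(1)[OF assms]] sde_solution_start[OF Xbar_sde(1)[OF _ assms] noise_facts(1)[OF assms]]
    sde_solution_start[OF Xhat_sde(1)[OF assms] noise_facts(1)[OF assms]] T by (auto intro: less_imp_le)

text \<open>Each particle is a function of its own noise, and these noises are independent.\<close>

lemma Xbar_joint_law:
  assumes \<eta>: "\<eta> > 0" and t: "t \<in> {0..T}"
  shows "distributed M (config_measure (slots r)) (\<lambda>\<omega>. \<lambda>p\<in>slots r. Xbar_at \<eta> p t \<omega>) (\<lambda>y. ennreal (tensor r (u_eta \<eta> t) y))"
proof -
  define R where "R = slots r"
  have R: "finite R" "R \<subseteq> UNIV \<times> {1..}" unfolding R_def by (rule slots_finite, rule slots_sub)
  have "\<exists>x\<in>borel_measurable (noise_sigma M W \<zeta> {p} t). AE \<omega> in M. Xbar_at \<eta> p t \<omega> = x \<omega>" if "p \<in> R" for p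
    using Xbar_noise_measurable[OF \<eta> _ t, of p] slots_snd that unfolding R_def by blast
  then obtain x where x: "\<And>p. p \<in> R \<Longrightarrow> x p \<in> borel_measurable (noise_sigma M W \<zeta> {p} t)" "\<And>p. p \<in> R \<Longrightarrow> AE \<omega> in M. Xbar_at \<eta> p t \<omega> = x p \<omega>"
    by metis
  have xM: "x p \<in> borel_measurable M" if "p \<in> R" for p
  proof -
    interpret BF: brownian_family M "{}" W_at "noise_sigma M W \<zeta> {p}"
      using noise_brownian_family[OF fil noise, of "{p}" "{}"] R that by (auto simp: W_at_def[abs_def])
    show ?thesis by (rule BF.G_meas[OF _ x(1)[OF that]]) (use t in simp)
  qed
  have ind: "indep_vars (\<lambda>_. borel) x R"
  proof (cases "R = {}")
    case True then show ?thesis by (simp add: indep_vars_def indep_sets_def)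
  next
    case False
    show ?thesis by (rule noise_indep_vars[OF fil noise R(1) False R(2) _ x(1)]) (use t in auto)
  qed
  have Xm: "Xbar_at \<eta> p t \<in> borel_measurable M" if "p \<in> R" for p
    using Xbar_measurable[OF \<eta> slots_snd t, of p r] that by (simp add: R_def)
  have xd: "distributed M lborel (x p) (\<lambda>y. ennreal (u_eta \<eta> t (fst p) y))" if "p \<in> R" for p
    by (rule distributed_cong_AE[OF Xbar_sde(2)[OF \<eta> _ t] x(2)[OF that]]) (use xM[OF that] slots_snd[of p r] that in \<open>auto simp: R_def\<close>)
  have "distributed M (PiM R (\<lambda>_. lborel)) (\<lambda>\<omega>. \<lambda>p\<in>R. x p \<omega>) (\<lambda>y. ennreal (\<Prod>p\<in>R. u_eta \<eta> t (fst p) (y p)))"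
    by (rule distributed_PiM[OF R(1) ind xd]) (use u_eta_measurable[OF \<eta> t] u_eta_facts(1)[OF \<eta> t] in auto)
  moreover have "AE \<omega> in M. (\<lambda>p\<in>R. x p \<omega>) = (\<lambda>p\<in>R. Xbar_at \<eta> p t \<omega>)"
  proof -
    have "AE \<omega> in M. \<forall>p\<in>R. Xbar_at \<eta> p t \<omega> = x p \<omega>" using R(1) x(2) by (simp add: AE_finite_all)
    then show ?thesis by eventually_elim (auto simp: restrict_def)
  qed
  moreover have "(\<lambda>\<omega>. \<lambda>p\<in>R. Xbar_at \<eta> p t \<omega>) \<in> M \<rightarrow>\<^sub>M PiM R (\<lambda>_. lborel)"
    by (rule measurable_restrict) (use Xm in simp)
  ultimately have "distributed M (PiM R (\<lambda>_. lborel)) (\<lambda>\<omega>. \<lambda>p\<in>R. Xbar_at \<eta> p t \<omega>) (\<lambda>y. ennreal (\<Prod>p\<in>R. u_eta \<eta> t (fst p) (y p)))"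
    by (rule distributed_cong_AE)
  moreover have "tensor r (u_eta \<eta> t) y = (\<Prod>p\<in>R. u_eta \<eta> t (fst p) (y p))" for y
    unfolding tensor_def R_def slots_def by (subst prod.Sigma) (auto simp: split_beta')
  ultimately show ?thesis by (simp add: config_measure_def R_def)
qed

end

section \<open>Distances between the densities\<close>

context chaos
begin

text \<open>The mean-field assumption at a fixed particle and time, with the squared distance converted to a first moment.\<close>

lemma A3_bounds:
  assumes \<epsilon>: "0 < \<epsilon>" "\<epsilon> < \<epsilon>1" and \<eta>: "\<eta> > 0" and adm: "admissible TYPE('a) \<epsilon> \<eta> N" and N: "N \<ge> 1"
    and p: "p \<in> slots (\<lambda>_. N)" and \<tau>: "0 < \<tau>" "\<tau> < T"
  defines "q \<equiv> sqrt (C3 * real N powr (- 1 + C3 * \<epsilon>))"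
  shows "(\<integral>\<^sup>+\<omega>. ennreal (norm (X_at \<eta> N p \<tau> \<omega> - Xbar_at \<eta> p \<tau> \<omega>)) \<partial>M) \<le> ennreal q"
    and "(\<integral>\<^sup>+\<omega>. ennreal (norm (X_at \<eta> N p \<tau> \<omega> - Xhat_at p \<tau> \<omega>)) \<partial>M) \<le> ennreal (C3 * \<eta>)"
proof -
  define i k where "i = fst p" and "k = snd p"
  have k: "k \<in> {1..N}" using p by (auto simp: k_def slots_def)
  have \<tau>': "\<tau> \<in> {0<..<T}" "\<tau> \<in> {0..T}" using \<tau> by auto
  have A: "(SUP k\<in>{1..N}. \<integral>\<^sup>+\<omega>. (\<Sum>i\<in>UNIV. SUP t\<in>{0<..<T}. ennreal ((norm (X \<eta> N i k t \<omega> - Xbar \<eta> i k t \<omega>))\<^sup>2)) \<partial>M)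
          \<le> ennreal (C3 * real N powr (- 1 + C3 * \<epsilon>)) \<and>
        (SUP k\<in>{1..N}. \<integral>\<^sup>+\<omega>. (\<Sum>i\<in>UNIV. SUP t\<in>{0<..<T}. ennreal (norm (X \<eta> N i k t \<omega> - Xhat i k t \<omega>))) \<partial>M)
          \<le> ennreal (C3 * \<eta>)"
    using A3 \<epsilon> \<eta> adm unfolding assumption_A3_def by blast
  have q: "q > 0" using C3 N by (simp add: q_def)
  have q2: "q\<^sup>2 = C3 * real N powr (- 1 + C3 * \<epsilon>)" using C3 by (simp add: q_def)
  have Xm: "X_at \<eta> N p \<tau> \<in> borel_measurable M" "Xbar_at \<eta> p \<tau> \<in> borel_measurable M" "Xhat_at p \<tau> \<in> borel_measurable M"
    using X_measurable[OF \<eta> p \<tau>'(2)] Xbar_measurable[OF \<eta> slots_snd[OF p] \<tau>'(2)] Xhat_measurable[OF slots_snd[OF p] \<tau>'(2)] by auto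
  have pick: "g i \<tau> \<omega> \<le> (\<Sum>i\<in>UNIV. SUP t\<in>{0<..<T}. g i t \<omega>)" for g :: "'n \<Rightarrow> real \<Rightarrow> 'w \<Rightarrow> ennreal" and \<omega>
    by (rule order_trans[OF SUP_upper[OF \<tau>'(1), of "\<lambda>t. g i t \<omega>"] member_le_sum_ennreal[of UNIV i "\<lambda>i. SUP t\<in>{0<..<T}. g i t \<omega>"]]) auto
  have "(\<integral>\<^sup>+\<omega>. ennreal ((norm (X \<eta> N i k \<tau> \<omega> - Xbar \<eta> i k \<tau> \<omega>))\<^sup>2) \<partial>M) \<le>
      (\<integral>\<^sup>+\<omega>. (\<Sum>i\<in>UNIV. SUP t\<in>{0<..<T}. ennreal ((norm (X \<eta> N i k t \<omega> - Xbar \<eta> i k t \<omega>))\<^sup>2)) \<partial>M)"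
    by (rule nn_integral_mono) (rule pick)
  also have "\<dots> \<le> ennreal (C3 * real N powr (- 1 + C3 * \<epsilon>))"
    by (rule order_trans[OF SUP_upper[OF k] conjunct1[OF A]])
  finally have sq: "(\<integral>\<^sup>+\<omega>. ennreal ((norm (X_at \<eta> N p \<tau> \<omega> - Xbar_at \<eta> p \<tau> \<omega>))\<^sup>2) \<partial>M) \<le> ennreal (q\<^sup>2)"
    unfolding q2 X_at_def Xbar_at_def i_def k_def .
  show "(\<integral>\<^sup>+\<omega>. ennreal (norm (X_at \<eta> N p \<tau> \<omega> - Xbar_at \<eta> p \<tau> \<omega>)) \<partial>M) \<le> ennreal q"
    by (rule nn_integral_le_of_second_moment[OF _ _ q sq]) (use Xm in auto)
  have "(\<integral>\<^sup>+\<omega>. ennreal (norm (X \<eta> N i k \<tau> \<omega> - Xhat i k \<tau> \<omega>)) \<partial>M) \<le>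
      (\<integral>\<^sup>+\<omega>. (\<Sum>i\<in>UNIV. SUP t\<in>{0<..<T}. ennreal (norm (X \<eta> N i k t \<omega> - Xhat i k t \<omega>))) \<partial>M)"
    by (rule nn_integral_mono) (rule pick)
  also have "\<dots> \<le> ennreal (C3 * \<eta>)"
    by (rule order_trans[OF SUP_upper[OF k] conjunct2[OF A]])
  finally show "(\<integral>\<^sup>+\<omega>. ennreal (norm (X_at \<eta> N p \<tau> \<omega> - Xhat_at p \<tau> \<omega>)) \<partial>M) \<le> ennreal (C3 * \<eta>)"
    unfolding X_at_def Xhat_at_def i_def k_def .
qed

lemma marginal_law:
  assumes \<eta>: "\<eta> > 0" and N: "N \<ge> 1" and r: "\<And>i. r i \<le> N" and t: "t \<in> {0..T}"
  shows "distributed M (PiM (slots r) (\<lambda>_. lborel)) (\<lambda>\<omega>. \<lambda>p\<in>slots r. X_at \<eta> N p t \<omega>) (\<lambda>y. ennreal (marginal N r (uN \<eta> N t) y))"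
    and "marginal N r (uN \<eta> N t) \<in> borel_measurable (PiM (slots r) (\<lambda>_. lborel))"
    and "y \<in> space (PiM (slots r) (\<lambda>_. lborel)) \<Longrightarrow> 0 \<le> marginal N r (uN \<eta> N t) y"
proof -
  define I R where "I = slots (\<lambda>_::'n. N)" and "R = slots r"
  have RI: "R \<subseteq> I" unfolding I_def R_def by (rule slots_mono[OF r])
  have jd: "\<forall>\<eta>>0. \<forall>N\<ge>1. (\<forall>t\<in>{0..T}. distributed M (config_measure (slots (\<lambda>_. N)))
        (\<lambda>\<omega>. \<lambda>(i, k)\<in>slots (\<lambda>_. N). X \<eta> N i k t \<omega>) (\<lambda>x. ennreal (uN \<eta> N t x))) \<and>
     probability_densities T N (uN \<eta> N)"
    using joint unfolding joint_density_def by blast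
  have Zd: "distributed M (PiM I (\<lambda>_. lborel)) (\<lambda>\<omega>. \<lambda>p\<in>I. X_at \<eta> N p t \<omega>) (\<lambda>x. ennreal (uN \<eta> N t x))"
  proof -
    have "(\<lambda>\<omega>. \<lambda>(i, k)\<in>slots (\<lambda>_. N). X \<eta> N i k t \<omega>) = (\<lambda>\<omega>. \<lambda>p\<in>I. X_at \<eta> N p t \<omega>)"
      by (simp add: I_def X_at_def split_beta')
    then show ?thesis
      using bspec[OF conjunct1[OF jd[rule_format, OF \<eta> N]] t] by (simp add: config_measure_def I_def)
  qed
  have vd: "(\<forall>x\<in>PiE I (\<lambda>_. UNIV). uN \<eta> N t x \<ge> 0) \<and> has_bochner_integral (config_measure I) (uN \<eta> N t) 1"
    using conjunct2[OF jd[rule_format, OF \<eta> N]] t unfolding probability_densities_def I_def by blast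
  have vi: "integrable (PiM I (\<lambda>_. lborel)) (uN \<eta> N t)"
    using conjunct2[OF vd] by (simp add: has_bochner_integral_iff config_measure_def)
  have Ifin: "finite I" unfolding I_def by (rule slots_finite)
  have v0: "\<And>x. x \<in> PiE I (\<lambda>_. UNIV) \<Longrightarrow> 0 \<le> uN \<eta> N t x" using conjunct1[OF vd] by blast
  note mg = distributed_marginal[OF Ifin RI Zd vi v0]
  have mg1: "distributed M (PiM R (\<lambda>_. lborel)) (\<lambda>\<omega>. restrict (\<lambda>p\<in>I. X_at \<eta> N p t \<omega>) R)
      (\<lambda>y. ennreal (\<integral>z. uN \<eta> N t (merge R (I - R) (y, z)) \<partial>PiM (I - R) (\<lambda>_. lborel)))"
    by (rule mg(1))
  have mg2: "(\<lambda>y. \<integral>z. uN \<eta> N t (merge R (I - R) (y, z)) \<partial>PiM (I - R) (\<lambda>_. lborel)) \<in> borel_measurable (PiM R (\<lambda>_. lborel))"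
    by (rule mg(2))
  have mdef: "marginal N r (uN \<eta> N t) = (\<lambda>y. \<integral>z. uN \<eta> N t (merge R (I - R) (y, z)) \<partial>PiM (I - R) (\<lambda>_. lborel))"
    by (simp add: marginal_def[abs_def] Let_def config_measure_def I_def R_def)
  have restr: "(\<lambda>\<omega>. restrict (\<lambda>p\<in>I. X_at \<eta> N p t \<omega>) R) = (\<lambda>\<omega>. \<lambda>p\<in>R. X_at \<eta> N p t \<omega>)"
    using RI by (auto simp: restrict_def fun_eq_iff)
  show "distributed M (PiM (slots r) (\<lambda>_. lborel)) (\<lambda>\<omega>. \<lambda>p\<in>slots r. X_at \<eta> N p t \<omega>) (\<lambda>y. ennreal (marginal N r (uN \<eta> N t) y))"
    using mg1 unfolding mdef restr unfolding R_def .
  show "marginal N r (uN \<eta> N t) \<in> borel_measurable (PiM (slots r) (\<lambda>_. lborel))"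
    using mg2 unfolding mdef R_def .
  show "y \<in> space (PiM (slots r) (\<lambda>_. lborel)) \<Longrightarrow> 0 \<le> marginal N r (uN \<eta> N t) y"
    unfolding mdef R_def by (rule mg(3)[unfolded R_def])
qed

lemma tensor_measurable:
  assumes "\<And>i. w i \<in> borel_measurable lborel"
  shows "tensor r w \<in> borel_measurable (PiM (slots r) (\<lambda>_. lborel))"
proof -
  have "(\<lambda>y. w i (y (i, k))) \<in> borel_measurable (PiM (slots r) (\<lambda>_. lborel))" if "k \<in> {1..r i}" for i k
    by (rule measurable_compose[OF measurable_component_singleton]) (use that assms in \<open>auto simp: slots_def\<close>)
  then show ?thesis unfolding tensor_def[abs_def] by (intro borel_measurable_prod)
qed

lemma marginal_L1_le_tv:
  assumes \<eta>: "\<eta> > 0" and N: "N \<ge> 1" and r: "\<And>i. r i \<le> N" and t: "t \<in> {0..T}"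
    and tv: "\<And>A. A \<in> sets (PiM (slots r) (\<lambda>_. lborel)) \<Longrightarrow>
      \<bar>prob ((\<lambda>\<omega>. \<lambda>p\<in>slots r. X_at \<eta> N p t \<omega>) -` A \<inter> space M) - prob ((\<lambda>\<omega>. \<lambda>p\<in>slots r. Xbar_at \<eta> p t \<omega>) -` A \<inter> space M)\<bar> \<le> b"
  shows "(\<integral>\<^sup>+y. ennreal \<bar>marginal N r (uN \<eta> N t) y - tensor r (u_eta \<eta> t) y\<bar> \<partial>config_measure (slots r)) \<le> ennreal (2 * b)"
  unfolding config_measure_def
proof (rule L1_density_le_tv[OF marginal_law(1)[OF \<eta> N r t] _ marginal_law(2)[OF \<eta> N r t] _ marginal_law(3)[OF \<eta> N r t]])
  show "distributed M (PiM (slots r) (\<lambda>_. lborel)) (\<lambda>\<omega>. \<lambda>p\<in>slots r. Xbar_at \<eta> p t \<omega>) (\<lambda>y. ennreal (tensor r (u_eta \<eta> t) y))"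
    using Xbar_joint_law[OF \<eta> t, of r] by (simp add: config_measure_def)
  show "tensor r (u_eta \<eta> t) \<in> borel_measurable (PiM (slots r) (\<lambda>_. lborel))"
    by (rule tensor_measurable) (use u_eta_measurable[OF \<eta> t] in simp)
  show "0 \<le> tensor r (u_eta \<eta> t) x" for x unfolding tensor_def by (intro prod_nonneg u_eta_facts(1)[OF \<eta> t])
qed (assumption, rule tv)

text \<open>Here \<open>e\<close> bounds the mean distance at the start of the window of length \<open>\<delta>\<close>.\<close>

lemma joint_L1:
  assumes \<eta>: "\<eta> > 0" and N: "N \<ge> 1" and r: "\<And>i. r i \<le> N" and t: "t \<in> {0..T}" and \<delta>: "\<delta> > 0" and e0: "e \<ge> 0"
    and e: "\<And>p \<tau>. p \<in> slots (\<lambda>_. N) \<Longrightarrow> 0 < \<tau> \<Longrightarrow> \<tau> < T \<Longrightarrow> (\<integral>\<^sup>+\<omega>. ennreal (norm (X_at \<eta> N p \<tau> \<omega> - Xbar_at \<eta> p \<tau> \<omega>)) \<partial>M) \<le> ennreal e"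
  shows "(\<integral>\<^sup>+y. ennreal \<bar>marginal N r (uN \<eta> N t) y - tensor r (u_eta \<eta> t) y\<bar> \<partial>config_measure (slots r)) \<le>
    ennreal (2 * (\<Sum>p\<in>slots r. (6 * (\<eta> powr (- real DIM('a)) / \<eta> * K_sum + drift_bound) * sqrt \<delta> + 2 * e / sqrt \<delta>) / c p))"
proof (rule marginal_L1_le_tv[OF \<eta> N r t])
  define R where "R = slots r"
  have RI': "R \<subseteq> slots (\<lambda>_. N)" unfolding R_def by (rule slots_mono[OF r])
  interpret BF: brownian_family M R W_at "noise_sigma M W \<zeta> (slots (\<lambda>_. N))" by (rule noise_family[OF N RI'])
  have e': "expectation (\<lambda>\<omega>. norm (X_at \<eta> N p \<tau> \<omega> - Xbar_at \<eta> p \<tau> \<omega>)) \<le> e" if "p \<in> R" "0 < \<tau>" "\<tau> < T" for p \<tau>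
  proof (rule expectation_le_of_nn_integral[OF _ _ e e0])
    have p': "p \<in> slots (\<lambda>_. N)" using that RI' by auto
    show "p \<in> slots (\<lambda>_. N)" by (rule p')
    show "(\<lambda>\<omega>. norm (X_at \<eta> N p \<tau> \<omega> - Xbar_at \<eta> p \<tau> \<omega>)) \<in> borel_measurable M"
      using X_measurable[OF \<eta> p', of \<tau>] Xbar_measurable[OF \<eta> slots_snd[OF p'], of \<tau>] that by auto
  qed (use that in auto)
  have st: "AE \<omega> in M. X_at \<eta> N p 0 \<omega> = Xbar_at \<eta> p 0 \<omega>" if "p \<in> R" for p
  proof -
    have p': "p \<in> slots (\<lambda>_. N)" using that RI' by auto
    show ?thesis
      using start_eq(1)[OF slots_snd[OF p'] \<eta> p'] start_eq(2)[OF slots_snd[OF p'] \<eta>] by eventually_elim simp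
  qed
  have B1: "0 \<le> \<eta> powr (- real DIM('a)) / \<eta> * K_sum" using \<eta> K_sum_nonneg by simp
  fix A :: "('n \<times> nat \<Rightarrow> 'a) set" assume "A \<in> sets (PiM (slots r) (\<lambda>_. lborel))"
  then have A: "A \<in> sets (PiM R (\<lambda>_. lborel))" by (simp add: R_def)
  obtain A' where A': "A' \<in> sets borel" "\<forall>x. config R x \<in> A' \<longleftrightarrow> (\<lambda>p\<in>R. x p) \<in> A"
    using config_event[OF A] ..
  have "\<bar>prob ((\<lambda>\<omega>. config R (\<lambda>p. X_at \<eta> N p t \<omega>)) -` A' \<inter> space M) - prob ((\<lambda>\<omega>. config R (\<lambda>p. Xbar_at \<eta> p t \<omega>)) -` A' \<inter> space M)\<bar>
     \<le> (\<Sum>p\<in>R. (6 * (\<eta> powr (- real DIM('a)) / \<eta> * K_sum + drift_bound) * sqrt \<delta> + 2 * e / sqrt \<delta>) / c p)"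
    by (rule BF.tv_drift_processes_same_start[OF c_pos B1 drift_bound_nonneg X_drift[OF \<eta> N RI'] Xbar_drift[OF \<eta> N RI'] st e' e0 t \<delta> A'(1)])
  moreover have "(\<lambda>\<omega>. config R (\<lambda>p. X_at \<eta> N p t \<omega>)) -` A' \<inter> space M = (\<lambda>\<omega>. \<lambda>p\<in>R. X_at \<eta> N p t \<omega>) -` A \<inter> space M"
    "(\<lambda>\<omega>. config R (\<lambda>p. Xbar_at \<eta> p t \<omega>)) -` A' \<inter> space M = (\<lambda>\<omega>. \<lambda>p\<in>R. Xbar_at \<eta> p t \<omega>) -` A \<inter> space M"
    using A'(2) by auto
  ultimately show "\<bar>prob ((\<lambda>\<omega>. \<lambda>p\<in>slots r. X_at \<eta> N p t \<omega>) -` A \<inter> space M) - prob ((\<lambda>\<omega>. \<lambda>p\<in>slots r. Xbar_at \<eta> p t \<omega>) -` A \<inter> space M)\<bar>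
     \<le> (\<Sum>p\<in>slots r. (6 * (\<eta> powr (- real DIM('a)) / \<eta> * K_sum + drift_bound) * sqrt \<delta> + 2 * e / sqrt \<delta>) / c p)"
    by (simp add: R_def)
qed

text \<open>The smoothing route for one particle: good if the diffusivity is large.\<close>

lemma single_L1_smoothing:
  assumes \<eta>: "\<eta> > 0" and t: "t \<in> {0..T}" and \<delta>: "\<delta> > 0" and e0: "e \<ge> 0"
    and e: "\<And>\<tau>. 0 < \<tau> \<Longrightarrow> \<tau> < T \<Longrightarrow> (\<integral>\<^sup>+\<omega>. ennreal (norm (Xbar_at \<eta> (i, 1) \<tau> \<omega> - Xhat_at (i, 1) \<tau> \<omega>)) \<partial>M) \<le> ennreal e"
  shows "(\<integral>\<^sup>+x. ennreal \<bar>u_eta \<eta> t i x - u t i x\<bar> \<partial>lborel) \<le> ennreal (2 * ((12 * drift_bound * sqrt \<delta> + 2 * e / sqrt \<delta>) / sqrt (2 * \<sigma> i)))"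
proof -
  define p where "p = (i, 1::nat)"
  have p1: "snd p \<ge> 1" by (simp add: p_def)
  interpret BF: brownian_family M "{p}" W_at F by (rule single_family[OF p1])
  have d1: "distributed M lborel (Xbar_at \<eta> p t) (\<lambda>x. ennreal (u_eta \<eta> t i x))" using Xbar_sde(2)[OF \<eta> p1 t] by (simp add: p_def)
  have d2: "distributed M lborel (Xhat_at p t) (\<lambda>x. ennreal (u t i x))" using Xhat_sde(2)[OF p1 t] by (simp add: p_def)
  have e': "expectation (\<lambda>\<omega>. norm (Xbar_at \<eta> q \<tau> \<omega> - Xhat_at q \<tau> \<omega>)) \<le> e" if "q \<in> {p}" "0 < \<tau>" "\<tau> < T" for q \<tau>
  proof (rule expectation_le_of_nn_integral)
    show "(\<integral>\<^sup>+\<omega>. ennreal (norm (Xbar_at \<eta> q \<tau> \<omega> - Xhat_at q \<tau> \<omega>)) \<partial>M) \<le> ennreal e" using e[OF that(2,3)] that(1) by (simp add: p_def)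
    show "(\<lambda>\<omega>. norm (Xbar_at \<eta> q \<tau> \<omega> - Xhat_at q \<tau> \<omega>)) \<in> borel_measurable M"
      using Xbar_measurable[OF \<eta> p1, of \<tau>] Xhat_measurable[OF p1, of \<tau>] that by auto
  qed (use e0 in auto)
  have st: "AE \<omega> in M. Xbar_at \<eta> q 0 \<omega> = Xhat_at q 0 \<omega>" if "q \<in> {p}" for q
    using that start_eq(2)[OF p1 \<eta>] start_eq(3)[OF p1] by (auto elim: eventually_elim2)
  show ?thesis
  proof (rule L1_density_le_tv[OF d1 d2])
    fix A :: "'a set" assume "A \<in> sets lborel"
    then have A: "A \<in> sets borel" by simp
    have "(\<lambda>f :: 'n \<times> nat \<Rightarrow> 'a. f p) \<in> borel_measurable borel"
      by (intro borel_measurable_continuous_onI) simp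
    from measurable_sets[OF this A] have A': "(\<lambda>f :: 'n \<times> nat \<Rightarrow> 'a. f p) -` A \<in> sets borel" by simp
    have "\<bar>prob ((\<lambda>\<omega>. config {p} (\<lambda>p. Xbar_at \<eta> p t \<omega>)) -` ((\<lambda>f. f p) -` A) \<inter> space M) - prob ((\<lambda>\<omega>. config {p} (\<lambda>p. Xhat_at p t \<omega>)) -` ((\<lambda>f. f p) -` A) \<inter> space M)\<bar>
       \<le> (\<Sum>p\<in>{p}. (6 * (drift_bound + drift_bound) * sqrt \<delta> + 2 * e / sqrt \<delta>) / c p)"
      by (rule BF.tv_drift_processes_same_start[OF c_pos drift_bound_nonneg drift_bound_nonneg single_drift[OF \<eta> p1] st e' e0 t \<delta> A'])
    moreover have "(\<lambda>\<omega>. config {p} (\<lambda>p. Z p \<omega>)) -` ((\<lambda>f. f p) -` A) \<inter> space M = Z p -` A \<inter> space M" for Z :: "'n \<times> nat \<Rightarrow> 'w \<Rightarrow> 'a"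
      by (auto simp: config_def)
    ultimately show "\<bar>prob (Xbar_at \<eta> p t -` A \<inter> space M) - prob (Xhat_at p t -` A \<inter> space M)\<bar> \<le> (12 * drift_bound * sqrt \<delta> + 2 * e / sqrt \<delta>) / sqrt (2 * \<sigma> i)"
      by (simp add: c_def p_def)
  qed (use u_eta_measurable[OF \<eta> t] u_measurable[OF t] u_eta_facts(1)[OF \<eta> t] u_facts(1)[OF t] in auto)
qed

text \<open>The \<open>L\<^sup>2\<close> assumption is an essential supremum, so it is available at almost every time only.\<close>

lemma L2_bound:
  assumes \<eta>: "\<eta> > 0"
  shows "AE t in lborel. t \<in> {0<..<T} \<longrightarrow> (\<forall>i. (\<integral>\<^sup>+x. ennreal ((u_eta \<eta> t i x - u t i x)\<^sup>2) \<partial>lborel) \<le> ennreal ((C2 * \<eta>)\<^sup>2))"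
proof -
  have "time_Linf T (\<lambda>t. L2_norm (\<lambda>i x. u_eta \<eta> t i x - u t i x)) + 0 \<le> time_Linf T (\<lambda>t. L2_norm (\<lambda>i x. u_eta \<eta> t i x - u t i x)) +
     time_L2 T (\<lambda>t. L2_norm (\<lambda>i. grad (\<lambda>x. u_eta \<eta> t i x - u t i x)))"
    by (rule add_left_mono) simp
  also have "\<dots> \<le> ennreal (C2 * \<eta>)" using A2 \<eta> unfolding assumption_A2_def by (elim allE impE)
  finally have "time_Linf T (\<lambda>t. L2_norm (\<lambda>i x. u_eta \<eta> t i x - u t i x)) \<le> ennreal (C2 * \<eta>)" by simp
  from AE_le_of_time_Linf[OF this] show ?thesis
  proof eventually_elim
    case (elim t)
    show ?case
    proof (intro impI allI)
      fix i assume t: "t \<in> {0<..<T}"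
      have "(\<Sum>i\<in>UNIV. \<integral>\<^sup>+x. ennreal ((norm (u_eta \<eta> t i x - u t i x))\<^sup>2) \<partial>lborel) \<le> ennreal ((C2 * \<eta>)\<^sup>2)"
        by (rule esqrt_leD) (use elim t C2 \<eta> in \<open>auto simp: L2_norm_def\<close>)
      then show "(\<integral>\<^sup>+x. ennreal ((u_eta \<eta> t i x - u t i x)\<^sup>2) \<partial>lborel) \<le> ennreal ((C2 * \<eta>)\<^sup>2)"
        using member_le_sum_ennreal[of UNIV i "\<lambda>i. \<integral>\<^sup>+x. ennreal ((norm (u_eta \<eta> t i x - u t i x))\<^sup>2) \<partial>lborel"]
        by (auto intro: order_trans)
    qed
  qed
qed

definition "second_moment i = (\<integral>x. u0 i x * (norm x)\<^sup>2 \<partial>lborel)"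

text \<open>Applied to the intermediate and the limiting process; \<open>Z0\<close> is the value at time zero.\<close>

lemma tail_bound:
  assumes t: "t \<in> {0<..<T}" and r: "r > 0" and Z: "Z \<in> borel_measurable M"
    and st: "AE \<omega> in M. Z0 \<omega> = start_at p \<omega>" and p: "snd p \<ge> 1"
    and inc: "AE \<omega> in M. norm (Z \<omega> - Z0 \<omega> - c p *\<^sub>R (W_at p t \<omega> - W_at p 0 \<omega>)) \<le> drift_bound * (t - 0)"
  shows "prob {\<omega>\<in>space M. r < norm (Z \<omega>)} \<le> real DIM('a) ^ 9 * 105 * T ^ 4 * (2 * sqrt (2 * \<sigma> (fst p)) / r) ^ 8 + 8 * (second_moment (fst p) + (drift_bound * T)\<^sup>2) / r\<^sup>2"
proof -
  define i where "i = fst p"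
  have t': "0 < t" "t < T" using t by auto
  have Wd: "distributed M lborel (\<lambda>\<omega>. W_at p t \<omega> - W_at p 0 \<omega>) (\<lambda>x. ennreal (gauss t x))"
    using conjunct2[OF conjunct2[OF noise_facts(1)[OF p, unfolded brownian_motion_def]], rule_format, of 0 t] t' unfolding gauss_def[abs_def] by simp
  note zd = noise_facts(3)[OF p]
  have zm: "start_at p \<in> borel_measurable M" using distributed_measurable[OF zd] by simp
  have u0: "\<And>x. 0 \<le> u0 i x" using init by (auto simp: initial_data_def)
  have m2: "(\<lambda>x::'a. (norm x)\<^sup>2) \<in> borel_measurable lborel" by measurable
  have zi: "integrable M (\<lambda>\<omega>. (norm (start_at p \<omega>))\<^sup>2)"
    using distributed_integrable[OF zd m2] moment[of i] u0 by (simp add: i_def)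
  have zE: "expectation (\<lambda>\<omega>. (norm (start_at p \<omega>))\<^sup>2) = second_moment i"
    using distributed_integral[OF zd m2] u0 by (simp add: i_def second_moment_def)
  have b: "0 \<le> drift_bound * t" using drift_bound_nonneg t' by simp
  have X: "AE \<omega> in M. norm (Z \<omega> - start_at p \<omega> - c p *\<^sub>R (W_at p t \<omega> - W_at p 0 \<omega>)) \<le> drift_bound * t"
    using inc st by eventually_elim simp
  have "prob {\<omega>\<in>space M. r < norm (Z \<omega>)} \<le>
     real DIM('a) ^ 9 * 105 * t ^ 4 * (2 * c p / r) ^ 8 + 8 * (second_moment i + (drift_bound * t)\<^sup>2) / r\<^sup>2"
    using tail_of_gauss_plus_square_integrable[OF Wd t'(1) r c_pos[of p] b Z zm zi X] unfolding zE .
  also have "\<dots> \<le> real DIM('a) ^ 9 * 105 * T ^ 4 * (2 * c p / r) ^ 8 + 8 * (second_moment i + (drift_bound * T)\<^sup>2) / r\<^sup>2"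
    using t' drift_bound_nonneg r c_pos[of p]
    by (intro add_mono mult_right_mono mult_left_mono divide_right_mono power_mono) auto
  finally show ?thesis by (simp add: c_def i_def)
qed

text \<open>The moment route for one particle: good if the diffusivity is small.\<close>

lemma single_L1_moments:
  fixes i :: 'n
  assumes \<eta>: "\<eta> > 0" and t: "t \<in> {0..T}" and l: "l > 0" and r: "r > 0"
  defines "e \<equiv> l * (unit_ball_vol (real DIM('a)) * r ^ DIM('a)) + (C2 * \<eta>)\<^sup>2 / l +
     2 * (real DIM('a) ^ 9 * 105 * T ^ 4 * (2 * sqrt (2 * \<sigma> i) / r) ^ 8 + 8 * (second_moment i + (drift_bound * T)\<^sup>2) / r\<^sup>2)"
  shows "(\<integral>\<^sup>+x. ennreal \<bar>u_eta \<eta> t i x - u t i x\<bar> \<partial>lborel) \<le> ennreal (2 * e)"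
proof -
  define p where "p = (i, 1::nat)"
  have p1: "snd p \<ge> 1" and fp: "fst p = i" by (auto simp: p_def)
  have second_moment: "0 \<le> second_moment i" unfolding second_moment_def using init by (intro integral_nonneg_AE) (auto simp: initial_data_def)
  have e0: "0 \<le> e"
    unfolding e_def using l r second_moment sigma_pos[of i] T by (intro add_nonneg_nonneg mult_nonneg_nonneg divide_nonneg_nonneg) auto
  have d1: "distributed M lborel (Xbar_at \<eta> p t) (\<lambda>x. ennreal (u_eta \<eta> t i x))" if "t \<in> {0..T}" for t using Xbar_sde(2)[OF \<eta> p1 that] by (simp add: fp)
  have d2: "distributed M lborel (Xhat_at p t) (\<lambda>x. ennreal (u t i x))" if "t \<in> {0..T}" for t using Xhat_sde(2)[OF p1 that] by (simp add: fp)
  have good: "(\<integral>\<^sup>+x. ennreal \<bar>u_eta \<eta> t i x - u t i x\<bar> \<partial>lborel) \<le> ennreal e"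
    if t: "t \<in> {0<..<T}" and L2: "\<forall>i. (\<integral>\<^sup>+x. ennreal ((u_eta \<eta> t i x - u t i x)\<^sup>2) \<partial>lborel) \<le> ennreal ((C2 * \<eta>)\<^sup>2)" for t
  proof -
    have t': "t \<in> {0..T}" "0 \<in> {0..T}" using t by auto
    have "prob {\<omega>\<in>space M. r < norm (Xbar_at \<eta> p t \<omega>)} \<le> real DIM('a) ^ 9 * 105 * T ^ 4 * (2 * sqrt (2 * \<sigma> (fst p)) / r) ^ 8 + 8 * (second_moment (fst p) + (drift_bound * T)\<^sup>2) / r\<^sup>2"
      by (rule tail_bound[OF t r Xbar_measurable[OF \<eta> p1 t'(1)] start_eq(2)[OF p1 \<eta>] p1 Xbar_increment[OF \<eta> p1 t'(2) t'(1)]])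
    moreover have "prob {\<omega>\<in>space M. r < norm (Xhat_at p t \<omega>)} \<le> real DIM('a) ^ 9 * 105 * T ^ 4 * (2 * sqrt (2 * \<sigma> (fst p)) / r) ^ 8 + 8 * (second_moment (fst p) + (drift_bound * T)\<^sup>2) / r\<^sup>2"
      by (rule tail_bound[OF t r Xhat_measurable[OF p1 t'(1)] start_eq(3)[OF p1] p1 Xhat_increment[OF p1 t'(2) t'(1)]])
    moreover define B where "B = real DIM('a) ^ 9 * 105 * T ^ 4 * (2 * sqrt (2 * \<sigma> i) / r) ^ 8 + 8 * (second_moment i + (drift_bound * T)\<^sup>2) / r\<^sup>2"
    ultimately have le: "l * (unit_ball_vol (real DIM('a)) * r ^ DIM('a)) + (C2 * \<eta>)\<^sup>2 / l + prob {\<omega>\<in>space M. r < norm (Xbar_at \<eta> p t \<omega>)} + prob {\<omega>\<in>space M. r < norm (Xhat_at p t \<omega>)} \<le> e"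
      unfolding e_def fp B_def[symmetric] by linarith
    have "(\<integral>\<^sup>+x. ennreal \<bar>u_eta \<eta> t i x - u t i x\<bar> \<partial>lborel) \<le>
      ennreal (l * (unit_ball_vol (real DIM('a)) * r ^ DIM('a)) + (C2 * \<eta>)\<^sup>2 / l + prob {\<omega>\<in>space M. r < norm (Xbar_at \<eta> p t \<omega>)} + prob {\<omega>\<in>space M. r < norm (Xhat_at p t \<omega>)})"
      by (rule L1_le_L2_plus_tails[OF d1[OF t'(1)] d2[OF t'(1)] u_eta_measurable[OF \<eta> t'(1)] u_measurable[OF t'(1)]
            u_eta_facts(1)[OF \<eta> t'(1)] u_facts(1)[OF t'(1)] L2[rule_format] l less_imp_le[OF r]])
    also have "\<dots> \<le> ennreal e" using le by (rule ennreal_leI)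
    finally show ?thesis .
  qed
  \<comment> \<open>The paths are continuous in time, so the bound
    passes to the limit for continuous test functions, hence for the laws.\<close>
  obtain f where f': "(\<forall>n. f n \<in> {0<..<T} \<and> (\<forall>i. (\<integral>\<^sup>+x. ennreal ((u_eta \<eta> (f n) i x - u (f n) i x)\<^sup>2) \<partial>lborel) \<le> ennreal ((C2 * \<eta>)\<^sup>2))) \<and> f \<longlonglongrightarrow> t"
    using AE_dense_sequence[OF L2_bound[OF \<eta>] T t] ..
  note f = conjunct1[OF f', rule_format] and ft = conjunct2[OF f']
  have fT: "f n \<in> {0..T}" for n using f[of n] by auto
  show ?thesis
  proof (rule L1_density_le_tv[OF d1[OF t] d2[OF t]])
    fix A :: "'a set" assume "A \<in> sets lborel"
    then have A: "A \<in> sets borel" by simp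
    show "\<bar>prob (Xbar_at \<eta> p t -` A \<inter> space M) - prob (Xhat_at p t -` A \<inter> space M)\<bar> \<le> e"
    proof (rule tv_le_of_continuous[OF Xbar_measurable[OF \<eta> p1 t] Xhat_measurable[OF p1 t] _ A])
      fix \<phi> :: "'a \<Rightarrow> real" assume \<phi>: "continuous_on UNIV \<phi>" and \<phi>01: "\<And>x. 0 \<le> \<phi> x \<and> \<phi> x \<le> 1"
      have \<phi>m[measurable]: "\<phi> \<in> borel_measurable borel" using \<phi> by (rule borel_measurable_continuous_onI)
      have \<phi>1: "\<bar>\<phi> x\<bar> \<le> 1" for x using \<phi>01[of x] by simp
      have conv: "(\<lambda>n. expectation (\<lambda>\<omega>. \<phi> (Z (f n) \<omega>))) \<longlonglongrightarrow> expectation (\<lambda>\<omega>. \<phi> (Z t \<omega>))"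
        if Zm: "\<And>t. t \<in> {0..T} \<Longrightarrow> Z t \<in> borel_measurable M" and Zc: "AE \<omega> in M. continuous_on {0..T} (\<lambda>t. Z t \<omega>)" for Z
      proof (rule integral_dominated_convergence[where w="\<lambda>_. 1"])
        show "AE \<omega> in M. (\<lambda>n. \<phi> (Z (f n) \<omega>)) \<longlonglongrightarrow> \<phi> (Z t \<omega>)"
          using Zc
        proof eventually_elim
          case (elim \<omega>)
          have "(\<lambda>n. Z (f n) \<omega>) \<longlonglongrightarrow> Z t \<omega>"
            by (rule continuous_on_tendsto_compose[OF elim ft t]) (use fT in auto)
          then show ?case by (rule continuous_on_tendsto_compose[OF \<phi>]) auto
        qed
      qed (use Zm[OF t] Zm[OF fT] \<phi>1 in auto)
      have "(\<lambda>n. \<bar>expectation (\<lambda>\<omega>. \<phi> (Xbar_at \<eta> p (f n) \<omega>)) - expectation (\<lambda>\<omega>. \<phi> (Xhat_at p (f n) \<omega>))\<bar>)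
         \<longlonglongrightarrow> \<bar>expectation (\<lambda>\<omega>. \<phi> (Xbar_at \<eta> p t \<omega>)) - expectation (\<lambda>\<omega>. \<phi> (Xhat_at p t \<omega>))\<bar>"
      proof (intro tendsto_intros conv)
        show "AE \<omega> in M. continuous_on {0..T} (\<lambda>t. Xbar_at \<eta> p t \<omega>)"
          using Xbar_sde(1)[OF \<eta> p1] unfolding sde_solution_def by (auto elim!: eventually_mono)
        show "AE \<omega> in M. continuous_on {0..T} (\<lambda>t. Xhat_at p t \<omega>)"
          using Xhat_sde(1)[OF p1] unfolding sde_solution_def by (auto elim!: eventually_mono)
      qed (use Xbar_measurable[OF \<eta> p1] Xhat_measurable[OF p1] in auto)
      then show "\<bar>expectation (\<lambda>\<omega>. \<phi> (Xbar_at \<eta> p t \<omega>)) - expectation (\<lambda>\<omega>. \<phi> (Xhat_at p t \<omega>))\<bar> \<le> e"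
      proof (rule LIMSEQ_le_const2, intro exI allI impI)
        fix n
        show "\<bar>expectation (\<lambda>\<omega>. \<phi> (Xbar_at \<eta> p (f n) \<omega>)) - expectation (\<lambda>\<omega>. \<phi> (Xhat_at p (f n) \<omega>))\<bar> \<le> e"
          by (rule expectation_diff_le_L1_density[OF d1[OF fT] d2[OF fT] _ _ _ _ _ \<phi>1 good[OF conjunct1[OF f] conjunct2[OF f]] e0])
            (use u_eta_measurable[OF \<eta> fT] u_measurable[OF fT] u_eta_facts(1)[OF \<eta> fT] u_facts(1)[OF fT] in auto)
      qed
    qed
  qed (use u_eta_measurable[OF \<eta> t] u_measurable[OF t] u_eta_facts(1)[OF \<eta> t] u_facts(1)[OF t] in auto)
qed

lemma tensor_L1:
  assumes \<eta>: "\<eta> > 0" and t: "t \<in> {0..T}"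
  shows "(\<integral>\<^sup>+y. ennreal \<bar>tensor r (u_eta \<eta> t) y - tensor r (u t) y\<bar> \<partial>config_measure (slots r)) \<le>
    (\<Sum>p\<in>slots r. \<integral>\<^sup>+x. ennreal \<bar>u_eta \<eta> t (fst p) x - u t (fst p) x\<bar> \<partial>lborel)"
proof -
  have tn: "tensor r w y = (\<Prod>p\<in>slots r. w (fst p) (y p))" for w :: "'n \<Rightarrow> 'a \<Rightarrow> real" and y
    unfolding tensor_def slots_def by (subst prod.Sigma) (auto simp: split_beta')
  have one: "(\<integral>\<^sup>+x. ennreal (w x) \<partial>lborel) = 1" if "has_bochner_integral lborel w 1" "\<And>x. 0 \<le> w x" for w :: "'a \<Rightarrow> real"
    using nn_integral_eq_integral[of lborel w] that by (simp add: has_bochner_integral_iff)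
  show ?thesis
    unfolding tn config_measure_def
    by (rule L1_product_le_sum[OF slots_finite])
      (use u_eta_measurable[OF \<eta> t] u_measurable[OF t] u_eta_facts(1,2)[OF \<eta> t] u_facts(1,2)[OF t] in \<open>auto intro!: one\<close>)
qed

end

section \<open>Rates\<close>

text \<open>From \<open>1 + x / k \<le> exp (x / k)\<close>.\<close>

lemma power_le_exp:
  assumes "0 \<le> (x::real)" and "0 < k"
  shows "(x / real k) ^ k \<le> exp x"
proof -
  have "x / real k \<le> exp (x / real k)" using exp_ge_add_one_self[of "x / real k"] by linarith
  then have "(x / real k) ^ k \<le> exp (x / real k) ^ k" by (rule power_mono) (use assms in simp)
  also have "\<dots> = exp x" using assms(2) by (simp flip: exp_of_nat_mult)
  finally show ?thesis .
qed

text \<open>For \<open>N = 0\<close> and \<open>N = 1\<close> the logarithm vanishes, so the coupling fails.\<close>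

lemma admissible_ge_2:
  assumes "admissible TYPE('a::euclidean_space) \<epsilon> \<eta> N" and "\<eta> > 0"
  shows "2 \<le> N"
proof (rule ccontr)
  assume "\<not> 2 \<le> N"
  then have "N = 0 \<or> N = 1" by auto
  then have "ln (real N) = 0" by auto
  then have "\<eta> powr (- 2 * real DIM('a) - 4) \<le> 0" using assms by (simp add: admissible_def)
  then show False using assms(2) by simp
qed

text \<open>The coupling forces \<open>ln N / 8 \<ge> 1 / \<eta>\<close>, and the exponential dominates every power.\<close>

lemma admissible_rate:
  assumes adm: "admissible TYPE('a::euclidean_space) \<epsilon> \<eta> N" and \<epsilon>: "0 < \<epsilon>" "\<epsilon> \<le> 1 / 8" and \<eta>: "0 < \<eta>" "\<eta> \<le> 1"
  shows "real N powr (- 1 / 8) \<le> real (DIM('a) + 2) ^ (DIM('a) + 2) * \<eta> ^ (DIM('a) + 2)"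
proof -
  define k where "k = DIM('a) + 2"
  have k: "0 < k" by (simp add: k_def)
  have N: "2 \<le> N" by (rule admissible_ge_2[OF adm \<eta>(1)])
  have "1 / \<eta> = \<eta> powr (- 1)" using \<eta> by (simp add: powr_minus inverse_eq_divide)
  also have "\<dots> \<le> \<eta> powr (- 2 * real DIM('a) - 4)" by (rule powr_mono') (use \<eta> in auto)
  also have "\<dots> \<le> \<epsilon> * ln (real N)" using adm by (simp add: admissible_def)
  also have "\<dots> \<le> 1 / 8 * ln (real N)" by (rule mult_right_mono) (use \<epsilon> N in auto)
  finally have ln: "1 / \<eta> \<le> ln (real N) / 8" by simp
  have "real N powr (- 1 / 8) = exp (- (ln (real N) / 8))" using N by (simp add: powr_def)
  also have "\<dots> \<le> exp (- (1 / \<eta>))" using ln by simp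
  also have "\<dots> = 1 / exp (1 / \<eta>)" by (simp add: exp_minus inverse_eq_divide)
  also have "\<dots> \<le> 1 / (1 / \<eta> / real k) ^ k"
    by (rule divide_left_mono) (use power_le_exp[of "1 / \<eta>" k] \<eta> k in auto)
  also have "\<dots> = real k ^ k * \<eta> ^ k" using \<eta> k by (simp add: power_divide power_mult_distrib)
  finally show ?thesis by (simp add: k_def)
qed

text \<open>With the window \<open>\<delta>\<close>, both the smoothing error and the ratio of the mean distance \<open>q\<close> to \<open>sqrt \<delta>\<close> are at most of the order
\<open>N powr (- 1 / 8)\<close>; the exponent \<open>- 1 / 8\<close> leaves room for \<open>C * \<epsilon>\<close> up to \<open>1 / 4\<close>.\<close>

lemma fluctuation_rate:
  assumes N: "2 \<le> N" and C: "C > 0" and \<epsilon>: "C * \<epsilon> \<le> 1 / 4"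
  defines "\<nu> \<equiv> real N powr (- 1 / 8)" and "q \<equiv> sqrt (C * real N powr (- 1 + C * \<epsilon>))"
    and "\<delta> \<equiv> real N powr (- 1 / 2)"
  shows "sqrt \<delta> \<le> \<nu>" and "q / sqrt \<delta> \<le> sqrt C * \<nu>" and "q \<le> sqrt C * \<nu>"
proof -
  have N1: "1 \<le> real N" "0 < real N" using N by auto
  have sp: "sqrt (real N powr x) = real N powr (x / 2)" for x using N1 by (simp add: powr_half_sqrt[symmetric] powr_powr)
  have sd: "sqrt \<delta> = real N powr (- 1 / 4)" by (simp add: \<delta>_def sp)
  show "sqrt \<delta> \<le> \<nu>" unfolding sd \<nu>_def by (rule powr_mono) (use N1 in auto)
  have q: "q = sqrt C * real N powr ((- 1 + C * \<epsilon>) / 2)" by (simp add: q_def real_sqrt_mult sp)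
  have ex: "(- 1 + C * \<epsilon>) / 2 - (- 1 / 4) \<le> - 1 / 8" using \<epsilon> by argo
  have ex': "(- 1 + C * \<epsilon>) / 2 \<le> - 1 / 8" using \<epsilon> by argo
  have "q / sqrt \<delta> = sqrt C * real N powr ((- 1 + C * \<epsilon>) / 2 - (- 1 / 4))" unfolding q sd powr_diff by simp
  also have "\<dots> \<le> sqrt C * \<nu>" unfolding \<nu>_def by (intro mult_left_mono powr_mono ex) (use N1 C in auto)
  finally show "q / sqrt \<delta> \<le> sqrt C * \<nu>" .
  show "q \<le> sqrt C * \<nu>" unfolding q \<nu>_def by (intro mult_left_mono powr_mono ex') (use N1 C in auto)
qed

text \<open>The threshold is chosen such that \<open>\<eta> / \<sigma>\<close> is at most \<open>\<eta> powr (8 / (4 + d))\<close>.\<close>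

lemma large_diffusion_rate:
  fixes d :: nat
  assumes \<eta>: "0 < \<eta>" and \<sigma>: "\<eta> powr (- ((4 - real d) / (4 + real d))) \<le> \<sigma>"
  shows "sqrt \<eta> / sqrt (2 * \<sigma>) \<le> \<eta> powr (4 / (4 + real d))"
proof -
  define \<gamma> where "\<gamma> = (4 - real d) / (4 + real d)"
  have p: "0 < \<eta> powr (- \<gamma>)" using \<eta> by simp
  then have \<sigma>0: "0 < \<sigma>" using \<sigma> unfolding \<gamma>_def by linarith
  have sp: "sqrt (\<eta> powr (2 * x)) = \<eta> powr x" for x using \<eta> by (simp add: powr_half_sqrt[symmetric] powr_powr)
  have e: "1 + \<gamma> = 2 * (4 / (4 + real d))" by (simp add: \<gamma>_def field_simps)
  have "sqrt \<eta> / sqrt (2 * \<sigma>) = sqrt (\<eta> / (2 * \<sigma>))" by (simp add: real_sqrt_divide)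
  also have "\<dots> \<le> sqrt (\<eta> / \<eta> powr (- \<gamma>))"
    by (intro real_sqrt_le_mono divide_left_mono) (use \<eta> \<sigma> \<sigma>0 p in \<open>auto simp: \<gamma>_def\<close>)
  also have "\<eta> / \<eta> powr (- \<gamma>) = \<eta> powr (1 + \<gamma>)" using \<eta> by (simp add: powr_add powr_minus divide_inverse)
  also have "sqrt \<dots> = \<eta> powr (4 / (4 + real d))" unfolding e sp ..
  finally show ?thesis .
qed

text \<open>Below the threshold, all four terms of the moment route are of the required order.  In the last one, \<open>\<sigma> / r\<^sup>2\<close> is at most
\<open>\<eta> powr (d / (4 + d))\<close>, whose fourth power is small enough as \<open>d \<ge> 1\<close>.\<close>

lemma small_diffusion_rates:
  fixes d :: nat
  assumes \<eta>: "0 < \<eta>" "\<eta> \<le> 1" and d: "1 \<le> d" and \<sigma>0: "0 < \<sigma>" and \<sigma>: "\<sigma> \<le> \<eta> powr (- ((4 - real d) / (4 + real d)))"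
  defines "\<kappa> \<equiv> \<eta> powr (4 / (4 + real d))" and "r \<equiv> \<eta> powr (- 2 / (4 + real d))" and "l \<equiv> \<eta> powr (1 + real d / (4 + real d))"
  shows "l * r ^ d = \<kappa>" and "\<eta>\<^sup>2 / l = \<kappa>" and "1 / r\<^sup>2 = \<kappa>" and "(2 * sqrt (2 * \<sigma>) / r) ^ 8 \<le> 4096 * \<kappa>"
proof -
  have d4: "0 < 4 + real d" by simp
  have rp: "r ^ n = \<eta> powr (real n * (- 2 / (4 + real d)))" for n
    unfolding r_def using \<eta> by (simp add: powr_realpow[symmetric] powr_powr mult.commute)
  have "l * r ^ d = \<eta> powr (1 + real d / (4 + real d) + real d * (- 2 / (4 + real d)))" unfolding l_def rp powr_add ..
  also have "1 + real d / (4 + real d) + real d * (- 2 / (4 + real d)) = 4 / (4 + real d)"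
  proof -
    have "real d / (4 + real d) = 1 - 4 / (4 + real d)" "real d * (- 2 / (4 + real d)) = - 2 * (real d / (4 + real d))"
      using d4 by (simp_all add: diff_divide_eq_iff)
    then show ?thesis by linarith
  qed
  finally show "l * r ^ d = \<kappa>" by (simp add: \<kappa>_def)
  have "\<eta>\<^sup>2 / l = \<eta> powr (2 - (1 + real d / (4 + real d)))" unfolding l_def powr_diff using \<eta> by (simp add: powr_numeral)
  also have "2 - (1 + real d / (4 + real d)) = 4 / (4 + real d)" using d4 by (simp add: field_simps)
  finally show "\<eta>\<^sup>2 / l = \<kappa>" by (simp add: \<kappa>_def)
  have "1 / r\<^sup>2 = \<eta> powr (- (2 * (- 2 / (4 + real d))))" unfolding rp powr_minus_divide by simp
  then show "1 / r\<^sup>2 = \<kappa>" by (simp add: \<kappa>_def)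
  have "(2 * sqrt (2 * \<sigma>) / r) ^ 8 = ((2 * sqrt (2 * \<sigma>))\<^sup>2) ^ 4 * (1 / r ^ 8)" by (simp add: power_divide flip: power_mult)
  also have "(2 * sqrt (2 * \<sigma>))\<^sup>2 = 8 * \<sigma>" using \<sigma>0 by (simp add: power_mult_distrib)
  also have "(8 * \<sigma>) ^ 4 * (1 / r ^ 8) = 4096 * (\<sigma> ^ 4 * (1 / r ^ 8))" by (simp add: power_mult_distrib)
  also have "\<dots> \<le> 4096 * ((\<eta> powr (- ((4 - real d) / (4 + real d)))) ^ 4 * (1 / r ^ 8))"
    by (intro mult_left_mono mult_right_mono power_mono \<sigma>) (use \<sigma>0 in \<open>auto simp: r_def\<close>)
  also have "(\<eta> powr (- ((4 - real d) / (4 + real d)))) ^ 4 * (1 / r ^ 8)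
     = \<eta> powr (4 * (- ((4 - real d) / (4 + real d))) - 8 * (- 2 / (4 + real d)))"
    unfolding powr_diff rp using \<eta> by (simp add: powr_realpow[symmetric] powr_powr mult.commute)
  also have "4 * (- ((4 - real d) / (4 + real d))) - 8 * (- 2 / (4 + real d)) = 4 * real d / (4 + real d)"
  proof -
    have "(4 - real d) / (4 + real d) = 4 / (4 + real d) - real d / (4 + real d)" by (rule diff_divide_distrib)
    moreover have "8 * (- 2 / (4 + real d)) = - 4 * (4 / (4 + real d))" "4 * real d / (4 + real d) = 4 * (real d / (4 + real d))" by simp_all
    ultimately show ?thesis by argo
  qed
  also have "\<eta> powr (4 * real d / (4 + real d)) \<le> \<kappa>"
    unfolding \<kappa>_def by (intro powr_mono' divide_right_mono) (use \<eta> d in auto)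
  finally show "(2 * sqrt (2 * \<sigma>) / r) ^ 8 \<le> 4096 * \<kappa>" by simp
qed

section \<open>Convergence rate of the marginals\<close>

text \<open>Bounds the mean distance of the interacting and the intermediate particles, in units of \<open>\<eta>\<close>.\<close>

definition fluctuation_constant :: "nat \<Rightarrow> real \<Rightarrow> real" where
  "fluctuation_constant d C = sqrt C * real (d + 2) ^ (d + 2)"

text \<open>The first summand belongs to the smoothing route, the second to the moment route; \<open>B\<close> bounds the drift and \<open>m\<close> the
second moments of the initial data.\<close>

definition one_particle_constant :: "nat \<Rightarrow> real \<Rightarrow> real \<Rightarrow> real \<Rightarrow> real \<Rightarrow> real \<Rightarrow> real" where
  "one_particle_constant d T C2 C3 B m =
     2 * (12 * B + 2 * (fluctuation_constant d C3 + C3)) +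
     2 * (unit_ball_vol (real d) + C2\<^sup>2 + 2 * (real d ^ 9 * 105 * T ^ 4 * 4096 + 8 * (m + (B * T)\<^sup>2)))"

text \<open>The first summand belongs to the joint law, the second to the \<open>R\<close> single-particle distances, and the remaining ones
cover \<open>\<eta> > 1\<close>, where every \<open>L\<^sup>1\<close> distance is at most 2.\<close>

definition rate_constant :: "nat \<Rightarrow> real \<Rightarrow> real \<Rightarrow> real \<Rightarrow> real \<Rightarrow> real \<Rightarrow> real \<Rightarrow> real \<Rightarrow> nat \<Rightarrow> real" where
  "rate_constant d smin T C2 C3 B k m R =
     2 * real R * ((6 * k + 6 * B + 2 * sqrt C3) * real (d + 2) ^ (d + 2) / sqrt (2 * smin)) +
     real R * one_particle_constant d T C2 C3 B m + 2 + 2 * real R"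

context chaos
begin

lemma second_moment_nonneg: "0 \<le> second_moment i"
  unfolding second_moment_def using init by (intro integral_nonneg_AE) (auto simp: initial_data_def)

lemma second_moment_le: "second_moment i \<le> (\<Sum>i\<in>UNIV. second_moment i)"
  by (rule member_le_sum) (auto simp: second_moment_nonneg)

text \<open>The drift of the interacting particles is of order \<open>\<eta> powr (- d) / \<eta>\<close>; this factor is compensated by the power
\<open>\<eta> ^ (d + 2)\<close> gained from the size of \<open>N\<close>, and one power of \<open>\<eta>\<close> is left.\<close>

lemma joint_rate:
  assumes adm: "admissible TYPE('a) \<epsilon> \<eta> N" and \<epsilon>: "0 < \<epsilon>" "\<epsilon> < \<epsilon>1" "\<epsilon> \<le> 1 / 8" "C3 * \<epsilon> \<le> 1 / 4"
    and \<eta>: "0 < \<eta>" "\<eta> \<le> 1" and r: "\<And>i. r i \<le> N" and t: "t \<in> {0..T}"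
  shows "(\<integral>\<^sup>+y. ennreal \<bar>marginal N r (uN \<eta> N t) y - tensor r (u_eta \<eta> t) y\<bar> \<partial>config_measure (slots r)) \<le>
    ennreal (2 * real (card (slots r)) * ((6 * K_sum + 6 * drift_bound + 2 * sqrt C3) * real (DIM('a) + 2) ^ (DIM('a) + 2) / sqrt (2 * sigma_min)) * \<eta>)"
proof -
  define \<nu> where "\<nu> = real N powr (- 1 / 8)"
  define q where "q = sqrt (C3 * real N powr (- 1 + C3 * \<epsilon>))"
  define \<delta> where "\<delta> = real N powr (- 1 / 2)"
  define D where "D = real (DIM('a) + 2) ^ (DIM('a) + 2)"
  define h where "h = \<eta> powr (- real DIM('a)) / \<eta>"
  have N2: "2 \<le> N" by (rule admissible_ge_2[OF adm \<eta>(1)])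
  then have N: "1 \<le> N" and \<delta>: "0 < \<delta>" by (auto simp: \<delta>_def)
  have q0: "0 \<le> q" using C3 by (simp add: q_def)
  note fl = fluctuation_rate[OF N2 C3 \<epsilon>(4), folded \<nu>_def q_def \<delta>_def]
  have \<nu>: "\<nu> \<le> D * \<eta> ^ (DIM('a) + 2)" unfolding \<nu>_def D_def by (rule admissible_rate[OF adm \<epsilon>(1,3) \<eta>])
  have \<nu>0: "0 \<le> \<nu>" by (simp add: \<nu>_def)
  have D0: "0 \<le> D" by (simp add: D_def)
  have heq: "h * \<eta> ^ (DIM('a) + 2) = \<eta>"
    using \<eta> by (simp add: h_def powr_minus powr_realpow power_add power2_eq_square field_simps)
  have "1 \<le> \<eta> powr (- real DIM('a))" using powr_mono'[of "- real DIM('a)" 0 \<eta>] \<eta> by simp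
  then have h1: "1 \<le> h" using \<eta> by (simp add: h_def)
  have summand: "(6 * (h * K_sum + drift_bound) * sqrt \<delta> + 2 * q / sqrt \<delta>) / c p \<le> (6 * K_sum + 6 * drift_bound + 2 * sqrt C3) * D / sqrt (2 * sigma_min) * \<eta>" for p
  proof -
    have c: "sqrt (2 * sigma_min) \<le> c p" unfolding c_def using sigma_ge[of "fst p"] by simp
    have A0: "0 \<le> 6 * K_sum + 6 * drift_bound + 2 * sqrt C3" using K_sum_nonneg drift_bound_nonneg C3 by simp
    have "6 * (h * K_sum + drift_bound) * sqrt \<delta> + 2 * q / sqrt \<delta> \<le> 6 * (h * K_sum + h * drift_bound) * \<nu> + 2 * (h * (sqrt C3 * \<nu>))"
    proof (rule add_mono)
      have "drift_bound \<le> h * drift_bound" using mult_right_mono[OF h1 drift_bound_nonneg] by simp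
      then show "6 * (h * K_sum + drift_bound) * sqrt \<delta> \<le> 6 * (h * K_sum + h * drift_bound) * \<nu>"
        using fl(1) K_sum_nonneg drift_bound_nonneg h1 \<delta> by (intro mult_mono add_left_mono) auto
      have "sqrt C3 * \<nu> \<le> h * (sqrt C3 * \<nu>)" using mult_right_mono[OF h1, of "sqrt C3 * \<nu>"] \<nu>0 C3 by simp
      then show "2 * q / sqrt \<delta> \<le> 2 * (h * (sqrt C3 * \<nu>))" using fl(2) by simp
    qed
    also have "\<dots> = (6 * K_sum + 6 * drift_bound + 2 * sqrt C3) * (h * \<nu>)" by (simp add: algebra_simps)
    also have "\<dots> \<le> (6 * K_sum + 6 * drift_bound + 2 * sqrt C3) * (h * (D * \<eta> ^ (DIM('a) + 2)))"
      by (intro mult_left_mono \<nu> A0) (use h1 in simp)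
    also have "\<dots> = (6 * K_sum + 6 * drift_bound + 2 * sqrt C3) * D * (h * \<eta> ^ (DIM('a) + 2))" by (simp only: mult_ac)
    also have "\<dots> = (6 * K_sum + 6 * drift_bound + 2 * sqrt C3) * D * \<eta>" by (simp only: heq)
    finally have num: "6 * (h * K_sum + drift_bound) * sqrt \<delta> + 2 * q / sqrt \<delta> \<le> (6 * K_sum + 6 * drift_bound + 2 * sqrt C3) * D * \<eta>" .
    have "(6 * (h * K_sum + drift_bound) * sqrt \<delta> + 2 * q / sqrt \<delta>) / c p \<le> ((6 * K_sum + 6 * drift_bound + 2 * sqrt C3) * D * \<eta>) / sqrt (2 * sigma_min)"
      by (rule frac_le[OF _ num _ c]) (use A0 D0 \<eta> sigma_min_pos in auto)
    then show ?thesis by simp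
  qed
  have "(\<Sum>p\<in>slots r. (6 * (h * K_sum + drift_bound) * sqrt \<delta> + 2 * q / sqrt \<delta>) / c p) \<le>
     of_nat (card (slots r)) * ((6 * K_sum + 6 * drift_bound + 2 * sqrt C3) * D / sqrt (2 * sigma_min) * \<eta>)"
    by (rule sum_bounded_above) (rule summand)
  then have "2 * (\<Sum>p\<in>slots r. (6 * (h * K_sum + drift_bound) * sqrt \<delta> + 2 * q / sqrt \<delta>) / c p) \<le>
     2 * real (card (slots r)) * ((6 * K_sum + 6 * drift_bound + 2 * sqrt C3) * D / sqrt (2 * sigma_min)) * \<eta>" by simp
  moreover have "(\<integral>\<^sup>+y. ennreal \<bar>marginal N r (uN \<eta> N t) y - tensor r (u_eta \<eta> t) y\<bar> \<partial>config_measure (slots r)) \<le>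
    ennreal (2 * (\<Sum>p\<in>slots r. (6 * (h * K_sum + drift_bound) * sqrt \<delta> + 2 * q / sqrt \<delta>) / c p))"
    unfolding h_def
    by (rule joint_L1[OF \<eta>(1) N r t \<delta> q0]) (unfold q_def, rule A3_bounds(1)[OF \<epsilon>(1,2) \<eta>(1) adm N])
  ultimately show ?thesis unfolding D_def by (elim order_trans) (rule ennreal_leI)
qed

text \<open>Both processes are close to the interacting particle that uses the same noise.\<close>

lemma intermediate_limit_distance:
  assumes adm: "admissible TYPE('a) \<epsilon> \<eta> N" and \<epsilon>: "0 < \<epsilon>" "\<epsilon> < \<epsilon>1" "\<epsilon> \<le> 1 / 8" "C3 * \<epsilon> \<le> 1 / 4"
    and \<eta>: "0 < \<eta>" "\<eta> \<le> 1" and \<tau>: "0 < \<tau>" "\<tau> < T"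
  shows "(\<integral>\<^sup>+\<omega>. ennreal (norm (Xbar_at \<eta> (i, 1) \<tau> \<omega> - Xhat_at (i, 1) \<tau> \<omega>)) \<partial>M) \<le>
    ennreal ((fluctuation_constant DIM('a) C3 + C3) * \<eta>)"
proof -
  define q where "q = sqrt (C3 * real N powr (- 1 + C3 * \<epsilon>))"
  define p where "p = (i, 1::nat)"
  have N2: "2 \<le> N" by (rule admissible_ge_2[OF adm \<eta>(1)])
  then have N: "1 \<le> N" and p: "p \<in> slots (\<lambda>_. N)" by (auto simp: p_def slots_def)
  have q0: "0 \<le> q" using C3 by (simp add: q_def)
  have "q \<le> sqrt C3 * real N powr (- 1 / 8)" unfolding q_def by (rule fluctuation_rate(3)[OF N2 C3 \<epsilon>(4)])
  also have "\<dots> \<le> sqrt C3 * (real (DIM('a) + 2) ^ (DIM('a) + 2) * \<eta> ^ (DIM('a) + 2))"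
    by (intro mult_left_mono admissible_rate[OF adm \<epsilon>(1,3) \<eta>]) (use C3 in simp)
  also have "\<dots> = fluctuation_constant DIM('a) C3 * \<eta> ^ (DIM('a) + 2)" by (simp only: fluctuation_constant_def mult_ac)
  also have "\<dots> \<le> fluctuation_constant DIM('a) C3 * \<eta> ^ 1"
    by (intro mult_left_mono power_decreasing) (use \<eta> C3 in \<open>auto simp: fluctuation_constant_def\<close>)
  finally have q: "q \<le> fluctuation_constant DIM('a) C3 * \<eta>" by simp
  have \<tau>': "\<tau> \<in> {0..T}" using \<tau> by auto
  have m: "X_at \<eta> N p \<tau> \<in> borel_measurable M" "Xbar_at \<eta> p \<tau> \<in> borel_measurable M" "Xhat_at p \<tau> \<in> borel_measurable M"
    using X_measurable[OF \<eta>(1) p \<tau>'] Xbar_measurable[OF \<eta>(1) slots_snd[OF p] \<tau>'] Xhat_measurable[OF slots_snd[OF p] \<tau>'] by auto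
  have "(\<integral>\<^sup>+\<omega>. ennreal (norm (Xbar_at \<eta> p \<tau> \<omega> - Xhat_at p \<tau> \<omega>)) \<partial>M) \<le>
     (\<integral>\<^sup>+\<omega>. ennreal (norm (X_at \<eta> N p \<tau> \<omega> - Xbar_at \<eta> p \<tau> \<omega>)) + ennreal (norm (X_at \<eta> N p \<tau> \<omega> - Xhat_at p \<tau> \<omega>)) \<partial>M)"
  proof (rule nn_integral_mono)
    fix \<omega>
    have "norm (Xbar_at \<eta> p \<tau> \<omega> - Xhat_at p \<tau> \<omega>) \<le> norm (X_at \<eta> N p \<tau> \<omega> - Xbar_at \<eta> p \<tau> \<omega>) + norm (X_at \<eta> N p \<tau> \<omega> - Xhat_at p \<tau> \<omega>)"
      using norm_triangle_ineq4[of "X_at \<eta> N p \<tau> \<omega> - Xhat_at p \<tau> \<omega>" "X_at \<eta> N p \<tau> \<omega> - Xbar_at \<eta> p \<tau> \<omega>"] by simp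
    then show "ennreal (norm (Xbar_at \<eta> p \<tau> \<omega> - Xhat_at p \<tau> \<omega>)) \<le> ennreal (norm (X_at \<eta> N p \<tau> \<omega> - Xbar_at \<eta> p \<tau> \<omega>)) + ennreal (norm (X_at \<eta> N p \<tau> \<omega> - Xhat_at p \<tau> \<omega>))"
      by (simp add: ennreal_leI flip: ennreal_plus)
  qed
  also have "\<dots> = (\<integral>\<^sup>+\<omega>. ennreal (norm (X_at \<eta> N p \<tau> \<omega> - Xbar_at \<eta> p \<tau> \<omega>)) \<partial>M) + (\<integral>\<^sup>+\<omega>. ennreal (norm (X_at \<eta> N p \<tau> \<omega> - Xhat_at p \<tau> \<omega>)) \<partial>M)"
    by (rule nn_integral_add) (use m in auto)
  also have "\<dots> \<le> ennreal q + ennreal (C3 * \<eta>)"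
    unfolding q_def by (intro add_mono A3_bounds[OF \<epsilon>(1,2) \<eta>(1) adm N p \<tau>])
  also have "\<dots> = ennreal (q + C3 * \<eta>)" using q0 C3 \<eta> by (simp add: ennreal_plus)
  also have "\<dots> \<le> ennreal ((fluctuation_constant DIM('a) C3 + C3) * \<eta>)"
    using q by (intro ennreal_leI) (simp add: distrib_right)
  finally show ?thesis by (simp add: p_def)
qed

text \<open>The two routes, chosen according to the size of the diffusivity.\<close>

lemma single_rate:
  assumes adm: "admissible TYPE('a) \<epsilon> \<eta> N" and \<epsilon>: "0 < \<epsilon>" "\<epsilon> < \<epsilon>1" "\<epsilon> \<le> 1 / 8" "C3 * \<epsilon> \<le> 1 / 4"
    and \<eta>: "0 < \<eta>" "\<eta> \<le> 1" and t: "t \<in> {0..T}"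
  shows "(\<integral>\<^sup>+x. ennreal \<bar>u_eta \<eta> t i x - u t i x\<bar> \<partial>lborel) \<le>
    ennreal (one_particle_constant DIM('a) T C2 C3 drift_bound (\<Sum>i\<in>UNIV. second_moment i) * \<eta> powr (4 / (4 + real DIM('a))))"
proof -
  define d where "d = DIM('a)"
  define \<kappa> where "\<kappa> = \<eta> powr (4 / (4 + real d))"
  define E where "E = fluctuation_constant d C3 + C3"
  define m where "m = (\<Sum>i\<in>UNIV. second_moment i)"
  define c1 where "c1 = 2 * (12 * drift_bound + 2 * E)"
  define c2 where "c2 = 2 * (unit_ball_vol (real d) + C2\<^sup>2 + 2 * (real d ^ 9 * 105 * T ^ 4 * 4096 + 8 * (m + (drift_bound * T)\<^sup>2)))"
  have d1: "1 \<le> d" using DIM_positive[where 'a='a] by (simp add: d_def Suc_le_eq)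
  have \<kappa>0: "0 \<le> \<kappa>" by (simp add: \<kappa>_def)
  have E0: "0 \<le> E" using C3 by (simp add: E_def fluctuation_constant_def)
  have m: "second_moment i \<le> m" "0 \<le> m" unfolding m_def using second_moment_le second_moment_nonneg by (auto intro: sum_nonneg)
  have c1: "0 \<le> c1" using E0 drift_bound_nonneg by (simp add: c1_def)
  have c2: "0 \<le> c2" using m T by (simp add: c2_def)
  have const: "one_particle_constant DIM('a) T C2 C3 drift_bound (\<Sum>i\<in>UNIV. second_moment i) = c1 + c2"
    by (simp only: one_particle_constant_def c1_def c2_def E_def d_def m_def)
  show ?thesis
  proof (cases "\<eta> powr (- ((4 - real d) / (4 + real d))) \<le> \<sigma> i")
    case True
    have "(\<integral>\<^sup>+x. ennreal \<bar>u_eta \<eta> t i x - u t i x\<bar> \<partial>lborel) \<le> ennreal (2 * ((12 * drift_bound * sqrt \<eta> + 2 * (E * \<eta>) / sqrt \<eta>) / sqrt (2 * \<sigma> i)))"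
      by (rule single_L1_smoothing[OF \<eta>(1) t \<eta>(1)])
        (use E0 \<eta> intermediate_limit_distance[OF adm \<epsilon> \<eta>] in \<open>auto simp: E_def d_def\<close>)
    also have "2 * ((12 * drift_bound * sqrt \<eta> + 2 * (E * \<eta>) / sqrt \<eta>) / sqrt (2 * \<sigma> i)) = c1 * (sqrt \<eta> / sqrt (2 * \<sigma> i))"
    proof -
      have "2 * (E * \<eta>) / sqrt \<eta> = 2 * E * sqrt \<eta>" using \<eta> by (simp add: real_div_sqrt mult.assoc flip: times_divide_eq_right)
      then show ?thesis by (simp add: c1_def distrib_right distrib_left mult.assoc)
    qed
    also have "ennreal \<dots> \<le> ennreal (c1 * \<kappa>)"
      unfolding \<kappa>_def by (intro ennreal_leI mult_left_mono large_diffusion_rate[OF \<eta>(1) True] c1)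
    also have "\<dots> \<le> ennreal ((c1 + c2) * \<kappa>)"
      by (intro ennreal_leI mult_right_mono) (use c2 \<kappa>0 in auto)
    finally show ?thesis unfolding const by (simp add: \<kappa>_def d_def)
  next
    case False
    define r where "r = \<eta> powr (- 2 / (4 + real d))"
    define l where "l = \<eta> powr (1 + real d / (4 + real d))"
    have rl: "0 < r" "0 < l" using \<eta> by (auto simp: r_def l_def)
    have \<sigma>: "\<sigma> i \<le> \<eta> powr (- ((4 - real d) / (4 + real d)))" using False by simp
    note sr = small_diffusion_rates[OF \<eta> d1 sigma_pos \<sigma>, folded r_def l_def \<kappa>_def]
    have "l * (unit_ball_vol (real d) * r ^ d) + (C2 * \<eta>)\<^sup>2 / l +
        2 * (real d ^ 9 * 105 * T ^ 4 * (2 * sqrt (2 * \<sigma> i) / r) ^ 8 + 8 * (second_moment i + (drift_bound * T)\<^sup>2) / r\<^sup>2)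
      = unit_ball_vol (real d) * (l * r ^ d) + C2\<^sup>2 * (\<eta>\<^sup>2 / l) +
        2 * (real d ^ 9 * 105 * T ^ 4 * (2 * sqrt (2 * \<sigma> i) / r) ^ 8 + 8 * (second_moment i + (drift_bound * T)\<^sup>2) * (1 / r\<^sup>2))"
      by (simp add: power_mult_distrib)
    also have "\<dots> \<le> unit_ball_vol (real d) * \<kappa> + C2\<^sup>2 * \<kappa> +
        2 * (real d ^ 9 * 105 * T ^ 4 * (4096 * \<kappa>) + 8 * (m + (drift_bound * T)\<^sup>2) * \<kappa>)"
      unfolding sr(1-3)
      by (intro add_mono mult_left_mono mult_right_mono order_refl sr(4) m(1)) (use T \<kappa>0 in auto)
    also have "2 * \<dots> = c2 * \<kappa>" by (simp add: c2_def algebra_simps)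
    finally have e: "2 * (l * (unit_ball_vol (real d) * r ^ d) + (C2 * \<eta>)\<^sup>2 / l +
        2 * (real d ^ 9 * 105 * T ^ 4 * (2 * sqrt (2 * \<sigma> i) / r) ^ 8 + 8 * (second_moment i + (drift_bound * T)\<^sup>2) / r\<^sup>2)) \<le> c2 * \<kappa>" by simp
    note single_L1_moments[OF \<eta>(1) t rl(2,1), of i, folded d_def]
    also note ennreal_leI[OF e]
    also have "ennreal (c2 * \<kappa>) \<le> ennreal ((c1 + c2) * \<kappa>)"
      by (intro ennreal_leI mult_right_mono) (use c1 \<kappa>0 in auto)
    finally show ?thesis unfolding const by (simp add: \<kappa>_def d_def)
  qed
qed

lemma single_L1_le_2:
  assumes \<eta>: "0 < \<eta>" and t: "t \<in> {0..T}"
  shows "(\<integral>\<^sup>+x. ennreal \<bar>u_eta \<eta> t i x - u t i x\<bar> \<partial>lborel) \<le> ennreal 2"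
proof -
  define p where "p = (i, 1::nat)"
  have p1: "snd p \<ge> 1" by (simp add: p_def)
  have d1: "distributed M lborel (Xbar_at \<eta> p t) (\<lambda>x. ennreal (u_eta \<eta> t i x))" using Xbar_sde(2)[OF \<eta> p1 t] by (simp add: p_def)
  have d2: "distributed M lborel (Xhat_at p t) (\<lambda>x. ennreal (u t i x))" using Xhat_sde(2)[OF p1 t] by (simp add: p_def)
  have "(\<integral>\<^sup>+x. ennreal \<bar>u_eta \<eta> t i x - u t i x\<bar> \<partial>lborel) \<le> ennreal (2 * 1)"
  proof (rule L1_density_le_tv[OF d1 d2])
    show "\<bar>prob (Xbar_at \<eta> p t -` A \<inter> space M) - prob (Xhat_at p t -` A \<inter> space M)\<bar> \<le> 1" for A
      using prob_le_1[of "Xbar_at \<eta> p t -` A \<inter> space M"] prob_le_1[of "Xhat_at p t -` A \<inter> space M"]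
        measure_nonneg[of M "Xbar_at \<eta> p t -` A \<inter> space M"] measure_nonneg[of M "Xhat_at p t -` A \<inter> space M"] by linarith
  qed (use u_eta_measurable[OF \<eta> t] u_measurable[OF t] u_eta_facts(1)[OF \<eta> t] u_facts(1)[OF t] in auto)
  then show ?thesis by simp
qed

lemma joint_L1_le_2:
  assumes \<eta>: "\<eta> > 0" and N: "N \<ge> 1" and r: "\<And>i. r i \<le> N" and t: "t \<in> {0..T}"
  shows "(\<integral>\<^sup>+y. ennreal \<bar>marginal N r (uN \<eta> N t) y - tensor r (u_eta \<eta> t) y\<bar> \<partial>config_measure (slots r)) \<le> ennreal 2"
proof -
  have "\<bar>prob A - prob B\<bar> \<le> 1" for A B
    using prob_le_1[of A] prob_le_1[of B] measure_nonneg[of M A] measure_nonneg[of M B] by linarith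
  from marginal_L1_le_tv[OF \<eta> N r t this] show ?thesis by simp
qed

lemma marginal_tensor_triangle:
  assumes \<eta>: "\<eta> > 0" and N: "N \<ge> 1" and r: "\<And>i. r i \<le> N" and t: "t \<in> {0..T}" and nn: "0 \<le> x" "0 \<le> y"
    and x: "(\<integral>\<^sup>+y. ennreal \<bar>marginal N r (uN \<eta> N t) y - tensor r (u_eta \<eta> t) y\<bar> \<partial>config_measure (slots r)) \<le> ennreal x"
    and y: "\<And>i. (\<integral>\<^sup>+x. ennreal \<bar>u_eta \<eta> t i x - u t i x\<bar> \<partial>lborel) \<le> ennreal y"
  shows "(\<integral>\<^sup>+y. ennreal \<bar>marginal N r (uN \<eta> N t) y - tensor r (u t) y\<bar> \<partial>config_measure (slots r)) \<le>
    ennreal (x + real (card (slots r)) * y)"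
proof -
  let ?m = "marginal N r (uN \<eta> N t)" and ?w = "tensor r (u_eta \<eta> t)" and ?v = "tensor r (u t)"
  have meas: "?m \<in> borel_measurable (config_measure (slots r))" "?w \<in> borel_measurable (config_measure (slots r))"
      "?v \<in> borel_measurable (config_measure (slots r))"
    unfolding config_measure_def
    by (rule marginal_law(2)[OF \<eta> N r t] tensor_measurable; use u_eta_measurable[OF \<eta> t] u_measurable[OF t] in simp)+
  have "(\<integral>\<^sup>+y. ennreal \<bar>?m y - ?v y\<bar> \<partial>config_measure (slots r)) \<le> (\<integral>\<^sup>+y. ennreal \<bar>?m y - ?w y\<bar> + ennreal \<bar>?w y - ?v y\<bar> \<partial>config_measure (slots r))"
    by (rule nn_integral_mono) (simp add: ennreal_leI flip: ennreal_plus)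
  also have "\<dots> = (\<integral>\<^sup>+y. ennreal \<bar>?m y - ?w y\<bar> \<partial>config_measure (slots r)) + (\<integral>\<^sup>+y. ennreal \<bar>?w y - ?v y\<bar> \<partial>config_measure (slots r))"
    by (rule nn_integral_add) (use meas in measurable)
  also have "\<dots> \<le> ennreal x + (\<Sum>p\<in>slots r. ennreal y)"
    by (intro add_mono x order_trans[OF tensor_L1[OF \<eta> t]] sum_mono y)
  also have "\<dots> = ennreal (x + real (card (slots r)) * y)"
    using nn by (simp add: ennreal_plus ennreal_mult' ennreal_of_nat_eq_real_of_nat)
  finally show ?thesis .
qed

lemma marginal_rate:
  assumes adm: "admissible TYPE('a) \<epsilon> \<eta> N" and \<epsilon>: "0 < \<epsilon>" "\<epsilon> < \<epsilon>1" "\<epsilon> \<le> 1 / 8" "C3 * \<epsilon> \<le> 1 / 4"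
    and \<eta>: "0 < \<eta>" and r: "\<And>i. r i \<le> N" and t: "t \<in> {0..T}"
  shows "(\<integral>\<^sup>+y. ennreal \<bar>marginal N r (uN \<eta> N t) y - tensor r (u t) y\<bar> \<partial>config_measure (slots r)) \<le>
    ennreal (rate_constant DIM('a) sigma_min T C2 C3 drift_bound K_sum (\<Sum>i\<in>UNIV. second_moment i) (card (slots r)) * \<eta> powr (4 / (4 + real DIM('a))))"
proof -
  define \<kappa> where "\<kappa> = \<eta> powr (4 / (4 + real DIM('a)))"
  define R where "R = real (card (slots r))"
  define J where "J = 2 * R * ((6 * K_sum + 6 * drift_bound + 2 * sqrt C3) * real (DIM('a) + 2) ^ (DIM('a) + 2) / sqrt (2 * sigma_min))"
  define S where "S = one_particle_constant DIM('a) T C2 C3 drift_bound (\<Sum>i\<in>UNIV. second_moment i)"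
  have N: "1 \<le> N" using admissible_ge_2[OF adm \<eta>] by simp
  have R0: "0 \<le> R" by (simp add: R_def)
  have \<kappa>0: "0 \<le> \<kappa>" by (simp add: \<kappa>_def)
  have J0: "0 \<le> J" unfolding J_def using R0 K_sum_nonneg drift_bound_nonneg C3 sigma_min_pos by (intro mult_nonneg_nonneg divide_nonneg_nonneg) auto
  have "0 \<le> (\<Sum>i\<in>UNIV. second_moment i)" by (intro sum_nonneg second_moment_nonneg)
  then have S0: "0 \<le> S" unfolding S_def one_particle_constant_def fluctuation_constant_def
    using C3 T drift_bound_nonneg by (intro add_nonneg_nonneg mult_nonneg_nonneg) auto
  have const: "rate_constant DIM('a) sigma_min T C2 C3 drift_bound K_sum (\<Sum>i\<in>UNIV. second_moment i) (card (slots r)) = J + R * S + 2 + 2 * R"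
    by (simp add: rate_constant_def J_def R_def S_def)
  show ?thesis
  proof (cases "\<eta> \<le> 1")
    case True
    have "\<eta> = \<eta> powr 1" using \<eta> by simp
    also have "\<dots> \<le> \<kappa>" unfolding \<kappa>_def by (rule powr_mono') (use \<eta> True in auto)
    finally have \<eta>\<kappa>: "\<eta> \<le> \<kappa>" .
    have "(\<integral>\<^sup>+y. ennreal \<bar>marginal N r (uN \<eta> N t) y - tensor r (u t) y\<bar> \<partial>config_measure (slots r)) \<le> ennreal (J * \<eta> + real (card (slots r)) * (S * \<kappa>))"
    proof (rule marginal_tensor_triangle[OF \<eta> N r t])
      show "0 \<le> J * \<eta>" "0 \<le> S * \<kappa>" using J0 S0 \<kappa>0 \<eta> by auto
      show "(\<integral>\<^sup>+y. ennreal \<bar>marginal N r (uN \<eta> N t) y - tensor r (u_eta \<eta> t) y\<bar> \<partial>config_measure (slots r)) \<le> ennreal (J * \<eta>)"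
        unfolding J_def R_def by (rule joint_rate[OF adm \<epsilon> \<eta> True r t])
      show "(\<integral>\<^sup>+x. ennreal \<bar>u_eta \<eta> t i x - u t i x\<bar> \<partial>lborel) \<le> ennreal (S * \<kappa>)" for i
        unfolding S_def \<kappa>_def by (rule single_rate[OF adm \<epsilon> \<eta> True t])
    qed
    also have "\<dots> \<le> ennreal ((J + R * S + 2 + 2 * R) * \<kappa>)"
    proof (rule ennreal_leI)
      have "J * \<eta> \<le> J * \<kappa>" by (rule mult_left_mono[OF \<eta>\<kappa> J0])
      moreover have "0 \<le> (2 + 2 * R) * \<kappa>" using R0 \<kappa>0 by simp
      ultimately show "J * \<eta> + real (card (slots r)) * (S * \<kappa>) \<le> (J + R * S + 2 + 2 * R) * \<kappa>"
        unfolding R_def[symmetric] by (simp add: algebra_simps)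
    qed
    finally show ?thesis unfolding const \<kappa>_def .
  next
    case False
    then have \<kappa>1: "1 \<le> \<kappa>" unfolding \<kappa>_def by (intro ge_one_powr_ge_zero) auto
    have "(\<integral>\<^sup>+y. ennreal \<bar>marginal N r (uN \<eta> N t) y - tensor r (u t) y\<bar> \<partial>config_measure (slots r)) \<le> ennreal (2 + real (card (slots r)) * 2)"
      by (rule marginal_tensor_triangle[OF \<eta> N r t _ _ joint_L1_le_2[OF \<eta> N r t] single_L1_le_2[OF \<eta> t]]) auto
    also have "\<dots> \<le> ennreal ((J + R * S + 2 + 2 * R) * \<kappa>)"
    proof (rule ennreal_leI)
      have "2 + real (card (slots r)) * 2 \<le> J + R * S + 2 + 2 * R" using J0 mult_nonneg_nonneg[OF R0 S0] by (simp add: R_def)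
      also have "\<dots> \<le> (J + R * S + 2 + 2 * R) * \<kappa>"
        using mult_left_mono[OF \<kappa>1, of "J + R * S + 2 + 2 * R"] J0 R0 mult_nonneg_nonneg[OF R0 S0] by simp
      finally show "2 + real (card (slots r)) * 2 \<le> (J + R * S + 2 + 2 * R) * \<kappa>" .
    qed
    finally show ?thesis unfolding const \<kappa>_def .
  qed
qed

end

theorem theorem1p1:
  fixes T s sigma_min C0 C2 C3 \<epsilon>1 :: real
    and K :: "'n::finite \<Rightarrow> 'n \<Rightarrow> real"
    and u0 :: "'n \<Rightarrow> 'a::euclidean_space \<Rightarrow> real"
    and r :: "'n \<Rightarrow> nat"
  assumes "T > 0" and "s > real DIM('a) / 2 + 2"
    and "C0 > 0" and "C2 > 0" and "C3 > 0" and "\<epsilon>1 > 0"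
    and "initial_data s u0"
    and "\<And>i. integrable lborel (\<lambda>x. u0 i x * (norm x)\<^sup>2)"
  shows "\<exists>\<epsilon>0>0. \<exists>C>0.
    \<forall>\<sigma> (V :: 'n \<Rightarrow> 'n \<Rightarrow> 'a \<Rightarrow> real) a u u_eta (M :: 'w measure) F W \<zeta> X Xbar Xhat uN.
      potentials sigma_min K \<sigma> V a \<longrightarrow>
      filtered_prob_space M F \<longrightarrow>
      driving_noise M F u0 W \<zeta> \<longrightarrow>
      particle_systems M F T \<sigma> V a u u_eta W \<zeta> X Xbar Xhat \<longrightarrow>
      joint_density M T \<sigma> V u0 X uN \<longrightarrow>
      assumption_A1 T s C0 u0 \<sigma> V a u u_eta \<longrightarrow>
      assumption_A2 T C2 u u_eta \<longrightarrow>
      assumption_A3 M T \<epsilon>1 C3 X Xbar Xhat \<longrightarrow>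
      (\<forall>\<epsilon> \<eta> N. 0 < \<epsilon> \<and> \<epsilon> < \<epsilon>0 \<and> \<eta> > 0 \<and> (\<forall>i. r i \<le> N) \<and> admissible TYPE('a) \<epsilon> \<eta> N \<longrightarrow>
        (SUP t\<in>{0..T}. \<integral>\<^sup>+y. ennreal \<bar>marginal N r (uN \<eta> N t) y - tensor r (u t) y\<bar>
            \<partial>config_measure (slots r))
          \<le> ennreal (C * \<eta> powr (4 / (4 + real DIM('a)))))"
proof -
  \<comment> \<open>All constants are fixed before the coefficients, the potentials and the solutions are introduced.\<close>
  obtain \<Lambda> where \<Lambda>: "\<Lambda> \<ge> 0 \<and> (\<forall>v :: real \<Rightarrow> 'n \<Rightarrow> 'a \<Rightarrow> real. solution_bounds T s C0 u0 v \<longrightarrow> (\<forall>t\<in>{0..T}. \<forall>i. continuous_on UNIV (v t i)) \<longrightarrow>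
     (AE t in lborel. t \<in> {0..T} \<longrightarrow> (\<forall>i x y. \<bar>v t i x - v t i y\<bar> \<le> \<Lambda> * norm (x - y))))"
    using solution_lipschitz_constant[OF assms(2,7,3), of T] by auto
  define k where "k = (\<Sum>i\<in>UNIV. \<Sum>j\<in>UNIV. K i j)"
  define B where "B = 2 * \<Lambda> * measure lborel (ball (0::'a) 1) * k"
  define m where "m = (\<Sum>i\<in>UNIV. \<integral>x. u0 i x * (norm x)\<^sup>2 \<partial>lborel)"
  \<comment> \<open>The maximum with 1 gives a positive constant for every value of \<open>sigma_min\<close>.\<close>
  define C where "C = max 1 (rate_constant DIM('a) sigma_min T C2 C3 B k m (card (slots r)))"
  define \<epsilon>0 where "\<epsilon>0 = min \<epsilon>1 (min (1 / 8) (1 / (4 * C3)))"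
  show ?thesis
  proof (rule exI[of _ \<epsilon>0], rule conjI, goal_cases)
    case 1
    show ?case using assms(5,6) by (simp add: \<epsilon>0_def)
  next
    case 2
    show ?case
  proof (rule exI[of _ C], rule conjI, goal_cases)
    case 1
    show ?case by (simp add: C_def)
  next
    case 2
    show ?case
  proof (intro allI impI)
    fix \<sigma> :: "'n \<Rightarrow> real" and V :: "'n \<Rightarrow> 'n \<Rightarrow> 'a \<Rightarrow> real" and a u u_eta and M :: "'w measure" and F W \<zeta> X Xbar Xhat uN and \<epsilon> \<eta> :: real and N
    assume H: "potentials sigma_min K \<sigma> V a" "filtered_prob_space M F" "driving_noise M F u0 W \<zeta>"
      "particle_systems M F T \<sigma> V a u u_eta W \<zeta> X Xbar Xhat" "joint_density M T \<sigma> V u0 X uN"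
      "assumption_A1 T s C0 u0 \<sigma> V a u u_eta" "assumption_A2 T C2 u u_eta" "assumption_A3 M T \<epsilon>1 C3 X Xbar Xhat"
    assume \<epsilon>: "0 < \<epsilon> \<and> \<epsilon> < \<epsilon>0 \<and> \<eta> > 0 \<and> (\<forall>i. r i \<le> N) \<and> admissible TYPE('a) \<epsilon> \<eta> N"
    interpret chaos T s sigma_min C0 C2 C3 \<epsilon>1 \<Lambda> K u0 \<sigma> V a u u_eta M F W \<zeta> X Xbar Xhat uN
      by (rule chaos.intro[OF assms(1,5,4,8,7) H conjunct1[OF \<Lambda>] conjunct2[OF \<Lambda>, THEN spec, THEN mp, THEN mp]])
    have \<epsilon>': "0 < \<epsilon>" "\<epsilon> < \<epsilon>1" "\<epsilon> \<le> 1 / 8" "C3 * \<epsilon> \<le> 1 / 4" and \<eta>: "0 < \<eta>" and adm: "admissible TYPE('a) \<epsilon> \<eta> N" and rN: "\<And>i. r i \<le> N"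
      using \<epsilon> assms(5) by (auto simp: \<epsilon>0_def field_simps)
    have eq: "K_sum = k" "drift_bound = B" "(\<Sum>i\<in>UNIV. second_moment i) = m"
      by (simp_all add: K_sum_def k_def drift_bound_def B_def ball_vol_def second_moment_def m_def)
    show "(SUP t\<in>{0..T}. \<integral>\<^sup>+y. ennreal \<bar>marginal N r (uN \<eta> N t) y - tensor r (u t) y\<bar> \<partial>config_measure (slots r))
          \<le> ennreal (C * \<eta> powr (4 / (4 + real DIM('a))))"
    proof (rule SUP_least)
      fix t assume "t \<in> {0..T}"
      from marginal_rate[OF adm \<epsilon>' \<eta> rN this]
      show "(\<integral>\<^sup>+y. ennreal \<bar>marginal N r (uN \<eta> N t) y - tensor r (u t) y\<bar> \<partial>config_measure (slots r)) \<le> ennreal (C * \<eta> powr (4 / (4 + real DIM('a))))"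
        unfolding eq by (rule order_trans) (intro ennreal_leI mult_right_mono, auto simp: C_def)
    qed
  qed
  qed
  qed
qed

end
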